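(* Let $m>n\ge1$. The stable range branching algebra $\mathcal{B}_{Sp}$ for $(Sp_{2m},Sp_{2n})$ is isomorphic to the length $n$ branching algebra $\mathcal{B}_{2m,n}^{2n}$ for $(GL_{2m},GL_{2n})$.
   Context: Definition of $\mathcal{B}_{2m,n}^{2n}$. For $a>b$ and $k\le a$, $GL_a\times GL_k$ acts on the space $\mathsf{M}_{a,k}$ of complex $a\times k$ matrices by $(g_1,g_2)\cdot Q=(g_1^t)^{-1}Qg_2^{-1}$, hence on $\mathbb{C}[\mathsf{M}_{a,k}]$. $U_r\subset GL_r$ is the group of upper triangular matrices with $1$'s on the diagonal, and $GL_b\subset GL_a$ via $X\mapsto\begin{bmatrix}X&0\\0&I\end{bmatrix}$. Then $\mathcal{B}_{a,k}^b=\mathbb{C}[\mathsf{M}_{a,k}]^{U_b\times U_k}$. Here $a=2m$, $b=2n$, $k=n$. Definition of $\mathcal{B}_{Sp}$. Let $J_m$ be the $m\times m$ matrix with $1$'s on the antidiagonal and $0$ elsewhere; $Sp_{2m}\subset GL_{2m}$ is the group preserving the skew form on $\mathbb{C}^{2m}$ given by $\begin{bmatrix}0&J_m\\-J_m&0\end{bmatrix}$. $\tau_{2m}^F$ ($F$ a Young diagram with $\ell(F)\le m$ rows) is the irreducible rational representation of $Sp_{2m}$ with highest weight $F$; $\rho_{2m}^F$ is the irreducible polynomial representation of $GL_{2m}$ with highest weight $F$. We have $\mathbb{C}[\mathsf{M}_{2m,m}]^{U_m}=\bigoplus_{\ell(F)\le m}\rho_{2m}^F$ (the $F$-summand being the weight-$F$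 space for the diagonal torus of $GL_m$). For each $F$ write $\rho_{2m}^F=\tau_{2m}^F\oplus\mathcal{I}^F$ as $Sp_{2m}$-modules ($\tau_{2m}^F$ occurs once, and $\mathcal{I}^F$ is the $Sp_{2m}$-stable complement). $\mathcal{I}_{Sp}=\sum_F\mathcal{I}^F$ is an ideal, and $\mathcal{F}_{Sp}=\mathbb{C}[\mathsf{M}_{2m,m}]^{U_m}/\mathcal{I}_{Sp}$. Let $\langle 2m\rangle=\{u_1<v_1<u_2<v_2<\cdots<u_m<v_m\}$. $\mathcal{L}_{Sp}$ is the set of subsets $J$ of $\langle2m\rangle$ with $1\le|J|\le n$ of the form $[u_1,\dots,u_c,y_1,\dots,y_s]$, $[u_1,\dots,u_c]$ or $[y_1,\dots,y_s]$ with $c\le n$ and $u_{n+1}\le y_1<\cdots<y_s\le v_m$. Let $\psi(u_c)=c$, $\psi(v_c)=2m+1-c$ for $1\le c\le m$. For $I=[w_1,\dots,w_r]$ with $w_1<\cdots<w_r$, $r\le m$, $I'$ denotes its image under $\psi$, and $\delta_{I'}(Q)$, $Q\in\mathsf{M}_{2m,m}$, is the determinant of the $r\times r$ matrix whose $j$-th row consists of the first $r$ entries of row $\psi(w_j)$ of $Q$. $\mathcal{B}_{Sp}$ is the subalgebra of $\mathcal{F}_{Sp}$ generated by $\{\delta_{I'}+\mathcal{I}_{Sp}:I\in\mathcal{L}_{Sp}\}$. *)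

theory Defs
  imports
    "Jordan_Normal_Form.Determinant"
    "HOL-Algebra.Module"
    "HOL-Algebra.QuotRing"
begin

section \<open>Complex algebras\<close>

text \<open>
  An algebra over the complex numbers is a record of type \<^typ>\<open>(complex, 'a) module\<close>,
  to be read over the following ring of scalars.
\<close>

definition complex_ring :: "complex ring" where
  "complex_ring = \<lparr>carrier = UNIV, mult = (*), one = 1, zero = 0, add = (+)\<rparr>"

definition quot_alg :: "(complex, 'a) module \<Rightarrow> 'a set \<Rightarrow> (complex, 'a set) module" where
  "quot_alg A I =
    \<lparr>carrier = carrier (A Quot I), mult = mult (A Quot I), one = one (A Quot I),
     zero = zero (A Quot I), add = add (A Quot I),
     module.smult = (\<lambda>c X. \<Union>x\<in>X. I +>\<^bsub>A\<^esub> (c \<odot>\<^bsub>A\<^esub> x))\<rparr>"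

inductive_set gen_subalg :: "(complex, 'a) module \<Rightarrow> 'a set \<Rightarrow> 'a set"
  for A :: "(complex, 'a) module" and S :: "'a set" where
  one: "\<one>\<^bsub>A\<^esub> \<in> gen_subalg A S"
| incl: "x \<in> S \<Longrightarrow> x \<in> gen_subalg A S"
| add: "x \<in> gen_subalg A S \<Longrightarrow> y \<in> gen_subalg A S \<Longrightarrow> x \<oplus>\<^bsub>A\<^esub> y \<in> gen_subalg A S"
| mult: "x \<in> gen_subalg A S \<Longrightarrow> y \<in> gen_subalg A S \<Longrightarrow> x \<otimes>\<^bsub>A\<^esub> y \<in> gen_subalg A S"
| smult: "x \<in> gen_subalg A S \<Longrightarrow> c \<odot>\<^bsub>A\<^esub> x \<in> gen_subalg A S"

definition alg_isomorphic ::
  "(complex, 'a) module \<Rightarrow> (complex, 'b) module \<Rightarrow> bool" where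
  "alg_isomorphic A B \<longleftrightarrow>
    (\<exists>\<phi> \<in> ring_iso A B. \<forall>c. \<forall>x \<in> carrier A. \<phi> (c \<odot>\<^bsub>A\<^esub> x) = c \<odot>\<^bsub>B\<^esub> \<phi> x)"


section \<open>Polynomial functions on matrices and the action of pairs of invertible matrices\<close>

text \<open>
  Since the complex numbers are infinite, polynomials in the matrix entries are the same as
  polynomial functions.  These are taken to be \<^const>\<open>undefined\<close> outside the
  \<open>a \<times> k\<close> matrices, so that equality of functions is equality on those matrices.
  All matrix indices below start at 0.
\<close>

inductive_set poly_funs :: "nat \<Rightarrow> nat \<Rightarrow> (complex mat \<Rightarrow> complex) set"
  for a k :: nat where
  const: "(\<lambda>Q\<in>carrier_mat a k. c) \<in> poly_funs a k"
| entry: "i < a \<Longrightarrow> j < k \<Longrightarrow> (\<lambda>Q\<in>carrier_mat a k. Q $$ (i, j)) \<in> poly_funs a k"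
| add: "f \<in> poly_funs a k \<Longrightarrow> g \<in> poly_funs a k \<Longrightarrow>
    (\<lambda>Q\<in>carrier_mat a k. f Q + g Q) \<in> poly_funs a k"
| mult: "f \<in> poly_funs a k \<Longrightarrow> g \<in> poly_funs a k \<Longrightarrow>
    (\<lambda>Q\<in>carrier_mat a k. f Q * g Q) \<in> poly_funs a k"

definition mat_poly_alg :: "nat \<Rightarrow> nat \<Rightarrow> (complex, complex mat \<Rightarrow> complex) module" where
  "mat_poly_alg a k =
    \<lparr>carrier = poly_funs a k,
     mult = (\<lambda>f g. \<lambda>Q\<in>carrier_mat a k. f Q * g Q),
     one = (\<lambda>Q\<in>carrier_mat a k. 1),
     zero = (\<lambda>Q\<in>carrier_mat a k. 0),
     add = (\<lambda>f g. \<lambda>Q\<in>carrier_mat a k. f Q + g Q),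
     module.smult = (\<lambda>c f. \<lambda>Q\<in>carrier_mat a k. c * f Q)\<rparr>"

definition GL :: "nat \<Rightarrow> complex mat monoid" where
  "GL r = units_of (ring_mat TYPE(complex) r ())"

definition mat_act ::
  "nat \<Rightarrow> nat \<Rightarrow> complex mat \<Rightarrow> complex mat \<Rightarrow> complex mat \<Rightarrow> complex mat" where
  "mat_act a k g1 g2 Q = m_inv (GL a) (transpose_mat g1) * Q * m_inv (GL k) g2"

definition fun_act ::
  "nat \<Rightarrow> nat \<Rightarrow> complex mat \<Rightarrow> complex mat \<Rightarrow> (complex mat \<Rightarrow> complex) \<Rightarrow> complex mat \<Rightarrow> complex"
where
  "fun_act a k g1 g2 f =
    (\<lambda>Q\<in>carrier_mat a k. f (mat_act a k (m_inv (GL a) g1) (m_inv (GL k) g2) Q))"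

lemma GL_iff:
  "g \<in> carrier (GL r) \<longleftrightarrow>
    g \<in> carrier_mat r r \<and> (\<exists>h \<in> carrier_mat r r. h * g = 1\<^sub>m r \<and> g * h = 1\<^sub>m r)"
  by (auto simp: GL_def units_of_def Units_def ring_mat_def)

lemma GL_group: "group (GL r)"
proof -
  interpret ring "ring_mat TYPE(complex) r ()" by (rule ring_mat)
  show ?thesis unfolding GL_def by (rule units_group)
qed

lemma GL_inv_eqI:
  assumes "g \<in> carrier_mat r r" "h \<in> carrier_mat r r" "h * g = 1\<^sub>m r" "g * h = 1\<^sub>m r"
  shows "m_inv (GL r) g = h"
proof -
  interpret group "GL r" by (rule GL_group)
  have "g \<in> carrier (GL r)" "h \<in> carrier (GL r)"
    using assms GL_iff by blast+
  moreover have "h \<otimes>\<^bsub>GL r\<^esub> g = \<one>\<^bsub>GL r\<^esub>"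
    using assms by (simp add: GL_def units_of_def ring_mat_def)
  ultimately show ?thesis by (simp add: inv_equality)
qed

lemma fun_act_eq:
  assumes "g1 \<in> carrier (GL a)" "g2 \<in> carrier (GL k)" "Q \<in> carrier_mat a k"
  shows "fun_act a k g1 g2 f Q = f (transpose_mat g1 * Q * g2)"
proof -
  obtain h1 where h1: "h1 \<in> carrier_mat a a" "h1 * g1 = 1\<^sub>m a" "g1 * h1 = 1\<^sub>m a"
    using assms(1) GL_iff by blast
  obtain h2 where h2: "h2 \<in> carrier_mat k k" "h2 * g2 = 1\<^sub>m k" "g2 * h2 = 1\<^sub>m k"
    using assms(2) GL_iff by blast
  have g: "g1 \<in> carrier_mat a a" "g2 \<in> carrier_mat k k"
    using assms GL_iff by blast+
  have "transpose_mat g1 * transpose_mat h1 = 1\<^sub>m a" "transpose_mat h1 * transpose_mat g1 = 1\<^sub>m a"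
    using g h1 by (metis transpose_mult transpose_one)+
  hence "m_inv (GL a) (transpose_mat h1) = transpose_mat g1"
    using g h1 by (intro GL_inv_eqI) auto
  moreover have "m_inv (GL a) g1 = h1" "m_inv (GL k) g2 = h2" "m_inv (GL k) h2 = g2"
    using g h1 h2 by (auto intro!: GL_inv_eqI)
  ultimately show ?thesis
    using assms(3) by (simp add: fun_act_def mat_act_def)
qed

definition unitri :: "nat \<Rightarrow> complex mat set" where
  "unitri r = {A \<in> carrier_mat r r. upper_triangular A \<and> (\<forall>i<r. A $$ (i, i) = 1)}"

definition GL_embed :: "nat \<Rightarrow> nat \<Rightarrow> complex mat \<Rightarrow> complex mat" where
  "GL_embed b a X = four_block_mat X (0\<^sub>m b (a - b)) (0\<^sub>m (a - b) b) (1\<^sub>m (a - b))"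


section \<open>The branching algebra of general linear groups\<close>

definition branching_GL ::
  "nat \<Rightarrow> nat \<Rightarrow> nat \<Rightarrow> (complex, complex mat \<Rightarrow> complex) module" where
  "branching_GL a k b = (mat_poly_alg a k)
    \<lparr>carrier := {f \<in> carrier (mat_poly_alg a k).
       \<forall>u1 \<in> unitri b. \<forall>u2 \<in> unitri k. fun_act a k (GL_embed b a u1) u2 f = f}\<rparr>"


section \<open>The branching algebra of symplectic groups\<close>

definition skew_form :: "nat \<Rightarrow> complex mat" where
  "skew_form m =
    (let J = mat m m (\<lambda>(i, j). if i + j + 1 = m then 1 else 0)
     in four_block_mat (0\<^sub>m m m) J (- J) (0\<^sub>m m m))"

definition Sp :: "nat \<Rightarrow> complex mat set" where
  "Sp m = {g \<in> carrier (GL (2 * m)). transpose_mat g * skew_form m * g = skew_form m}"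

definition U_invariants :: "nat \<Rightarrow> (complex, complex mat \<Rightarrow> complex) module" where
  "U_invariants m = (mat_poly_alg (2 * m) m)
    \<lparr>carrier := {f \<in> carrier (mat_poly_alg (2 * m) m).
       \<forall>u \<in> unitri m. fun_act (2 * m) m (1\<^sub>m (2 * m)) u f = f}\<rparr>"

text \<open>
  Row \<open>i + 1\<close> of a Young diagram \<open>F\<close> with at most \<open>m\<close> rows has length \<open>F i\<close>.
\<close>

definition young :: "nat \<Rightarrow> (nat \<Rightarrow> nat) set" where
  "young m = {F. antimono F \<and> (\<forall>i\<ge>m. F i = 0)}"

text \<open>
  The diagonal torus of \<open>Sp m\<close> consists of the matrices
  \<open>diag(t\<^sub>1, \<dots>, t\<^sub>m, 1/t\<^sub>m, \<dots>, 1/t\<^sub>1)\<close>, so the following also gives its characters.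
\<close>

definition torus_char :: "nat \<Rightarrow> (nat \<Rightarrow> nat) \<Rightarrow> complex mat \<Rightarrow> complex" where
  "torus_char m F t = (\<Prod>i<m. (t $$ (i, i)) ^ F i)"

definition rho :: "nat \<Rightarrow> (nat \<Rightarrow> nat) \<Rightarrow> (complex mat \<Rightarrow> complex) set" where
  "rho m F = {f \<in> carrier (U_invariants m).
     \<forall>t \<in> carrier (GL m). diagonal_mat t \<longrightarrow>
       fun_act (2 * m) m (1\<^sub>m (2 * m)) t f = torus_char m F t \<odot>\<^bsub>U_invariants m\<^esub> f}"

definition Sp_act :: "nat \<Rightarrow> complex mat \<Rightarrow> (complex mat \<Rightarrow> complex) \<Rightarrow> complex mat \<Rightarrow> complex" where
  "Sp_act m g = fun_act (2 * m) m g (1\<^sub>m m)"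

definition Sp_submodule :: "nat \<Rightarrow> (complex mat \<Rightarrow> complex) set \<Rightarrow> bool" where
  "Sp_submodule m W \<longleftrightarrow>
    submodule W complex_ring (U_invariants m) \<and> (\<forall>g \<in> Sp m. \<forall>f \<in> W. Sp_act m g f \<in> W)"

definition Sp_irreducible :: "nat \<Rightarrow> (complex mat \<Rightarrow> complex) set \<Rightarrow> bool" where
  "Sp_irreducible m T \<longleftrightarrow>
    Sp_submodule m T \<and> T \<noteq> {\<zero>\<^bsub>U_invariants m\<^esub>} \<and>
    (\<forall>S. Sp_submodule m S \<and> S \<subseteq> T \<longrightarrow> S = {\<zero>\<^bsub>U_invariants m\<^esub>} \<or> S = T)"

text \<open>
  With the above skew form the upper triangular matrices in \<open>Sp m\<close> form a Borel subgroup.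
\<close>

definition has_highest_weight ::
  "nat \<Rightarrow> (nat \<Rightarrow> nat) \<Rightarrow> (complex mat \<Rightarrow> complex) set \<Rightarrow> bool" where
  "has_highest_weight m F T \<longleftrightarrow>
    (\<exists>h \<in> T. h \<noteq> \<zero>\<^bsub>U_invariants m\<^esub> \<and>
      (\<forall>u \<in> Sp m \<inter> unitri (2 * m). Sp_act m u h = h) \<and>
      (\<forall>t \<in> Sp m. diagonal_mat t \<longrightarrow> Sp_act m t h = torus_char m F t \<odot>\<^bsub>U_invariants m\<^esub> h))"

definition is_tau :: "nat \<Rightarrow> (nat \<Rightarrow> nat) \<Rightarrow> (complex mat \<Rightarrow> complex) set \<Rightarrow> bool" where
  "is_tau m F T \<longleftrightarrow> T \<subseteq> rho m F \<and> Sp_irreducible m T \<and> has_highest_weight m F T"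

text \<open>
  The description is proper: \<open>rho m F\<close> contains exactly one \<open>T\<close> with \<open>is_tau m F T\<close>, with
  multiplicity one, and finite-dimensional representations of \<open>Sp m\<close> are completely reducible.
\<close>

definition Sp_complement :: "nat \<Rightarrow> (nat \<Rightarrow> nat) \<Rightarrow> (complex mat \<Rightarrow> complex) set" where
  "Sp_complement m F = (THE W. Sp_submodule m W \<and>
     (\<exists>T. is_tau m F T \<and> T <+>\<^bsub>U_invariants m\<^esub> W = rho m F \<and> T \<inter> W = {\<zero>\<^bsub>U_invariants m\<^esub>}))"

definition I_Sp :: "nat \<Rightarrow> (complex mat \<Rightarrow> complex) set" where
  "I_Sp m = {finsum (U_invariants m) w S | w S.
     finite S \<and> S \<subseteq> young m \<and> w \<in> (\<Pi> F\<in>S. Sp_complement m F)}"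

definition F_Sp :: "nat \<Rightarrow> (complex, (complex mat \<Rightarrow> complex) set) module" where
  "F_Sp m = quot_alg (U_invariants m) (I_Sp m)"

text \<open>
  The ordered alphabet \<open>u\<^sub>1 < v\<^sub>1 < \<dots> < u\<^sub>m < v\<^sub>m\<close> is encoded as \<open>1 < 2 < \<dots> < 2 m\<close>.
\<close>

definition sym_u :: "nat \<Rightarrow> nat" where "sym_u c = 2 * c - 1"

definition sym_v :: "nat \<Rightarrow> nat" where "sym_v c = 2 * c"

definition L_Sp :: "nat \<Rightarrow> nat \<Rightarrow> nat set set" where
  "L_Sp m n = {J. J \<subseteq> {1..2 * m} \<and> 1 \<le> card J \<and> card J \<le> n \<and>
     (\<exists>c Y. c \<le> n \<and> Y \<subseteq> {sym_u (n + 1)..sym_v m} \<and> J = sym_u ` {1..c} \<union> Y)}"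

definition psi :: "nat \<Rightarrow> nat \<Rightarrow> nat" where
  "psi m w = (if odd w then (w + 1) div 2 else 2 * m + 1 - w div 2)"

lemma psi_sym:
  assumes "1 \<le> c" "c \<le> m"
  shows "psi m (sym_u c) = c" "psi m (sym_v c) = 2 * m + 1 - c"
  using assms by (auto simp: psi_def sym_u_def sym_v_def)

text \<open>
  The argument \<open>I\<close> below is the subset of the alphabet, not its image under \<^const>\<open>psi\<close>:
  the rows are listed in the order of the alphabet.
\<close>

definition delta :: "nat \<Rightarrow> nat set \<Rightarrow> complex mat \<Rightarrow> complex" where
  "delta m I = (\<lambda>Q\<in>carrier_mat (2 * m) m.
     det (mat (card I) (card I) (\<lambda>(i, j). Q $$ (psi m (sorted_list_of_set I ! i) - 1, j))))"

definition branching_Sp :: "nat \<Rightarrow> nat \<Rightarrow> (complex, (complex mat \<Rightarrow> complex) set) module" where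
  "branching_Sp m n = (F_Sp m)
    \<lparr>carrier := gen_subalg (F_Sp m)
       {I_Sp m +>\<^bsub>U_invariants m\<^esub> delta m I | I. I \<in> L_Sp m n}\<rparr>"

end

theory Submission
  imports Defs
begin

text \<open>
  Write \<open>E\<close> for the \<open>2m \<times> m\<close> matrix formed by the first \<open>m\<close> unit vectors. The complement of
  \<open>\<tau>\<^sup>F\<close> in \<open>\<rho>\<^sup>F\<close> consists of the functions vanishing on the matrices \<open>g E\<close> with \<open>g\<close> symplectic:
  by a limit along a one-parameter subgroup of the torus, a submodule containing a function that does
  not vanish there contains the highest weight vector, and complements exist because \<open>Sp\<close> is closed
  under conjugate transposes. So the ideal consists of the invariants vanishing on all \<open>g E\<close>.

  The rows and columns that occur in the generators \<open>\<delta>\<close> can be prescribed freely (up to genericity)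
  in an isotropic frame. Hence pulling functions back along the selection of these rows is injective
  from the branching algebra of \<open>GL\<close> to the quotient by the ideal. Its image is generated by the
  \<open>\<delta>\<close> because the branching algebra of \<open>GL\<close> is generated by the minors on rows
  \<open>1, \<dots>, c, y\<^sub>1 < \<dots> < y\<^sub>s\<close> with \<open>y\<^sub>1 > 2n\<close>. This is proved by adding one row at a time: the top
  coefficients of the expansion in the last row are again invariants, and the representation theory of
  \<open>SL\<^sub>2\<close> bounds their exponents so that the last row can be appended to sufficiently many factors.
\<close>

section \<open>Polynomial functions\<close>

text \<open>\<open>Sp_complement\<close> is a definite description, so a complement of tau in
  \<open>rho m F\<close> must be shown to exist and to be unique. Both follow from one dichotomy: a
  submodule of \<open>rho m F\<close> lies in \<open>vanishing m F\<close> or contains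
  \<open>highest_vec m F\<close>. A module with \<open>is_tau\<close> contains
  \<open>highest_vec\<close> and meets \<open>vanishing\<close> in 0; a complement of it misses
  \<open>highest_vec\<close> and so lies in \<open>vanishing\<close>.

  Isotropy costs nothing for the following reason. In a Lagrangian frame [X; J S X] the symbol u_p
  selects row p of X and v_p selects row p of S X. Once the first n rows of X are fixed and
  independent in the first n columns, the later rows of X are free, and the block of S coupling the
  last m - n coordinates to the first n can give the later rows of S X any value in these columns.
  Rows n + 1 to 2n of the general linear side have no counterpart, but the unitriangular group of
  size 2n clears them on a generic matrix.

  The induction on rows starts at 2n >= n rows, where a generic matrix has one normal form up to
  column scaling.\<close>

definition is_poly :: "nat \<Rightarrow> nat \<Rightarrow> (complex mat \<Rightarrow> complex) \<Rightarrow> bool" where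
  "is_poly a k f \<longleftrightarrow> (\<lambda>Q\<in>carrier_mat a k. f Q) \<in> poly_funs a k"

lemma poly_funs_restrict: "f \<in> poly_funs a k \<Longrightarrow> (\<lambda>Q\<in>carrier_mat a k. f Q) = f"
  by (induction rule: poly_funs.induct) (auto simp: restrict_def fun_eq_iff)

lemma poly_funs_is_poly: "f \<in> poly_funs a k \<Longrightarrow> is_poly a k f"
  by (simp add: is_poly_def poly_funs_restrict)

lemma is_poly_cong:
  assumes "is_poly a k g" "\<And>Q. Q \<in> carrier_mat a k \<Longrightarrow> f Q = g Q"
  shows "is_poly a k f"
  using assms by (simp add: is_poly_def cong: restrict_cong)

lemma is_poly_const: "is_poly a k (\<lambda>Q. c)"
  by (simp add: is_poly_def poly_funs.const)

lemma is_poly_entry: "i < a \<Longrightarrow> j < k \<Longrightarrow> is_poly a k (\<lambda>Q. Q $$ (i, j))"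
  by (simp add: is_poly_def poly_funs.entry)

lemma is_poly_add: "is_poly a k f \<Longrightarrow> is_poly a k g \<Longrightarrow> is_poly a k (\<lambda>Q. f Q + g Q)"
  using poly_funs.add[of "restrict f (carrier_mat a k)" a k "restrict g (carrier_mat a k)"]
  by (simp add: is_poly_def cong: restrict_cong)

lemma is_poly_mult: "is_poly a k f \<Longrightarrow> is_poly a k g \<Longrightarrow> is_poly a k (\<lambda>Q. f Q * g Q)"
  using poly_funs.mult[of "restrict f (carrier_mat a k)" a k "restrict g (carrier_mat a k)"]
  by (simp add: is_poly_def cong: restrict_cong)

lemma is_poly_sum: "(\<And>x. x \<in> S \<Longrightarrow> is_poly a k (f x)) \<Longrightarrow> is_poly a k (\<lambda>Q. \<Sum>x\<in>S. f x Q)"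
  by (induction S rule: infinite_finite_induct) (auto intro: is_poly_const is_poly_add)

lemma is_poly_prod: "(\<And>x. x \<in> S \<Longrightarrow> is_poly a k (f x)) \<Longrightarrow> is_poly a k (\<lambda>Q. \<Prod>x\<in>S. f x Q)"
  by (induction S rule: infinite_finite_induct) (auto intro: is_poly_const is_poly_mult)

lemma is_poly_sum_list:
  "(\<And>x. x \<in> set xs \<Longrightarrow> is_poly a k (f x)) \<Longrightarrow> is_poly a k (\<lambda>Q. \<Sum>x\<leftarrow>xs. f x Q)"
  by (induction xs) (auto intro: is_poly_const is_poly_add)

lemma is_poly_prod_list:
  "(\<And>x. x \<in> set xs \<Longrightarrow> is_poly a k (f x)) \<Longrightarrow> is_poly a k (\<lambda>Q. \<Prod>x\<leftarrow>xs. f x Q)"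
  by (induction xs) (auto intro: is_poly_const is_poly_mult)

lemma is_poly_power: "is_poly a k f \<Longrightarrow> is_poly a k (\<lambda>Q. f Q ^ e)"
  by (induction e) (auto intro: is_poly_const is_poly_mult)

lemma is_poly_diff:
  assumes "is_poly a k f" "is_poly a k g"
  shows "is_poly a k (\<lambda>Q. f Q - g Q)"
proof -
  have "is_poly a k (\<lambda>Q. f Q + (-1) * g Q)"
    by (intro is_poly_add is_poly_mult is_poly_const assms)
  thus ?thesis by simp
qed

lemma is_poly_det:
  assumes "\<And>i j. i < r \<Longrightarrow> j < r \<Longrightarrow> is_poly a k (f i j)"
  shows "is_poly a k (\<lambda>Q. det (mat r r (\<lambda>(i, j). f i j Q)))"
proof -
  have "is_poly a k (\<lambda>Q. \<Sum>p\<in>{p. p permutes {0..<r}}. signof p * (\<Prod>i = 0..<r. f i (p i) Q))"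
    by (intro is_poly_sum is_poly_mult is_poly_const is_poly_prod assms)
       (auto simp: permutes_in_image)
  moreover have "(\<Sum>p\<in>{p. p permutes {0..<r}}. signof p * (\<Prod>i = 0..<r. f i (p i) Q)) =
      det (mat r r (\<lambda>(i, j). f i j Q))" for Q
    unfolding det_def'[OF mat_carrier]
    by (intro sum.cong refl arg_cong2[of _ _ _ _ "(*)"] prod.cong) (auto simp: permutes_in_image)
  ultimately show ?thesis by simp
qed

lemma is_poly_induct [consumes 1, case_names cong const entry add mult]:
  assumes "is_poly a k f"
    and cong: "\<And>f g. P g \<Longrightarrow> (\<And>Q. Q \<in> carrier_mat a k \<Longrightarrow> f Q = g Q) \<Longrightarrow> P f"
    and const: "\<And>c. P (\<lambda>Q. c)"
    and entry: "\<And>i j. i < a \<Longrightarrow> j < k \<Longrightarrow> P (\<lambda>Q. Q $$ (i, j))"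
    and add: "\<And>f g. P f \<Longrightarrow> P g \<Longrightarrow> P (\<lambda>Q. f Q + g Q)"
    and mult: "\<And>f g. P f \<Longrightarrow> P g \<Longrightarrow> P (\<lambda>Q. f Q * g Q)"
  shows "P f"
proof -
  have "P g" if "g \<in> poly_funs a k" for g
    using that
  proof (induction rule: poly_funs.induct)
    case (const c) show ?case by (rule cong[OF assms(3)[of c]]) simp
  next
    case (entry i j) show ?case by (rule cong[OF assms(4)[OF entry]]) simp
  next
    case (add f g) show ?case by (rule cong[OF assms(5)[OF add.IH]]) simp
  next
    case (mult f g) show ?case by (rule cong[OF assms(6)[OF mult.IH]]) simp
  qed
  from this[OF assms(1)[unfolded is_poly_def]] show ?thesis
    by (rule cong) simp
qed

lemma is_poly_compose:
  assumes "is_poly a k f"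
    and carr: "\<And>Q. Q \<in> carrier_mat a' k' \<Longrightarrow> \<sigma> Q \<in> carrier_mat a k"
    and ent: "\<And>i j. i < a \<Longrightarrow> j < k \<Longrightarrow> is_poly a' k' (\<lambda>Q. \<sigma> Q $$ (i, j))"
  shows "is_poly a' k' (\<lambda>Q. f (\<sigma> Q))"
  using assms(1)
proof (induction rule: is_poly_induct)
  case (cong f g) thus ?case using carr by (auto intro: is_poly_cong[of a' k' "\<lambda>Q. g (\<sigma> Q)"])
qed (auto intro: is_poly_const is_poly_add is_poly_mult ent)

text \<open>Restriction to polynomial curves reduces density arguments, degree bounds and limits to
  polynomials in one variable.\<close>

lemma is_poly_curve:
  assumes "is_poly a k f"
  shows "\<exists>p. \<forall>s. f (mat a k (\<lambda>(i, j). poly (q i j) s)) = poly p s"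
  using assms
proof (induction rule: is_poly_induct)
  case (const c) show ?case by (rule exI[of _ "[:c:]"]) simp
next
  case (entry i j) thus ?case by auto
next
  case (add f g)
  then obtain p p' where "\<forall>s. f (mat a k (\<lambda>(i, j). poly (q i j) s)) = poly p s"
    "\<forall>s. g (mat a k (\<lambda>(i, j). poly (q i j) s)) = poly p' s" by blast
  thus ?case by (intro exI[of _ "p + p'"]) simp
next
  case (mult f g)
  then obtain p p' where "\<forall>s. f (mat a k (\<lambda>(i, j). poly (q i j) s)) = poly p s"
    "\<forall>s. g (mat a k (\<lambda>(i, j). poly (q i j) s)) = poly p' s" by blast
  thus ?case by (intro exI[of _ "p * p'"]) simp
qed auto

lemma poly_fun_eq_0_iff: "(\<forall>s. poly p s = 0) \<longleftrightarrow> (p :: complex poly) = 0"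
  using poly_all_0_iff_0 by blast

text \<open>On the line from \<open>Q0\<close> to \<open>Q\<close> both functions become polynomials
  in one parameter; their product is zero and the second is nonzero at 0. This is the density of the
  set where \<open>g\<close> does not vanish.\<close>

lemma is_poly_eq_0_of_mult:
  assumes f: "is_poly a k f" and g: "is_poly a k g"
    and fg: "\<And>Q. Q \<in> carrier_mat a k \<Longrightarrow> f Q * g Q = 0"
    and Q0: "Q0 \<in> carrier_mat a k" "g Q0 \<noteq> 0" and Q: "Q \<in> carrier_mat a k"
  shows "f Q = 0"
proof -
  define q where "q = (\<lambda>i j. [:Q0 $$ (i, j), Q $$ (i, j) - Q0 $$ (i, j):])"
  obtain pf where pf: "\<forall>s. f (mat a k (\<lambda>(i, j). poly (q i j) s)) = poly pf s"
    using is_poly_curve[OF f] by blast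
  obtain pg where pg: "\<forall>s. g (mat a k (\<lambda>(i, j). poly (q i j) s)) = poly pg s"
    using is_poly_curve[OF g] by blast
  have "poly (pf * pg) s = 0" for s
    using fg[of "mat a k (\<lambda>(i, j). poly (q i j) s)"] pf pg by simp
  hence "pf * pg = 0" using poly_fun_eq_0_iff by blast
  moreover have "mat a k (\<lambda>(i, j). poly (q i j) 0) = Q0"
    using Q0 by (auto simp: q_def)
  hence "pg \<noteq> 0" using pg Q0 by (metis poly_0)
  ultimately have "pf = 0" by simp
  moreover have "mat a k (\<lambda>(i, j). poly (q i j) 1) = Q"
    using Q by (auto simp: q_def)
  ultimately show ?thesis using pf by (metis poly_0)
qed

text \<open>A polynomial function is a sum of terms, each a scalar with a list of matrix positions.\<close>

definition entry_prod :: "(nat \<times> nat) list \<Rightarrow> complex mat \<Rightarrow> complex" where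
  "entry_prod xs Q = (\<Prod>x\<leftarrow>xs. Q $$ x)"

definition term_sum :: "(complex \<times> (nat \<times> nat) list) list \<Rightarrow> complex mat \<Rightarrow> complex" where
  "term_sum ts Q = (\<Sum>t\<leftarrow>ts. fst t * entry_prod (snd t) Q)"

definition terms :: "nat \<Rightarrow> nat \<Rightarrow> (complex \<times> (nat \<times> nat) list) set" where
  "terms a k = {t. set (snd t) \<subseteq> {..<a} \<times> {..<k}}"

lemma entry_prod_simps [simp]:
  "entry_prod [] Q = 1" "entry_prod (x # xs) Q = Q $$ x * entry_prod xs Q"
  "entry_prod (xs @ ys) Q = entry_prod xs Q * entry_prod ys Q"
  by (simp_all add: entry_prod_def)

lemma term_sum_simps [simp]:
  "term_sum [] Q = 0" "term_sum (t # ts) Q = fst t * entry_prod (snd t) Q + term_sum ts Q"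
  "term_sum (ts @ us) Q = term_sum ts Q + term_sum us Q"
  by (simp_all add: term_sum_def)

definition term_mult ::
  "(complex \<times> (nat \<times> nat) list) list \<Rightarrow> (complex \<times> (nat \<times> nat) list) list \<Rightarrow>
   (complex \<times> (nat \<times> nat) list) list" where
  "term_mult ts us = concat (map (\<lambda>t. map (\<lambda>u. (fst t * fst u, snd t @ snd u)) us) ts)"

lemma term_sum_mult: "term_sum (term_mult ts us) Q = term_sum ts Q * term_sum us Q"
proof (induction ts)
  case (Cons t ts)
  have "term_sum (map (\<lambda>u. (fst t * fst u, snd t @ snd u)) us) Q =
      fst t * entry_prod (snd t) Q * term_sum us Q"
    by (induction us) (auto simp: algebra_simps)
  thus ?case using Cons by (simp add: term_mult_def algebra_simps)
qed (simp add: term_mult_def)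

lemma set_term_mult:
  "set (term_mult ts us) = (\<lambda>(t, u). (fst t * fst u, snd t @ snd u)) ` (set ts \<times> set us)"
  by (auto simp: term_mult_def image_iff)

lemma is_poly_entry_prod: "set xs \<subseteq> {..<a} \<times> {..<k} \<Longrightarrow> is_poly a k (entry_prod xs)"
  unfolding entry_prod_def by (intro is_poly_prod_list) (auto intro: is_poly_entry)

lemma is_poly_term_sum: "set ts \<subseteq> terms a k \<Longrightarrow> is_poly a k (term_sum ts)"
  unfolding term_sum_def
  by (intro is_poly_sum_list is_poly_mult is_poly_const is_poly_entry_prod) (auto simp: terms_def)

lemma is_poly_terms:
  assumes "is_poly a k f"
  obtains ts where "set ts \<subseteq> terms a k" "\<And>Q. Q \<in> carrier_mat a k \<Longrightarrow> f Q = term_sum ts Q"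
proof -
  have "\<exists>ts. set ts \<subseteq> terms a k \<and> (\<forall>Q\<in>carrier_mat a k. f Q = term_sum ts Q)"
    using assms
  proof (induction rule: is_poly_induct)
    case (const c) show ?case by (rule exI[of _ "[(c, [])]"]) (simp add: terms_def)
  next
    case (entry i j) thus ?case by (intro exI[of _ "[(1, [(i, j)])]"]) (simp add: terms_def)
  next
    case (add f g)
    then obtain ts us where "set ts \<subseteq> terms a k \<and> (\<forall>Q\<in>carrier_mat a k. f Q = term_sum ts Q)"
      "set us \<subseteq> terms a k \<and> (\<forall>Q\<in>carrier_mat a k. g Q = term_sum us Q)" by blast
    thus ?case by (intro exI[of _ "ts @ us"]) auto
  next
    case (mult f g)
    then obtain ts us where "set ts \<subseteq> terms a k \<and> (\<forall>Q\<in>carrier_mat a k. f Q = term_sum ts Q)"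
      "set us \<subseteq> terms a k \<and> (\<forall>Q\<in>carrier_mat a k. g Q = term_sum us Q)" by blast
    thus ?case by (intro exI[of _ "term_mult ts us"])
        (fastforce simp: term_sum_mult set_term_mult terms_def)
  qed auto
  thus ?thesis using that by blast
qed

text \<open>The key depends only on the positions in a term: it will be the column count, the
  exponents in the last row, or the torus exponent.\<close>

lemma term_sum_group:
  assumes "finite K" "(\<lambda>t. key (snd t)) ` set ts \<subseteq> K"
  shows "term_sum ts Q = (\<Sum>\<kappa>\<in>K. term_sum (filter (\<lambda>t. key (snd t) = \<kappa>) ts) Q)"
  using assms(2)
proof (induction ts)
  case (Cons t ts)
  have "(\<Sum>\<kappa>\<in>K. term_sum (filter (\<lambda>t. key (snd t) = \<kappa>) (t # ts)) Q) =
      (\<Sum>\<kappa>\<in>K. (if key (snd t) = \<kappa> then fst t * entry_prod (snd t) Q else 0) +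
        term_sum (filter (\<lambda>t. key (snd t) = \<kappa>) ts) Q)"
    by (intro sum.cong) auto
  also have "\<dots> = fst t * entry_prod (snd t) Q + term_sum ts Q"
    using Cons assms(1) by (simp add: sum.distrib)
  finally show ?case by simp
qed simp

text \<open>Eigenvectors with distinct characters are separated by killing all but one of them in turn;
  \<open>P a\<close> is to be read as: the combination with coefficients \<open>a\<close> lies in the given
  invariant subspace.\<close>

lemma eigen_separation:
  fixes \<chi> :: "'p \<Rightarrow> 'i \<Rightarrow> complex"
  assumes "finite S" "P a"
    and step: "\<And>a p c. P a \<Longrightarrow> p \<in> D \<Longrightarrow> P (\<lambda>\<gamma>. (\<chi> p \<gamma> - c) * a \<gamma>)"
    and sep: "\<And>\<gamma>. \<gamma> \<in> S \<Longrightarrow> \<gamma> \<noteq> \<beta> \<Longrightarrow> \<exists>p\<in>D. \<chi> p \<gamma> \<noteq> \<chi> p \<beta>"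
  shows "\<exists>a' e. P a' \<and> (\<forall>\<gamma>\<in>S. \<gamma> \<noteq> \<beta> \<longrightarrow> a' \<gamma> = 0) \<and> e \<noteq> 0 \<and> a' \<beta> = e * a \<beta>"
  using assms(1) sep
proof (induction S rule: finite_induct)
  case empty thus ?case using assms(2) by (intro exI[of _ a] exI[of _ 1]) auto
next
  case (insert x S)
  then obtain a' e where a': "P a'" "\<forall>\<gamma>\<in>S. \<gamma> \<noteq> \<beta> \<longrightarrow> a' \<gamma> = 0" "e \<noteq> 0" "a' \<beta> = e * a \<beta>"
    by blast
  show ?case
  proof (cases "x = \<beta>")
    case True thus ?thesis using a' by blast
  next
    case False
    then obtain p where p: "p \<in> D" "\<chi> p x \<noteq> \<chi> p \<beta>" using insert.prems by blast
    show ?thesis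
      by (rule exI[of _ "\<lambda>\<gamma>. (\<chi> p \<gamma> - \<chi> p x) * a' \<gamma>"], rule exI[of _ "(\<chi> p \<beta> - \<chi> p x) * e"])
        (use a' p step in auto)
  qed
qed

section \<open>Independence of monomials on the torus\<close>

definition mpow :: "nat \<Rightarrow> (nat \<Rightarrow> complex) \<Rightarrow> (nat \<Rightarrow> nat) \<Rightarrow> complex" where
  "mpow n t \<beta> = (\<Prod>j<n. t j ^ \<beta> j)"

lemma mpow_mult: "mpow n (\<lambda>j. s j * t j) \<beta> = mpow n s \<beta> * mpow n t \<beta>"
  by (simp add: mpow_def power_mult_distrib prod.distrib)

lemma mpow_add: "mpow n t (\<lambda>j. \<beta> j + \<gamma> j) = mpow n t \<beta> * mpow n t \<gamma>"
  by (simp add: mpow_def power_add prod.distrib)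

lemma two_power_eq_iff: "(2 :: complex) ^ a = 2 ^ b \<longleftrightarrow> a = b"
proof -
  have "(2 :: complex) ^ a = 2 ^ b \<longleftrightarrow> (of_nat (2 ^ a) :: complex) = of_nat (2 ^ b)" by simp
  also have "\<dots> \<longleftrightarrow> a = b" unfolding of_nat_eq_iff by simp
  finally show ?thesis .
qed

text \<open>Distinct exponent vectors are distinct characters of the torus, told apart by a point
  with one coordinate 2 and all others 1. \<open>eigen_separation\<close> isolates the term of
  \<open>\<beta>\<close>, which is then read off at the point 1. Only points with nonzero
  coordinates are tested, because weight vectors are controlled under invertible scalings
  only.\<close>

lemma mpow_independent:
  assumes fin: "finite S" and supp: "\<And>\<beta> j. \<beta> \<in> S \<Longrightarrow> n \<le> j \<Longrightarrow> \<beta> j = 0"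
    and zero: "\<And>t. (\<And>j. t j \<noteq> 0) \<Longrightarrow> (\<Sum>\<beta>\<in>S. mpow n t \<beta> * c \<beta>) = 0"
    and \<beta>: "\<beta> \<in> S"
  shows "c \<beta> = 0"
proof -
  define P where "P a \<longleftrightarrow> (\<forall>t. (\<forall>j. t j \<noteq> 0) \<longrightarrow> (\<Sum>\<beta>\<in>S. a \<beta> * mpow n t \<beta> * c \<beta>) = 0)" for a
  have "\<exists>a' e. P a' \<and> (\<forall>\<gamma>\<in>S. \<gamma> \<noteq> \<beta> \<longrightarrow> a' \<gamma> = 0) \<and> e \<noteq> 0 \<and> a' \<beta> = e * 1"
  proof (rule eigen_separation[where \<chi> = "mpow n" and D = "{t. \<forall>j. t j \<noteq> 0}"])
    show "P (\<lambda>_. 1)" using zero by (simp add: P_def)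
  next
    fix a p and d :: complex assume a: "P a" and p: "p \<in> {t. \<forall>j. t (j::nat) \<noteq> (0::complex)}"
    show "P (\<lambda>\<gamma>. (mpow n p \<gamma> - d) * a \<gamma>)"
      unfolding P_def
    proof (intro allI impI)
      fix t :: "nat \<Rightarrow> complex" assume t: "\<forall>j. t j \<noteq> 0"
      have "(\<Sum>\<beta>\<in>S. a \<beta> * mpow n (\<lambda>j. p j * t j) \<beta> * c \<beta>) = 0"
        using a p t by (simp add: P_def)
      moreover have "(\<Sum>\<beta>\<in>S. a \<beta> * mpow n t \<beta> * c \<beta>) = 0"
        using a t by (simp add: P_def)
      ultimately have "(\<Sum>\<beta>\<in>S. a \<beta> * mpow n (\<lambda>j. p j * t j) \<beta> * c \<beta>) -
          d * (\<Sum>\<beta>\<in>S. a \<beta> * mpow n t \<beta> * c \<beta>) = 0" by simp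
      thus "(\<Sum>\<beta>\<in>S. (mpow n p \<beta> - d) * a \<beta> * mpow n t \<beta> * c \<beta>) = 0"
        by (simp add: mpow_mult sum_distrib_left sum_subtractf[symmetric] algebra_simps)
    qed
  next
    fix \<gamma> assume \<gamma>: "\<gamma> \<in> S" "\<gamma> \<noteq> \<beta>"
    then obtain j where j: "\<gamma> j \<noteq> \<beta> j" by blast
    have "j < n" using j supp[OF \<gamma>(1), of j] supp[OF \<beta>, of j] by force
    moreover have "mpow n ((\<lambda>_. 1)(j := 2)) \<delta> = 2 ^ \<delta> j" if "j < n" for \<delta>
    proof -
      have "mpow n ((\<lambda>_. 1)(j := 2)) \<delta> = (\<Prod>i<n. if i = j then 2 ^ \<delta> j else 1)"
        unfolding mpow_def by (intro prod.cong) auto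
      thus ?thesis using that by simp
    qed
    ultimately show "\<exists>p\<in>{t. \<forall>j. t j \<noteq> 0}. mpow n p \<gamma> \<noteq> mpow n p \<beta>"
      using j by (intro bexI[of _ "(\<lambda>_. 1)(j := 2)"]) (auto simp: two_power_eq_iff)
  qed fact
  then obtain a' e where a': "P a'" "\<forall>\<gamma>\<in>S. \<gamma> \<noteq> \<beta> \<longrightarrow> a' \<gamma> = 0" "e \<noteq> 0" "a' \<beta> = e" by auto
  have "0 = (\<Sum>\<gamma>\<in>S. a' \<gamma> * mpow n (\<lambda>_. 1) \<gamma> * c \<gamma>)"
    using a'(1) by (simp add: P_def)
  also have "\<dots> = (\<Sum>\<gamma>\<in>S. if \<gamma> = \<beta> then e * c \<beta> else 0)"
    using a' by (intro sum.cong) (auto simp: mpow_def)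
  finally show ?thesis using fin \<beta> a' by simp
qed

section \<open>Column weights and invariance under unitriangular matrices\<close>

definition col_scale :: "(nat \<Rightarrow> complex) \<Rightarrow> complex mat \<Rightarrow> complex mat" where
  "col_scale t Q = mat (dim_row Q) (dim_col Q) (\<lambda>(i, j). t j * Q $$ (i, j))"

definition col_count :: "(nat \<times> nat) list \<Rightarrow> nat \<Rightarrow> nat" where
  "col_count xs j = length (filter (\<lambda>x. snd x = j) xs)"

text \<open>The zero function has every weight, so results such as dominance of the weight also ask
  for a point where the function is nonzero.\<close>

definition has_weight :: "nat \<Rightarrow> nat \<Rightarrow> (nat \<Rightarrow> nat) \<Rightarrow> (complex mat \<Rightarrow> complex) \<Rightarrow> bool" where
  "has_weight a k \<nu> f \<longleftrightarrow>
    (\<forall>t. (\<forall>j. t j \<noteq> 0) \<longrightarrow> (\<forall>Q\<in>carrier_mat a k. f (col_scale t Q) = mpow k t \<nu> * f Q))"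

definition right_inv :: "nat \<Rightarrow> nat \<Rightarrow> (complex mat \<Rightarrow> complex) \<Rightarrow> bool" where
  "right_inv a k f \<longleftrightarrow> (\<forall>u\<in>unitri k. \<forall>Q\<in>carrier_mat a k. f (Q * u) = f Q)"

text \<open>The transpose comes from \<open>fun_act\<close>, which evaluates at the transpose of g1
  times Q times g2. Hence the row operations concerned add multiples of earlier rows to later ones
  among the first \<open>b\<close>.\<close>

definition left_inv :: "nat \<Rightarrow> nat \<Rightarrow> nat \<Rightarrow> (complex mat \<Rightarrow> complex) \<Rightarrow> bool" where
  "left_inv b a k f \<longleftrightarrow>
    (\<forall>u\<in>unitri b. \<forall>Q\<in>carrier_mat a k. f (transpose_mat (GL_embed b a u) * Q) = f Q)"

lemma col_scale_carrier [simp]: "col_scale t Q \<in> carrier_mat a k \<longleftrightarrow> Q \<in> carrier_mat a k"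
  unfolding carrier_mat_def col_scale_def by simp

lemma col_scale_index [simp]:
  "Q \<in> carrier_mat a k \<Longrightarrow> i < a \<Longrightarrow> j < k \<Longrightarrow> col_scale t Q $$ (i, j) = t j * Q $$ (i, j)"
  by (auto simp: col_scale_def)

lemma col_scale_one: "Q \<in> carrier_mat a k \<Longrightarrow> col_scale (\<lambda>_. 1) Q = Q"
  by (auto simp: col_scale_def)

lemma col_scale_scale:
  "Q \<in> carrier_mat a k \<Longrightarrow> col_scale s (col_scale t Q) = col_scale (\<lambda>j. s j * t j) Q"
  by (auto simp: col_scale_def)

lemma has_weightD:
  "has_weight a k \<nu> f \<Longrightarrow> (\<And>j. t j \<noteq> 0) \<Longrightarrow> Q \<in> carrier_mat a k \<Longrightarrow>
    f (col_scale t Q) = mpow k t \<nu> * f Q"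
  by (auto simp: has_weight_def)

lemma has_weight_cong:
  "has_weight a k \<nu> g \<Longrightarrow> (\<And>Q. Q \<in> carrier_mat a k \<Longrightarrow> f Q = g Q) \<Longrightarrow> has_weight a k \<nu> f"
  by (simp add: has_weight_def)

lemma has_weight_add:
  "has_weight a k \<nu> f \<Longrightarrow> has_weight a k \<nu> g \<Longrightarrow> has_weight a k \<nu> (\<lambda>Q. f Q + g Q)"
  by (simp add: has_weight_def algebra_simps)

lemma has_weight_diff:
  "has_weight a k \<nu> f \<Longrightarrow> has_weight a k \<nu> g \<Longrightarrow> has_weight a k \<nu> (\<lambda>Q. f Q - g Q)"
  by (simp add: has_weight_def algebra_simps)

lemma has_weight_cmult: "has_weight a k \<nu> f \<Longrightarrow> has_weight a k \<nu> (\<lambda>Q. c * f Q)"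
  by (simp add: has_weight_def algebra_simps)

lemma has_weight_mult:
  "has_weight a k \<nu> f \<Longrightarrow> has_weight a k \<mu> g \<Longrightarrow> has_weight a k (\<lambda>j. \<nu> j + \<mu> j) (\<lambda>Q. f Q * g Q)"
  by (simp add: has_weight_def mpow_add)

lemma entry_prod_col_scale:
  assumes "set xs \<subseteq> {..<a} \<times> {..<k}" "Q \<in> carrier_mat a k"
  shows "entry_prod xs (col_scale t Q) = mpow k t (col_count xs) * entry_prod xs Q"
  using assms(1)
proof (induction xs)
  case Nil show ?case by (simp add: mpow_def col_count_def)
next
  case (Cons x xs)
  obtain i j where x: "x = (i, j)" by force
  have "mpow k t (col_count (x # xs)) = (\<Prod>l<k. (if l = j then t j else 1) * t l ^ col_count xs l)"
    unfolding mpow_def by (intro prod.cong) (auto simp: col_count_def x)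
  also have "\<dots> = t j * mpow k t (col_count xs)"
    using Cons.prems x by (simp add: prod.distrib mpow_def)
  finally show ?case using Cons x assms(2) by simp
qed

lemma col_count_support: "set xs \<subseteq> {..<a} \<times> {..<k} \<Longrightarrow> k \<le> j \<Longrightarrow> col_count xs j = 0"
  by (auto simp: col_count_def filter_empty_conv)

lemma term_sum_homogeneous:
  assumes "set ts \<subseteq> terms a k" "\<And>t. t \<in> set ts \<Longrightarrow> col_count (snd t) = \<kappa>" "Q \<in> carrier_mat a k"
  shows "term_sum ts (col_scale t Q) = mpow k t \<kappa> * term_sum ts Q"
  using assms(1,2)
proof (induction ts)
  case (Cons x ts)
  thus ?case
    using entry_prod_col_scale[of "snd x" a k Q t] assms(3) by (auto simp: terms_def algebra_simps)
qed simp

text \<open>Scaling the columns and comparing characters shows that the terms of every other column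
  count cancel among themselves. An arbitrary list of terms can therefore be thinned out without
  changing the function.\<close>

lemma term_sum_weight:
  assumes ts: "set ts \<subseteq> terms a k" and f: "\<And>Q. Q \<in> carrier_mat a k \<Longrightarrow> f Q = term_sum ts Q"
    and wt: "has_weight a k \<nu> f" and supp: "\<And>j. k \<le> j \<Longrightarrow> \<nu> j = 0" and Q: "Q \<in> carrier_mat a k"
  shows "f Q = term_sum (filter (\<lambda>t. col_count (snd t) = \<nu>) ts) Q"
proof -
  \<comment> \<open>The weight \<open>\<nu>\<close> is added since no term need have it; its
    filtered sum is then empty and \<open>f\<close> is zero.\<close>
  let ?K = "insert \<nu> ((\<lambda>t. col_count (snd t)) ` set ts)"
  let ?g = "\<lambda>\<kappa>. term_sum (filter (\<lambda>t. col_count (snd t) = \<kappa>) ts)"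
  have dec: "term_sum ts R = (\<Sum>\<kappa>\<in>?K. ?g \<kappa> R)" for R
    by (rule term_sum_group) auto
  have "(\<Sum>\<kappa>\<in>?K. mpow k t \<kappa> * (?g \<kappa> Q - (if \<kappa> = \<nu> then f Q else 0))) = 0"
    if t: "\<And>j. t j \<noteq> 0" for t
  proof -
    have "(\<Sum>\<kappa>\<in>?K. mpow k t \<kappa> * ?g \<kappa> Q) = (\<Sum>\<kappa>\<in>?K. ?g \<kappa> (col_scale t Q))"
      using ts Q by (intro sum.cong refl term_sum_homogeneous[symmetric]) auto
    also have "\<dots> = mpow k t \<nu> * f Q"
      using dec[of "col_scale t Q"] f[of "col_scale t Q"] has_weightD[OF wt t Q] Q by simp
    also have "\<dots> = (\<Sum>\<kappa>\<in>?K. mpow k t \<kappa> * (if \<kappa> = \<nu> then f Q else 0))"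
      by (simp add: if_distrib sum.delta cong: if_cong)
    finally show ?thesis by (simp add: algebra_simps sum_subtractf)
  qed
  hence "?g \<nu> Q - (if \<nu> = \<nu> then f Q else 0) = 0"
  proof (rule mpow_independent[rotated 2])
    fix \<beta> j assume "\<beta> \<in> ?K" "k \<le> j"
    thus "\<beta> j = 0" using ts supp col_count_support by (fastforce simp: terms_def)
  qed auto
  thus ?thesis by simp
qed

lemma weight_decomposition:
  assumes "is_poly a k f"
  obtains S F where "finite S" "\<And>Q. Q \<in> carrier_mat a k \<Longrightarrow> f Q = (\<Sum>\<kappa>\<in>S. F \<kappa> Q)"
    "\<And>\<kappa>. is_poly a k (F \<kappa>)" "\<And>\<kappa>. has_weight a k \<kappa> (F \<kappa>)"
    "\<And>\<kappa> j. \<kappa> \<in> S \<Longrightarrow> k \<le> j \<Longrightarrow> \<kappa> j = 0"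
proof -
  obtain ts where ts: "set ts \<subseteq> terms a k" "\<And>Q. Q \<in> carrier_mat a k \<Longrightarrow> f Q = term_sum ts Q"
    using is_poly_terms[OF assms] by blast
  show ?thesis
  proof (rule that[of "(\<lambda>t. col_count (snd t)) ` set ts"
        "\<lambda>\<kappa>. term_sum (filter (\<lambda>t. col_count (snd t) = \<kappa>) ts)"])
    show "f Q = (\<Sum>\<kappa>\<in>(\<lambda>t. col_count (snd t)) ` set ts.
        term_sum (filter (\<lambda>t. col_count (snd t) = \<kappa>) ts) Q)" if "Q \<in> carrier_mat a k" for Q
      using ts(2)[OF that] by (simp add: term_sum_group[symmetric])
    show "is_poly a k (term_sum (filter (\<lambda>t. col_count (snd t) = \<kappa>) ts))" for \<kappa>
      using ts(1) by (intro is_poly_term_sum) auto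
    show "has_weight a k \<kappa> (term_sum (filter (\<lambda>t. col_count (snd t) = \<kappa>) ts))" for \<kappa>
      unfolding has_weight_def using ts(1) by (auto intro!: term_sum_homogeneous)
    show "\<kappa> j = 0" if "\<kappa> \<in> (\<lambda>t. col_count (snd t)) ` set ts" "k \<le> j" for \<kappa> j
      using that ts(1) col_count_support by (fastforce simp: terms_def)
  qed auto
qed

text \<open>A coincidence of the values of \<open>f\<close> at two matrices that survives all column
  scalings passes to each weight component. This is how the components inherit invariance.\<close>

lemma weight_component_eq_0:
  assumes "finite S" "\<And>Q. Q \<in> carrier_mat a k \<Longrightarrow> f Q = (\<Sum>\<kappa>\<in>S. F \<kappa> Q)"
    "\<And>\<kappa>. has_weight a k \<kappa> (F \<kappa>)" "\<And>\<kappa> j. \<kappa> \<in> S \<Longrightarrow> k \<le> j \<Longrightarrow> \<kappa> j = 0"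
    and Q: "Q \<in> carrier_mat a k" "R \<in> carrier_mat a k"
    and zero: "\<And>t. (\<And>j. t j \<noteq> 0) \<Longrightarrow> f (col_scale t Q) = f (col_scale t R)" and "\<kappa> \<in> S"
  shows "F \<kappa> Q = F \<kappa> R"
proof -
  have "(\<Sum>\<kappa>\<in>S. mpow k t \<kappa> * (F \<kappa> Q - F \<kappa> R)) = 0" if t: "\<And>j. t j \<noteq> 0" for t
  proof -
    have "(\<Sum>\<kappa>\<in>S. mpow k t \<kappa> * F \<kappa> Q) = f (col_scale t Q)"
      using assms(2)[of "col_scale t Q"] Q has_weightD[OF assms(3) t Q(1)] by simp
    moreover have "(\<Sum>\<kappa>\<in>S. mpow k t \<kappa> * F \<kappa> R) = f (col_scale t R)"
      using assms(2)[of "col_scale t R"] Q has_weightD[OF assms(3) t Q(2)] by simp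
    ultimately show ?thesis using zero t by (simp add: algebra_simps sum_subtractf)
  qed
  hence "F \<kappa> Q - F \<kappa> R = 0"
    using assms(1,4,8) by (intro mpow_independent[of S k "\<lambda>\<kappa>. F \<kappa> Q - F \<kappa> R" \<kappa>]) auto
  thus ?thesis by simp
qed

section \<open>Unitriangular matrices and their interaction with the torus\<close>

lemma unitri_carrier: "u \<in> unitri r \<Longrightarrow> u \<in> carrier_mat r r"
  by (simp add: unitri_def)

lemma unitri_index:
  "u \<in> unitri r \<Longrightarrow> i < r \<Longrightarrow> u $$ (i, i) = 1"
  "u \<in> unitri r \<Longrightarrow> j < i \<Longrightarrow> i < r \<Longrightarrow> u $$ (i, j) = 0"
  by (auto simp: unitri_def upper_triangular_def)

lemma unitriI:
  assumes "u \<in> carrier_mat r r" "\<And>i. i < r \<Longrightarrow> u $$ (i, i) = 1"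
    "\<And>i j. j < i \<Longrightarrow> i < r \<Longrightarrow> u $$ (i, j) = 0"
  shows "u \<in> unitri r"
  using assms by (auto simp: unitri_def)

lemma one_in_unitri: "1\<^sub>m r \<in> unitri r"
  by (rule unitriI) auto

lemma mult_index_sum:
  assumes "A \<in> carrier_mat a b" "B \<in> carrier_mat b c" "i < a" "j < c"
  shows "(A * B) $$ (i, j) = (\<Sum>l<b. A $$ (i, l) * B $$ (l, j))"
  using assms by (auto simp: scalar_prod_def atLeast0LessThan intro!: sum.cong)

text \<open>The torus normalises the unitriangular group: the last factor is the conjugate of u by
  the diagonal matrix of t.\<close>

lemma mult_col_scale:
  assumes "Q \<in> carrier_mat a k" "u \<in> carrier_mat k k" "\<And>j. t j \<noteq> 0"
  shows "col_scale t (Q * u) =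
    col_scale t Q * mat k k (\<lambda>(i, j). u $$ (i, j) * t j / t i)"
proof (rule eq_matI)
  fix i j assume "i < dim_row (col_scale t Q * mat k k (\<lambda>(i, j). u $$ (i, j) * t j / t i))"
    "j < dim_col (col_scale t Q * mat k k (\<lambda>(i, j). u $$ (i, j) * t j / t i))"
  hence ij: "i < a" "j < k" using assms by (auto simp: col_scale_def)
  have "(col_scale t Q * mat k k (\<lambda>(i, j). u $$ (i, j) * t j / t i)) $$ (i, j) =
      (\<Sum>l<k. (t l * Q $$ (i, l)) * (u $$ (l, j) * t j / t l))"
    using ij assms by (subst mult_index_sum[of _ a k _ k]) auto
  also have "\<dots> = t j * (Q * u) $$ (i, j)"
    using ij assms(3)
    by (subst mult_index_sum[OF assms(1,2)]) (auto simp: sum_distrib_left intro!: sum.cong)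
  finally show "col_scale t (Q * u) $$ (i, j) =
      (col_scale t Q * mat k k (\<lambda>(i, j). u $$ (i, j) * t j / t i)) $$ (i, j)"
    using ij assms by (simp add: col_scale_index[of _ a k])
qed (use assms in \<open>auto simp: col_scale_def\<close>)

lemma left_mult_col_scale:
  assumes "L \<in> carrier_mat c a" "Q \<in> carrier_mat a k"
  shows "col_scale t (L * Q) = L * col_scale t Q"
proof (rule eq_matI)
  fix i j assume "i < dim_row (L * col_scale t Q)" "j < dim_col (L * col_scale t Q)"
  hence ij: "i < c" "j < k" using assms by (auto simp: col_scale_def)
  show "col_scale t (L * Q) $$ (i, j) = (L * col_scale t Q) $$ (i, j)"
    using ij assms
    by (simp add: col_scale_index[of _ c k] mult_index_sum[of _ c a _ k] sum_distrib_left algebra_simps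
        del: index_mult_mat)
qed (use assms in \<open>auto simp: col_scale_def\<close>)

lemma unitri_conj:
  assumes "u \<in> unitri k" "\<And>j. t j \<noteq> 0"
  shows "mat k k (\<lambda>(i, j). u $$ (i, j) * t j / t i) \<in> unitri k"
  using assms by (intro unitriI) (auto simp: unitri_index)

lemma GL_embed_carrier [simp]:
  assumes "u \<in> carrier_mat b b" "b \<le> a" shows "GL_embed b a u \<in> carrier_mat a a"
  using four_block_carrier_mat[OF assms(1) one_carrier_mat[of "a - b"]] assms(2)
  by (simp add: GL_embed_def)

lemma GL_embed_index:
  assumes "u \<in> carrier_mat b b" "b \<le> a" "i < a" "j < a"
  shows "GL_embed b a u $$ (i, j) =
    (if i < b \<and> j < b then u $$ (i, j) else if i = j then 1 else 0)"
  using assms by (auto simp: GL_embed_def)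

lemma GL_embed_unitri: "u \<in> unitri b \<Longrightarrow> b \<le> a \<Longrightarrow> GL_embed b a u \<in> unitri a"
  by (rule unitriI) (auto simp: GL_embed_index unitri_carrier unitri_index)

lemma weight_component_right_inv:
  assumes "finite S" "\<And>Q. Q \<in> carrier_mat a k \<Longrightarrow> f Q = (\<Sum>\<kappa>\<in>S. F \<kappa> Q)"
    "\<And>\<kappa>. has_weight a k \<kappa> (F \<kappa>)" "\<And>\<kappa> j. \<kappa> \<in> S \<Longrightarrow> k \<le> j \<Longrightarrow> \<kappa> j = 0"
    and inv: "right_inv a k f" and "\<kappa> \<in> S"
  shows "right_inv a k (F \<kappa>)"
  unfolding right_inv_def
proof (intro ballI)
  fix u Q :: "complex mat" assume u: "u \<in> unitri k" and Q: "Q \<in> carrier_mat a k"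
  have "f (col_scale t (Q * u)) = f (col_scale t Q)" if "\<And>j. t j \<noteq> 0" for t
    unfolding mult_col_scale[OF Q unitri_carrier[OF u] that]
    using inv Q unitri_conj[OF u that] by (simp add: right_inv_def)
  thus "F \<kappa> (Q * u) = F \<kappa> Q"
    using Q unitri_carrier[OF u] assms
    by (intro weight_component_eq_0[where S = S and F = F and f = f and a = a and k = k]) auto
qed

lemma weight_component_left_inv:
  assumes "finite S" "\<And>Q. Q \<in> carrier_mat a k \<Longrightarrow> f Q = (\<Sum>\<kappa>\<in>S. F \<kappa> Q)"
    "\<And>\<kappa>. has_weight a k \<kappa> (F \<kappa>)" "\<And>\<kappa> j. \<kappa> \<in> S \<Longrightarrow> k \<le> j \<Longrightarrow> \<kappa> j = 0"
    and inv: "left_inv b a k f" and "b \<le> a" "\<kappa> \<in> S"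
  shows "left_inv b a k (F \<kappa>)"
  unfolding left_inv_def
proof (intro ballI)
  fix u Q :: "complex mat" assume u: "u \<in> unitri b" and Q: "Q \<in> carrier_mat a k"
  let ?L = "transpose_mat (GL_embed b a u)"
  have L: "?L \<in> carrier_mat a a" using unitri_carrier[OF u] \<open>b \<le> a\<close> by simp
  have "f (col_scale t (?L * Q)) = f (col_scale t Q)" for t
    unfolding left_mult_col_scale[OF L Q] using inv u Q by (simp add: left_inv_def)
  thus "F \<kappa> (?L * Q) = F \<kappa> Q"
    using Q L assms
    by (intro weight_component_eq_0[where S = S and F = F and f = f and a = a and k = k]) auto
qed

section \<open>Minors\<close>

text \<open>The columns are always the first ones: such minors are the ones unchanged by
  unitriangular column operations.\<close>

definition minor :: "nat list \<Rightarrow> complex mat \<Rightarrow> complex" where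
  "minor xs Q = det (mat (length xs) (length xs) (\<lambda>(i, j). Q $$ (xs ! i, j)))"

lemma minor_Nil [simp]: "minor [] Q = 1"
  by (simp add: minor_def)

lemma is_poly_minor: "set xs \<subseteq> {..<a} \<Longrightarrow> length xs \<le> k \<Longrightarrow> is_poly a k (minor xs)"
  unfolding minor_def by (intro is_poly_det is_poly_entry) (auto simp: subset_iff)

lemma prod_list_upt: "(\<Prod>i\<leftarrow>[0..<n]. f i) = (\<Prod>i<n. f i :: complex)"
  by (induction n) auto

text \<open>The first r columns of \<open>Q * u\<close> are combinations of the first r columns of
  \<open>Q\<close>, so the r x r submatrix is multiplied by the leading block of \<open>u\<close>,
  which is triangular.\<close>

lemma minor_mult_right:
  assumes Q: "Q \<in> carrier_mat a k" and u: "u \<in> carrier_mat k k" "upper_triangular u"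
    and xs: "set xs \<subseteq> {..<a}" "length xs \<le> k"
  shows "minor xs (Q * u) = (\<Prod>j<length xs. u $$ (j, j)) * minor xs Q"
proof -
  let ?r = "length xs"
  let ?B = "mat ?r ?r (\<lambda>(i, j). Q $$ (xs ! i, j))"
  let ?U = "mat ?r ?r (\<lambda>(i, j). u $$ (i, j))"
  have "mat ?r ?r (\<lambda>(i, j). (Q * u) $$ (xs ! i, j)) = ?B * ?U"
  proof (rule eq_matI)
    fix i j assume "i < dim_row (?B * ?U)" "j < dim_col (?B * ?U)"
    hence ij: "i < ?r" "j < ?r" by auto
    hence x: "xs ! i < a" using xs nth_mem by fastforce
    have "(Q * u) $$ (xs ! i, j) = (\<Sum>l<k. Q $$ (xs ! i, l) * u $$ (l, j))"
      using x ij xs by (intro mult_index_sum[OF Q u(1)]) auto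
    also have "\<dots> = (\<Sum>l<?r. Q $$ (xs ! i, l) * u $$ (l, j))"
    proof (rule sum.mono_neutral_right)
      show "\<forall>l\<in>{..<k} - {..<?r}. Q $$ (xs ! i, l) * u $$ (l, j) = 0"
        using ij u by (auto simp: upper_triangular_def)
    qed (use xs in auto)
    also have "\<dots> = (?B * ?U) $$ (i, j)"
      using ij by (subst mult_index_sum[of _ ?r ?r _ ?r]) auto
    finally show "mat ?r ?r (\<lambda>(i, j). (Q * u) $$ (xs ! i, j)) $$ (i, j) = (?B * ?U) $$ (i, j)"
      using ij by simp
  qed auto
  hence "minor xs (Q * u) = det ?B * det ?U"
    by (simp add: minor_def det_mult[of _ ?r])
  also have "det ?U = (\<Prod>j<?r. u $$ (j, j))"
    using u xs(2) by (subst det_upper_triangular[of _ ?r])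
      (auto simp: upper_triangular_def diag_mat_def prod_list_upt)
  finally show ?thesis by (simp add: minor_def)
qed

lemma minor_right_inv: "set xs \<subseteq> {..<a} \<Longrightarrow> length xs \<le> k \<Longrightarrow> right_inv a k (minor xs)"
  unfolding right_inv_def
proof (intro ballI)
  fix u Q :: "complex mat" assume "set xs \<subseteq> {..<a}" "length xs \<le> k" and u: "u \<in> unitri k" and "Q \<in> carrier_mat a k"
  hence "minor xs (Q * u) = (\<Prod>j<length xs. u $$ (j, j)) * minor xs Q"
    by (intro minor_mult_right) (auto simp: unitri_def)
  thus "minor xs (Q * u) = minor xs Q" using u \<open>length xs \<le> k\<close> by (simp add: unitri_index)
qed

lemma col_scale_eq_mult:
  assumes "Q \<in> carrier_mat a k"
  shows "col_scale t Q = Q * mat k k (\<lambda>(i, j). if i = j then t j else 0)"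
proof (rule eq_matI)
  let ?D = "mat k k (\<lambda>(i, j). if i = j then t j else 0)"
  fix i j assume "i < dim_row (Q * ?D)" "j < dim_col (Q * ?D)"
  hence ij: "i < a" "j < k" using assms by auto
  have "(Q * ?D) $$ (i, j) = (\<Sum>l<k. Q $$ (i, l) * (if l = j then t j else 0))"
    using ij assms by (subst mult_index_sum[of _ a k _ k]) auto
  also have "\<dots> = t j * Q $$ (i, j)" using ij by (simp add: if_distrib cong: if_cong)
  finally show "col_scale t Q $$ (i, j) = (Q * ?D) $$ (i, j)" using ij assms by simp
qed (use assms in \<open>auto simp: col_scale_def\<close>)

lemma minor_col_scale:
  assumes "Q \<in> carrier_mat a k" "set xs \<subseteq> {..<a}" "length xs \<le> k"
  shows "minor xs (col_scale t Q) = (\<Prod>j<length xs. t j) * minor xs Q"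
  unfolding col_scale_eq_mult[OF assms(1)] using assms
  by (subst minor_mult_right[of _ a k]) (auto simp: upper_triangular_def)

lemma minor_has_weight:
  assumes "set xs \<subseteq> {..<a}" "length xs \<le> k"
  shows "has_weight a k (\<lambda>j. if j < length xs then 1 else 0) (minor xs)"
  unfolding has_weight_def
proof (intro allI impI ballI)
  fix t :: "nat \<Rightarrow> complex" and Q :: "complex mat"
  assume Q: "Q \<in> carrier_mat a k"
  have "mpow k t (\<lambda>j. if j < length xs then 1 else 0) =
      (\<Prod>j<k. if j < length xs then t j else 1)"
    unfolding mpow_def by (intro prod.cong) auto
  also have "\<dots> = (\<Prod>j\<in>{..<k} \<inter> {j. j < length xs}. t j)" by (simp add: prod.inter_restrict)
  also have "{..<k} \<inter> {j. j < length xs} = {..<length xs}" using assms by auto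
  finally show "minor xs (col_scale t Q) =
      mpow k t (\<lambda>j. if j < length xs then 1 else 0) * minor xs Q"
    by (simp add: minor_col_scale[OF Q assms])
qed

lemma GL_embed_mult_index:
  assumes u: "u \<in> carrier_mat b b" "b \<le> a" and Q: "Q \<in> carrier_mat a k" and ij: "i < a" "j < k"
  shows "(transpose_mat (GL_embed b a u) * Q) $$ (i, j) =
    (if i < b then \<Sum>l<b. u $$ (l, i) * Q $$ (l, j) else Q $$ (i, j))"
proof -
  have "(transpose_mat (GL_embed b a u) * Q) $$ (i, j) =
      (\<Sum>l<a. GL_embed b a u $$ (l, i) * Q $$ (l, j))"
    using assms GL_embed_carrier[OF u]
    by (subst mult_index_sum[of _ a a _ k]) (auto intro!: sum.cong simp del: GL_embed_carrier)
  also have "\<dots> = (\<Sum>l<a. if i < b \<and> l < b then u $$ (l, i) * Q $$ (l, j)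
      else if l = i then Q $$ (l, j) else 0)"
    using assms by (intro sum.cong) (auto simp: GL_embed_index)
  also have "\<dots> = (if i < b then \<Sum>l<b. u $$ (l, i) * Q $$ (l, j) else Q $$ (i, j))"
  proof (cases "i < b")
    case True
    have "(\<Sum>l<a. if i < b \<and> l < b then u $$ (l, i) * Q $$ (l, j)
        else if l = i then Q $$ (l, j) else 0) = (\<Sum>l<a. if l < b then u $$ (l, i) * Q $$ (l, j) else 0)"
      using True by (intro sum.cong) auto
    also have "\<dots> = (\<Sum>l\<in>{..<a} \<inter> {l. l < b}. u $$ (l, i) * Q $$ (l, j))"
      by (simp add: sum.inter_restrict)
    also have "{..<a} \<inter> {l. l < b} = {..<b}" using u by auto
    finally show ?thesis using True by simp
  qed (use ij in simp)
  finally show ?thesis .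
qed

text \<open>The row operations preserve an initial segment of rows, on which they act by a lower
  unitriangular matrix, and do not move the rows in \<open>ys\<close>. So the submatrix is
  multiplied by \<open>?L\<close> of determinant 1.\<close>

lemma minor_left_inv:
  assumes "xs = [0..<c] @ ys" "c \<le> b" "set ys \<subseteq> {b..<a}" "length xs \<le> k" "b \<le> a"
  shows "left_inv b a k (minor xs)"
  unfolding left_inv_def
proof (intro ballI)
  fix u Q :: "complex mat" assume u: "u \<in> unitri b" and Q: "Q \<in> carrier_mat a k"
  let ?r = "length xs"
  let ?B = "mat ?r ?r (\<lambda>(i, j). Q $$ (xs ! i, j))"
  let ?L = "mat ?r ?r (\<lambda>(p, q). if p < c \<and> q < c then u $$ (q, p) else if p = q then 1 else 0)"
  have c: "c \<le> ?r" using assms by simp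
  have low: "xs ! p = p" if "p < c" for p using that assms by (simp add: nth_append)
  have high: "xs ! p \<in> {b..<a}" if "c \<le> p" "p < ?r" for p
  proof -
    have "xs ! p = ys ! (p - c)" "p - c < length ys" using that assms by (auto simp: nth_append)
    thus ?thesis using assms(3) nth_mem by fastforce
  qed
  have "mat ?r ?r (\<lambda>(i, j). (transpose_mat (GL_embed b a u) * Q) $$ (xs ! i, j)) = ?L * ?B"
  proof (rule eq_matI)
    fix i j assume "i < dim_row (?L * ?B)" "j < dim_col (?L * ?B)"
    hence ij: "i < ?r" "j < ?r" by auto
    have jk: "j < k" using ij assms by simp
    have rhs: "(?L * ?B) $$ (i, j) = (\<Sum>q<?r. (if i < c \<and> q < c then u $$ (q, i)
        else if i = q then 1 else 0) * Q $$ (xs ! q, j))"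
      using ij by (subst mult_index_sum[of _ ?r ?r _ ?r]) auto
    show "mat ?r ?r (\<lambda>(i, j). (transpose_mat (GL_embed b a u) * Q) $$ (xs ! i, j)) $$ (i, j) =
        (?L * ?B) $$ (i, j)"
    proof (cases "i < c")
      case True
      have "(?L * ?B) $$ (i, j) = (\<Sum>q<c. u $$ (q, i) * Q $$ (q, j))"
        unfolding rhs using True c low
        by (intro sum.mono_neutral_cong_right) auto
      also have "\<dots> = (\<Sum>q<b. u $$ (q, i) * Q $$ (q, j))"
        using True assms(2) u by (intro sum.mono_neutral_left) (auto simp: unitri_index)
      finally show ?thesis
        using ij jk True assms low unitri_carrier[OF u] Q by (simp add: GL_embed_mult_index)
    next
      case False
      have "(?L * ?B) $$ (i, j) = (\<Sum>q<?r. if q = i then Q $$ (xs ! q, j) else 0)"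
        unfolding rhs using False by (intro sum.cong) auto
      also have "\<dots> = Q $$ (xs ! i, j)" using ij by simp
      finally show ?thesis
        using ij jk False high[of i] assms unitri_carrier[OF u] Q by (simp add: GL_embed_mult_index)
    qed
  qed auto
  hence "minor xs (transpose_mat (GL_embed b a u) * Q) = det ?L * det ?B"
    by (simp add: minor_def det_mult[of _ ?r])
  also have "det ?L = prod_list (diag_mat ?L)"
    using u assms by (intro det_lower_triangular[of ?r]) (auto simp: unitri_index)
  also have "\<dots> = 1"
    using u assms(2) by (auto simp: diag_mat_def prod_list_upt unitri_index intro!: prod.neutral)
  finally show "minor xs (transpose_mat (GL_embed b a u) * Q) = minor xs Q"
    by (simp add: minor_def)
qed

section \<open>Generic matrices\<close>

definition lower_unitri :: "nat \<Rightarrow> nat \<Rightarrow> complex mat set" where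
  "lower_unitri a k = {n \<in> carrier_mat a k.
    \<forall>i<a. \<forall>j<k. (i = j \<longrightarrow> n $$ (i, j) = 1) \<and> (i < j \<longrightarrow> n $$ (i, j) = 0)}"

definition id_mat :: "nat \<Rightarrow> nat \<Rightarrow> complex mat" where
  "id_mat a k = mat a k (\<lambda>(i, j). if i = j then 1 else 0)"

definition generic :: "nat \<Rightarrow> complex mat \<Rightarrow> bool" where
  "generic k Q \<longleftrightarrow> (\<forall>i\<le>k. minor [0..<i] Q \<noteq> 0)"

lemma id_mat_carrier [simp]: "id_mat a k \<in> carrier_mat a k"
  by (simp add: id_mat_def)

lemma id_mat_index [simp]:
  "i < a \<Longrightarrow> j < k \<Longrightarrow> id_mat a k $$ (i, j) = (if i = j then 1 else 0)"
  by (simp add: id_mat_def)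

lemma lower_unitri_carrier: "n \<in> lower_unitri a k \<Longrightarrow> n \<in> carrier_mat a k"
  by (simp add: lower_unitri_def)

lemma lower_unitri_diag: "n \<in> lower_unitri a k \<Longrightarrow> i < a \<Longrightarrow> i < k \<Longrightarrow> n $$ (i, i) = 1"
  by (auto simp: lower_unitri_def)

lemma minor_lower_unitri:
  assumes "n \<in> lower_unitri a k" "i \<le> k" "k \<le> a"
  shows "minor [0..<i] n = 1"
proof -
  have "minor [0..<i] n = prod_list (diag_mat (mat i i (\<lambda>(r, c). n $$ ([0..<i] ! r, c))))"
    unfolding minor_def length_upt diff_zero
    using assms by (intro det_lower_triangular[of i]) (auto simp: lower_unitri_def)
  also have "\<dots> = 1"
    using assms by (auto simp: diag_mat_def prod_list_upt lower_unitri_diag intro!: prod.neutral)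
  finally show ?thesis .
qed

lemma id_mat_lower_unitri: "id_mat a k \<in> lower_unitri a k"
  by (simp add: lower_unitri_def)

text \<open>Density of the big cell: the product of the leading minors is a polynomial with value 1
  at \<open>id_mat\<close>.\<close>

lemma generic_zero:
  assumes f: "is_poly a k f" and "k \<le> a"
    and zero: "\<And>Q. Q \<in> carrier_mat a k \<Longrightarrow> generic k Q \<Longrightarrow> f Q = 0"
    and Q: "Q \<in> carrier_mat a k"
  shows "f Q = 0"
proof (rule is_poly_eq_0_of_mult[OF f _ _ _ _ Q])
  let ?g = "\<lambda>Q. \<Prod>i\<le>k. minor [0..<i] Q"
  show "is_poly a k ?g"
    using \<open>k \<le> a\<close> by (intro is_poly_prod is_poly_minor) auto
  show "f Q * ?g Q = 0" if "Q \<in> carrier_mat a k" for Q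
    using zero[OF that] by (cases "generic k Q") (auto simp: generic_def)
  show "?g (id_mat a k) \<noteq> 0"
    using minor_lower_unitri[OF id_mat_lower_unitri] \<open>k \<le> a\<close> by simp
qed simp

lemma det_nonzero_solve:
  fixes A :: "complex mat"
  assumes A: "A \<in> carrier_mat j j" and "det A \<noteq> 0"
  obtains x where "\<And>i. i < j \<Longrightarrow> (\<Sum>l<j. A $$ (i, l) * x l) = b i"
proof -
  from det_non_zero_imp_unit[OF assms, of undefined] obtain B where
    B: "B \<in> carrier_mat j j" "A * B = 1\<^sub>m j"
    by (auto simp: Units_def ring_mat_def)
  show ?thesis
  proof (rule that)
    fix i assume i: "i < j"
    have "(\<Sum>l<j. A $$ (i, l) * (\<Sum>m<j. B $$ (l, m) * b m)) =
        (\<Sum>m<j. (\<Sum>l<j. A $$ (i, l) * B $$ (l, m)) * b m)"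
      unfolding sum_distrib_left sum_distrib_right by (subst sum.swap) (simp add: mult.assoc)
    also have "\<dots> = (\<Sum>m<j. (A * B) $$ (i, m) * b m)"
      using i by (intro sum.cong) (auto simp: mult_index_sum[OF A B(1)] simp del: index_mult_mat)
    also have "\<dots> = (\<Sum>m<j. if m = i then b m else 0)"
      using i by (intro sum.cong) (auto simp: B(2))
    also have "\<dots> = b i" using i by simp
    finally show "(\<Sum>l<j. A $$ (i, l) * (\<Sum>m<j. B $$ (l, m) * b m)) = b i" .
  qed
qed

text \<open>Gauss elimination by columns. The diagonal entries that remain multiply up to the
  leading minors, which the column operations do not change.\<close>

lemma generic_decomposition:
  assumes Q: "Q \<in> carrier_mat a k" and gen: "generic k Q" and "k \<le> a"
  obtains u d n where "u \<in> unitri k" "\<And>j. d j \<noteq> 0" "n \<in> lower_unitri a k" "Q * u = col_scale d n"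
    "\<And>i. i \<le> k \<Longrightarrow> minor [0..<i] Q = (\<Prod>j<i. d j)"
proof -
  \<comment> \<open>The coefficients x put above the diagonal in column j of u combine the earlier
    columns of Q so as to clear the first j rows of column j; the system is the leading j x j
    block.\<close>
  have "\<exists>x. \<forall>i<j. (\<Sum>l<j. Q $$ (i, l) * x l) = - Q $$ (i, j)" if j: "j < k" for j
  proof -
    let ?A = "mat j j (\<lambda>(i, l). Q $$ ([0..<j] ! i, l))"
    have "det ?A \<noteq> 0"
      using gen j unfolding generic_def minor_def length_upt diff_zero by (meson less_imp_le)
    from det_nonzero_solve[OF mat_carrier this, of "\<lambda>i. - Q $$ (i, j)"] obtain x where
      "\<And>i. i < j \<Longrightarrow> (\<Sum>l<j. ?A $$ (i, l) * x l) = - Q $$ (i, j)" by blast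
    thus ?thesis by (intro exI[of _ x]) auto
  qed
  then obtain x where x: "\<And>j i. j < k \<Longrightarrow> i < j \<Longrightarrow> (\<Sum>l<j. Q $$ (i, l) * x j l) = - Q $$ (i, j)"
    by metis
  define u where "u = mat k k (\<lambda>(i, j). if i = j then 1 else if i < j then x j i else 0)"
  have u: "u \<in> unitri k" by (intro unitriI) (auto simp: u_def)
  note uc = unitri_carrier[OF u]
  have low: "(Q * u) $$ (i, j) = 0" if "i < j" "j < k" for i j
  proof -
    have "(Q * u) $$ (i, j) = (\<Sum>l<k. Q $$ (i, l) * u $$ (l, j))"
      using that \<open>k \<le> a\<close> by (intro mult_index_sum[OF Q uc]) auto
    also have "\<dots> = (\<Sum>l<Suc j. Q $$ (i, l) * u $$ (l, j))"
      using that by (intro sum.mono_neutral_right) (auto simp: u_def)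
    also have "\<dots> = (\<Sum>l<j. Q $$ (i, l) * x j l) + Q $$ (i, j)"
      using that by (simp add: u_def)
    finally show ?thesis using x that by simp
  qed
  have lead: "minor [0..<i] Q = (\<Prod>j<i. (Q * u) $$ (j, j))" if "i \<le> k" for i
  proof -
    have "minor [0..<i] Q = minor [0..<i] (Q * u)"
      using minor_right_inv[of "[0..<i]" a k] Q u that \<open>k \<le> a\<close>
      by (simp add: right_inv_def subset_iff)
    also have "\<dots> = prod_list (diag_mat (mat i i (\<lambda>(r, c). (Q * u) $$ ([0..<i] ! r, c))))"
      unfolding minor_def length_upt diff_zero
      using that low by (intro det_lower_triangular[of i]) auto
    finally show ?thesis by (simp add: diag_mat_def prod_list_upt)
  qed
  \<comment> \<open>The value 1 out of range keeps d nonzero at every index, as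
    \<open>has_weight\<close> requires of a scaling.\<close>
  define d where "d j = (if j < k then (Q * u) $$ (j, j) else 1)" for j
  have d: "d j \<noteq> 0" for j
  proof (cases "j < k")
    case True
    hence "(\<Prod>i<Suc j. (Q * u) $$ (i, i)) \<noteq> 0"
      using lead[of "Suc j"] gen unfolding generic_def by (metis Suc_leI)
    thus ?thesis using True by (simp add: d_def)
  qed (simp add: d_def)
  define n where "n = col_scale (\<lambda>j. 1 / d j) (Q * u)"
  have Qu: "Q * u \<in> carrier_mat a k" using Q uc by simp
  show ?thesis
  proof (rule that[OF u d])
    show "n \<in> lower_unitri a k"
      using Qu low d unfolding lower_unitri_def n_def
      by (auto simp: col_scale_index[OF Qu] d_def simp del: index_mult_mat)
    show "Q * u = col_scale d n"
      using d by (simp add: n_def col_scale_scale[OF Qu] col_scale_one[OF Qu])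
    show "minor [0..<i] Q = (\<Prod>j<i. d j)" if "i \<le> k" for i
      using lead[OF that] that by (simp add: d_def)
  qed
qed

text \<open>The classical highest weight vector: the diagram with rows \<open>\<nu>\<close> has
  \<open>\<nu> i - \<nu> (Suc i)\<close> columns of length i + 1. The formula is meant for
  decreasing \<open>\<nu>\<close>, where the subtraction is genuine.\<close>

definition lead_monomial :: "nat \<Rightarrow> (nat \<Rightarrow> nat) \<Rightarrow> complex mat \<Rightarrow> complex" where
  "lead_monomial k \<nu> Q = (\<Prod>i<k. minor [0..<Suc i] Q ^ (\<nu> i - \<nu> (Suc i)))"

text \<open>Summation by parts in the exponents. The boundary factor with exponent
  \<open>\<nu> k\<close> makes the induction on k possible; in the applications
  \<open>\<nu> k\<close> is 0.\<close>

lemma prod_powers_telescope: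
  fixes d :: "nat \<Rightarrow> complex"
  assumes "\<And>i. i < k \<Longrightarrow> \<nu> (Suc i) \<le> \<nu> i"
  shows "(\<Prod>i<k. (\<Prod>j<Suc i. d j) ^ (\<nu> i - \<nu> (Suc i))) * (\<Prod>j<k. d j) ^ \<nu> k = mpow k d \<nu>"
  using assms
proof (induction k)
  case (Suc k)
  have "(\<Prod>j<Suc k. d j) ^ (\<nu> k - \<nu> (Suc k)) * (\<Prod>j<Suc k. d j) ^ \<nu> (Suc k) =
      (\<Prod>j<k. d j) ^ \<nu> k * d k ^ \<nu> k"
    using Suc.prems[of k] by (simp add: power_add[symmetric] power_mult_distrib del: prod.lessThan_Suc)
      (simp add: power_mult_distrib)
  thus ?case using Suc by (simp add: mpow_def mult.assoc[symmetric])
      (metis (no_types, lifting) mult.assoc mult.commute less_Suc_eq)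
qed (simp add: mpow_def)

lemma lead_monomial_generic:
  assumes "\<And>i. i < k \<Longrightarrow> \<nu> (Suc i) \<le> \<nu> i" "\<nu> k = 0" "\<And>i. i \<le> k \<Longrightarrow> minor [0..<i] Q = (\<Prod>j<i. d j)"
  shows "lead_monomial k \<nu> Q = mpow k d \<nu>"
proof -
  have "lead_monomial k \<nu> Q = (\<Prod>i<k. (\<Prod>j<Suc i. d j) ^ (\<nu> i - \<nu> (Suc i)))"
    unfolding lead_monomial_def 
    using assms(3) by (intro prod.cong refl arg_cong2[of _ _ _ _ "(^)"]) (auto simp del: upt_Suc)
  thus ?thesis using prod_powers_telescope[of k \<nu> d] assms by simp
qed

lemma is_poly_lead_monomial: "k \<le> a \<Longrightarrow> is_poly a k (lead_monomial k \<nu>)"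
  unfolding lead_monomial_def by (intro is_poly_prod is_poly_power is_poly_minor) auto

lemma eval_generic:
  assumes "right_inv a k f" "has_weight a k \<nu> f" "Q \<in> carrier_mat a k" "u \<in> unitri k"
    "\<And>j. d j \<noteq> 0" "n \<in> carrier_mat a k" "Q * u = col_scale d n"
  shows "f Q = mpow k d \<nu> * f n"
proof -
  have "f Q = f (Q * u)" using assms(1,3,4) by (simp add: right_inv_def)
  also have "\<dots> = mpow k d \<nu> * f n" unfolding assms(7) by (rule has_weightD[OF assms(2,5,6)])
  finally show ?thesis .
qed

section \<open>Column operations\<close>

definition add_col :: "nat \<Rightarrow> complex \<Rightarrow> complex mat \<Rightarrow> complex mat" where
  "add_col j c Q = mat (dim_row Q) (dim_col Q)
    (\<lambda>(r, l). if l = Suc j then Q $$ (r, l) + c * Q $$ (r, j) else Q $$ (r, l))"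

text \<open>The diagonal torus of the SL2 that acts on columns j and j + 1.\<close>

definition two_scale :: "nat \<Rightarrow> complex \<Rightarrow> nat \<Rightarrow> complex" where
  "two_scale j s l = (if l = j then s else if l = Suc j then 1 / s else 1)"

lemma two_scale_nonzero: "s \<noteq> 0 \<Longrightarrow> two_scale j s l \<noteq> 0"
  by (simp add: two_scale_def)

lemma mpow_two_scale:
  assumes "Suc j < k"
  shows "mpow k (two_scale j s) \<nu> = s ^ \<nu> j * (1 / s) ^ \<nu> (Suc j)"
proof -
  have "mpow k (two_scale j s) \<nu> =
      (\<Prod>l<k. (if l = j then s ^ \<nu> j else 1) * (if l = Suc j then (1 / s) ^ \<nu> (Suc j) else 1))"
    unfolding mpow_def by (intro prod.cong) (auto simp: two_scale_def)
  thus ?thesis using assms by (simp add: prod.distrib)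
qed

lemma add_col_carrier [simp]: "Q \<in> carrier_mat a k \<Longrightarrow> add_col j c Q \<in> carrier_mat a k"
  by (auto simp: add_col_def)

definition col_elem :: "nat \<Rightarrow> nat \<Rightarrow> complex \<Rightarrow> complex mat" where
  "col_elem k j c = mat k k (\<lambda>(i, l). if i = l then 1 else if i = j \<and> l = Suc j then c else 0)"

lemma col_elem_unitri: "col_elem k j c \<in> unitri k"
  by (rule unitriI) (auto simp: col_elem_def)

lemma add_col_eq_mult:
  assumes Q: "Q \<in> carrier_mat a k" and j: "Suc j < k"
  shows "add_col j c Q = Q * col_elem k j c"
proof (rule eq_matI)
  fix r l assume "r < dim_row (Q * col_elem k j c)" "l < dim_col (Q * col_elem k j c)"
  hence rl: "r < a" "l < k" using Q by (auto simp: col_elem_def)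
  have "(Q * col_elem k j c) $$ (r, l) = (\<Sum>i<k. Q $$ (r, i) * col_elem k j c $$ (i, l))"
    using rl by (intro mult_index_sum[OF Q]) (auto simp: col_elem_def)
  also have "\<dots> = (\<Sum>i<k. (if i = l then Q $$ (r, l) else 0) +
      (if i = j then (if l = Suc j then c * Q $$ (r, j) else 0) else 0))"
    using rl by (intro sum.cong) (auto simp: col_elem_def)
  also have "\<dots> = add_col j c Q $$ (r, l)"
    using rl j Q by (simp add: sum.distrib add_col_def)
  finally show "add_col j c Q $$ (r, l) = (Q * col_elem k j c) $$ (r, l)" by simp
qed (use Q in \<open>auto simp: add_col_def col_elem_def\<close>)

text \<open>A polynomial that tends to 0 at infinity is zero. Multiplication by s to the power d =
  degree T turns this into an equation between \<open>monom 1 d * P\<close> and a polynomial of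
  degree less than d.\<close>

lemma poly_eq_0_if_vanishes_at_infinity:
  fixes P T :: "complex poly"
  assumes PT: "\<And>s. s \<noteq> 0 \<Longrightarrow> poly P s = poly T (1 / s)" and T0: "poly T 0 = 0"
  shows "P = 0"
proof (rule ccontr)
  assume P: "P \<noteq> 0"
  let ?d = "degree T"
  define R where "R = (\<Sum>i\<in>{1..?d}. monom (coeff T i) (?d - i))"
  have eq: "poly (monom 1 ?d * P - R) s = 0" if "s \<noteq> 0" for s
  proof -
    have "poly T (1 / s) = (\<Sum>i\<le>?d. coeff T i * (1 / s) ^ i)" by (rule poly_altdef)
    also have "\<dots> = (\<Sum>i\<in>{1..?d}. coeff T i * (1 / s) ^ i)"
      using T0 by (intro sum.mono_neutral_right) (auto simp: poly_0_coeff_0 Suc_le_eq)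
    finally have "s ^ ?d * poly P s = (\<Sum>i\<in>{1..?d}. s ^ ?d * (coeff T i * (1 / s) ^ i))"
      using PT[OF that] by (simp add: sum_distrib_left)
    also have "\<dots> = (\<Sum>i\<in>{1..?d}. coeff T i * s ^ (?d - i))"
      using that by (intro sum.cong) (auto simp: power_diff field_simps)
    finally show ?thesis by (simp add: R_def poly_monom poly_sum)
  qed
  \<comment> \<open>The additional factor s covers the point 0, at which the equation is not yet
    known.\<close>
  have "poly ([:0, 1:] * (monom 1 ?d * P - R)) s = 0" for s
    using eq[of s] by (cases "s = 0") auto
  hence "[:0, 1:] * (monom 1 ?d * P - R) = 0" using poly_fun_eq_0_iff by blast
  hence mP: "monom 1 ?d * P = R" by simp
  have T: "?d \<noteq> 0"
  proof
    assume "?d = 0"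
    hence "monom 1 0 * P = 0" using mP by (simp add: R_def)
    thus False using P by (simp add: monom_0)
  qed
  have "degree (monom 1 ?d * P) = ?d + degree P"
    using P by (subst degree_mult_eq) (auto simp: degree_monom_eq)
  moreover have "degree R < ?d" unfolding R_def
    using T by (intro degree_sum_less) (auto intro: le_less_trans[OF degree_monom_le])
  ultimately show False using mP by simp
qed

text \<open>Substitute \<open>x = y s + w\<close> for the columns \<open>j\<close> and \<open>j + 1\<close>: a column operation turns
  \<open>(y s + w, y)\<close> into \<open>(y s + w, - w / s)\<close>, and the homogeneity of the \<open>h i\<close> then makes
  the polynomial \<open>s \<mapsto> g\<close> vanish at infinity.\<close>

lemma column_degree_bound:
  assumes g: "is_poly a k g" and j: "Suc j < k" and h: "\<And>i. i \<le> K \<Longrightarrow> is_poly a k (h i)"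
    and add: "\<And>c Q. Q \<in> carrier_mat a k \<Longrightarrow> g (add_col j c Q) = (\<Sum>i\<le>K. c ^ i * h i Q)"
    and hom: "\<And>i s Q. i \<le> K \<Longrightarrow> s \<noteq> 0 \<Longrightarrow> Q \<in> carrier_mat a k \<Longrightarrow>
      h i (col_scale (two_scale j s) Q) = s ^ (p + i) * (1 / s) ^ (q - i) * h i Q"
    and pq: "p + K < q" and Q: "Q \<in> carrier_mat a k"
  shows "g Q = 0"
proof -
  define Qs where "Qs = (\<lambda>r l. if l = j then [:Q $$ (r, j), Q $$ (r, Suc j):] else [:Q $$ (r, l):])"
  define Rs where "Rs = (\<lambda>r l. if l = j then [:Q $$ (r, Suc j), Q $$ (r, j):]
    else if l = Suc j then [:- Q $$ (r, j):] else [:Q $$ (r, l):])"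
  define QQ where "QQ s = mat a k (\<lambda>(r, l). poly (Qs r l) s)" for s
  define RR where "RR s = mat a k (\<lambda>(r, l). poly (Rs r l) s)" for s
  obtain P where P: "\<And>s. g (QQ s) = poly P s"
    using is_poly_curve[OF g] unfolding QQ_def by meson
  have "\<forall>i. \<exists>H. i \<le> K \<longrightarrow> (\<forall>s. h i (RR s) = poly H s)"
    using is_poly_curve[OF h] unfolding RR_def by meson
  then obtain H where H: "\<And>i s. i \<le> K \<Longrightarrow> h i (RR s) = poly (H i) s" by metis
  define T where "T = (\<Sum>i\<le>K. monom 1 (q - p - i) * H i)"
  have RRc: "RR s \<in> carrier_mat a k" for s by (simp add: RR_def)
  have "poly P s = poly T (1 / s)" if s: "s \<noteq> 0" for s
  proof -
    \<comment> \<open>With w and y for columns j and j + 1 of Q, \<open>RR (1 / s)\<close> has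
      columns y + w/s and -w; scaling gives s y + w and -w/s, and adding 1/s times the former to the
      latter restores y.\<close>
    have "QQ s = add_col j (1 / s) (col_scale (two_scale j s) (RR (1 / s)))"
    proof (rule eq_matI)
      fix r l assume "r < dim_row (add_col j (1 / s) (col_scale (two_scale j s) (RR (1 / s))))"
        "l < dim_col (add_col j (1 / s) (col_scale (two_scale j s) (RR (1 / s))))"
      hence rl: "r < a" "l < k" by (auto simp: add_col_def col_scale_def RR_def)
      thus "QQ s $$ (r, l) = add_col j (1 / s) (col_scale (two_scale j s) (RR (1 / s))) $$ (r, l)"
        using s j by (auto simp: QQ_def RR_def Qs_def Rs_def add_col_def col_scale_def two_scale_def field_simps)
    qed (auto simp: QQ_def add_col_def col_scale_def RR_def)
    hence "poly P s = (\<Sum>i\<le>K. (1 / s) ^ i * h i (col_scale (two_scale j s) (RR (1 / s))))"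
      using add[of "col_scale (two_scale j s) (RR (1 / s))"] RRc by (simp add: P[symmetric])
    also have "\<dots> = (\<Sum>i\<le>K. (1 / s) ^ (q - p - i) * poly (H i) (1 / s))"
    proof (intro sum.cong refl)
      fix i assume "i \<in> {..K}"
      hence i: "i \<le> K" by simp
      \<comment> \<open>All powers of s combine to the exponent q - p - i of 1/s. It is positive for
        i at most K because p + K < q, so T has no constant term.\<close>
      have "q - i = (q - p - i) + p" using i pq by simp
      hence "(1 / s) ^ i * (s ^ (p + i) * (1 / s) ^ (q - i)) = (1 / s) ^ (q - p - i)"
        using s by (simp add: power_add power_one_over field_simps)
      thus "(1 / s) ^ i * h i (col_scale (two_scale j s) (RR (1 / s))) =
          (1 / s) ^ (q - p - i) * poly (H i) (1 / s)"
        using hom[OF i s RRc] H[OF i] by (metis mult.assoc)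
    qed
    also have "\<dots> = poly T (1 / s)" by (simp add: T_def poly_sum poly_monom)
    finally show ?thesis .
  qed
  moreover have "poly T 0 = 0"
    unfolding T_def poly_sum poly_mult poly_monom using pq by (intro sum.neutral) auto
  ultimately have "P = 0" by (rule poly_eq_0_if_vanishes_at_infinity)
  hence "g (QQ 0) = 0" using P by simp
  moreover have "QQ 0 = Q" using Q by (auto simp: QQ_def Qs_def)
  ultimately show ?thesis by simp
qed

text \<open>The case K = 0 of \<open>column_degree_bound\<close>: f is fixed by the column
  operation, so if its weight were larger in column j + 1 than in column j, f would be zero.\<close>

lemma weight_dominant:
  assumes f: "is_poly a k f" "right_inv a k f" "has_weight a k \<nu> f" and j: "Suc j < k"
    and Q: "Q \<in> carrier_mat a k" "f Q \<noteq> 0"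
  shows "\<nu> (Suc j) \<le> \<nu> j"
proof (rule ccontr)
  assume less: "\<not> \<nu> (Suc j) \<le> \<nu> j"
  have "f Q = 0"
  proof (rule column_degree_bound[OF f(1) j, where K = 0 and h = "\<lambda>_. f" and p = "\<nu> j" and q = "\<nu> (Suc j)"])
    show "f (add_col j c Q) = (\<Sum>i\<le>0. c ^ i * f Q)" if "Q \<in> carrier_mat a k" for c Q
      using f(2) that col_elem_unitri by (simp add: add_col_eq_mult[OF that j] right_inv_def)
    show "f (col_scale (two_scale j s) Q) = s ^ (\<nu> j + i) * (1 / s) ^ (\<nu> (Suc j) - i) * f Q"
      if "i \<le> 0" "s \<noteq> 0" "Q \<in> carrier_mat a k" for i s Q
      using that has_weightD[OF f(3), of "two_scale j s" Q]
      by (simp add: mpow_two_scale[OF j] two_scale_nonzero)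
  qed (use f Q less in auto)
  thus False using Q by simp
qed

section \<open>Products of minors\<close>

text \<open>Rows are numbered from 0: \<open>[0..<c]\<close> is an initial segment of the block
  moved by \<open>GL_embed\<close>, and \<open>ys\<close> lies beyond that block. The empty list,
  with minor 1, is included.\<close>

definition row_lists :: "nat \<Rightarrow> nat \<Rightarrow> nat \<Rightarrow> nat list set" where
  "row_lists b N n = {xs. \<exists>c ys. xs = [0..<c] @ ys \<and> c \<le> b \<and> sorted_wrt (<) ys \<and>
     set ys \<subseteq> {b..<N} \<and> length xs \<le> n}"

definition minor_prod :: "nat list list \<Rightarrow> complex mat \<Rightarrow> complex" where
  "minor_prod G Q = (\<Prod>xs\<leftarrow>G. minor xs Q)"

text \<open>A factor with r rows is a column of length r of a Young diagram, and the shape gives the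
  row lengths of that diagram. It is the column weight of the product; empty factors do not
  contribute.\<close>

definition shape :: "nat list list \<Rightarrow> nat \<Rightarrow> nat" where
  "shape G j = length (filter (\<lambda>xs. j < length xs) G)"

definition minor_comb :: "(complex \<times> nat list list) list \<Rightarrow> complex mat \<Rightarrow> complex" where
  "minor_comb ts Q = (\<Sum>t\<leftarrow>ts. fst t * minor_prod (snd t) Q)"

text \<open>Every single product has shape \<open>\<nu>\<close>, not only the sum weight
  \<open>\<nu>\<close>: appending a row requires counting the factors of each length.\<close>

definition minor_span :: "nat \<Rightarrow> nat \<Rightarrow> nat \<Rightarrow> (nat \<Rightarrow> nat) \<Rightarrow> (complex mat \<Rightarrow> complex) \<Rightarrow> bool" where
  "minor_span b N n \<nu> f \<longleftrightarrow> (\<exists>ts. (\<forall>t\<in>set ts. set (snd t) \<subseteq> row_lists b N n \<and> shape (snd t) = \<nu>) \<and>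
     (\<forall>Q\<in>carrier_mat N n. f Q = minor_comb ts Q))"

lemma minor_prod_simps [simp]:
  "minor_prod [] Q = 1" "minor_prod (xs # G) Q = minor xs Q * minor_prod G Q"
  "minor_prod (G @ H) Q = minor_prod G Q * minor_prod H Q"
  by (simp_all add: minor_prod_def)

lemma minor_comb_simps [simp]:
  "minor_comb [] Q = 0" "minor_comb (t # ts) Q = fst t * minor_prod (snd t) Q + minor_comb ts Q"
  "minor_comb (ts @ us) Q = minor_comb ts Q + minor_comb us Q"
  by (simp_all add: minor_comb_def)

lemma shape_simps [simp]:
  "shape [] = (\<lambda>_. 0)" "shape (xs # G) j = (if j < length xs then 1 else 0) + shape G j"
  "shape (G @ H) j = shape G j + shape H j"
  by (auto simp: shape_def)

lemma row_listsD:
  assumes "xs \<in> row_lists b N n" "b \<le> N"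
  shows "set xs \<subseteq> {..<N}" "length xs \<le> n"
  using assms by (fastforce simp: row_lists_def)+

lemma minor_prod_invariant:
  assumes "set G \<subseteq> row_lists b N n" "b \<le> N"
  shows "is_poly N n (minor_prod G)" "right_inv N n (minor_prod G)" "left_inv b N n (minor_prod G)"
    "has_weight N n (shape G) (minor_prod G)"
proof -
  have *: "is_poly N n (minor xs)" "right_inv N n (minor xs)" "left_inv b N n (minor xs)"
    "has_weight N n (\<lambda>j. if j < length xs then 1 else 0) (minor xs)" if "xs \<in> set G" for xs
  proof -
    from that assms have xs: "xs \<in> row_lists b N n" by blast
    note d = row_listsD[OF xs \<open>b \<le> N\<close>]
    show "is_poly N n (minor xs)" "right_inv N n (minor xs)"
      "has_weight N n (\<lambda>j. if j < length xs then 1 else 0) (minor xs)"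
      using d by (auto intro!: is_poly_minor minor_right_inv minor_has_weight)
    from xs obtain c ys where "xs = [0..<c] @ ys" "c \<le> b" "set ys \<subseteq> {b..<N}" "length xs \<le> n"
      by (auto simp: row_lists_def)
    thus "left_inv b N n (minor xs)" using \<open>b \<le> N\<close> by (rule minor_left_inv)
  qed
  show "is_poly N n (minor_prod G)"
    unfolding minor_prod_def using * by (intro is_poly_prod_list) auto
  show "right_inv N n (minor_prod G)" "left_inv b N n (minor_prod G)"
    using *(2,3) by (induction G) (auto simp: right_inv_def left_inv_def)
  show "has_weight N n (shape G) (minor_prod G)"
    using *(4)
  proof (induction G)
    case Nil show ?case by (simp add: has_weight_def mpow_def)
  next
    case (Cons xs G)
    have "has_weight N n (\<lambda>j. (if j < length xs then 1 else 0) + shape G j)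
        (\<lambda>Q. minor xs Q * minor_prod G Q)"
      using Cons by (intro has_weight_mult) auto
    moreover have "shape (xs # G) = (\<lambda>j. (if j < length xs then 1 else 0) + shape G j)" by auto
    moreover have "minor_prod (xs # G) = (\<lambda>Q. minor xs Q * minor_prod G Q)" by auto
    ultimately show ?case by metis
  qed
qed

lemma minor_comb_invariant:
  assumes "\<forall>t\<in>set ts. set (snd t) \<subseteq> row_lists b N n \<and> shape (snd t) = \<nu>" "b \<le> N"
  shows "is_poly N n (minor_comb ts)" "right_inv N n (minor_comb ts)" "left_inv b N n (minor_comb ts)"
    "has_weight N n \<nu> (minor_comb ts)"
proof -
  show "is_poly N n (minor_comb ts)"
    unfolding minor_comb_def using assms minor_prod_invariant(1)
    by (intro is_poly_sum_list is_poly_mult is_poly_const) blast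
  have *: "right_inv N n (minor_comb ts) \<and> left_inv b N n (minor_comb ts) \<and> has_weight N n \<nu> (minor_comb ts)"
    using assms(1)
  proof (induction ts)
    case Nil show ?case by (auto simp: right_inv_def left_inv_def has_weight_def)
  next
    case (Cons t ts)
    hence IH: "right_inv N n (minor_comb ts)" "left_inv b N n (minor_comb ts)"
      "has_weight N n \<nu> (minor_comb ts)" by auto
    have t: "set (snd t) \<subseteq> row_lists b N n" "shape (snd t) = \<nu>" using Cons.prems by auto
    note p = minor_prod_invariant[OF t(1) \<open>b \<le> N\<close>, unfolded t(2)]
    show ?case using p IH
      by (auto simp: right_inv_def left_inv_def has_weight_def algebra_simps)
  qed
  thus "right_inv N n (minor_comb ts)" "left_inv b N n (minor_comb ts)"
    "has_weight N n \<nu> (minor_comb ts)" by auto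
qed

lemma minor_span_add:
  assumes "minor_span b N n \<nu> f" "minor_span b N n \<nu> g"
  shows "minor_span b N n \<nu> (\<lambda>Q. f Q + g Q)"
proof -
  obtain ts us where
    "\<forall>t\<in>set ts. set (snd t) \<subseteq> row_lists b N n \<and> shape (snd t) = \<nu>" "\<forall>Q\<in>carrier_mat N n. f Q = minor_comb ts Q"
    "\<forall>t\<in>set us. set (snd t) \<subseteq> row_lists b N n \<and> shape (snd t) = \<nu>" "\<forall>Q\<in>carrier_mat N n. g Q = minor_comb us Q"
    using assms unfolding minor_span_def by blast
  thus ?thesis unfolding minor_span_def by (intro exI[of _ "ts @ us"]) auto
qed

lemma minor_span_zero: "minor_span b N n \<nu> (\<lambda>_. 0)"
  unfolding minor_span_def by (intro exI[of _ "[]"]) auto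

lemma minor_span_sum:
  "(\<And>x. x \<in> S \<Longrightarrow> minor_span b N n \<nu> (f x)) \<Longrightarrow> minor_span b N n \<nu> (\<lambda>Q. \<Sum>x\<in>S. f x Q)"
  by (induction S rule: infinite_finite_induct) (auto intro: minor_span_add minor_span_zero)

lemma minor_span_cong:
  "minor_span b N n \<nu> g \<Longrightarrow> (\<And>Q. Q \<in> carrier_mat N n \<Longrightarrow> f Q = g Q) \<Longrightarrow> minor_span b N n \<nu> f"
  unfolding minor_span_def by auto

text \<open>Row and column operations bring a generic b x n matrix with n at most b to the form
  \<open>col_scale d (id_mat b n)\<close>. So f is determined by its value at \<open>id_mat\<close>
  and is that multiple of \<open>lead_monomial\<close>.\<close>

lemma minor_span_base:
  assumes "n \<le> b" and f: "is_poly b n f" "right_inv b n f" "left_inv b b n f" "has_weight b n \<nu> f"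
    and supp: "\<And>j. n \<le> j \<Longrightarrow> \<nu> j = 0"
  shows "minor_span b b n \<nu> f"
proof (cases "\<forall>Q\<in>carrier_mat b n. f Q = 0")
  case True thus ?thesis by (intro minor_span_cong[OF minor_span_zero]) auto
next
  case False
  then obtain Q0 where Q0: "Q0 \<in> carrier_mat b n" "f Q0 \<noteq> 0" by blast
  have dom: "\<nu> (Suc j) \<le> \<nu> j" if "j < n" for j
    using weight_dominant[OF f(1,2,4) _ Q0] supp by (cases "Suc j < n") auto
  have low: "f m = f (id_mat b n)" if m: "m \<in> lower_unitri b n" for m
  proof -
    \<comment> \<open>The first n columns of the transpose of u are those of m, so its row operation
      carries \<open>id_mat\<close> to m.\<close>
    define u where "u = mat b b (\<lambda>(j, i). if j < n then m $$ (i, j) else if i = j then 1 else 0)"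
    have u: "u \<in> unitri b"
      using m \<open>n \<le> b\<close> by (intro unitriI) (auto simp: u_def lower_unitri_def)
    have "transpose_mat (GL_embed b b u) * id_mat b n = m"
    proof (rule eq_matI)
      fix i j assume "i < dim_row m" "j < dim_col m"
      hence ij: "i < b" "j < n" using lower_unitri_carrier[OF m] by auto
      have "(transpose_mat (GL_embed b b u) * id_mat b n) $$ (i, j) =
          (\<Sum>l<b. u $$ (l, i) * id_mat b n $$ (l, j))"
        using ij by (subst GL_embed_mult_index[OF unitri_carrier[OF u] _ id_mat_carrier]) auto
      also have "\<dots> = (\<Sum>l<b. if l = j then u $$ (l, i) else 0)"
        using ij by (intro sum.cong) auto
      also have "\<dots> = m $$ (i, j)" using ij \<open>n \<le> b\<close> by (simp add: u_def)
      finally show "(transpose_mat (GL_embed b b u) * id_mat b n) $$ (i, j) = m $$ (i, j)" .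
    qed (use lower_unitri_carrier[OF m] GL_embed_carrier[OF unitri_carrier[OF u]] in \<open>auto simp: id_mat_def\<close>)
    thus ?thesis using f(3) u by (metis left_inv_def id_mat_carrier)
  qed
  have eq: "f Q = f (id_mat b n) * lead_monomial n \<nu> Q" if Q: "Q \<in> carrier_mat b n" for Q
  proof -
    have "f Q - f (id_mat b n) * lead_monomial n \<nu> Q = 0"
    proof (rule generic_zero[OF _ \<open>n \<le> b\<close> _ Q])
      show "is_poly b n (\<lambda>Q. f Q - f (id_mat b n) * lead_monomial n \<nu> Q)"
        using \<open>n \<le> b\<close> by (intro is_poly_diff is_poly_mult is_poly_const is_poly_lead_monomial f)
      fix R assume R: "R \<in> carrier_mat b n" and gen: "generic n R"
      obtain u d m where g: "u \<in> unitri n" "\<And>j. d j \<noteq> 0" "m \<in> lower_unitri b n"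
        "R * u = col_scale d m" "\<And>i. i \<le> n \<Longrightarrow> minor [0..<i] R = (\<Prod>j<i. d j)"
        using generic_decomposition[OF R gen \<open>n \<le> b\<close>] by blast
      have "f R = mpow n d \<nu> * f m"
        by (rule eval_generic[OF f(2,4) R g(1,2) lower_unitri_carrier[OF g(3)] g(4)])
      thus "f R - f (id_mat b n) * lead_monomial n \<nu> R = 0"
        using lead_monomial_generic[of n \<nu> R d] dom g(5) supp low[OF g(3)] by simp
    qed
    thus ?thesis by simp
  qed
  \<comment> \<open>The factors of \<open>lead_monomial\<close>, listed with multiplicity.\<close>
  define G where "G k = concat (map (\<lambda>i. replicate (\<nu> i - \<nu> (Suc i)) [0..<Suc i]) [0..<k])" for k
  have G_Suc: "G (Suc k) = G k @ replicate (\<nu> k - \<nu> (Suc k)) [0..<Suc k]" for k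
    by (simp add: G_def)
  have rep: "minor_prod (replicate e xs) Q = minor xs Q ^ e" for e xs Q
    by (simp add: minor_prod_def)
  have Gp: "minor_prod (G k) Q = lead_monomial k \<nu> Q" for k Q
  proof (induction k)
    case (Suc k) thus ?case by (simp add: G_Suc rep lead_monomial_def del: upt_Suc)
  qed (simp add: G_def lead_monomial_def)
  have "shape (G k) j = (if j < k then \<nu> j - \<nu> k else 0)" if "k \<le> n" for k j
    using that
  proof (induction k)
    case (Suc k)
    have anti: "\<nu> k \<le> \<nu> j" if "j \<le> k" "k \<le> n" for j k
      using that by (induction k) (auto simp: le_Suc_eq intro: order_trans[OF dom])
    have "shape (replicate e xs) j = (if j < length xs then e else 0)" for e xs
      by (auto simp: shape_def)
    hence "shape (G (Suc k)) j = shape (G k) j + (if j < Suc k then \<nu> k - \<nu> (Suc k) else 0)"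
      by (simp add: G_Suc)
    thus ?case using Suc dom[of k] anti[of j k] by (cases "j = k") auto
  qed (simp add: G_def)
  hence Gs: "shape (G n) = \<nu>" using supp by (auto simp: fun_eq_iff)
  have "[0..<Suc i] \<in> row_lists b b n" if "i < n" for i
    unfolding row_lists_def using that \<open>n \<le> b\<close>
    by (intro CollectI exI[of _ "Suc i"] exI[of _ "[]"]) simp
  hence "set (replicate e [0..<Suc i]) \<subseteq> row_lists b b n" if "i < n" for i e
    using that by (cases "e = 0") auto
  hence Gr: "set (G k) \<subseteq> row_lists b b n" if "k \<le> n" for k
    using that by (induction k) (simp_all add: G_Suc Suc_le_eq del: upt_Suc set_replicate_conv_if, simp add: G_def)
  show ?thesis
    unfolding minor_span_def
  proof (intro exI[of _ "[(f (id_mat b n), G n)]"] conjI ballI)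
    show "f Q = minor_comb [(f (id_mat b n), G n)] Q" if "Q \<in> carrier_mat b n" for Q
      by (simp add: eq[OF that] Gp)
  qed (use Gs Gr[of n] in simp_all)
qed

section \<open>Expansion in the last row\<close>

text \<open>Giving later columns of the last row \<open>N\<close> a higher degree makes the coefficients of the
  top component invariant under the column operations on the rows above it.\<close>

definition row_degree :: "nat \<Rightarrow> (nat \<times> nat) list \<Rightarrow> nat" where
  "row_degree N xs = (\<Sum>x\<leftarrow>xs. if fst x = N then Suc (snd x) else 0)"

text \<open>With the strict bound, W = 0 means the zero function, which starts the descent, and W =
  1 means independence of row N.\<close>

definition row_degree_less :: "nat \<Rightarrow> nat \<Rightarrow> nat \<Rightarrow> (complex mat \<Rightarrow> complex) \<Rightarrow> bool" where
  "row_degree_less N n W f \<longleftrightarrow> (\<exists>ts. set ts \<subseteq> terms (Suc N) n \<and> (\<forall>t\<in>set ts. row_degree N (snd t) < W) \<and>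
     (\<forall>Q\<in>carrier_mat (Suc N) n. f Q = term_sum ts Q))"

definition top_rows :: "nat \<Rightarrow> nat \<Rightarrow> complex mat \<Rightarrow> complex mat" where
  "top_rows N n Q = mat N n (\<lambda>ij. Q $$ ij)"

definition add_row :: "nat \<Rightarrow> nat \<Rightarrow> complex mat \<Rightarrow> (nat \<Rightarrow> complex) \<Rightarrow> complex mat" where
  "add_row N n Q z = mat (Suc N) n (\<lambda>(i, j). if i < N then Q $$ (i, j) else z j)"

definition weighted_degree :: "nat \<Rightarrow> (nat \<Rightarrow> nat) \<Rightarrow> nat" where
  "weighted_degree n \<beta> = (\<Sum>j<n. Suc j * \<beta> j)"

lemma row_degree_append [simp]: "row_degree N (xs @ ys) = row_degree N xs + row_degree N ys"
  by (simp add: row_degree_def)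

lemma row_degree_less_cong:
  "row_degree_less N n W g \<Longrightarrow> (\<And>Q. Q \<in> carrier_mat (Suc N) n \<Longrightarrow> f Q = g Q) \<Longrightarrow> row_degree_less N n W f"
  unfolding row_degree_less_def by auto

lemma row_degree_less_mono: "row_degree_less N n W f \<Longrightarrow> W \<le> W' \<Longrightarrow> row_degree_less N n W' f"
  unfolding row_degree_less_def by (meson less_le_trans)

lemma row_degree_less_zero: "row_degree_less N n W (\<lambda>_. 0)"
  unfolding row_degree_less_def by (rule exI[of _ "[]"]) simp

lemma row_degree_less_add:
  assumes "row_degree_less N n W f" "row_degree_less N n W g"
  shows "row_degree_less N n W (\<lambda>Q. f Q + g Q)"
proof -
  obtain ts us where
    "set ts \<subseteq> terms (Suc N) n" "\<forall>t\<in>set ts. row_degree N (snd t) < W" "\<forall>Q\<in>carrier_mat (Suc N) n. f Q = term_sum ts Q"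
    "set us \<subseteq> terms (Suc N) n" "\<forall>t\<in>set us. row_degree N (snd t) < W" "\<forall>Q\<in>carrier_mat (Suc N) n. g Q = term_sum us Q"
    using assms unfolding row_degree_less_def by blast
  thus ?thesis unfolding row_degree_less_def by (intro exI[of _ "ts @ us"]) auto
qed

text \<open>One factor has degree at most a, the other degree less than b: in this form an error
  term stays of lower order after multiplication by a leading term.\<close>

lemma row_degree_less_mult:
  assumes "row_degree_less N n (Suc a) f" "row_degree_less N n b g"
  shows "row_degree_less N n (a + b) (\<lambda>Q. f Q * g Q)"
proof -
  obtain ts us where
    ts: "set ts \<subseteq> terms (Suc N) n" "\<forall>t\<in>set ts. row_degree N (snd t) < Suc a" "\<forall>Q\<in>carrier_mat (Suc N) n. f Q = term_sum ts Q"
    and us: "set us \<subseteq> terms (Suc N) n" "\<forall>t\<in>set us. row_degree N (snd t) < b" "\<forall>Q\<in>carrier_mat (Suc N) n. g Q = term_sum us Q"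
    using assms unfolding row_degree_less_def by blast
  have "row_degree N (snd t) + row_degree N (snd u) < a + b" if "t \<in> set ts" "u \<in> set us" for t u
    using ts(2) us(2) that by (intro add_le_less_mono) (auto simp: less_Suc_eq_le)
  hence "\<forall>t\<in>set (term_mult ts us). row_degree N (snd t) < a + b"
    unfolding set_term_mult by fastforce
  moreover have "set (term_mult ts us) \<subseteq> terms (Suc N) n"
    unfolding set_term_mult using ts(1) us(1) by (fastforce simp: terms_def)
  ultimately show ?thesis
    unfolding row_degree_less_def using ts(3) us(3)
    by (intro exI[of _ "term_mult ts us"]) (simp add: term_sum_mult)
qed

lemma row_degree_less_mult':
  "row_degree_less N n a f \<Longrightarrow> row_degree_less N n (Suc b) g \<Longrightarrow> row_degree_less N n (a + b) (\<lambda>Q. f Q * g Q)"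
  using row_degree_less_mult[of N n b g a f] by (simp add: mult.commute add.commute)

lemma row_degree_less_const: "row_degree_less N n 1 (\<lambda>_. c)"
  unfolding row_degree_less_def by (rule exI[of _ "[(c, [])]"]) (simp add: terms_def row_degree_def)

lemma row_degree_less_cmult: "row_degree_less N n a f \<Longrightarrow> row_degree_less N n a (\<lambda>Q. c * f Q)"
  using row_degree_less_mult[of N n 0 "\<lambda>_. c" a f] row_degree_less_const by simp

lemma row_degree_less_sum:
  "(\<And>x. x \<in> S \<Longrightarrow> row_degree_less N n W (f x)) \<Longrightarrow> row_degree_less N n W (\<lambda>Q. \<Sum>x\<in>S. f x Q)"
  by (induction S rule: infinite_finite_induct) (auto intro: row_degree_less_add row_degree_less_zero)

lemma row_degree_less_entry: "j < n \<Longrightarrow> row_degree_less N n (Suc (Suc j)) (\<lambda>Q. Q $$ (N, j))"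
  unfolding row_degree_less_def
  by (rule exI[of _ "[(1, [(N, j)])]"]) (simp add: terms_def row_degree_def)

lemma row_degree_less_mpow: "row_degree_less N n (Suc (weighted_degree n \<beta>)) (\<lambda>Q. mpow n (\<lambda>j. Q $$ (N, j)) \<beta>)"
proof -
  have pow: "row_degree_less N n (Suc (Suc j * e)) (\<lambda>Q. Q $$ (N, j) ^ e)" if "j < n" for j e
  proof (induction e)
    case (Suc e)
    show ?case using row_degree_less_mult[OF row_degree_less_entry[OF that] Suc] by (simp add: algebra_simps)
  qed (use row_degree_less_const[of N n 1] in simp)
  have "row_degree_less N n (Suc (\<Sum>j<k. Suc j * \<beta> j)) (\<lambda>Q. \<Prod>j<k. Q $$ (N, j) ^ \<beta> j)" if "k \<le> n" for k
    using that
  proof (induction k)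
    case (Suc k)
    show ?case
      using row_degree_less_mult[OF Suc.IH pow[of k "\<beta> k"]] Suc.prems by simp
  qed (use row_degree_less_const[of N n 1] in simp)
  thus ?thesis by (simp add: mpow_def weighted_degree_def)
qed

lemma top_rows_carrier [simp]: "top_rows N n Q \<in> carrier_mat N n"
  by (simp add: top_rows_def)

lemma top_rows_index [simp]: "i < N \<Longrightarrow> j < n \<Longrightarrow> top_rows N n Q $$ (i, j) = Q $$ (i, j)"
  by (simp add: top_rows_def)

lemma add_row_carrier [simp]: "add_row N n Q z \<in> carrier_mat (Suc N) n"
  by (simp add: add_row_def)

lemma add_row_index [simp]:
  "i < N \<Longrightarrow> j < n \<Longrightarrow> add_row N n Q z $$ (i, j) = Q $$ (i, j)"
  "j < n \<Longrightarrow> add_row N n Q z $$ (N, j) = z j"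
  by (simp_all add: add_row_def)

lemma top_rows_add_row [simp]: "Q \<in> carrier_mat N n \<Longrightarrow> top_rows N n (add_row N n Q z) = Q"
  by (auto simp: top_rows_def)

lemma entry_prod_cong:
  "(\<And>x. x \<in> set xs \<Longrightarrow> Q $$ x = R $$ x) \<Longrightarrow> entry_prod xs Q = entry_prod xs R"
  unfolding entry_prod_def by (intro arg_cong[of _ _ prod_list] map_cong) auto

lemma row_degree_less_top:
  assumes "is_poly N n g"
  shows "row_degree_less N n 1 (\<lambda>Q. g (top_rows N n Q))"
proof -
  obtain ts where ts: "set ts \<subseteq> terms N n" "\<And>Q. Q \<in> carrier_mat N n \<Longrightarrow> g Q = term_sum ts Q"
    using is_poly_terms[OF assms] by blast
  have "row_degree N (snd t) < 1" if "t \<in> set ts" for t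
  proof -
    have "set (snd t) \<subseteq> {..<N} \<times> {..<n}" using that ts(1) by (auto simp: terms_def)
    hence "(if fst x = N then Suc (snd x) else 0) = 0" if "x \<in> set (snd t)" for x using that by auto
    thus ?thesis by (simp add: row_degree_def)
  qed
  moreover have "set ts \<subseteq> terms (Suc N) n" using ts(1) by (fastforce simp: terms_def)
  moreover have "term_sum ts (top_rows N n Q) = term_sum ts Q" for Q
  proof -
    have "entry_prod (snd t) (top_rows N n Q) = entry_prod (snd t) Q" if "t \<in> set ts" for t
    proof -
      have "set (snd t) \<subseteq> {..<N} \<times> {..<n}" using that ts(1) by (auto simp: terms_def)
      thus ?thesis by (intro entry_prod_cong) auto
    qed
    thus ?thesis unfolding term_sum_def by (intro arg_cong[of _ _ sum_list] map_cong) auto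
  qed
  ultimately show ?thesis
    unfolding row_degree_less_def using ts(2) by (intro exI[of _ ts]) auto
qed

lemma minor_top_rows:
  assumes "set xs \<subseteq> {..<N}" "length xs \<le> n"
  shows "minor xs (top_rows N n Q) = minor xs Q"
  unfolding minor_def using assms
  by (intro arg_cong[of _ _ det] eq_matI) (auto simp: subset_iff)

text \<open>Laplace expansion along row N. The entry in the last column of the minor has the highest
  degree, by the choice of \<open>row_degree\<close>, and its cofactor is the minor on
  \<open>xs\<close>.\<close>

lemma minor_snoc:
  assumes xs: "set xs \<subseteq> {..<N}" and n: "length xs < n"
  shows "row_degree_less N n (Suc (length xs))
    (\<lambda>Q. minor (xs @ [N]) Q - Q $$ (N, length xs) * minor xs Q)"
proof -
  let ?j = "length xs"
  define A where "A Q = mat (Suc ?j) (Suc ?j) (\<lambda>(i, j). Q $$ ((xs @ [N]) ! i, j))" for Q :: "complex mat"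
  have Ac: "A Q \<in> carrier_mat (Suc ?j) (Suc ?j)" for Q by (simp add: A_def)
  define g where "g l Q = (- 1) ^ (?j + l) *
    det (mat ?j ?j (\<lambda>(p, q). Q $$ (xs ! p, if q < l then q else Suc q)))" for l and Q :: "complex mat"
  have cof: "cofactor (A Q) ?j l = g l (top_rows N n Q)" if "l \<le> ?j" for l Q
  proof -
    have "mat_delete (A Q) ?j l =
        mat ?j ?j (\<lambda>(p, q). top_rows N n Q $$ (xs ! p, if q < l then q else Suc q))"
      using that xs n by (intro eq_matI) (auto simp: mat_delete_def A_def nth_append subset_iff)
    thus ?thesis by (simp add: cofactor_def g_def)
  qed
  have g: "is_poly N n (g l)" for l
    unfolding g_def using xs n by (intro is_poly_mult is_poly_const is_poly_det is_poly_entry)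
      (auto simp: subset_iff)
  have exp: "minor (xs @ [N]) Q - Q $$ (N, ?j) * minor xs Q =
      (\<Sum>l<?j. Q $$ (N, l) * g l (top_rows N n Q))" for Q
  proof -
    have "minor (xs @ [N]) Q = det (A Q)" by (simp add: minor_def A_def)
    also have "\<dots> = (\<Sum>l<Suc ?j. A Q $$ (?j, l) * cofactor (A Q) ?j l)"
      by (rule laplace_expansion_row[OF Ac]) simp
    also have "\<dots> = (\<Sum>l<Suc ?j. Q $$ (N, l) * g l (top_rows N n Q))"
      by (intro sum.cong refl) (simp add: cof, simp add: A_def)
    \<comment> \<open>The sign of this cofactor is (-1) to the power 2j, and deleting the last
      column shifts no index.\<close>
    also have "g ?j (top_rows N n Q) = minor xs (top_rows N n Q)"
      unfolding g_def minor_def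
      by (simp add: power_add[symmetric] mult_2[symmetric])
        (intro arg_cong[of _ _ det] eq_matI; auto)
    hence "(\<Sum>l<Suc ?j. Q $$ (N, l) * g l (top_rows N n Q)) =
        (\<Sum>l<?j. Q $$ (N, l) * g l (top_rows N n Q)) + Q $$ (N, ?j) * minor xs Q"
      using xs n by (simp add: minor_top_rows)
    finally show ?thesis by simp
  qed
  have "row_degree_less N n (Suc ?j) (\<lambda>Q. Q $$ (N, l) * g l (top_rows N n Q))" if "l < ?j" for l
    using row_degree_less_mult[OF row_degree_less_entry row_degree_less_top[OF g], of l l] that n
    by (auto intro: row_degree_less_mono)
  thus ?thesis unfolding exp by (intro row_degree_less_sum) auto
qed

lemma row_lists_snoc:
  assumes "xs \<in> row_lists b N n" "length xs < n" "b \<le> N"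
  shows "xs @ [N] \<in> row_lists b (Suc N) n"
proof -
  obtain c ys where "xs = [0..<c] @ ys" "c \<le> b" "sorted_wrt (<) ys" "set ys \<subseteq> {b..<N}"
    using assms(1) by (auto simp: row_lists_def)
  thus ?thesis using assms unfolding row_lists_def
    by (intro CollectI exI[of _ c] exI[of _ "ys @ [N]"]) (fastforce simp: sorted_wrt_append)
qed

lemma row_lists_mono: "row_lists b N n \<subseteq> row_lists b (Suc N) n"
  unfolding row_lists_def by fastforce

text \<open>Appending row \<open>N\<close> to \<open>\<beta> j\<close> of the factors with \<open>j\<close> rows multiplies the leading part by
  the monomial with exponents \<open>\<beta>\<close>.\<close>

lemma minor_prod_extend:
  assumes "set G \<subseteq> row_lists b N n" "\<And>j. \<beta> j \<le> length (filter (\<lambda>xs. length xs = j) G)"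
    "\<And>j. n \<le> j \<Longrightarrow> \<beta> j = 0" "b \<le> N"
  shows "\<exists>G'. set G' \<subseteq> row_lists b (Suc N) n \<and> (\<forall>j. shape G' j = shape G j + \<beta> j) \<and>
    row_degree_less N n (weighted_degree n \<beta>)
      (\<lambda>Q. minor_prod G' Q - mpow n (\<lambda>j. Q $$ (N, j)) \<beta> * minor_prod G Q)"
  using assms(1-3)
proof (induction G arbitrary: \<beta>)
  case Nil
  hence "\<beta> = (\<lambda>_. 0)" by auto
  thus ?case
    by (intro exI[of _ "[]"]) (simp add: mpow_def weighted_degree_def row_degree_less_zero)
next
  case (Cons xs G)
  let ?j = "length xs"
  let ?z = "\<lambda>Q \<beta>. mpow n (\<lambda>j. Q $$ (N, j)) \<beta>"
  have xs: "xs \<in> row_lists b N n" using Cons.prems by simp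
  note xsd = row_listsD[OF xs \<open>b \<le> N\<close>]
  have G: "set G \<subseteq> row_lists b N n" using Cons.prems by simp
  have R1: "row_degree_less N n 1 (minor_prod G)"
  proof -
    have "minor_prod G (top_rows N n Q) = minor_prod G Q" for Q
      using G row_listsD[OF _ \<open>b \<le> N\<close>] by (induction G) (auto simp: minor_top_rows)
    thus ?thesis
      using row_degree_less_top[OF minor_prod_invariant(1)[OF G \<open>b \<le> N\<close>]] by simp
  qed
  have m1: "row_degree_less N n 1 (minor xs)"
    using row_degree_less_top[OF is_poly_minor[OF xsd]] by (simp add: minor_top_rows[OF xsd])
  show ?case
  proof (cases "\<beta> ?j = 0")
    case True
    have "\<beta> j \<le> length (filter (\<lambda>xs. length xs = j) G)" for j
      using Cons.prems(2)[of j] True by (cases "j = ?j") auto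
    from Cons.IH[OF G this Cons.prems(3)] obtain G' where
      G': "set G' \<subseteq> row_lists b (Suc N) n" "\<forall>j. shape G' j = shape G j + \<beta> j"
      "row_degree_less N n (weighted_degree n \<beta>) (\<lambda>Q. minor_prod G' Q - ?z Q \<beta> * minor_prod G Q)" by blast
    have "row_degree_less N n (0 + weighted_degree n \<beta>)
        (\<lambda>Q. minor xs Q * (minor_prod G' Q - ?z Q \<beta> * minor_prod G Q))"
      using m1 by (intro row_degree_less_mult G') simp
    moreover have "minor xs Q * (minor_prod G' Q - ?z Q \<beta> * minor_prod G Q) =
        minor_prod (xs # G') Q - ?z Q \<beta> * minor_prod (xs # G) Q" for Q
      by (simp add: algebra_simps)
    ultimately show ?thesis
      using G' subsetD[OF row_lists_mono xs] by (intro exI[of _ "xs # G'"]) auto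
  next
    case False
    hence j: "?j < n" using Cons.prems(3)[of ?j] by (meson not_less)
    \<comment> \<open>The row is appended to the present factor, which uses up one unit of the
      exponent at its length.\<close>
    define \<beta>' where "\<beta>' = \<beta>(?j := \<beta> ?j - 1)"
    have "\<beta>' j \<le> length (filter (\<lambda>xs. length xs = j) G)" for j
      using Cons.prems(2)[of j] by (auto simp: \<beta>'_def)
    moreover have "\<beta>' j = 0" if "n \<le> j" for j using Cons.prems(3) that by (simp add: \<beta>'_def)
    ultimately obtain G' where
      G': "set G' \<subseteq> row_lists b (Suc N) n" "\<forall>j. shape G' j = shape G j + \<beta>' j"
      "row_degree_less N n (weighted_degree n \<beta>') (\<lambda>Q. minor_prod G' Q - ?z Q \<beta>' * minor_prod G Q)"
      using Cons.IH[OF G, of \<beta>'] by blast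
    have \<beta>: "\<beta> = (\<lambda>i. (if i = ?j then 1 else 0) + \<beta>' i)" using False by (auto simp: \<beta>'_def)
    have "weighted_degree n \<beta> = (\<Sum>i<n. (if i = ?j then Suc ?j else 0) + Suc i * \<beta>' i)"
      unfolding weighted_degree_def by (intro sum.cong refl, subst \<beta>) (auto simp: algebra_simps)
    hence wd: "weighted_degree n \<beta> = Suc ?j + weighted_degree n \<beta>'"
      using j by (simp add: sum.distrib weighted_degree_def)
    have "mpow n (\<lambda>j. Q $$ (N, j)) (\<lambda>i. if i = ?j then 1 else 0) = Q $$ (N, ?j)" for Q :: "complex mat"
    proof -
      have "mpow n (\<lambda>j. Q $$ (N, j)) (\<lambda>i. if i = ?j then 1 else 0) =
          (\<Prod>i<n. if i = ?j then Q $$ (N, ?j) else 1)"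
        unfolding mpow_def by (intro prod.cong) auto
      thus ?thesis using j by simp
    qed
    hence z: "?z Q \<beta> = Q $$ (N, ?j) * ?z Q \<beta>'" for Q
      by (subst \<beta>) (simp add: mpow_add)
    let ?r = "\<lambda>Q. minor (xs @ [N]) Q - Q $$ (N, ?j) * minor xs Q"
    let ?r' = "\<lambda>Q. minor_prod G' Q - ?z Q \<beta>' * minor_prod G Q"
    have r: "row_degree_less N n (Suc ?j) ?r" by (rule minor_snoc[OF xsd(1) j])
    \<comment> \<open>Writing the new minor as A + r and the product for G' as B + r', the
      difference from A B is A r' + r B + r r'; each summand has too low a degree to affect the
      leading part.\<close>
    have eq: "minor_prod ((xs @ [N]) # G') Q - ?z Q \<beta> * minor_prod (xs # G) Q =
        (Q $$ (N, ?j) * minor xs Q) * ?r' Q + ?r Q * (?z Q \<beta>' * minor_prod G Q) + ?r Q * ?r' Q" for Q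
      by (simp add: z algebra_simps)
    have "row_degree_less N n (Suc ?j + 1) (\<lambda>Q. Q $$ (N, ?j) * minor xs Q)"
      using j m1 by (intro row_degree_less_mult row_degree_less_entry)
    hence "row_degree_less N n (Suc ?j + weighted_degree n \<beta>') (\<lambda>Q. (Q $$ (N, ?j) * minor xs Q) * ?r' Q)"
      by (intro row_degree_less_mult G') simp
    moreover have "row_degree_less N n (weighted_degree n \<beta>' + 1) (\<lambda>Q. ?z Q \<beta>' * minor_prod G Q)"
      by (intro row_degree_less_mult row_degree_less_mpow R1)
    hence "row_degree_less N n (Suc ?j + weighted_degree n \<beta>') (\<lambda>Q. ?r Q * (?z Q \<beta>' * minor_prod G Q))"
      by (intro row_degree_less_mult' r) simp
    moreover have "row_degree_less N n (Suc ?j + weighted_degree n \<beta>') (\<lambda>Q. ?r Q * ?r' Q)"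
      by (intro row_degree_less_mult G' row_degree_less_mono[OF r]) simp
    ultimately have "row_degree_less N n (weighted_degree n \<beta>)
        (\<lambda>Q. minor_prod ((xs @ [N]) # G') Q - ?z Q \<beta> * minor_prod (xs # G) Q)"
      unfolding eq wd by (intro row_degree_less_add)
    moreover have "shape ((xs @ [N]) # G') i = shape (xs # G) i + \<beta> i" for i
      using G'(2) False by (auto simp: \<beta>'_def)
    moreover have "set ((xs @ [N]) # G') \<subseteq> row_lists b (Suc N) n"
      using G'(1) row_lists_snoc[OF xs j \<open>b \<le> N\<close>] by simp
    ultimately show ?thesis by blast
  qed
qed

section \<open>Collecting terms by their exponents in the last row\<close>

definition row_count :: "nat \<Rightarrow> (nat \<times> nat) list \<Rightarrow> nat \<Rightarrow> nat" where
  "row_count N xs j = length (filter (\<lambda>x. x = (N, j)) xs)"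

definition other_rows :: "nat \<Rightarrow> (nat \<times> nat) list \<Rightarrow> (nat \<times> nat) list" where
  "other_rows N xs = filter (\<lambda>x. fst x \<noteq> N) xs"

lemma entry_prod_add_row:
  assumes "set xs \<subseteq> {..<Suc N} \<times> {..<n}" "Q \<in> carrier_mat N n"
  shows "entry_prod xs (add_row N n Q z) =
    mpow n z (row_count N xs) * entry_prod (other_rows N xs) Q"
  using assms(1)
proof (induction xs)
  case Nil show ?case by (simp add: mpow_def row_count_def other_rows_def)
next
  case (Cons x xs)
  obtain i j where x: "x = (i, j)" by force
  have IH: "entry_prod xs (add_row N n Q z) =
    mpow n z (row_count N xs) * entry_prod (other_rows N xs) Q" using Cons by simp
  show ?case
  proof (cases "i = N")
    case True
    have "mpow n z (row_count N (x # xs)) =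
        (\<Prod>l<n. (if l = j then z j else 1) * z l ^ row_count N xs l)"
      unfolding mpow_def using True by (intro prod.cong) (auto simp: row_count_def x)
    also have "\<dots> = z j * mpow n z (row_count N xs)"
      using Cons.prems x by (simp add: prod.distrib mpow_def)
    finally show ?thesis using True x IH Cons.prems by (simp add: other_rows_def)
  next
    case False
    hence "row_count N (x # xs) = row_count N xs" by (auto simp: row_count_def x)
    thus ?thesis using False x IH Cons.prems by (simp add: other_rows_def)
  qed
qed

lemma row_degree_eq_weighted_degree:
  assumes "set xs \<subseteq> {..<Suc N} \<times> {..<n}"
  shows "row_degree N xs = weighted_degree n (row_count N xs)"
  using assms
proof (induction xs)
  case Nil show ?case by (simp add: row_degree_def weighted_degree_def row_count_def)
next
  case (Cons x xs)
  obtain i j where x: "x = (i, j)" by force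
  have "weighted_degree n (row_count N (x # xs)) =
      (\<Sum>l<n. (if l = j then if i = N then Suc j else 0 else 0) + Suc l * row_count N xs l)"
    unfolding weighted_degree_def by (intro sum.cong) (auto simp: row_count_def x)
  also have "\<dots> = (if i = N then Suc j else 0) + weighted_degree n (row_count N xs)"
    using Cons.prems x by (simp add: sum.distrib weighted_degree_def)
  finally show ?case using Cons x by (simp add: row_degree_def)
qed

lemma col_count_split: "col_count xs j = row_count N xs j + col_count (other_rows N xs) j"
  by (induction xs) (auto simp: col_count_def row_count_def other_rows_def)

text \<open>Each term splits into its part in row N, with exponents \<open>\<beta>\<close>, and its
  part in the other rows, which gives the coefficient of weight
  \<open>\<mu> - \<beta>\<close>.\<close>

lemma last_row_expansion:
  assumes wt: "has_weight (Suc N) n \<mu> f" and supp: "\<And>j. n \<le> j \<Longrightarrow> \<mu> j = 0"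
    and deg: "row_degree_less N n (Suc W) f"
  obtains S F where "finite S" "\<And>\<beta> j. \<beta> \<in> S \<Longrightarrow> n \<le> j \<Longrightarrow> \<beta> j = 0"
    "\<And>\<beta>. \<beta> \<in> S \<Longrightarrow> weighted_degree n \<beta> \<le> W" "\<And>\<beta> j. \<beta> \<in> S \<Longrightarrow> \<beta> j \<le> \<mu> j"
    "\<And>\<beta>. is_poly N n (F \<beta>)"
    "\<And>\<beta>. \<beta> \<in> S \<Longrightarrow> has_weight N n (\<lambda>j. \<mu> j - \<beta> j) (F \<beta>)"
    "\<And>Q z. Q \<in> carrier_mat N n \<Longrightarrow> f (add_row N n Q z) = (\<Sum>\<beta>\<in>S. mpow n z \<beta> * F \<beta> Q)"
proof -
  obtain ts where ts: "set ts \<subseteq> terms (Suc N) n" "\<forall>t\<in>set ts. row_degree N (snd t) < Suc W"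
    "\<And>Q. Q \<in> carrier_mat (Suc N) n \<Longrightarrow> f Q = term_sum ts Q"
    using deg unfolding row_degree_less_def by blast
  \<comment> \<open>Only the terms of column count \<open>\<mu>\<close> are kept. This forces
    \<open>\<beta>\<close> to be at most \<open>\<mu>\<close>, so the subtraction of weights is
    genuine.\<close>
  define us where "us = filter (\<lambda>t. col_count (snd t) = \<mu>) ts"
  have us: "set (snd t) \<subseteq> {..<Suc N} \<times> {..<n}" "row_degree N (snd t) \<le> W" "col_count (snd t) = \<mu>"
    if "t \<in> set us" for t
    using that ts(1,2) by (auto simp: us_def terms_def less_Suc_eq_le)
  have fus: "f Q = term_sum us Q" if "Q \<in> carrier_mat (Suc N) n" for Q
    unfolding us_def using ts(1,3) wt supp that by (rule term_sum_weight)
  define part where "part \<beta> = map (\<lambda>t. (fst t, other_rows N (snd t)))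
    (filter (\<lambda>t. row_count N (snd t) = \<beta>) us)" for \<beta>
  have part: "set (part \<beta>) \<subseteq> terms N n" for \<beta>
    using us(1) by (fastforce simp: part_def terms_def other_rows_def)
  show ?thesis
  proof (rule that[of "(\<lambda>t. row_count N (snd t)) ` set us" "\<lambda>\<beta>. term_sum (part \<beta>)"])
    fix \<beta> j assume \<beta>: "\<beta> \<in> (\<lambda>t. row_count N (snd t)) ` set us"
    then obtain t where t: "t \<in> set us" "\<beta> = row_count N (snd t)" by blast
    show le: "\<beta> j \<le> \<mu> j" using us(3)[OF t(1)] col_count_split[of "snd t" _ N] t(2)
      by (metis le_add1)
    show "\<beta> j = 0" if "n \<le> j" using le supp[OF that] by simp
  next
    fix \<beta> assume "\<beta> \<in> (\<lambda>t. row_count N (snd t)) ` set us"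
    then obtain t where t: "t \<in> set us" "\<beta> = row_count N (snd t)" by blast
    show "weighted_degree n \<beta> \<le> W"
      using us(2)[OF t(1)] row_degree_eq_weighted_degree[OF us(1)[OF t(1)]] t(2) by simp
  next
    fix \<beta>
    show "is_poly N n (term_sum (part \<beta>))" by (rule is_poly_term_sum[OF part])
    have "col_count (snd t) = (\<lambda>j. \<mu> j - \<beta> j)" if "t \<in> set (part \<beta>)" for t
    proof -
      from that obtain t' where t': "t' \<in> set us" "row_count N (snd t') = \<beta>"
        "snd t = other_rows N (snd t')" by (auto simp: part_def)
      show ?thesis
        using us(3)[OF t'(1)] col_count_split[of "snd t'" _ N] t'(2,3)
        by (metis (no_types, lifting) add_diff_cancel_left' ext)
    qed
    thus "has_weight N n (\<lambda>j. \<mu> j - \<beta> j) (term_sum (part \<beta>))"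
      unfolding has_weight_def by (auto intro!: term_sum_homogeneous[OF part])
  next
    fix Q :: "complex mat" and z assume Q: "Q \<in> carrier_mat N n"
    have part_eval: "term_sum vs (add_row N n Q z) =
        mpow n z \<beta> * term_sum (map (\<lambda>t. (fst t, other_rows N (snd t))) vs) Q"
      if "\<And>t. t \<in> set vs \<Longrightarrow> t \<in> set us \<and> row_count N (snd t) = \<beta>" for \<beta> vs
      using that
    proof (induction vs)
      case (Cons t vs)
      thus ?case using entry_prod_add_row[OF us(1)[of t] Q] by (simp add: algebra_simps)
    qed simp
    have p: "term_sum (filter (\<lambda>t. row_count N (snd t) = \<beta>) us) (add_row N n Q z) =
        mpow n z \<beta> * term_sum (part \<beta>) Q" for \<beta>
      unfolding part_def by (rule part_eval) auto
    have "f (add_row N n Q z) = term_sum us (add_row N n Q z)" by (rule fus) simp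
    also have "\<dots> = (\<Sum>\<beta>\<in>(\<lambda>t. row_count N (snd t)) ` set us.
        term_sum (filter (\<lambda>t. row_count N (snd t) = \<beta>) us) (add_row N n Q z))"
      by (rule term_sum_group) auto
    finally show "f (add_row N n Q z) =
        (\<Sum>\<beta>\<in>(\<lambda>t. row_count N (snd t)) ` set us. mpow n z \<beta> * term_sum (part \<beta>) Q)"
      by (simp add: p)
  qed auto
qed

lemma add_row_cong: "(\<And>j. j < n \<Longrightarrow> z j = z' j) \<Longrightarrow> add_row N n Q z = add_row N n Q z'"
  unfolding add_row_def by (intro cong_mat) auto

lemma add_row_mult:
  assumes Q: "Q \<in> carrier_mat N n" and u: "u \<in> carrier_mat n n"
  shows "add_row N n Q z * u = add_row N n (Q * u) (\<lambda>j. \<Sum>i<n. z i * u $$ (i, j))"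
proof (rule eq_matI)
  fix i j assume "i < dim_row (add_row N n (Q * u) (\<lambda>j. \<Sum>i<n. z i * u $$ (i, j)))"
    "j < dim_col (add_row N n (Q * u) (\<lambda>j. \<Sum>i<n. z i * u $$ (i, j)))"
  hence ij: "i < Suc N" "j < n" by (auto simp: add_row_def)
  have "(add_row N n Q z * u) $$ (i, j) = (\<Sum>l<n. add_row N n Q z $$ (i, l) * u $$ (l, j))"
    using ij by (intro mult_index_sum[OF add_row_carrier u])
  also have "\<dots> = add_row N n (Q * u) (\<lambda>j. \<Sum>i<n. z i * u $$ (i, j)) $$ (i, j)"
    using ij mult_index_sum[OF Q u, of i j]
    by (cases "i = N") (auto simp del: index_mult_mat)
  finally show "(add_row N n Q z * u) $$ (i, j) =
      add_row N n (Q * u) (\<lambda>j. \<Sum>i<n. z i * u $$ (i, j)) $$ (i, j)" .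
qed (use assms in \<open>auto simp: add_row_def\<close>)

lemma GL_embed_mult_add_row:
  assumes Q: "Q \<in> carrier_mat N n" and u: "u \<in> carrier_mat b b" "b \<le> N"
  shows "transpose_mat (GL_embed b (Suc N) u) * add_row N n Q z =
    add_row N n (transpose_mat (GL_embed b N u) * Q) z"
proof (rule eq_matI)
  have N: "b \<le> Suc N" using u by simp
  note c = GL_embed_carrier[OF u(1) N] GL_embed_carrier[OF u]
  fix i j assume "i < dim_row (add_row N n (transpose_mat (GL_embed b N u) * Q) z)"
    "j < dim_col (add_row N n (transpose_mat (GL_embed b N u) * Q) z)"
  hence ij: "i < Suc N" "j < n" by (auto simp: add_row_def)
  show "(transpose_mat (GL_embed b (Suc N) u) * add_row N n Q z) $$ (i, j) =
      add_row N n (transpose_mat (GL_embed b N u) * Q) z $$ (i, j)"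
    unfolding GL_embed_mult_index[OF u(1) N add_row_carrier ij]
    using ij GL_embed_mult_index[OF u Q, of i j] u(2)
    by (cases "i = N") (auto simp del: index_mult_mat)
next
  have N: "b \<le> Suc N" using u by simp
  note c = GL_embed_carrier[OF u(1) N]
  show "dim_row (transpose_mat (GL_embed b (Suc N) u) * add_row N n Q z) =
      dim_row (add_row N n (transpose_mat (GL_embed b N u) * Q) z)"
    "dim_col (transpose_mat (GL_embed b (Suc N) u) * add_row N n Q z) =
      dim_col (add_row N n (transpose_mat (GL_embed b N u) * Q) z)"
    using c by (auto simp: add_row_def)
qed

lemma isCont_zero_extend:
  fixes c :: "complex \<Rightarrow> complex"
  assumes "isCont c 0" "\<And>\<epsilon>. \<epsilon> \<noteq> 0 \<Longrightarrow> c \<epsilon> = 0"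
  shows "c 0 = 0"
proof -
  have "c \<midarrow>0\<rightarrow> c 0" using assms(1) by (simp add: isCont_def)
  moreover have "c \<midarrow>0\<rightarrow> 0" using assms(2) by (subst LIM_cong[of 0 0 c "\<lambda>_. 0"]) auto
  ultimately show ?thesis using LIM_unique by blast
qed

text \<open>Row N lies beyond the embedded block and is not moved, so invariance of f can be
  compared coefficient by coefficient in z. Unlike for column operations, this applies to all
  coefficients.\<close>

lemma coefficient_left_inv:
  assumes f: "left_inv b (Suc N) n f" "b \<le> N"
    and S: "finite S" "\<And>\<beta> j. \<beta> \<in> S \<Longrightarrow> n \<le> j \<Longrightarrow> \<beta> j = 0"
    and exp: "\<And>Q z. Q \<in> carrier_mat N n \<Longrightarrow> f (add_row N n Q z) = (\<Sum>\<beta>\<in>S. mpow n z \<beta> * F \<beta> Q)"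
    and "\<beta> \<in> S"
  shows "left_inv b N n (F \<beta>)"
  unfolding left_inv_def
proof (intro ballI)
  fix u Q :: "complex mat" assume u: "u \<in> unitri b" and Q: "Q \<in> carrier_mat N n"
  let ?LQ = "transpose_mat (GL_embed b N u) * Q"
  have LQ: "?LQ \<in> carrier_mat N n" using Q GL_embed_carrier[OF unitri_carrier[OF u] f(2)] by auto
  have "(\<Sum>\<beta>\<in>S. mpow n z \<beta> * (F \<beta> ?LQ - F \<beta> Q)) = 0" for z
  proof -
    have "f (add_row N n ?LQ z) = f (add_row N n Q z)"
      using f(1) u add_row_carrier
      unfolding GL_embed_mult_add_row[OF Q unitri_carrier[OF u] f(2), symmetric] left_inv_def by blast
    thus ?thesis by (simp add: exp[OF LQ] exp[OF Q] algebra_simps sum_subtractf)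
  qed
  hence "F \<beta> ?LQ - F \<beta> Q = 0"
    using S \<open>\<beta> \<in> S\<close> by (intro mpow_independent[of S n "\<lambda>\<beta>. F \<beta> ?LQ - F \<beta> Q" \<beta>]) auto
  thus "F \<beta> ?LQ = F \<beta> Q" by simp
qed

text \<open>Scaling column \<open>i\<close> of the last row by \<open>\<epsilon>\<^sup>-\<^sup>i\<^sup>-\<^sup>1\<close> turns \<open>u\<close>, acting on that
  row, into a matrix tending to the identity as \<open>\<epsilon>\<close> tends to 0.\<close>

lemma top_coefficient_right_inv:
  assumes f: "right_inv (Suc N) n f"
    and S: "finite S" "\<And>\<beta> j. \<beta> \<in> S \<Longrightarrow> n \<le> j \<Longrightarrow> \<beta> j = 0" "\<And>\<beta>. \<beta> \<in> S \<Longrightarrow> weighted_degree n \<beta> \<le> W"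
    and exp: "\<And>Q z. Q \<in> carrier_mat N n \<Longrightarrow> f (add_row N n Q z) = (\<Sum>\<beta>\<in>S. mpow n z \<beta> * F \<beta> Q)"
    and \<beta>: "\<beta> \<in> S" "weighted_degree n \<beta> = W"
  shows "right_inv N n (F \<beta>)"
  unfolding right_inv_def
proof (intro ballI)
  fix u Q :: "complex mat" assume u: "u \<in> unitri n" and Q: "Q \<in> carrier_mat N n"
  note uc = unitri_carrier[OF u]
  have Qu: "Q * u \<in> carrier_mat N n" using Q uc by simp
  let ?T = "{\<beta>\<in>S. weighted_degree n \<beta> = W}"
  have "(\<Sum>\<beta>\<in>?T. mpow n z \<beta> * (F \<beta> (Q * u) - F \<beta> Q)) = 0" for z
  proof -
    define w where "w \<epsilon> j = (\<Sum>i\<le>j. z i * \<epsilon> ^ (j - i) * u $$ (i, j))" for \<epsilon> j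
    \<comment> \<open>The invariance equation for the scaled row, multiplied by
      \<open>\<epsilon>\<close> to the power W to remove the pole. At \<open>\<epsilon> = 0\<close>
      only the exponents of weighted degree W survive, and w becomes z.\<close>
    define c where "c \<epsilon> = (\<Sum>\<beta>\<in>S. \<epsilon> ^ (W - weighted_degree n \<beta>) *
      (mpow n (w \<epsilon>) \<beta> * F \<beta> (Q * u) - mpow n z \<beta> * F \<beta> Q))" for \<epsilon>
    have c_zero: "c \<epsilon> = 0" if "\<epsilon> \<noteq> 0" for \<epsilon>
    proof -
      define e where "e j = (1 / \<epsilon>) ^ Suc j" for j
      have e: "mpow n e \<beta> * \<epsilon> ^ W = \<epsilon> ^ (W - weighted_degree n \<beta>)" if "\<beta> \<in> S" for \<beta>
      proof -
        have "mpow n e \<beta> = (1 / \<epsilon>) ^ weighted_degree n \<beta>"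
          unfolding mpow_def e_def weighted_degree_def by (simp only: power_mult[symmetric] power_sum)
        thus ?thesis using S(3)[OF that] \<open>\<epsilon> \<noteq> 0\<close> by (simp add: power_diff power_one_over field_simps)
      qed
      have row: "(\<Sum>i<n. (e i * z i) * u $$ (i, j)) = e j * w \<epsilon> j" if "j < n" for j
      proof -
        have "(\<Sum>i<n. (e i * z i) * u $$ (i, j)) = (\<Sum>i\<le>j. (e i * z i) * u $$ (i, j))"
          using that u by (intro sum.mono_neutral_right) (auto simp: unitri_index)
        also have "\<dots> = e j * w \<epsilon> j"
          unfolding w_def sum_distrib_left
        proof (intro sum.cong refl)
          fix i assume "i \<in> {..j}"
          hence "e i = e j * \<epsilon> ^ (j - i)"
            using \<open>\<epsilon> \<noteq> 0\<close> by (simp add: e_def power_diff power_one_over field_simps)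
          thus "(e i * z i) * u $$ (i, j) = e j * (z i * \<epsilon> ^ (j - i) * u $$ (i, j))" by simp
        qed
        finally show ?thesis .
      qed
      have "f (add_row N n Q (\<lambda>j. e j * z j)) = f (add_row N n Q (\<lambda>j. e j * z j) * u)"
        using f u by (simp add: right_inv_def)
      also have "add_row N n Q (\<lambda>j. e j * z j) * u = add_row N n (Q * u) (\<lambda>j. e j * w \<epsilon> j)"
        unfolding add_row_mult[OF Q uc] by (intro add_row_cong row)
      finally have "(\<Sum>\<beta>\<in>S. mpow n (\<lambda>j. e j * z j) \<beta> * F \<beta> Q) * \<epsilon> ^ W =
          (\<Sum>\<beta>\<in>S. mpow n (\<lambda>j. e j * w \<epsilon> j) \<beta> * F \<beta> (Q * u)) * \<epsilon> ^ W"
        by (simp add: exp[OF Q] exp[OF Qu])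
      hence "(\<Sum>\<beta>\<in>S. (mpow n e \<beta> * \<epsilon> ^ W) * (mpow n z \<beta> * F \<beta> Q)) =
          (\<Sum>\<beta>\<in>S. (mpow n e \<beta> * \<epsilon> ^ W) * (mpow n (w \<epsilon>) \<beta> * F \<beta> (Q * u)))"
        by (simp add: mpow_mult sum_distrib_left sum_distrib_right algebra_simps)
      hence "(\<Sum>\<beta>\<in>S. \<epsilon> ^ (W - weighted_degree n \<beta>) * (mpow n z \<beta> * F \<beta> Q)) =
          (\<Sum>\<beta>\<in>S. \<epsilon> ^ (W - weighted_degree n \<beta>) * (mpow n (w \<epsilon>) \<beta> * F \<beta> (Q * u)))"
        by (simp only: e cong: sum.cong)
      thus ?thesis by (simp add: c_def right_diff_distrib sum_subtractf)
    qed
    have "isCont c 0"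
      unfolding c_def mpow_def w_def by (intro continuous_intros)
    hence "c 0 = 0" using c_zero by (rule isCont_zero_extend)
    have w0: "w 0 j = z j" if "j < n" for j
    proof -
      have "w 0 j = (\<Sum>i\<le>j. if i = j then z j else 0)"
        unfolding w_def using that u by (intro sum.cong) (auto simp: unitri_index)
      thus ?thesis by simp
    qed
    have "c 0 = (\<Sum>\<beta>\<in>S. if weighted_degree n \<beta> = W then mpow n z \<beta> * (F \<beta> (Q * u) - F \<beta> Q) else 0)"
      unfolding c_def
    proof (intro sum.cong refl)
      fix \<beta> assume "\<beta> \<in> S"
      have "mpow n (w 0) \<beta> = mpow n z \<beta>" unfolding mpow_def using w0 by (intro prod.cong) auto
      thus "0 ^ (W - weighted_degree n \<beta>) * (mpow n (w 0) \<beta> * F \<beta> (Q * u) - mpow n z \<beta> * F \<beta> Q) =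
          (if weighted_degree n \<beta> = W then mpow n z \<beta> * (F \<beta> (Q * u) - F \<beta> Q) else 0)"
        using S(3)[OF \<open>\<beta> \<in> S\<close>] by (auto simp: algebra_simps)
    qed
    also have "\<dots> = (\<Sum>\<beta>\<in>?T. mpow n z \<beta> * (F \<beta> (Q * u) - F \<beta> Q))"
      using S(1) by (simp add: sum.inter_filter)
    finally show ?thesis using \<open>c 0 = 0\<close> by simp
  qed
  hence "F \<beta> (Q * u) - F \<beta> Q = 0"
    using S \<beta> by (intro mpow_independent[of ?T n "\<lambda>\<beta>. F \<beta> (Q * u) - F \<beta> Q" \<beta>]) auto
  thus "F \<beta> (Q * u) = F \<beta> Q" by simp
qed

section \<open>The SL2 bound on the exponents of the last row\<close>

definition shift_exp :: "nat \<Rightarrow> (nat \<Rightarrow> nat) \<Rightarrow> nat \<Rightarrow> nat" where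
  "shift_exp j \<beta> = \<beta>(j := \<beta> j + \<beta> (Suc j), Suc j := 0)"

lemma weighted_degree_shift:
  assumes "Suc j < n"
  shows "weighted_degree n \<beta> = weighted_degree n (shift_exp j \<beta>) + \<beta> (Suc j)"
proof -
  have "(\<Sum>l<n. Suc l * shift_exp j \<beta> l + (if l = Suc j then Suc (Suc j) * \<beta> (Suc j) else 0)) =
      (\<Sum>l<n. Suc l * \<beta> l + (if l = j then Suc j * \<beta> (Suc j) else 0))"
    by (intro sum.cong) (auto simp: shift_exp_def algebra_simps)
  thus ?thesis using assms by (simp add: sum.distrib weighted_degree_def)
qed

lemma mpow_shift:
  assumes "Suc j < n"
  shows "mpow n (t(Suc j := c * t j)) \<beta> = c ^ \<beta> (Suc j) * mpow n t (shift_exp j \<beta>)"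
proof -
  have "mpow n (t(Suc j := c * t j)) \<beta> * (\<Prod>l<n. if l = j then t j ^ \<beta> (Suc j) else 1) =
      mpow n t (shift_exp j \<beta>) * (\<Prod>l<n. if l = Suc j then (c * t j) ^ \<beta> (Suc j) else 1)"
    unfolding mpow_def prod.distrib[symmetric]
    by (intro prod.cong) (auto simp: shift_exp_def power_add)
  hence *: "mpow n (t(Suc j := c * t j)) \<beta> * t j ^ \<beta> (Suc j) =
      c ^ \<beta> (Suc j) * mpow n t (shift_exp j \<beta>) * t j ^ \<beta> (Suc j)"
    using assms by (simp add: power_mult_distrib mult_ac)
  \<comment> \<open>Both sides carry an additional power of \<open>t j\<close> so far. When that
    power is zero it cannot be cancelled, but then both sides contain a vanishing entry with
    positive exponent.\<close>
  show ?thesis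
  proof (cases "t j = 0 \<and> \<beta> (Suc j) \<noteq> 0")
    case False thus ?thesis using * by auto
  next
    case True
    have "mpow n (t(Suc j := c * t j)) \<beta> = 0"
      unfolding mpow_def using True assms by (intro prod_zero) (auto intro!: bexI[of _ "Suc j"])
    moreover have "mpow n t (shift_exp j \<beta>) = 0"
      unfolding mpow_def using True assms
      by (intro prod_zero) (auto intro!: bexI[of _ j] simp: shift_exp_def)
    ultimately show ?thesis by simp
  qed
qed

text \<open>If the last row has entry -c t_j in column j + 1, the column operation with parameter c
  clears that entry. Comparing coefficients, the value of the coefficient at
  \<open>\<gamma> = shift_exp j \<beta>\<close> after the operation is a polynomial in c whose
  coefficients are, up to sign, sums of \<open>F \<alpha>\<close> with
  \<open>shift_exp j \<alpha> = \<gamma>\<close>. As \<open>\<beta>\<close> has top weighted degree,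
  the degree in c is at most K = \<open>\<beta> (Suc j)\<close>, with leading coefficient
  \<open>F \<beta>\<close> up to sign. In SL2 terms, \<open>F \<gamma>\<close> is killed by the
  power K + 1 of a raising operator, which forces it to vanish if its weight is too low.\<close>

lemma top_coefficient_weight:
  assumes f: "right_inv (Suc N) n f"
    and S: "finite S" "\<And>\<beta> j. \<beta> \<in> S \<Longrightarrow> n \<le> j \<Longrightarrow> \<beta> j = 0" "\<And>\<beta>. \<beta> \<in> S \<Longrightarrow> weighted_degree n \<beta> \<le> W"
      "\<And>\<beta> j. \<beta> \<in> S \<Longrightarrow> \<beta> j \<le> \<mu> j"
    and F: "\<And>\<beta>. is_poly N n (F \<beta>)" "\<And>\<beta>. \<beta> \<in> S \<Longrightarrow> has_weight N n (\<lambda>j. \<mu> j - \<beta> j) (F \<beta>)"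
    and exp: "\<And>Q z. Q \<in> carrier_mat N n \<Longrightarrow> f (add_row N n Q z) = (\<Sum>\<beta>\<in>S. mpow n z \<beta> * F \<beta> Q)"
    and \<beta>: "\<beta> \<in> S" "weighted_degree n \<beta> = W" and j: "Suc j < n"
    and Q0: "Q0 \<in> carrier_mat N n" "F \<beta> Q0 \<noteq> 0"
  shows "\<mu> (Suc j) + \<beta> j \<le> \<mu> j"
proof (rule ccontr)
  assume less: "\<not> \<mu> (Suc j) + \<beta> j \<le> \<mu> j"
  define \<gamma> where "\<gamma> = shift_exp j \<beta>"
  define K where "K = \<beta> (Suc j)"
  define A where "A = {\<alpha>\<in>S. shift_exp j \<alpha> = \<gamma>}"
  define h where "h i Q = (\<Sum>\<alpha>\<in>{\<alpha>\<in>A. \<alpha> (Suc j) = i}. (-1) ^ i * F \<alpha> Q)" for i Q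
  \<comment> \<open>The exponent \<open>\<gamma>\<close> need not occur in the expansion; its
    coefficient is then 0.\<close>
  define g where "g Q = (if \<gamma> \<in> S then F \<gamma> Q else 0)" for Q
  have finA: "finite A" using S(1) by (simp add: A_def)
  have AK: "\<alpha> (Suc j) \<le> K" if "\<alpha> \<in> A" for \<alpha>
    using that S(3)[of \<alpha>] \<beta>(2) weighted_degree_shift[OF j, of \<alpha>] weighted_degree_shift[OF j, of \<beta>]
    by (auto simp: A_def \<gamma>_def K_def)
  have add: "g (add_col j c Q) = (\<Sum>i\<le>K. c ^ i * h i Q)" if Q: "Q \<in> carrier_mat N n" for c Q
  proof -
    \<comment> \<open>The exponents that arise on either side of the comparison: those without
      column j + 1, and all shifted ones.\<close>
    let ?S' = "{\<alpha>\<in>S. \<alpha> (Suc j) = 0} \<union> shift_exp j ` S"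
    let ?c = "\<lambda>\<delta>. (if \<delta> \<in> S then F \<delta> (add_col j c Q) else 0) -
      (\<Sum>\<alpha>\<in>{\<alpha>\<in>S. shift_exp j \<alpha> = \<delta>}. (- c) ^ \<alpha> (Suc j) * F \<alpha> Q)"
    have sum0: "(\<Sum>\<delta>\<in>?S'. mpow n t \<delta> * ?c \<delta>) = 0" for t
    proof -
      let ?z = "t(Suc j := 0)"
      have aQ: "add_col j c Q \<in> carrier_mat N n" using Q by simp
      have uc: "col_elem n j c \<in> carrier_mat n n" by (simp add: col_elem_def)
      have "add_row N n Q (t(Suc j := (- c) * t j)) * col_elem n j c = add_row N n (add_col j c Q) ?z"
      proof -
        have "(\<Sum>i<n. (t(Suc j := (- c) * t j)) i * col_elem n j c $$ (i, l)) = ?z l" if "l < n" for l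
        proof -
          have "(\<Sum>i<n. (t(Suc j := (- c) * t j)) i * col_elem n j c $$ (i, l)) =
              (\<Sum>i<n. (if i = l then (t(Suc j := (- c) * t j)) l else 0) +
                (if i = j then (if l = Suc j then c * t j else 0) else 0))"
            using that by (intro sum.cong) (auto simp: col_elem_def)
          thus ?thesis using that j by (simp add: sum.distrib)
        qed
        thus ?thesis
          unfolding add_row_mult[OF Q uc] add_col_eq_mult[OF Q j] by (rule add_row_cong)
      qed
      hence "f (add_row N n (add_col j c Q) ?z) = f (add_row N n Q (t(Suc j := (- c) * t j)))"
        using f col_elem_unitri by (metis right_inv_def add_row_carrier)
      hence e: "(\<Sum>\<alpha>\<in>S. mpow n ?z \<alpha> * F \<alpha> (add_col j c Q)) =
          (\<Sum>\<alpha>\<in>S. (- c) ^ \<alpha> (Suc j) * mpow n t (shift_exp j \<alpha>) * F \<alpha> Q)"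
        by (simp add: exp[OF Q] exp[OF aQ] mpow_shift[OF j] del: mult_minus_left)
      have z: "mpow n ?z \<alpha> = (if \<alpha> (Suc j) = 0 then mpow n t \<alpha> else 0)" for \<alpha>
      proof (cases "\<alpha> (Suc j) = 0")
        case True thus ?thesis unfolding mpow_def by (auto intro!: prod.cong)
      next
        case False
        have "(\<Prod>l<n. ?z l ^ \<alpha> l) = 0"
          using False j by (intro prod_zero) (auto intro!: bexI[of _ "Suc j"])
        thus ?thesis using False by (simp add: mpow_def)
      qed
      have "(\<Sum>\<alpha>\<in>S. mpow n ?z \<alpha> * F \<alpha> (add_col j c Q)) =
          (\<Sum>\<delta>\<in>?S'. mpow n t \<delta> * (if \<delta> \<in> S then F \<delta> (add_col j c Q) else 0))"
        using S(1) by (intro sum.mono_neutral_cong) (auto simp: z shift_exp_def)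
      moreover have "(\<Sum>\<alpha>\<in>S. (- c) ^ \<alpha> (Suc j) * mpow n t (shift_exp j \<alpha>) * F \<alpha> Q) =
          (\<Sum>\<delta>\<in>?S'. mpow n t \<delta> * (\<Sum>\<alpha>\<in>{\<alpha>\<in>S. shift_exp j \<alpha> = \<delta>}. (- c) ^ \<alpha> (Suc j) * F \<alpha> Q))"
      proof -
        have "(\<Sum>\<alpha>\<in>S. (- c) ^ \<alpha> (Suc j) * mpow n t (shift_exp j \<alpha>) * F \<alpha> Q) =
            (\<Sum>\<delta>\<in>?S'. \<Sum>\<alpha>\<in>{\<alpha>\<in>S. shift_exp j \<alpha> = \<delta>}. (- c) ^ \<alpha> (Suc j) * mpow n t (shift_exp j \<alpha>) * F \<alpha> Q)"
          using S(1) by (intro sum.group[symmetric]) auto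
        also have "\<dots> = (\<Sum>\<delta>\<in>?S'. mpow n t \<delta> * (\<Sum>\<alpha>\<in>{\<alpha>\<in>S. shift_exp j \<alpha> = \<delta>}. (- c) ^ \<alpha> (Suc j) * F \<alpha> Q))"
          unfolding sum_distrib_left by (intro sum.cong) auto
        finally show ?thesis .
      qed
      ultimately show ?thesis using e by (simp add: algebra_simps sum_subtractf)
    qed
    have "?c \<gamma> = 0"
    proof (rule mpow_independent[of ?S' n ?c \<gamma>])
      show "\<delta> l = 0" if "\<delta> \<in> ?S'" "n \<le> l" for \<delta> l
        using that S(2) j by (auto simp: shift_exp_def)
    qed (use S(1) \<beta> sum0 in \<open>auto simp: \<gamma>_def\<close>)
    hence "g (add_col j c Q) = (\<Sum>\<alpha>\<in>A. (- c) ^ \<alpha> (Suc j) * F \<alpha> Q)" by (simp add: g_def A_def)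
    also have "\<dots> = (\<Sum>i\<le>K. \<Sum>\<alpha>\<in>{\<alpha>\<in>A. \<alpha> (Suc j) = i}. (- c) ^ \<alpha> (Suc j) * F \<alpha> Q)"
      using finA AK by (intro sum.group[symmetric]) auto
    also have "\<dots> = (\<Sum>i\<le>K. c ^ i * h i Q)"
      unfolding h_def sum_distrib_left
      by (intro sum.cong) (auto simp: power_minus[of c])
    finally show ?thesis .
  qed
  have g0: "g Q = 0" if Q: "Q \<in> carrier_mat N n" for Q
  proof (cases "\<gamma> \<in> S")
    case True
    \<comment> \<open>Then p + K equals \<open>\<mu> j - \<beta> j\<close>, so the negated claim is
      exactly the hypothesis p + K < q of the degree bound.\<close>
    define p where "p = \<mu> j - \<gamma> j"
    have p: "\<mu> j = p + \<gamma> j" using S(4)[OF True, of j] by (simp add: p_def)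
    show ?thesis
    proof (rule column_degree_bound[of N n g j K h p "\<mu> (Suc j)"])
      have "g = F \<gamma>" using True by (simp add: g_def fun_eq_iff)
      thus "is_poly N n g" using F(1) by simp
      show "is_poly N n (h i)" for i
        unfolding h_def by (intro is_poly_sum is_poly_mult is_poly_const F)
      show "h i (col_scale (two_scale j s) Q) = s ^ (p + i) * (1 / s) ^ (\<mu> (Suc j) - i) * h i Q"
        if "s \<noteq> 0" "Q \<in> carrier_mat N n" for i s Q
        unfolding h_def sum_distrib_left
      proof (intro sum.cong refl)
        fix \<alpha> assume "\<alpha> \<in> {\<alpha>\<in>A. \<alpha> (Suc j) = i}"
        hence \<alpha>: "\<alpha> \<in> S" "\<alpha> (Suc j) = i" "\<alpha> j + i = \<gamma> j" by (auto simp: A_def shift_exp_def)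
        have "\<mu> j - \<alpha> j = p + i" using p \<alpha>(3) by simp
        thus "(- 1) ^ i * F \<alpha> (col_scale (two_scale j s) Q) =
            s ^ (p + i) * (1 / s) ^ (\<mu> (Suc j) - i) * ((- 1) ^ i * F \<alpha> Q)"
          using has_weightD[OF F(2)[OF \<alpha>(1)], of "two_scale j s" Q] that \<alpha>
          by (simp add: two_scale_nonzero mpow_two_scale[OF j])
      qed
      show "p + K < \<mu> (Suc j)" using less p by (simp add: \<gamma>_def shift_exp_def K_def)
    qed (use j add Q in auto)
  qed (simp add: g_def)
  \<comment> \<open>As g is zero, all coefficients in c vanish, in particular the one at K, where
    \<open>\<beta>\<close> is the only exponent left in the fibre.\<close>
  have "(\<Sum>i\<le>K. c ^ i * h i Q0) = 0" for c
    using add[OF Q0(1), of c] g0[of "add_col j c Q0"] Q0(1) by simp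
  hence "poly (\<Sum>i\<le>K. monom (h i Q0) i) c = 0" for c
    by (simp add: poly_sum poly_monom mult.commute)
  hence "(\<Sum>i\<le>K. monom (h i Q0) i) = 0" using poly_fun_eq_0_iff by blast
  hence "coeff (\<Sum>i\<le>K. monom (h i Q0) i) K = 0" by simp
  hence "h K Q0 = 0" by (simp add: coeff_sum)
  moreover have "{\<alpha>\<in>A. \<alpha> (Suc j) = K} = {\<beta>}"
  proof -
    have "\<alpha> = \<beta>" if "shift_exp j \<alpha> = shift_exp j \<beta>" "\<alpha> (Suc j) = \<beta> (Suc j)" for \<alpha>
    proof
      fix l show "\<alpha> l = \<beta> l"
        using fun_cong[OF that(1), of l] that(2) by (auto simp: shift_exp_def split: if_splits)
    qed
    thus ?thesis using \<beta>(1) by (auto simp: A_def \<gamma>_def K_def)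
  qed
  ultimately show False using Q0(2) by (simp add: h_def)
qed

section \<open>The induction on the number of rows\<close>

lemma minor_span_invariant:
  assumes "minor_span b N n \<nu> f" "b \<le> N"
  shows "is_poly N n f" "right_inv N n f" "left_inv b N n f" "has_weight N n \<nu> f"
proof -
  obtain ts where ts: "\<forall>t\<in>set ts. set (snd t) \<subseteq> row_lists b N n \<and> shape (snd t) = \<nu>"
    "\<forall>Q\<in>carrier_mat N n. f Q = minor_comb ts Q"
    using assms unfolding minor_span_def by blast
  note m = minor_comb_invariant[OF ts(1) assms(2)]
  show "is_poly N n f" using m(1) ts(2) by (auto intro: is_poly_cong)
  show "has_weight N n \<nu> f" using m(4) ts(2) by (auto intro: has_weight_cong)
  show "right_inv N n f" "left_inv b N n f"
    unfolding right_inv_def left_inv_def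
  proof safe
    fix u Q :: "complex mat" assume Q: "Q \<in> carrier_mat N n"
    show "f (Q * u) = f Q" if u: "u \<in> unitri n"
    proof -
      have "Q * u \<in> carrier_mat N n" using Q unitri_carrier[OF u] by simp
      thus ?thesis using ts(2) Q m(2) u by (simp add: right_inv_def)
    qed
    show "f (transpose_mat (GL_embed b N u) * Q) = f Q" if u: "u \<in> unitri b"
    proof -
      have "transpose_mat (GL_embed b N u) * Q \<in> carrier_mat N n"
        using Q GL_embed_carrier[OF unitri_carrier[OF u] assms(2)] by auto
      thus ?thesis using ts(2) Q m(3) u by (simp add: left_inv_def)
    qed
  qed
qed

lemma shape_count:
  "shape G j = shape G (Suc j) + length (filter (\<lambda>xs. length xs = Suc j) G)"
  by (induction G) auto

text \<open>The number of factors with exactly j + 1 rows is the drop of the shape from j to j + 1.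
  By the inequality \<open>dom\<close> it is at least \<open>\<beta> (Suc j)\<close>, so there are
  enough factors to which row N can be appended.\<close>

lemma minor_comb_extend:
  assumes ts: "\<forall>t\<in>set ts. set (snd t) \<subseteq> row_lists b N n \<and> shape (snd t) = (\<lambda>j. \<mu> j - \<beta> j)"
    and "b \<le> N" and le: "\<And>j. \<beta> j \<le> \<mu> j" and supp: "\<And>j. n \<le> j \<Longrightarrow> \<beta> j = 0"
    and dom: "\<And>j. Suc j < n \<Longrightarrow> \<mu> (Suc j) + \<beta> j \<le> \<mu> j"
  shows "\<exists>us. (\<forall>t\<in>set us. set (snd t) \<subseteq> row_lists b (Suc N) n \<and> shape (snd t) = \<mu>) \<and>
    row_degree_less N n (weighted_degree n \<beta>)
      (\<lambda>Q. mpow n (\<lambda>j. Q $$ (N, j)) \<beta> * minor_comb ts Q - minor_comb us Q)"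
  using ts
proof (induction ts)
  case Nil show ?case by (intro exI[of _ "[]"]) (simp add: row_degree_less_zero)
next
  case (Cons t ts)
  then obtain us where us: "\<forall>t\<in>set us. set (snd t) \<subseteq> row_lists b (Suc N) n \<and> shape (snd t) = \<mu>"
    "row_degree_less N n (weighted_degree n \<beta>)
      (\<lambda>Q. mpow n (\<lambda>j. Q $$ (N, j)) \<beta> * minor_comb ts Q - minor_comb us Q)" by auto
  \<comment> \<open>Empty factors change neither product nor shape; they provide the places where a
    minor on row N alone is created.\<close>
  define G where "G = replicate (\<beta> 0) [] @ snd t"
  have t: "set (snd t) \<subseteq> row_lists b N n" "shape (snd t) = (\<lambda>j. \<mu> j - \<beta> j)"
    using Cons.prems by auto
  have shape_G: "shape G = (\<lambda>j. \<mu> j - \<beta> j)"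
    using t(2) by (auto simp: G_def shape_def fun_eq_iff)
  have "[] \<in> row_lists b N n" by (auto simp: row_lists_def)
  hence "set G \<subseteq> row_lists b N n" using t(1) by (auto simp: G_def)
  moreover have "\<beta> j \<le> length (filter (\<lambda>xs. length xs = j) G)" for j
  proof (cases j)
    case 0 thus ?thesis by (simp add: G_def)
  next
    case (Suc i)
    show ?thesis
    proof (cases "j < n")
      case True
      have "\<mu> i - \<beta> i = \<mu> j - \<beta> j + length (filter (\<lambda>xs. length xs = j) G)"
        using shape_count[of G i] shape_G Suc by simp
      thus ?thesis using dom[of i] True le[of j] Suc by simp
    qed (use supp in simp)
  qed
  ultimately obtain G' where G': "set G' \<subseteq> row_lists b (Suc N) n" "\<forall>j. shape G' j = shape G j + \<beta> j"
    "row_degree_less N n (weighted_degree n \<beta>)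
      (\<lambda>Q. minor_prod G' Q - mpow n (\<lambda>j. Q $$ (N, j)) \<beta> * minor_prod G Q)"
    using minor_prod_extend[of G b N n \<beta>] supp \<open>b \<le> N\<close> by blast
  have "minor_prod (replicate e []) Q = 1" for e Q by (induction e) auto
  hence Gt: "minor_prod G Q = minor_prod (snd t) Q" for Q by (simp add: G_def)
  have "row_degree_less N n (weighted_degree n \<beta>)
      (\<lambda>Q. - fst t * (minor_prod G' Q - mpow n (\<lambda>j. Q $$ (N, j)) \<beta> * minor_prod G Q) +
        (mpow n (\<lambda>j. Q $$ (N, j)) \<beta> * minor_comb ts Q - minor_comb us Q))"
    by (intro row_degree_less_add row_degree_less_cmult G' us)
  hence "row_degree_less N n (weighted_degree n \<beta>)
      (\<lambda>Q. mpow n (\<lambda>j. Q $$ (N, j)) \<beta> * minor_comb (t # ts) Q - minor_comb ((fst t, G') # us) Q)"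
    by (rule row_degree_less_cong) (simp add: Gt algebra_simps)
  moreover have "shape G' = \<mu>" using G'(2) shape_G le by (auto simp: fun_eq_iff)
  ultimately show ?case
    using us(1) G'(1) by (intro exI[of _ "(fst t, G') # us"]) auto
qed

text \<open>Descent on W: each top term of the expansion is matched by a combination of products of
  minors with the same leading part. Subtracting these leaves an invariant of the same weight and
  lower row degree.\<close>

lemma minor_span_step:
  assumes IH: "\<And>f \<nu>. is_poly N n f \<Longrightarrow> right_inv N n f \<Longrightarrow> left_inv b N n f \<Longrightarrow> has_weight N n \<nu> f \<Longrightarrow>
      (\<And>j. n \<le> j \<Longrightarrow> \<nu> j = 0) \<Longrightarrow> minor_span b N n \<nu> f"
    and "b \<le> N" and supp: "\<And>j. n \<le> j \<Longrightarrow> \<mu> j = 0"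
    and "is_poly (Suc N) n f" "right_inv (Suc N) n f" "left_inv b (Suc N) n f" "has_weight (Suc N) n \<mu> f"
    and "row_degree_less N n W f"
  shows "minor_span b (Suc N) n \<mu> f"
  using assms(4-8)
proof (induction W arbitrary: f)
  case 0
  then obtain ts where "\<forall>t\<in>set ts. row_degree N (snd t) < 0" "\<forall>Q\<in>carrier_mat (Suc N) n. f Q = term_sum ts Q"
    unfolding row_degree_less_def by blast
  hence "f Q = 0" if "Q \<in> carrier_mat (Suc N) n" for Q using that by (cases ts) auto
  thus ?case by (rule minor_span_cong[OF minor_span_zero])
next
  case (Suc W)
  note f = Suc.prems
  have bN: "b \<le> Suc N" using \<open>b \<le> N\<close> by simp
  obtain S F where S: "finite S" "\<And>\<beta> j. \<beta> \<in> S \<Longrightarrow> n \<le> j \<Longrightarrow> \<beta> j = 0"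
    "\<And>\<beta>. \<beta> \<in> S \<Longrightarrow> weighted_degree n \<beta> \<le> W" "\<And>\<beta> j. \<beta> \<in> S \<Longrightarrow> \<beta> j \<le> \<mu> j"
    and F: "\<And>\<beta>. is_poly N n (F \<beta>)" "\<And>\<beta>. \<beta> \<in> S \<Longrightarrow> has_weight N n (\<lambda>j. \<mu> j - \<beta> j) (F \<beta>)"
    and exp: "\<And>Q z. Q \<in> carrier_mat N n \<Longrightarrow> f (add_row N n Q z) = (\<Sum>\<beta>\<in>S. mpow n z \<beta> * F \<beta> Q)"
    using last_row_expansion[OF f(4) supp f(5)] by blast
  let ?T = "{\<beta>\<in>S. weighted_degree n \<beta> = W}"
  let ?m = "\<lambda>\<beta> Q. mpow n (\<lambda>j. Q $$ (N, j)) \<beta>"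
  \<comment> \<open>A coefficient that is identically zero is set apart, since the inequality on its
    exponents is available only at a nonzero value.\<close>
  have "\<exists>g. minor_span b (Suc N) n \<mu> g \<and>
      row_degree_less N n W (\<lambda>Q. ?m \<beta> Q * F \<beta> (top_rows N n Q) - g Q)" if "\<beta> \<in> ?T" for \<beta>
  proof (cases "\<forall>Q\<in>carrier_mat N n. F \<beta> Q = 0")
    case True
    thus ?thesis
      by (intro exI[of _ "\<lambda>_. 0"]) (simp add: minor_span_zero row_degree_less_zero)
  next
    case False
    then obtain Q0 where Q0: "Q0 \<in> carrier_mat N n" "F \<beta> Q0 \<noteq> 0" by blast
    have \<beta>: "\<beta> \<in> S" "weighted_degree n \<beta> = W" using that by auto
    have dom: "\<mu> (Suc j) + \<beta> j \<le> \<mu> j" if "Suc j < n" for j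
      
      using f(2) S F exp \<beta> that Q0
      by (rule top_coefficient_weight[where S = S and F = F and \<mu> = \<mu> and f = f and \<beta> = \<beta>])
    have "minor_span b N n (\<lambda>j. \<mu> j - \<beta> j) (F \<beta>)"
    proof (rule IH)
      show "right_inv N n (F \<beta>)" 
        using f(2) S(1-3) exp \<beta>
        by (rule top_coefficient_right_inv[where S = S and F = F and f = f and \<beta> = \<beta>])
      show "left_inv b N n (F \<beta>)" 
        using f(3) \<open>b \<le> N\<close> S(1,2) exp \<beta>(1)
        by (rule coefficient_left_inv[where S = S and F = F and f = f and \<beta> = \<beta>])
    qed (use F \<beta> supp in auto)
    then obtain ts where ts: "\<forall>t\<in>set ts. set (snd t) \<subseteq> row_lists b N n \<and> shape (snd t) = (\<lambda>j. \<mu> j - \<beta> j)"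
      "\<forall>Q\<in>carrier_mat N n. F \<beta> Q = minor_comb ts Q" unfolding minor_span_def by blast
    from ts(1) \<open>b \<le> N\<close> S(4)[OF \<beta>(1)] S(2)[OF \<beta>(1)] dom
    have "\<exists>us. (\<forall>t\<in>set us. set (snd t) \<subseteq> row_lists b (Suc N) n \<and> shape (snd t) = \<mu>) \<and>
      row_degree_less N n (weighted_degree n \<beta>) (\<lambda>Q. ?m \<beta> Q * minor_comb ts Q - minor_comb us Q)"
      by (rule minor_comb_extend[where \<mu> = \<mu> and \<beta> = \<beta>])
    then obtain us where
      us: "\<forall>t\<in>set us. set (snd t) \<subseteq> row_lists b (Suc N) n \<and> shape (snd t) = \<mu>"
      "row_degree_less N n W (\<lambda>Q. ?m \<beta> Q * minor_comb ts Q - minor_comb us Q)"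
      using \<beta>(2) by auto
    have "minor_prod G (top_rows N n Q) = minor_prod G Q" if "set G \<subseteq> row_lists b N n" for G Q
      using that row_listsD[OF _ \<open>b \<le> N\<close>] by (induction G) (auto simp: minor_top_rows)
    hence "minor_comb ts (top_rows N n Q) = minor_comb ts Q" for Q
      using ts(1) by (induction ts) auto
    hence "row_degree_less N n W (\<lambda>Q. ?m \<beta> Q * F \<beta> (top_rows N n Q) - minor_comb us Q)"
      using us(2) ts(2) by simp
    moreover have "minor_span b (Suc N) n \<mu> (minor_comb us)"
      unfolding minor_span_def using us(1) by blast
    ultimately show ?thesis by blast
  qed
  hence "\<forall>\<beta>\<in>?T. \<exists>g. minor_span b (Suc N) n \<mu> g \<and>
      row_degree_less N n W (\<lambda>Q. ?m \<beta> Q * F \<beta> (top_rows N n Q) - g Q)" by (intro ballI)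
  from bchoice[OF this] obtain g where
    g': "\<forall>\<beta>\<in>?T. minor_span b (Suc N) n \<mu> (g \<beta>) \<and>
      row_degree_less N n W (\<lambda>Q. ?m \<beta> Q * F \<beta> (top_rows N n Q) - g \<beta> Q)" ..
  have g: "minor_span b (Suc N) n \<mu> (g \<beta>)"
    "row_degree_less N n W (\<lambda>Q. ?m \<beta> Q * F \<beta> (top_rows N n Q) - g \<beta> Q)" if "\<beta> \<in> ?T" for \<beta>
    using bspec[OF g' that] by (rule conjunct1, rule conjunct2)
  let ?G = "\<lambda>Q. \<Sum>\<beta>\<in>?T. g \<beta> Q"
  have G: "minor_span b (Suc N) n \<mu> ?G" by (intro minor_span_sum g)
  note Gi = minor_span_invariant[OF G bN]
  have split: "f Q - ?G Q = (\<Sum>\<beta>\<in>S - ?T. ?m \<beta> Q * F \<beta> (top_rows N n Q)) +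
      (\<Sum>\<beta>\<in>?T. ?m \<beta> Q * F \<beta> (top_rows N n Q) - g \<beta> Q)" if Q: "Q \<in> carrier_mat (Suc N) n" for Q
  proof -
    have "Q = add_row N n (top_rows N n Q) (\<lambda>j. Q $$ (N, j))"
      using Q by (intro eq_matI) (auto simp: add_row_def less_Suc_eq)
    hence "f Q = (\<Sum>\<beta>\<in>S. ?m \<beta> Q * F \<beta> (top_rows N n Q))"
      using exp[of "top_rows N n Q" "\<lambda>j. Q $$ (N, j)"] by simp
    also have "\<dots> = (\<Sum>\<beta>\<in>S - ?T. ?m \<beta> Q * F \<beta> (top_rows N n Q)) +
        (\<Sum>\<beta>\<in>?T. ?m \<beta> Q * F \<beta> (top_rows N n Q))"
      using S(1) by (intro sum.subset_diff) auto
    finally show ?thesis by (simp add: sum_subtractf)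
  qed
  have "row_degree_less N n W (\<lambda>Q. ?m \<beta> Q * F \<beta> (top_rows N n Q))" if "\<beta> \<in> S - ?T" for \<beta>
  proof -
    have "row_degree_less N n (weighted_degree n \<beta> + 1) (\<lambda>Q. ?m \<beta> Q * F \<beta> (top_rows N n Q))"
      by (intro row_degree_less_mult row_degree_less_mpow row_degree_less_top F)
    thus ?thesis using S(3)[of \<beta>] that by (auto intro: row_degree_less_mono)
  qed
  hence "row_degree_less N n W (\<lambda>Q. (\<Sum>\<beta>\<in>S - ?T. ?m \<beta> Q * F \<beta> (top_rows N n Q)) +
      (\<Sum>\<beta>\<in>?T. ?m \<beta> Q * F \<beta> (top_rows N n Q) - g \<beta> Q))"
    by (intro row_degree_less_add row_degree_less_sum g)
  hence deg: "row_degree_less N n W (\<lambda>Q. f Q - ?G Q)"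
    by (rule row_degree_less_cong) (rule split)
  have "minor_span b (Suc N) n \<mu> (\<lambda>Q. f Q - ?G Q)"
  proof (rule Suc.IH[OF _ _ _ _ deg])
    show "is_poly (Suc N) n (\<lambda>Q. f Q - ?G Q)" by (intro is_poly_diff f Gi)
    show "has_weight (Suc N) n \<mu> (\<lambda>Q. f Q - ?G Q)" by (intro has_weight_diff f Gi)
    show "right_inv (Suc N) n (\<lambda>Q. f Q - ?G Q)" "left_inv b (Suc N) n (\<lambda>Q. f Q - ?G Q)"
      using f(2,3) Gi(2,3) by (simp_all add: right_inv_def left_inv_def)
  qed
  from minor_span_add[OF this G] show ?case by simp
qed

lemma minor_span_of_invariant:
  assumes "n \<le> b" "b \<le> N"
    and "is_poly N n f" "right_inv N n f" "left_inv b N n f" "has_weight N n \<nu> f"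
    and "\<And>j. n \<le> j \<Longrightarrow> \<nu> j = 0"
  shows "minor_span b N n \<nu> f"
  using assms(2-7)
proof (induction N arbitrary: f \<nu> rule: dec_induct)
  case base thus ?case using minor_span_base[OF \<open>n \<le> b\<close>] by blast
next
  case (step N)
  obtain ts where ts: "set ts \<subseteq> terms (Suc N) n" "\<And>Q. Q \<in> carrier_mat (Suc N) n \<Longrightarrow> f Q = term_sum ts Q"
    using is_poly_terms[OF step.prems(1)] by blast
  \<comment> \<open>Any bound on the row degree starts the descent; the sum over all terms is
    one.\<close>
  have "\<forall>t\<in>set ts. row_degree N (snd t) < Suc (\<Sum>t\<leftarrow>ts. row_degree N (snd t))"
    by (force simp: less_Suc_eq_le intro!: member_le_sum_list)
  hence "row_degree_less N n (Suc (\<Sum>t\<leftarrow>ts. row_degree N (snd t))) f"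
    using ts unfolding row_degree_less_def by blast
  thus ?case
    by (intro minor_span_step[OF step.IH \<open>b \<le> N\<close>] step.prems)
qed

section \<open>Invariant complements\<close>

definition herm :: "'i set \<Rightarrow> ('i \<Rightarrow> complex) \<Rightarrow> ('i \<Rightarrow> complex) \<Rightarrow> complex" where
  "herm I x y = (\<Sum>i\<in>I. x i * cnj (y i))"

lemma herm_linear_left: "herm I (\<lambda>i. a * x i + b * y i) z = a * herm I x z + b * herm I y z"
  by (simp add: herm_def algebra_simps sum.distrib sum_distrib_left)

lemma herm_linear_right:
  "herm I z (\<lambda>i. a * x i + b * y i) = cnj a * herm I z x + cnj b * herm I z y"
  by (simp add: herm_def algebra_simps sum.distrib sum_distrib_left)

lemma herm_commute: "herm I x y = cnj (herm I y x)"
  by (simp add: herm_def mult.commute)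

lemma herm_self_eq_0:
  assumes "finite I" "herm I x x = 0" "i \<in> I" shows "x i = 0"
proof -
  have "herm I x x = of_real (\<Sum>i\<in>I. (cmod (x i))\<^sup>2)"
    unfolding herm_def of_real_sum by (intro sum.cong) (simp_all only: complex_norm_square)
  hence "(\<Sum>i\<in>I. (cmod (x i))\<^sup>2) = 0" using assms(2) by (metis of_real_eq_0_iff)
  hence "(cmod (x i))\<^sup>2 = 0" using assms by (simp add: sum_nonneg_eq_0_iff)
  thus ?thesis by simp
qed

definition lin_space :: "'i set \<Rightarrow> ('i \<Rightarrow> complex) set \<Rightarrow> bool" where
  "lin_space I W \<longleftrightarrow> (\<lambda>_. 0) \<in> W \<and> (\<forall>w\<in>W. \<forall>i. i \<notin> I \<longrightarrow> w i = 0) \<and>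
    (\<forall>v\<in>W. \<forall>w\<in>W. \<forall>a b. (\<lambda>i. a * v i + b * w i) \<in> W)"

text \<open>Induction on the coordinates in place of a choice of basis: the vectors of W that vanish
  at the new coordinate form a subspace of codimension at most one, and a vector of W orthogonal to
  that subspace spans the rest.\<close>

lemma orthogonal_projection:
  assumes "finite I" "lin_space I W"
  shows "\<exists>w\<in>W. \<forall>v\<in>W. herm I (\<lambda>i. x i - w i) v = 0"
  using assms
proof (induction I arbitrary: W x rule: finite_induct)
  case empty thus ?case by (auto simp: herm_def lin_space_def)
next
  case (insert i I)
  define W0 where "W0 = {w\<in>W. w i = 0}"
  have lin: "(\<lambda>i. a * v i + b * w i) \<in> W" if "v \<in> W" "w \<in> W" for v w a b
    using insert.prems that by (auto simp: lin_space_def)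
  have W0: "lin_space I W0"
    using insert.prems by (auto simp: lin_space_def W0_def)
  have ext: "herm (insert i I) y v = herm I y v" if "v i = 0" for y v
    using insert.hyps that by (simp add: herm_def)
  note IH = insert.IH[OF W0]
  show ?case
  proof (cases "\<forall>v\<in>W. v i = 0")
    case True
    obtain w where "w \<in> W0" "\<forall>v\<in>W0. herm I (\<lambda>i. x i - w i) v = 0" using IH by blast
    moreover have "v \<in> W0" "v i = 0" if "v \<in> W" for v
      using that True by (simp_all add: W0_def)
    ultimately show ?thesis using ext by (intro bexI[of _ w]) (simp_all add: W0_def)
  next
    case False
    then obtain v where v: "v \<in> W" "v i \<noteq> 0" by blast
    obtain w1 where w1: "w1 \<in> W0" "\<forall>u\<in>W0. herm I (\<lambda>i. v i - w1 i) u = 0" using IH by blast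
    define v' where "v' = (\<lambda>i. 1 * v i + (-1) * w1 i)"
    have w1W: "w1 \<in> W" "w1 i = 0" using w1(1) by (simp_all add: W0_def)
    have v': "v' \<in> W" unfolding v'_def by (rule lin[OF v(1) w1W(1)])
    have v'i: "v' i \<noteq> 0" using v(2) w1W(2) by (simp add: v'_def)
    have v'W0: "herm (insert i I) v' u = 0" if "u \<in> W0" for u
      using w1(2) that ext[of u v'] by (simp add: v'_def W0_def)
    have N: "herm (insert i I) v' v' \<noteq> 0"
      using herm_self_eq_0[of "insert i I" v' i] v'i insert.hyps by auto
    obtain P where P: "P \<in> W0" "\<forall>u\<in>W0. herm I (\<lambda>i. x i - P i) u = 0" using IH by blast
    define c where "c = herm (insert i I) x v' / herm (insert i I) v' v'"
    let ?w = "\<lambda>i. 1 * P i + c * v' i"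
    have PW: "P \<in> W" using P by (simp add: W0_def)
    have xw: "herm (insert i I) (\<lambda>i. x i - ?w i) u =
        herm (insert i I) (\<lambda>i. x i - P i) u - c * herm (insert i I) v' u" for u
      using herm_linear_left[of "insert i I" 1 "\<lambda>i. x i - P i" "-c" v' u] by (simp add: algebra_simps)
    show ?thesis
    proof (intro bexI[of _ ?w] ballI)
      show "?w \<in> W" by (rule lin[OF PW v'])
      fix u assume u: "u \<in> W"
      \<comment> \<open>The component of u in W0: the multiple of v' is chosen to cancel the
        coordinate i.\<close>
      define w0 where "w0 = (\<lambda>j. 1 * u j + (- (u i / v' i)) * v' j)"
      have "w0 \<in> W" unfolding w0_def by (rule lin[OF u v'])
      moreover have "w0 i = 0" using v'i by (simp add: w0_def)
      ultimately have w0: "w0 \<in> W0" by (simp add: W0_def)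
      have "herm (insert i I) P v' = 0"
        using v'W0[OF P(1)] herm_commute[of "insert i I" P v'] by simp
      hence "herm (insert i I) (\<lambda>i. x i - P i) v' = herm (insert i I) x v'"
        using herm_linear_left[of "insert i I" 1 x "-1" P v'] by simp
      hence 1: "herm (insert i I) (\<lambda>i. x i - ?w i) v' = 0" unfolding xw using N by (simp add: c_def)
      have 2: "herm (insert i I) (\<lambda>i. x i - ?w i) w0 = 0"
        unfolding xw using v'W0[OF w0] P(2) w0 ext[of w0] by (simp add: W0_def)
      have "u = (\<lambda>j. 1 * w0 j + (u i / v' i) * v' j)" by (auto simp: w0_def)
      thus "herm (insert i I) (\<lambda>i. x i - ?w i) u = 0"
        using herm_linear_right[of "insert i I" "\<lambda>i. x i - ?w i" 1 w0 "u i / v' i" v'] 1 2 by simp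
    qed
  qed
qed

text \<open>Homogeneous polynomial functions of degree \<open>d\<close> are images of tensors, that is of functions on
  the lists of \<open>d\<close> positions; on tensors the standard Hermitian form satisfies
  \<open>\<langle>g c, w\<rangle> = \<langle>c, g\<^sup>* w\<rangle>\<close>.\<close>

definition positions :: "nat \<Rightarrow> nat \<Rightarrow> nat \<Rightarrow> (nat \<times> nat) list set" where
  "positions a k d = {xs. length xs = d \<and> set xs \<subseteq> {..<a} \<times> {..<k}}"

definition tensor_fun :: "nat \<Rightarrow> nat \<Rightarrow> nat \<Rightarrow> ((nat \<times> nat) list \<Rightarrow> complex) \<Rightarrow> complex mat \<Rightarrow> complex" where
  "tensor_fun a k d c Q = (\<Sum>xs\<in>positions a k d. c xs * entry_prod xs Q)"

text \<open>The matrix entries of a tensor power of g, acting on row indices only: every column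
  index has to agree.\<close>

fun tensor_coeff :: "complex mat \<Rightarrow> (nat \<times> nat) list \<Rightarrow> (nat \<times> nat) list \<Rightarrow> complex" where
  "tensor_coeff g [] [] = 1"
| "tensor_coeff g (y # ys) (x # xs) =
    (if snd y = snd x then g $$ (fst y, fst x) else 0) * tensor_coeff g ys xs"
| "tensor_coeff g _ _ = 0"

definition tensor_act ::
  "nat \<Rightarrow> nat \<Rightarrow> nat \<Rightarrow> complex mat \<Rightarrow> ((nat \<times> nat) list \<Rightarrow> complex) \<Rightarrow> (nat \<times> nat) list \<Rightarrow> complex" where
  "tensor_act a k d g c ys =
    (if ys \<in> positions a k d then \<Sum>xs\<in>positions a k d. tensor_coeff g ys xs * c xs else 0)"

definition conj_transpose :: "complex mat \<Rightarrow> complex mat" where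
  "conj_transpose g = map_mat cnj (transpose_mat g)"

lemma finite_positions: "finite (positions a k d)"
proof -
  have "positions a k d = {xs. set xs \<subseteq> {..<a} \<times> {..<k} \<and> length xs = d}"
    by (auto simp: positions_def)
  thus ?thesis using finite_lists_length_eq[of "{..<a} \<times> {..<k}" d] by simp
qed

lemma sum_positions_Suc:
  "(\<Sum>xs\<in>positions a k (Suc d). h xs) = (\<Sum>x\<in>{..<a} \<times> {..<k}. \<Sum>xs\<in>positions a k d. h (x # xs))"
proof -
  have "positions a k (Suc d) = (\<lambda>(x, xs). x # xs) ` (({..<a} \<times> {..<k}) \<times> positions a k d)"
    by (force simp: positions_def length_Suc_conv image_iff)
  moreover have "inj_on (\<lambda>(x, xs). x # xs) (({..<a} \<times> {..<k}) \<times> positions a k d)"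
    by (auto simp: inj_on_def)
  ultimately have "(\<Sum>xs\<in>positions a k (Suc d). h xs) =
      (\<Sum>(x, xs)\<in>({..<a} \<times> {..<k}) \<times> positions a k d. h (x # xs))"
    by (simp add: sum.reindex case_prod_unfold)
  thus ?thesis by (simp add: sum.cartesian_product)
qed

lemma entry_prod_transpose_mult:
  assumes g: "g \<in> carrier_mat a a" and Q: "Q \<in> carrier_mat a k" and xs: "set xs \<subseteq> {..<a} \<times> {..<k}"
  shows "entry_prod xs (transpose_mat g * Q) =
    (\<Sum>ys\<in>positions a k (length xs). tensor_coeff g ys xs * entry_prod ys Q)"
  using xs
proof (induction xs)
  case Nil
  have "positions a k 0 = {[]}" by (auto simp: positions_def)
  thus ?case by simp
next
  case (Cons x xs)
  obtain r j where x: "x = (r, j)" by force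
  have rj: "r < a" "j < k" using Cons.prems x by auto
  have "(transpose_mat g * Q) $$ (r, j) = (\<Sum>l<a. g $$ (l, r) * Q $$ (l, j))"
    using g Q rj by (subst mult_index_sum[of _ a a _ k]) auto
  also have "\<dots> = (\<Sum>l<a. \<Sum>i<k. if i = j then g $$ (l, r) * Q $$ (l, j) else 0)"
    using rj by simp
  also have "\<dots> = (\<Sum>y\<in>{..<a} \<times> {..<k}. (if snd y = j then g $$ (fst y, r) else 0) * Q $$ y)"
    unfolding sum.cartesian_product by (intro sum.cong) auto
  finally have "entry_prod (x # xs) (transpose_mat g * Q) =
      (\<Sum>y\<in>{..<a} \<times> {..<k}. (if snd y = j then g $$ (fst y, r) else 0) * Q $$ y) *
      (\<Sum>ys\<in>positions a k (length xs). tensor_coeff g ys xs * entry_prod ys Q)"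
    using Cons by (simp add: x)
  thus ?case
    unfolding sum_product x length_Cons sum_positions_Suc tensor_coeff.simps fst_conv snd_conv
    by (simp add: mult_ac)
qed

lemma tensor_fun_act:
  assumes g: "g \<in> carrier_mat a a" and Q: "Q \<in> carrier_mat a k"
  shows "tensor_fun a k d c (transpose_mat g * Q) = tensor_fun a k d (tensor_act a k d g c) Q"
proof -
  have "tensor_fun a k d c (transpose_mat g * Q) =
      (\<Sum>xs\<in>positions a k d. \<Sum>ys\<in>positions a k d. c xs * (tensor_coeff g ys xs * entry_prod ys Q))"
    unfolding tensor_fun_def sum_distrib_left[symmetric]
    by (intro sum.cong) (auto simp: positions_def entry_prod_transpose_mult[OF g Q])
  also have "\<dots> = (\<Sum>ys\<in>positions a k d. \<Sum>xs\<in>positions a k d. c xs * (tensor_coeff g ys xs * entry_prod ys Q))"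
    by (rule sum.swap)
  also have "\<dots> = tensor_fun a k d (tensor_act a k d g c) Q"
    unfolding tensor_fun_def tensor_act_def
    by (intro sum.cong) (auto simp: sum_distrib_left mult_ac)
  finally show ?thesis .
qed

lemma tensor_coeff_conj_transpose:
  assumes "g \<in> carrier_mat a a" "set xs \<subseteq> {..<a} \<times> {..<k}" "set ys \<subseteq> {..<a} \<times> {..<k}"
  shows "tensor_coeff (conj_transpose g) xs ys = cnj (tensor_coeff g ys xs)"
  using assms
proof (induction g ys xs rule: tensor_coeff.induct)
  case (2 g y ys x xs)
  thus ?case by (auto simp: conj_transpose_def)
qed auto

lemma tensor_act_adjoint:
  assumes "g \<in> carrier_mat a a"
  shows "herm (positions a k d) (tensor_act a k d g c) w =
    herm (positions a k d) c (tensor_act a k d (conj_transpose g) w)"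
proof -
  let ?T = "positions a k d"
  have "herm ?T (tensor_act a k d g c) w = (\<Sum>ys\<in>?T. \<Sum>xs\<in>?T. tensor_coeff g ys xs * c xs * cnj (w ys))"
    unfolding herm_def tensor_act_def by (intro sum.cong) (auto simp: sum_distrib_right)
  also have "\<dots> = (\<Sum>xs\<in>?T. \<Sum>ys\<in>?T. tensor_coeff g ys xs * c xs * cnj (w ys))" by (rule sum.swap)
  also have "\<dots> = herm ?T c (tensor_act a k d (conj_transpose g) w)"
    unfolding herm_def tensor_act_def
    by (intro sum.cong refl)
      (auto simp: sum_distrib_left positions_def tensor_coeff_conj_transpose[OF assms] mult_ac intro!: sum.cong)
  finally show ?thesis .
qed

section \<open>Stable spaces of functions and their complements\<close>

definition fun_space :: "nat \<Rightarrow> nat \<Rightarrow> (complex mat \<Rightarrow> complex) set \<Rightarrow> bool" where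
  "fun_space a k W \<longleftrightarrow> W \<subseteq> poly_funs a k \<and> (\<lambda>Q\<in>carrier_mat a k. 0) \<in> W \<and>
    (\<forall>f\<in>W. \<forall>g\<in>W. \<forall>c d. (\<lambda>Q\<in>carrier_mat a k. c * f Q + d * g Q) \<in> W)"

definition stable_under :: "nat \<Rightarrow> nat \<Rightarrow> complex mat set \<Rightarrow> (complex mat \<Rightarrow> complex) set \<Rightarrow> bool" where
  "stable_under a k \<Gamma> W \<longleftrightarrow> (\<forall>g\<in>\<Gamma>. \<forall>f\<in>W. (\<lambda>Q\<in>carrier_mat a k. f (transpose_mat g * Q)) \<in> W)"

text \<open>The passage from tensors to functions is not injective, so orthogonality is taken
  against the full preimage X of W. A tensor that is orthogonal to X and maps into W lies in X,
  hence is zero. Stability of the complement is the adjointness of g and its conjugate transpose.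
  One degree d serves for all of V.\<close>

lemma invariant_complement:
  assumes \<Gamma>: "\<Gamma> \<subseteq> carrier_mat a a" "\<And>g. g \<in> \<Gamma> \<Longrightarrow> conj_transpose g \<in> \<Gamma>"
    and V: "fun_space a k V" "stable_under a k \<Gamma> V"
    and W: "fun_space a k W" "stable_under a k \<Gamma> W" "W \<subseteq> V"
    and deg: "\<And>f. f \<in> V \<Longrightarrow> \<exists>c. \<forall>Q\<in>carrier_mat a k. f Q = tensor_fun a k d c Q"
  shows "\<exists>W'. fun_space a k W' \<and> stable_under a k \<Gamma> W' \<and> W' \<subseteq> V \<and>
    W \<inter> W' = {\<lambda>Q\<in>carrier_mat a k. 0} \<and>
    (\<forall>f\<in>V. \<exists>w\<in>W. \<exists>w'\<in>W'. f = (\<lambda>Q\<in>carrier_mat a k. w Q + w' Q))"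
proof -
  let ?C = "carrier_mat a k"
  let ?T = "positions a k d"
  let ?supp = "\<lambda>c. \<forall>xs. xs \<notin> ?T \<longrightarrow> c xs = (0::complex)"
  let ?f = "\<lambda>c. (\<lambda>Q\<in>?C. tensor_fun a k d c Q)"
  define X where "X = {c. ?supp c \<and> ?f c \<in> W}"
  define W' where "W' = {f\<in>V. \<exists>c. f = ?f c \<and> (\<forall>w\<in>X. herm ?T c w = 0)}"
  have lin: "tensor_fun a k d (\<lambda>xs. p * c xs + q * e xs) Q =
      p * tensor_fun a k d c Q + q * tensor_fun a k d e Q" for p q c e Q
    by (simp add: tensor_fun_def algebra_simps sum.distrib sum_distrib_left)
  have f_lin: "?f (\<lambda>xs. p * c xs + q * e xs) = (\<lambda>Q\<in>?C. p * ?f c Q + q * ?f e Q)" for p q c e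
    by (auto simp: lin)
  have f_zero: "?f (\<lambda>_. 0) = (\<lambda>Q\<in>?C. 0)" by (simp add: tensor_fun_def)
  have f_act: "(\<lambda>Q\<in>?C. ?f c (transpose_mat g * Q)) = ?f (tensor_act a k d g c)" if "g \<in> \<Gamma>" for c g
  proof (rule restrict_ext)
    fix Q :: "complex mat" assume Q: "Q \<in> ?C"
    have g: "g \<in> carrier_mat a a" using that \<Gamma> by blast
    hence "transpose_mat g * Q \<in> ?C" using Q by auto
    thus "?f c (transpose_mat g * Q) = tensor_fun a k d (tensor_act a k d g c) Q"
      using tensor_fun_act[OF g Q] by simp
  qed
  have X: "lin_space ?T X"
    unfolding lin_space_def
  proof (intro conjI ballI allI impI)
    show "(\<lambda>_. 0) \<in> X" using W(1) by (simp add: X_def f_zero fun_space_def)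
    show "w i = 0" if "w \<in> X" "i \<notin> ?T" for w i using that by (simp add: X_def)
    show "(\<lambda>i. p * v i + q * w i) \<in> X" if "v \<in> X" "w \<in> X" for v w p q
    proof -
      have "(\<lambda>Q\<in>?C. p * ?f v Q + q * ?f w Q) \<in> W"
        using that W(1) unfolding X_def fun_space_def by blast
      thus ?thesis using that by (simp only: X_def mem_Collect_eq f_lin) simp
    qed
  qed
  have actX: "tensor_act a k d g w \<in> X" if "w \<in> X" "g \<in> \<Gamma>" for g w
  proof -
    have "(\<lambda>Q\<in>?C. ?f w (transpose_mat g * Q)) \<in> W"
      using that W(2) unfolding X_def stable_under_def by blast
    thus ?thesis unfolding f_act[OF that(2)] by (simp add: X_def tensor_act_def)
  qed
  have zeroV: "(\<lambda>Q\<in>?C. 0) \<in> V" using V(1) by (simp add: fun_space_def)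
  show ?thesis
  proof (intro exI[of _ W'] conjI ballI)
    show "fun_space a k W'"
      unfolding fun_space_def
    proof (intro conjI ballI allI)
      show "W' \<subseteq> poly_funs a k" using V(1) by (auto simp: W'_def fun_space_def)
      show "(\<lambda>Q\<in>?C. 0) \<in> W'"
        using zeroV f_zero unfolding W'_def
        by (intro CollectI conjI exI[of _ "\<lambda>_. 0"]) (auto simp: herm_def)
      fix f g p q assume "f \<in> W'" "g \<in> W'"
      then obtain c e where fg: "f \<in> V" "f = ?f c" "\<forall>w\<in>X. herm ?T c w = 0"
        "g \<in> V" "g = ?f e" "\<forall>w\<in>X. herm ?T e w = 0" by (auto simp: W'_def)
      have "(\<lambda>Q\<in>?C. p * f Q + q * g Q) \<in> V" using fg(1,4) V(1) by (simp add: fun_space_def)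
      moreover have "(\<lambda>Q\<in>?C. p * f Q + q * g Q) = ?f (\<lambda>xs. p * c xs + q * e xs)"
        unfolding fg(2,5) f_lin ..
      moreover have "\<forall>w\<in>X. herm ?T (\<lambda>xs. p * c xs + q * e xs) w = 0"
        using fg(3,6) by (simp add: herm_linear_left)
      ultimately show "(\<lambda>Q\<in>?C. p * f Q + q * g Q) \<in> W'" unfolding W'_def by blast
    qed
    show "stable_under a k \<Gamma> W'"
      unfolding stable_under_def
    proof (intro ballI)
      fix g :: "complex mat" and f assume g: "g \<in> \<Gamma>" and "f \<in> W'"
      then obtain c where f: "f \<in> V" "f = ?f c" "\<forall>w\<in>X. herm ?T c w = 0" by (auto simp: W'_def)
      have "(\<lambda>Q\<in>?C. f (transpose_mat g * Q)) \<in> V" using V(2) g f(1) by (simp add: stable_under_def)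
      moreover have "(\<lambda>Q\<in>?C. f (transpose_mat g * Q)) = ?f (tensor_act a k d g c)"
        unfolding f(2) f_act[OF g] ..
      moreover have "\<forall>w\<in>X. herm ?T (tensor_act a k d g c) w = 0"
        using f(3) actX \<Gamma>(2)[OF g] tensor_act_adjoint[of g a k d c] \<Gamma>(1) g by auto
      ultimately show "(\<lambda>Q\<in>?C. f (transpose_mat g * Q)) \<in> W'" unfolding W'_def by blast
    qed
    show "W' \<subseteq> V" by (auto simp: W'_def)
    \<comment> \<open>A representing tensor may be nonzero off the positions of degree d; cutting it
      off there makes it eligible for X and changes neither the function nor the form.\<close>
    have trunc: "?f (\<lambda>xs. if xs \<in> ?T then c xs else 0) = ?f c"
      "herm ?T (\<lambda>xs. if xs \<in> ?T then c xs else 0) w = herm ?T c w" for c w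
      by (simp_all add: tensor_fun_def herm_def)
    show "W \<inter> W' = {\<lambda>Q\<in>?C. 0}"
    proof
      show "{\<lambda>Q\<in>?C. 0} \<subseteq> W \<inter> W'"
        using W(1) \<open>fun_space a k W'\<close> by (simp add: fun_space_def)
      show "W \<inter> W' \<subseteq> {\<lambda>Q\<in>?C. 0}"
      proof
        fix f assume "f \<in> W \<inter> W'"
        then obtain c where f: "f \<in> W" "f = ?f c" "\<forall>w\<in>X. herm ?T c w = 0" by (auto simp: W'_def)
        let ?c = "\<lambda>xs. if xs \<in> ?T then c xs else 0"
        have "?c \<in> X" using f(1,2) trunc(1)[of c] by (simp add: X_def)
        hence "herm ?T ?c ?c = 0" using f(3) trunc(2)[of c ?c] by simp
        hence "c xs = 0" if "xs \<in> ?T" for xs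
          using herm_self_eq_0[OF finite_positions, of a k d ?c xs] that by simp
        hence "tensor_fun a k d c = (\<lambda>_. 0)" by (simp add: tensor_fun_def fun_eq_iff)
        thus "f \<in> {\<lambda>Q\<in>?C. 0}" unfolding f(2) by (simp add: restrict_def)
      qed
    qed
    fix f assume f: "f \<in> V"
    then obtain c where c: "\<forall>Q\<in>?C. f Q = tensor_fun a k d c Q" using deg by blast
    have "f \<in> poly_funs a k" using f V(1) by (auto simp: fun_space_def)
    from poly_funs_restrict[OF this] have fc: "f = ?f c" using c by (metis (mono_tags, lifting) restrict_ext)
    obtain w where w: "w \<in> X" "\<forall>v\<in>X. herm ?T (\<lambda>i. c i - w i) v = 0"
      using orthogonal_projection[OF finite_positions X] by blast
    let ?w' = "\<lambda>i. 1 * c i + (-1) * w i"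
    have wW: "?f w \<in> W" using w(1) by (simp add: X_def)
    have "?f ?w' = (\<lambda>Q\<in>?C. 1 * f Q + (-1) * ?f w Q)" unfolding f_lin fc ..
    moreover have "(\<lambda>Q\<in>?C. 1 * f Q + (-1) * ?f w Q) \<in> V"
      using f wW W(3) V(1) unfolding fun_space_def by blast
    ultimately have "?f ?w' \<in> V" by simp
    hence "?f ?w' \<in> W'" using w(2) by (auto simp: W'_def)
    moreover have "f = (\<lambda>Q\<in>?C. ?f w Q + ?f ?w' Q)" unfolding f_lin fc by auto
    ultimately show "\<exists>w\<in>W. \<exists>w'\<in>W'. f = (\<lambda>Q\<in>?C. w Q + w' Q)" using wW by blast
  qed
qed

text \<open>The length of a list of positions is the sum of its column counts, so all terms of
  weight \<open>\<nu>\<close> have the same length.\<close>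

lemma homogeneous_tensor:
  assumes "is_poly a k f" "has_weight a k \<nu> f" "\<And>j. k \<le> j \<Longrightarrow> \<nu> j = 0"
  shows "\<exists>c. \<forall>Q\<in>carrier_mat a k. f Q = tensor_fun a k (\<Sum>j<k. \<nu> j) c Q"
proof -
  let ?d = "\<Sum>j<k. \<nu> j"
  obtain ts where ts: "set ts \<subseteq> terms a k" "\<And>Q. Q \<in> carrier_mat a k \<Longrightarrow> f Q = term_sum ts Q"
    using is_poly_terms[OF assms(1)] by blast
  define us where "us = filter (\<lambda>t. col_count (snd t) = \<nu>) ts"
  have len: "length xs = (\<Sum>j<k. col_count xs j)" if "set xs \<subseteq> {..<a} \<times> {..<k}" for xs
    using that
  proof (induction xs)
    case (Cons x xs)
    have "(\<Sum>j<k. col_count (x # xs) j) = (\<Sum>j<k. (if j = snd x then 1 else 0) + col_count xs j)"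
      by (intro sum.cong) (auto simp: col_count_def)
    thus ?case using Cons by (auto simp: sum.distrib)
  qed (simp add: col_count_def)
  have us: "snd t \<in> positions a k ?d" if "t \<in> set us" for t
    using that ts(1) len[of "snd t"] by (auto simp: us_def positions_def terms_def)
  have "\<exists>c. \<forall>Q. term_sum us Q = tensor_fun a k ?d c Q"
    using us
  proof (induction us)
    case Nil show ?case by (intro exI[of _ "\<lambda>_. 0"]) (simp add: tensor_fun_def)
  next
    case (Cons t us)
    then obtain c where c: "\<forall>Q. term_sum us Q = tensor_fun a k ?d c Q" by auto
    have "tensor_fun a k ?d (\<lambda>xs. (if xs = snd t then fst t else 0) + c xs) Q = term_sum (t # us) Q" for Q
    proof -
      have "tensor_fun a k ?d (\<lambda>xs. (if xs = snd t then fst t else 0) + c xs) Q =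
          (\<Sum>xs\<in>positions a k ?d. (if xs = snd t then fst t * entry_prod (snd t) Q else 0) + c xs * entry_prod xs Q)"
        unfolding tensor_fun_def by (intro sum.cong) (auto simp: algebra_simps)
      thus ?thesis using Cons.prems c finite_positions by (simp add: sum.distrib tensor_fun_def)
    qed
    thus ?case by metis
  qed
  then obtain c where "\<forall>Q. term_sum us Q = tensor_fun a k ?d c Q" ..
  thus ?thesis using term_sum_weight[OF ts assms(2,3)] by (intro exI[of _ c]) (simp add: us_def)
qed

section \<open>Algebras of polynomial functions\<close>

lemma complex_ring_cring: "cring complex_ring"
proof (rule cringI)
  show "abelian_group complex_ring"
  proof (rule abelian_groupI)
    fix x :: complex show "\<exists>y\<in>carrier complex_ring. y \<oplus>\<^bsub>complex_ring\<^esub> x = \<zero>\<^bsub>complex_ring\<^esub>"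
      by (rule bexI[of _ "- x"]) (simp_all add: complex_ring_def)
  qed (simp_all add: complex_ring_def)
  show "Group.comm_monoid complex_ring"
    by (rule comm_monoidI) (simp_all add: complex_ring_def)
qed (simp add: complex_ring_def algebra_simps)

lemma mat_poly_alg_simps [simp]:
  "f \<oplus>\<^bsub>mat_poly_alg a k\<^esub> g = (\<lambda>Q\<in>carrier_mat a k. f Q + g Q)"
  "f \<otimes>\<^bsub>mat_poly_alg a k\<^esub> g = (\<lambda>Q\<in>carrier_mat a k. f Q * g Q)"
  "\<one>\<^bsub>mat_poly_alg a k\<^esub> = (\<lambda>Q\<in>carrier_mat a k. 1)"
  "\<zero>\<^bsub>mat_poly_alg a k\<^esub> = (\<lambda>Q\<in>carrier_mat a k. 0)"
  "c \<odot>\<^bsub>mat_poly_alg a k\<^esub> f = (\<lambda>Q\<in>carrier_mat a k. c * f Q)"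
  by (simp_all add: mat_poly_alg_def)

lemma poly_subalgebra:
  assumes V: "V \<subseteq> poly_funs a k" and c: "\<And>c. (\<lambda>Q\<in>carrier_mat a k. c) \<in> V"
    and add: "\<And>f g. f \<in> V \<Longrightarrow> g \<in> V \<Longrightarrow> (\<lambda>Q\<in>carrier_mat a k. f Q + g Q) \<in> V"
    and mult: "\<And>f g. f \<in> V \<Longrightarrow> g \<in> V \<Longrightarrow> (\<lambda>Q\<in>carrier_mat a k. f Q * g Q) \<in> V"
  shows "algebra complex_ring ((mat_poly_alg a k)\<lparr>carrier := V\<rparr>)"
proof -
  let ?C = "carrier_mat a k"
  have smult: "(\<lambda>Q\<in>?C. d * f Q) \<in> V" if "f \<in> V" for d f
  proof -
    have "(\<lambda>Q\<in>?C. (\<lambda>Q\<in>?C. d) Q * f Q) \<in> V" by (rule mult[OF c that])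
    thus ?thesis by (simp cong: restrict_cong)
  qed
  have res: "(\<lambda>Q\<in>?C. f Q) = f" if "f \<in> V" for f using poly_funs_restrict that V by blast
  have ab: "abelian_group ((mat_poly_alg a k)\<lparr>carrier := V\<rparr>)"
  proof (rule abelian_groupI)
    fix f assume f: "f \<in> carrier ((mat_poly_alg a k)\<lparr>carrier := V\<rparr>)"
    show "\<exists>g\<in>carrier ((mat_poly_alg a k)\<lparr>carrier := V\<rparr>).
        g \<oplus>\<^bsub>(mat_poly_alg a k)\<lparr>carrier := V\<rparr>\<^esub> f = \<zero>\<^bsub>(mat_poly_alg a k)\<lparr>carrier := V\<rparr>\<^esub>"
      using f smult[of f "-1"] by (intro bexI[of _ "\<lambda>Q\<in>?C. -1 * f Q"]) (auto cong: restrict_cong)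
  qed (use add c res in \<open>auto simp: add.assoc add.commute cong: restrict_cong\<close>)
  have cm: "Group.comm_monoid ((mat_poly_alg a k)\<lparr>carrier := V\<rparr>)"
    by (rule comm_monoidI)
      (use mult c res in \<open>auto simp: mult.assoc mult.commute cong: restrict_cong\<close>)
  show ?thesis
  proof (rule algebraI[OF complex_ring_cring])
    show "cring ((mat_poly_alg a k)\<lparr>carrier := V\<rparr>)"
      by (rule cringI[OF ab cm]) (auto simp: distrib_right cong: restrict_cong)
  qed (use smult res in \<open>auto simp: complex_ring_def algebra_simps cong: restrict_cong\<close>)
qed

lemma unitri_GL: "unitri r \<subseteq> carrier (GL r)"
proof
  fix u assume u: "u \<in> unitri r"
  have "det u = prod_list (diag_mat u)"
    using u by (intro det_upper_triangular[of _ r]) (auto simp: unitri_def)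
  also have "\<dots> = 1" using unitri_carrier[OF u] unitri_index(1)[OF u] by (simp add: diag_mat_def prod_list_upt)
  finally have "u \<in> Units (ring_mat TYPE(complex) r ())"
    using unitri_carrier[OF u] by (intro det_non_zero_imp_unit) auto
  thus "u \<in> carrier (GL r)" by (simp add: GL_def units_of_def)
qed

lemma one_in_GL: "1\<^sub>m r \<in> carrier (GL r)"
  using unitri_GL one_in_unitri by blast

lemma fun_act_restrict:
  assumes "g1 \<in> carrier (GL a)" "g2 \<in> carrier (GL k)"
  shows "fun_act a k g1 g2 f = (\<lambda>Q\<in>carrier_mat a k. f (transpose_mat g1 * Q * g2))"
proof
  fix Q show "fun_act a k g1 g2 f Q = (\<lambda>Q\<in>carrier_mat a k. f (transpose_mat g1 * Q * g2)) Q"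
    using fun_act_eq[OF assms, of Q f] by (cases "Q \<in> carrier_mat a k") (auto simp: fun_act_def)
qed

lemma fun_act_eq_iff:
  assumes "g1 \<in> carrier (GL a)" "g2 \<in> carrier (GL k)" "f \<in> poly_funs a k"
  shows "fun_act a k g1 g2 f = f \<longleftrightarrow> (\<forall>Q\<in>carrier_mat a k. f (transpose_mat g1 * Q * g2) = f Q)"
proof -
  have "f = (\<lambda>Q\<in>carrier_mat a k. f Q)" using poly_funs_restrict[OF assms(3)] by simp
  thus ?thesis unfolding fun_act_restrict[OF assms(1,2)]
    by (metis (no_types, lifting) restrict_apply' restrict_ext)
qed

text \<open>Taking one of the two unitriangular matrices to be the identity separates the joint
  invariance into left and right invariance.\<close>

lemma branching_GL_carrier:
  assumes "b \<le> a"
  shows "carrier (branching_GL a k b) = {f \<in> poly_funs a k. left_inv b a k f \<and> right_inv a k f}"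
proof -
  have "(\<forall>u1\<in>unitri b. \<forall>u2\<in>unitri k. fun_act a k (GL_embed b a u1) u2 f = f) \<longleftrightarrow>
      left_inv b a k f \<and> right_inv a k f" (is "?L \<longleftrightarrow> ?R") if f: "f \<in> poly_funs a k" for f
  proof -
    have act: "fun_act a k (GL_embed b a u1) u2 f = f \<longleftrightarrow>
        (\<forall>Q\<in>carrier_mat a k. f (transpose_mat (GL_embed b a u1) * Q * u2) = f Q)"
      if "u1 \<in> unitri b" "u2 \<in> unitri k" for u1 u2
      using that f unitri_GL GL_embed_unitri[OF _ assms] by (intro fun_act_eq_iff) blast+
    show ?thesis
    proof
      assume L: ?L
      show ?R unfolding left_inv_def right_inv_def
      proof (intro conjI ballI)
        fix u Q :: "complex mat" assume u: "u \<in> unitri b" and Q: "Q \<in> carrier_mat a k"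
        have "transpose_mat (GL_embed b a u) * Q \<in> carrier_mat a k"
          using Q GL_embed_carrier[OF unitri_carrier[OF u] assms] by auto
        thus "f (transpose_mat (GL_embed b a u) * Q) = f Q"
          using L act[OF u one_in_unitri] u one_in_unitri Q by (metis right_mult_one_mat)
      next
        fix u Q :: "complex mat" assume u: "u \<in> unitri k" and Q: "Q \<in> carrier_mat a k"
        have "GL_embed b a (1\<^sub>m b) = 1\<^sub>m a"
          using assms by (intro eq_matI) (auto simp: GL_embed_index, auto simp: GL_embed_def)
        hence "transpose_mat (GL_embed b a (1\<^sub>m b)) * Q = Q" using Q by simp
        thus "f (Q * u) = f Q"
          using L act[OF one_in_unitri u] u one_in_unitri Q by metis
      qed
    next
      assume R: ?R
      show ?L
      proof (intro ballI)
        fix u1 u2 :: "complex mat" assume u: "u1 \<in> unitri b" "u2 \<in> unitri k"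
        show "fun_act a k (GL_embed b a u1) u2 f = f" unfolding act[OF u]
        proof
          fix Q :: "complex mat" assume Q: "Q \<in> carrier_mat a k"
          have "transpose_mat (GL_embed b a u1) * Q \<in> carrier_mat a k"
            using Q GL_embed_carrier[OF unitri_carrier[OF u(1)] assms] by auto
          thus "f (transpose_mat (GL_embed b a u1) * Q * u2) = f Q"
            using R u Q by (simp add: left_inv_def right_inv_def)
        qed
      qed
    qed
  qed
  thus ?thesis by (auto simp: branching_GL_def mat_poly_alg_def)
qed

lemma U_invariants_carrier:
  "carrier (U_invariants m) = {f \<in> poly_funs (2 * m) m. right_inv (2 * m) m f}"
proof -
  have "(\<forall>u\<in>unitri m. fun_act (2 * m) m (1\<^sub>m (2 * m)) u f = f) \<longleftrightarrow> right_inv (2 * m) m f"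
    if f: "f \<in> poly_funs (2 * m) m" for f
  proof -
    have "fun_act (2 * m) m (1\<^sub>m (2 * m)) u f = f \<longleftrightarrow> (\<forall>Q\<in>carrier_mat (2 * m) m. f (Q * u) = f Q)"
      if "u \<in> unitri m" for u
    proof -
      have "u \<in> carrier (GL m)" using that unitri_GL by blast
      thus ?thesis using fun_act_eq_iff[OF one_in_GL _ f, of u] by simp
    qed
    thus ?thesis by (simp add: right_inv_def)
  qed
  thus ?thesis by (auto simp: U_invariants_def mat_poly_alg_def)
qed

lemma U_invariants_eq: "U_invariants m = (mat_poly_alg (2 * m) m)\<lparr>carrier := carrier (U_invariants m)\<rparr>"
  by (simp add: U_invariants_def)

lemma U_invariants_simps [simp]:
  "f \<oplus>\<^bsub>U_invariants m\<^esub> g = (\<lambda>Q\<in>carrier_mat (2 * m) m. f Q + g Q)"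
  "f \<otimes>\<^bsub>U_invariants m\<^esub> g = (\<lambda>Q\<in>carrier_mat (2 * m) m. f Q * g Q)"
  "\<one>\<^bsub>U_invariants m\<^esub> = (\<lambda>Q\<in>carrier_mat (2 * m) m. 1)"
  "\<zero>\<^bsub>U_invariants m\<^esub> = (\<lambda>Q\<in>carrier_mat (2 * m) m. 0)"
  "c \<odot>\<^bsub>U_invariants m\<^esub> f = (\<lambda>Q\<in>carrier_mat (2 * m) m. c * f Q)"
  by (simp_all add: U_invariants_def mat_poly_alg_def)

lemma right_inv_restrict:
  assumes "right_inv a k f" shows "right_inv a k (\<lambda>Q\<in>carrier_mat a k. f Q)"
  unfolding right_inv_def
proof (intro ballI)
  fix u Q :: "complex mat" assume u: "u \<in> unitri k" and Q: "Q \<in> carrier_mat a k"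
  have "Q * u \<in> carrier_mat a k" using Q unitri_carrier[OF u] by simp
  thus "(\<lambda>Q\<in>carrier_mat a k. f Q) (Q * u) = (\<lambda>Q\<in>carrier_mat a k. f Q) Q"
    using assms u Q by (simp add: right_inv_def)
qed

lemma left_inv_restrict:
  assumes "left_inv b a k f" "b \<le> a" shows "left_inv b a k (\<lambda>Q\<in>carrier_mat a k. f Q)"
  unfolding left_inv_def
proof (intro ballI)
  fix u Q :: "complex mat" assume u: "u \<in> unitri b" and Q: "Q \<in> carrier_mat a k"
  have "transpose_mat (GL_embed b a u) * Q \<in> carrier_mat a k"
    using Q GL_embed_carrier[OF unitri_carrier[OF u] assms(2)] by auto
  thus "(\<lambda>Q\<in>carrier_mat a k. f Q) (transpose_mat (GL_embed b a u) * Q) = (\<lambda>Q\<in>carrier_mat a k. f Q) Q"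
    using assms u Q by (simp add: left_inv_def)
qed

lemma restrict_poly_funs: "is_poly a k f \<Longrightarrow> (\<lambda>Q\<in>carrier_mat a k. f Q) \<in> poly_funs a k"
  by (simp add: is_poly_def)

lemma U_invariantsI:
  assumes "is_poly (2 * m) m f" "right_inv (2 * m) m f"
  shows "(\<lambda>Q\<in>carrier_mat (2 * m) m. f Q) \<in> carrier (U_invariants m)"
  using assms by (simp add: U_invariants_carrier restrict_poly_funs right_inv_restrict)

lemma U_invariantsD:
  assumes "f \<in> carrier (U_invariants m)"
  shows "is_poly (2 * m) m f" "right_inv (2 * m) m f" "(\<lambda>Q\<in>carrier_mat (2 * m) m. f Q) = f"
  using assms by (auto simp: U_invariants_carrier poly_funs_is_poly poly_funs_restrict)

lemma U_invariants_algebra: "algebra complex_ring (U_invariants m)"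
proof (subst U_invariants_eq, rule poly_subalgebra)
  show "carrier (U_invariants m) \<subseteq> poly_funs (2 * m) m" by (auto simp: U_invariants_carrier)
  show "(\<lambda>Q\<in>carrier_mat (2 * m) m. c) \<in> carrier (U_invariants m)" for c
    by (intro U_invariantsI is_poly_const) (simp add: right_inv_def)
  fix f g assume fg: "f \<in> carrier (U_invariants m)" "g \<in> carrier (U_invariants m)"
  note d = U_invariantsD[OF fg(1)] U_invariantsD[OF fg(2)]
  show "(\<lambda>Q\<in>carrier_mat (2 * m) m. f Q + g Q) \<in> carrier (U_invariants m)"
    using d by (intro U_invariantsI is_poly_add) (simp_all add: right_inv_def)
  show "(\<lambda>Q\<in>carrier_mat (2 * m) m. f Q * g Q) \<in> carrier (U_invariants m)"
    using d by (intro U_invariantsI is_poly_mult) (simp_all add: right_inv_def)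
qed

lemma diagonal_GL:
  assumes "\<And>j. t j \<noteq> (0 :: complex)"
  shows "mat k k (\<lambda>(i, j). if i = j then t j else 0) \<in> carrier (GL k)"
proof -
  let ?D = "mat k k (\<lambda>(i, j). if i = j then t j else 0)"
  have "det ?D = prod_list (diag_mat ?D)"
    by (intro det_upper_triangular[of _ k]) auto
  also have "\<dots> = (\<Prod>j<k. t j)" by (simp add: diag_mat_def prod_list_upt)
  finally have "det ?D \<noteq> 0" using assms by simp
  hence "?D \<in> Units (ring_mat TYPE(complex) k ())"
    by (intro det_non_zero_imp_unit) auto
  thus ?thesis by (simp add: GL_def units_of_def)
qed

lemma rho_iff:
  "f \<in> rho m F \<longleftrightarrow> f \<in> carrier (U_invariants m) \<and> has_weight (2 * m) m F f"
proof -
  let ?C = "carrier_mat (2 * m) m"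
  have act: "fun_act (2 * m) m (1\<^sub>m (2 * m)) t f = torus_char m F t \<odot>\<^bsub>U_invariants m\<^esub> f \<longleftrightarrow>
      (\<forall>Q\<in>?C. f (Q * t) = torus_char m F t * f Q)" if "t \<in> carrier (GL m)" for t
    unfolding fun_act_restrict[OF one_in_GL that] U_invariants_simps
    by (auto simp: fun_eq_iff restrict_def)
  have tc: "torus_char m F (mat m m (\<lambda>(i, j). if i = j then t j else 0)) = mpow m t F" for t
    by (simp add: torus_char_def mpow_def)
  have "(\<forall>t\<in>carrier (GL m). diagonal_mat t \<longrightarrow>
      fun_act (2 * m) m (1\<^sub>m (2 * m)) t f = torus_char m F t \<odot>\<^bsub>U_invariants m\<^esub> f) \<longleftrightarrow>
      has_weight (2 * m) m F f" (is "?L \<longleftrightarrow> ?R")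
  proof
    assume L: ?L
    show ?R unfolding has_weight_def
    proof (intro allI impI ballI)
      fix t :: "nat \<Rightarrow> complex" and Q :: "complex mat"
      assume t: "\<forall>j. t j \<noteq> 0" and Q: "Q \<in> ?C"
      let ?D = "mat m m (\<lambda>(i, j). if i = j then t j else 0)"
      have D: "?D \<in> carrier (GL m)" using t by (intro diagonal_GL) auto
      have "diagonal_mat ?D" by (simp add: diagonal_mat_def)
      hence "f (Q * ?D) = torus_char m F ?D * f Q" using L act[OF D] D Q by blast
      thus "f (col_scale t Q) = mpow m t F * f Q" unfolding col_scale_eq_mult[OF Q] tc .
    qed
  next
    assume R: ?R
    show ?L
    proof (intro ballI impI)
      fix t assume t: "t \<in> carrier (GL m)" "diagonal_mat t"
      \<comment> \<open>The default 1 makes s nonzero everywhere, as \<open>has_weight\<close>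
        demands; within range, s is nonzero because t is invertible.\<close>
      define s where "s j = (if j < m then t $$ (j, j) else 1)" for j
      have tm: "t \<in> carrier_mat m m" "\<exists>h\<in>carrier_mat m m. t * h = 1\<^sub>m m" using t(1) GL_iff by blast+
      have ts: "t = mat m m (\<lambda>(i, j). if i = j then s j else 0)"
        using tm(1) t(2) by (intro eq_matI) (auto simp: s_def diagonal_mat_def)
      have s: "s j \<noteq> 0" for j
      proof (cases "j < m")
        case True
        obtain h where h: "h \<in> carrier_mat m m" "t * h = 1\<^sub>m m" using tm(2) by blast
        have "1 = (t * h) $$ (j, j)" using True h(2) by simp
        also have "\<dots> = (\<Sum>l<m. t $$ (j, l) * h $$ (l, j))" by (rule mult_index_sum[OF tm(1) h(1) True True])
        also have "\<dots> = (\<Sum>l<m. if l = j then t $$ (j, j) * h $$ (j, j) else 0)"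
          using t(2) tm(1) True by (intro sum.cong) (auto simp: diagonal_mat_def)
        also have "\<dots> = t $$ (j, j) * h $$ (j, j)" using True by simp
        finally show ?thesis using True by (auto simp: s_def)
      qed (simp add: s_def)
      have "f (Q * t) = torus_char m F t * f Q" if "Q \<in> ?C" for Q
        using has_weightD[OF R, of s Q] s that tc[of s] ts col_scale_eq_mult[OF that, of s] by simp
      thus "fun_act (2 * m) m (1\<^sub>m (2 * m)) t f = torus_char m F t \<odot>\<^bsub>U_invariants m\<^esub> f"
        unfolding act[OF t(1)] by blast
    qed
  qed
  thus ?thesis by (simp add: rho_def)
qed

section \<open>The symplectic group\<close>

lemma skew_form_carrier [simp]: "skew_form m \<in> carrier_mat (2 * m) (2 * m)"
  unfolding skew_form_def Let_def mult_2 by (intro four_block_carrier_mat) auto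

lemma skew_form_dim [simp]: "dim_row (skew_form m) = 2 * m" "dim_col (skew_form m) = 2 * m"
  using skew_form_carrier[of m] by blast+

lemma skew_form_index:
  assumes "i < 2 * m" "j < 2 * m"
  shows "skew_form m $$ (i, j) = (if i + j + 1 = 2 * m then if i < m then 1 else -1 else 0)"
  using assms by (auto simp: skew_form_def Let_def)

lemma skew_form_square: "skew_form m * skew_form m = - 1\<^sub>m (2 * m)"
proof (rule eq_matI)
  fix i j assume "i < dim_row (- 1\<^sub>m (2 * m) :: complex mat)" "j < dim_col (- 1\<^sub>m (2 * m) :: complex mat)"
  hence ij: "i < 2 * m" "j < 2 * m" by auto
  have "(skew_form m * skew_form m) $$ (i, j) = (\<Sum>l<2 * m. skew_form m $$ (i, l) * skew_form m $$ (l, j))"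
    by (rule mult_index_sum[OF skew_form_carrier skew_form_carrier ij])
  also have "\<dots> = (\<Sum>l<2 * m. if l = 2 * m - 1 - i then (if i = j then -1 else 0) else 0)"
    using ij by (intro sum.cong) (auto simp: skew_form_index)
  also have "\<dots> = (- 1\<^sub>m (2 * m)) $$ (i, j)" using ij by auto
  finally show "(skew_form m * skew_form m) $$ (i, j) = (- 1\<^sub>m (2 * m)) $$ (i, j)" .
qed (use skew_form_carrier[of m] in auto)

text \<open>The form squares to -1, so multiplying the defining equation by it on the left exhibits
  the inverse.\<close>

lemma Sp_inverse:
  assumes g: "g \<in> carrier_mat (2 * m) (2 * m)" and eq: "transpose_mat g * skew_form m * g = skew_form m"
  defines "h \<equiv> - (skew_form m * transpose_mat g * skew_form m)"
  shows "h \<in> carrier_mat (2 * m) (2 * m)" "h * g = 1\<^sub>m (2 * m)" "g * h = 1\<^sub>m (2 * m)"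
proof -
  let ?n = "2 * m"
  note S = skew_form_carrier[of m]
  have gt: "transpose_mat g \<in> carrier_mat ?n ?n" using g by simp
  show h: "h \<in> carrier_mat ?n ?n"
    unfolding h_def by (intro uminus_carrier_iff_mat[THEN iffD2] mult_carrier_mat[of _ ?n ?n] S gt)
  have "skew_form m * transpose_mat g * skew_form m * g = skew_form m * (transpose_mat g * skew_form m * g)"
    using S gt g by (simp add: assoc_mult_mat[of _ ?n ?n _ ?n _ ?n] mult_carrier_mat[of _ ?n ?n _ ?n])
  also have "\<dots> = - 1\<^sub>m ?n" by (simp add: eq skew_form_square)
  finally have "- (skew_form m * transpose_mat g * skew_form m * g) = 1\<^sub>m ?n" by simp
  moreover have "h * g = - (skew_form m * transpose_mat g * skew_form m * g)"
    unfolding h_def using g by (intro uminus_mult_left_mat) simp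
  ultimately show "h * g = 1\<^sub>m ?n" by simp
  thus "g * h = 1\<^sub>m ?n" by (rule mat_mult_left_right_inverse[OF h g])
qed

lemma Sp_iff:
  "g \<in> Sp m \<longleftrightarrow> g \<in> carrier_mat (2 * m) (2 * m) \<and> transpose_mat g * skew_form m * g = skew_form m"
  unfolding Sp_def GL_iff using Sp_inverse by blast

lemma Sp_carrier: "g \<in> Sp m \<Longrightarrow> g \<in> carrier_mat (2 * m) (2 * m)"
  by (simp add: Sp_iff)

lemma Sp_mult:
  assumes "g \<in> Sp m" "h \<in> Sp m" shows "g * h \<in> Sp m"
proof -
  let ?n = "2 * m"
  note S = skew_form_carrier[of m]
  note gh = Sp_carrier[OF assms(1)] Sp_carrier[OF assms(2)]
  have "transpose_mat (g * h) * skew_form m * (g * h) =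
      transpose_mat h * (transpose_mat g * skew_form m * g) * h"
    using gh S by (simp add: transpose_mult[of _ ?n ?n _ ?n] assoc_mult_mat[of _ ?n ?n _ ?n _ ?n]
        mult_carrier_mat[of _ ?n ?n _ ?n])
  thus ?thesis using assms gh by (simp add: Sp_iff)
qed

text \<open>The relation g h = 1 for the explicit inverse h, multiplied by the form on the right, is
  the defining equation of the transpose.\<close>

lemma Sp_transpose:
  assumes g: "g \<in> Sp m" shows "transpose_mat g \<in> Sp m"
proof -
  let ?n = "2 * m"
  note S = skew_form_carrier[of m]
  note gc = Sp_carrier[OF g]
  have gt: "transpose_mat g \<in> carrier_mat ?n ?n" using gc by simp
  let ?h = "skew_form m * transpose_mat g * skew_form m"
  have h: "?h \<in> carrier_mat ?n ?n" by (intro mult_carrier_mat[of _ ?n ?n] S gt)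
  have "g * (- ?h) = 1\<^sub>m ?n" using Sp_inverse(3)[OF gc] g by (simp add: Sp_iff)
  moreover have "g * (- ?h) = - (g * ?h)" using gc h by (intro uminus_mult_right_mat) simp
  ultimately have "- (g * ?h) = 1\<^sub>m ?n" by simp
  hence "g * ?h = - 1\<^sub>m ?n" by (metis uminus_uminus_mat)
  hence "g * ?h * skew_form m = - 1\<^sub>m ?n * skew_form m" by simp
  moreover have "g * ?h * skew_form m = g * skew_form m * transpose_mat g * (skew_form m * skew_form m)"
    using S gc gt by (simp add: assoc_mult_mat[of _ ?n ?n _ ?n _ ?n] mult_carrier_mat[of _ ?n ?n _ ?n])
  moreover have "- 1\<^sub>m ?n * skew_form m = - skew_form m"
    using left_mult_one_mat[OF S] by (subst uminus_mult_left_mat) simp_all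
  moreover have "g * skew_form m * transpose_mat g * (- 1\<^sub>m ?n) = - (g * skew_form m * transpose_mat g)"
    using right_mult_one_mat[of "g * skew_form m * transpose_mat g" ?n ?n] S gc gt
    by (subst uminus_mult_right_mat) (simp_all add: mult_carrier_mat[of _ ?n ?n _ ?n])
  ultimately have "- (g * skew_form m * transpose_mat g) = - skew_form m"
    unfolding skew_form_square by metis
  hence "g * skew_form m * transpose_mat g = skew_form m" by (metis uminus_uminus_mat)
  thus ?thesis using gt by (simp add: Sp_iff)
qed

text \<open>The form has real entries, so entrywise conjugation preserves the group as well. This is
  the closure property that yields invariant complements.\<close>

lemma Sp_conj_transpose:
  assumes g: "g \<in> Sp m" shows "conj_transpose g \<in> Sp m"
proof -
  let ?n = "2 * m"
  interpret cnj: comm_ring_hom "cnj" by unfold_locales auto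
  let ?t = "transpose_mat g"
  have t: "?t \<in> Sp m" by (rule Sp_transpose[OF g])
  note tc = Sp_carrier[OF t] and S = skew_form_carrier[of m]
  have Sc: "map_mat cnj (skew_form m) = skew_form m"
    by (intro eq_matI) (use S in \<open>auto simp: skew_form_index\<close>)
  have "transpose_mat (map_mat cnj ?t) * skew_form m * map_mat cnj ?t =
      map_mat cnj (transpose_mat ?t * skew_form m * ?t)"
    using tc S Sc by (simp add: cnj.mat_hom_mult[of _ ?n ?n _ ?n] mult_carrier_mat[of _ ?n ?n _ ?n] map_mat_transpose)
  also have "\<dots> = skew_form m" using t Sc by (simp add: Sp_iff)
  finally show ?thesis using tc by (simp add: Sp_iff conj_transpose_def)
qed

lemma one_in_Sp: "1\<^sub>m (2 * m) \<in> Sp m"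
  using left_mult_one_mat[OF skew_form_carrier] right_mult_one_mat[OF skew_form_carrier]
  by (simp add: Sp_iff)

lemma Sp_act_eq:
  assumes "g \<in> Sp m"
  shows "Sp_act m g f = (\<lambda>Q\<in>carrier_mat (2 * m) m. f (transpose_mat g * Q))"
proof -
  have "g \<in> carrier (GL (2 * m))" using assms by (simp add: Sp_def)
  hence "Sp_act m g f = (\<lambda>Q\<in>carrier_mat (2 * m) m. f (transpose_mat g * Q * 1\<^sub>m m))"
    unfolding Sp_act_def by (rule fun_act_restrict[OF _ one_in_GL])
  also have "\<dots> = (\<lambda>Q\<in>carrier_mat (2 * m) m. f (transpose_mat g * Q))"
  proof (rule restrict_ext)
    fix Q :: "complex mat" assume "Q \<in> carrier_mat (2 * m) m"
    hence "transpose_mat g * Q \<in> carrier_mat (2 * m) m" using Sp_carrier[OF assms] by auto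
    hence "transpose_mat g * Q * 1\<^sub>m m = transpose_mat g * Q" by (rule right_mult_one_mat)
    thus "f (transpose_mat g * Q * 1\<^sub>m m) = f (transpose_mat g * Q)" by (rule arg_cong)
  qed
  finally show ?thesis .
qed

lemma submodule_iff:
  "submodule W complex_ring (U_invariants m) \<longleftrightarrow>
    W \<subseteq> carrier (U_invariants m) \<and> fun_space (2 * m) m W" (is "?L \<longleftrightarrow> ?R")
proof -
  interpret A: algebra complex_ring "U_invariants m" by (rule U_invariants_algebra)
  show ?thesis
  proof
    assume ?L
    then interpret submodule W complex_ring "U_invariants m" .
    have sub: "W \<subseteq> carrier (U_invariants m)" using subset by simp
    have add: "f \<oplus>\<^bsub>U_invariants m\<^esub> g \<in> W" if "f \<in> W" "g \<in> W" for f g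
      using m_closed[OF that] by simp
    have "(\<lambda>Q\<in>carrier_mat (2 * m) m. c * f Q + d * g Q) \<in> W" if "f \<in> W" "g \<in> W" for f g c d
    proof -
      have "c \<odot>\<^bsub>U_invariants m\<^esub> f \<in> W" "d \<odot>\<^bsub>U_invariants m\<^esub> g \<in> W"
        using that by (intro smult_closed; simp add: complex_ring_def)+
      hence "(c \<odot>\<^bsub>U_invariants m\<^esub> f) \<oplus>\<^bsub>U_invariants m\<^esub> (d \<odot>\<^bsub>U_invariants m\<^esub> g) \<in> W"
        by (rule add)
      moreover have "(c \<odot>\<^bsub>U_invariants m\<^esub> f) \<oplus>\<^bsub>U_invariants m\<^esub> (d \<odot>\<^bsub>U_invariants m\<^esub> g) =
          (\<lambda>Q\<in>carrier_mat (2 * m) m. c * f Q + d * g Q)" by auto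
      ultimately show ?thesis by simp
    qed
    thus ?R using sub one_closed by (auto simp: fun_space_def U_invariants_carrier)
  next
    assume R: ?R
    hence lin: "(\<lambda>Q\<in>carrier_mat (2 * m) m. c * f Q + d * g Q) \<in> W" if "f \<in> W" "g \<in> W" for f g c d
      using that by (auto simp: fun_space_def)
    have smul: "c \<odot>\<^bsub>U_invariants m\<^esub> f \<in> W" if "f \<in> W" for c f
      using lin[OF that that, of c 0] by simp
    show ?L
    proof (rule A.submoduleI)
      show "W \<subseteq> carrier (U_invariants m)" using R by simp
      show "\<zero>\<^bsub>U_invariants m\<^esub> \<in> W" using R by (simp add: fun_space_def)
      show "c \<odot>\<^bsub>U_invariants m\<^esub> f \<in> W" if "f \<in> W" for c f by (rule smul[OF that])
      show "f \<oplus>\<^bsub>U_invariants m\<^esub> g \<in> W" if "f \<in> W" "g \<in> W" for f g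
        using lin[OF that, of 1 1] by simp
      fix f assume f: "f \<in> W"
      have fc: "f \<in> carrier (U_invariants m)" using f R by blast
      have "(-1) \<odot>\<^bsub>U_invariants m\<^esub> f \<oplus>\<^bsub>U_invariants m\<^esub> f = \<zero>\<^bsub>U_invariants m\<^esub>"
        by (simp cong: restrict_cong)
      hence "\<ominus>\<^bsub>U_invariants m\<^esub> f = (-1) \<odot>\<^bsub>U_invariants m\<^esub> f"
        using fc smul[OF f, of "-1"] R by (intro A.minus_equality) auto
      thus "\<ominus>\<^bsub>U_invariants m\<^esub> f \<in> W" using smul[OF f, of "-1"] by metis
    qed
  qed
qed

lemma Sp_submodule_iff:
  "Sp_submodule m W \<longleftrightarrow> W \<subseteq> carrier (U_invariants m) \<and> fun_space (2 * m) m W \<and> stable_under (2 * m) m (Sp m) W"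
  by (auto simp: Sp_submodule_def submodule_iff stable_under_def Sp_act_eq)

section \<open>The complement of the irreducible symplectic module\<close>

lemma two_powi_eq_iff: "(2 :: complex) powi a = 2 powi b \<longleftrightarrow> a = b"
proof -
  have *: "c = 0" if c: "(2 :: complex) powi c = 1" "c \<ge> 0" for c :: int
  proof -
    obtain k where k: "c = int k" using c(2) nonneg_int_cases by blast
    have "(2 :: complex) ^ k = 2 ^ 0" using c(1) k by simp
    thus ?thesis using two_power_eq_iff[of k 0] k by simp
  qed
  have "a = b" if eq: "(2 :: complex) powi a = 2 powi b"
  proof (cases "a \<ge> b")
    case True thus ?thesis using *[of "a - b"] eq by (simp add: power_int_diff)
  next
    case False thus ?thesis using *[of "b - a"] eq by (simp add: power_int_diff)
  qed
  thus ?thesis by blast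
qed

text \<open>The analogue of \<open>mpow_independent\<close> for one parameter and exponents of
  either sign, since the torus of the symplectic group acts on half of the rows by negative
  powers.\<close>

lemma powi_independent:
  fixes c :: "int \<Rightarrow> complex"
  assumes "finite S" and zero: "\<And>s. s \<noteq> 0 \<Longrightarrow> (\<Sum>\<kappa>\<in>S. s powi \<kappa> * c \<kappa>) = 0" and \<kappa>: "\<kappa> \<in> S"
  shows "c \<kappa> = 0"
proof -
  define P where "P a \<longleftrightarrow> (\<forall>s. s \<noteq> 0 \<longrightarrow> (\<Sum>\<kappa>\<in>S. a \<kappa> * (s powi \<kappa> * c \<kappa>)) = 0)" for a
  have "\<exists>a' e. P a' \<and> (\<forall>\<gamma>\<in>S. \<gamma> \<noteq> \<kappa> \<longrightarrow> a' \<gamma> = 0) \<and> e \<noteq> 0 \<and> a' \<kappa> = e * 1"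
  proof (rule eigen_separation[where \<chi> = "\<lambda>p \<gamma>. p powi \<gamma>" and D = "{s. s \<noteq> (0::complex)}"])
    show "P (\<lambda>_. 1)" using zero by (simp add: P_def)
  next
    fix a p and d :: complex assume a: "P a" and p: "p \<in> {s. s \<noteq> (0::complex)}"
    show "P (\<lambda>\<gamma>. (p powi \<gamma> - d) * a \<gamma>)"
      unfolding P_def
    proof (intro allI impI)
      fix s :: complex assume s: "s \<noteq> 0"
      have "(\<Sum>\<gamma>\<in>S. a \<gamma> * ((p * s) powi \<gamma> * c \<gamma>)) - d * (\<Sum>\<gamma>\<in>S. a \<gamma> * (s powi \<gamma> * c \<gamma>)) = 0"
        using a p s by (simp add: P_def)
      thus "(\<Sum>\<gamma>\<in>S. (p powi \<gamma> - d) * a \<gamma> * (s powi \<gamma> * c \<gamma>)) = 0"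
        by (simp add: power_int_mult_distrib sum_distrib_left sum_subtractf[symmetric] algebra_simps)
    qed
  next
    fix \<gamma> assume "\<gamma> \<noteq> \<kappa>"
    thus "\<exists>p\<in>{s. s \<noteq> (0::complex)}. p powi \<gamma> \<noteq> p powi \<kappa>"
      by (intro bexI[of _ 2]) (auto simp: two_powi_eq_iff)
  qed fact
  then obtain a' e where a': "P a'" "\<forall>\<gamma>\<in>S. \<gamma> \<noteq> \<kappa> \<longrightarrow> a' \<gamma> = 0" "e \<noteq> 0" "a' \<kappa> = e" by auto
  have "0 = (\<Sum>\<gamma>\<in>S. a' \<gamma> * (1 powi \<gamma> * c \<gamma>))"
    using a'(1) unfolding P_def by (metis zero_neq_one)
  also have "\<dots> = (\<Sum>\<gamma>\<in>S. if \<gamma> = \<kappa> then e * c \<kappa> else 0)"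
    using a' by (intro sum.cong) auto
  finally show ?thesis using assms(1) \<kappa> a' by simp
qed

text \<open>The exponents decrease, so that conjugation by \<open>torus m s\<close> contracts the lower
  unitriangular matrices to the identity as \<open>s\<close> grows.\<close>

definition torus_exp :: "nat \<Rightarrow> nat \<Rightarrow> int" where
  "torus_exp m i = (if i < m then int m - int i else int m - 1 - int i)"

definition diag_of :: "nat \<Rightarrow> (nat \<Rightarrow> complex) \<Rightarrow> complex mat" where
  "diag_of r x = mat r r (\<lambda>(i, j). if i = j then x i else 0)"

abbreviation torus :: "nat \<Rightarrow> complex \<Rightarrow> complex mat" where
  "torus m s \<equiv> diag_of (2 * m) (\<lambda>i. s powi torus_exp m i)"

definition torus_weight :: "nat \<Rightarrow> (nat \<Rightarrow> nat) \<Rightarrow> int" where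
  "torus_weight m F = (\<Sum>i<m. torus_exp m i * int (F i))"

lemma torus_exp_mono: "i < j \<Longrightarrow> torus_exp m j < torus_exp m i"
  by (auto simp: torus_exp_def)

lemma diag_of_transpose: "transpose_mat (diag_of r x) = diag_of r x"
  by (intro eq_matI) (auto simp: diag_of_def)

lemma diag_of_carrier [simp]: "diag_of r x \<in> carrier_mat r r"
  by (simp add: diag_of_def)

lemma diag_of_mult_index:
  assumes "Q \<in> carrier_mat r k" "i < r" "j < k"
  shows "(diag_of r x * Q) $$ (i, j) = x i * Q $$ (i, j)"
proof -
  have "(diag_of r x * Q) $$ (i, j) = (\<Sum>l<r. diag_of r x $$ (i, l) * Q $$ (l, j))"
    by (rule mult_index_sum[OF diag_of_carrier assms])
  also have "\<dots> = (\<Sum>l<r. if l = i then x i * Q $$ (i, j) else 0)"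
    using assms by (intro sum.cong) (auto simp: diag_of_def)
  also have "\<dots> = x i * Q $$ (i, j)" using assms by simp
  finally show ?thesis .
qed

lemma diag_of_Sp:
  assumes "\<And>i. i < 2 * m \<Longrightarrow> x i * x (2 * m - 1 - i) = 1"
  shows "diag_of (2 * m) x \<in> Sp m"
proof -
  let ?D = "diag_of (2 * m) x"
  have "?D * skew_form m * ?D = skew_form m"
  proof (rule eq_matI)
    fix i j assume "i < dim_row (skew_form m)" "j < dim_col (skew_form m)"
    hence ij: "i < 2 * m" "j < 2 * m" by auto
    have DS: "?D * skew_form m \<in> carrier_mat (2 * m) (2 * m)"
      by (rule mult_carrier_mat[OF diag_of_carrier skew_form_carrier])
    have "(?D * skew_form m * ?D) $$ (i, j) = (\<Sum>l<2 * m. (?D * skew_form m) $$ (i, l) * ?D $$ (l, j))"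
      by (rule mult_index_sum[OF DS diag_of_carrier ij])
    also have "\<dots> = (\<Sum>l<2 * m. if l = j then x i * skew_form m $$ (i, j) * x j else 0)"
      using ij by (intro sum.cong refl, subst diag_of_mult_index[of _ "2 * m" "2 * m"])
        (auto simp: diag_of_def)
    also have "\<dots> = x i * skew_form m $$ (i, j) * x j" using ij by simp
    also have "\<dots> = skew_form m $$ (i, j)"
    proof (cases "i + j + 1 = 2 * m")
      case True
      hence "j = 2 * m - 1 - i" by simp
      hence "x i * x j = 1" using assms[OF ij(1)] by simp
      thus ?thesis by (simp add: mult_ac)
    qed (use ij in \<open>simp add: skew_form_index\<close>)
    finally show "(?D * skew_form m * ?D) $$ (i, j) = skew_form m $$ (i, j)" .
  qed (auto simp: diag_of_def)
  thus ?thesis by (simp add: Sp_iff diag_of_transpose)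
qed

lemma torus_Sp:
  assumes "s \<noteq> 0" shows "torus m s \<in> Sp m"
proof (rule diag_of_Sp)
  fix i assume "i < 2 * m"
  hence "torus_exp m i + torus_exp m (2 * m - 1 - i) = 0" by (auto simp: torus_exp_def)
  thus "s powi torus_exp m i * s powi torus_exp m (2 * m - 1 - i) = 1"
    using assms by (simp add: power_int_add[symmetric])
qed

lemma powi_sum_prod: "s \<noteq> (0 :: complex) \<Longrightarrow> (\<Prod>i\<in>I. s powi e i) = s powi (\<Sum>i\<in>I. e i)"
  by (induction I rule: infinite_finite_induct) (auto simp: power_int_add)

lemma powi_power: "((s :: complex) powi e) ^ k = s powi (e * int k)"
  by (metis power_int_mult power_int_of_nat)

lemma mpow_torus:
  "s \<noteq> 0 \<Longrightarrow> mpow m (\<lambda>j. s powi torus_exp m j) F = s powi torus_weight m F"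
  by (simp add: mpow_def torus_weight_def powi_power powi_sum_prod)

section \<open>Limits along the one-parameter torus\<close>

definition row_exp :: "nat \<Rightarrow> (nat \<times> nat) list \<Rightarrow> int" where
  "row_exp m xs = (\<Sum>x\<leftarrow>xs. torus_exp m (fst x))"

lemma entry_prod_torus:
  assumes "set xs \<subseteq> {..<2 * m} \<times> {..<k}" "Q \<in> carrier_mat (2 * m) k" "s \<noteq> 0"
  shows "entry_prod xs (torus m s * Q) = s powi row_exp m xs * entry_prod xs Q"
  using assms(1)
proof (induction xs)
  case (Cons x xs)
  obtain i j where x: "x = (i, j)" by force
  show ?case using Cons x diag_of_mult_index[OF assms(2), of i j] assms(3)
    by (simp add: row_exp_def power_int_add del: index_mult_mat)
qed (simp add: row_exp_def)

text \<open>After elimination Q becomes a lower unitriangular n up to column scaling. Moving the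
  torus past n multiplies entry (i, j) by s to the power e_i - e_j, with e the decreasing sequence
  \<open>torus_exp m\<close>. For i > j this tends to 0 as s grows, so n tends to
  \<open>id_mat\<close>; the column scalings produce \<open>lead_monomial\<close> and the power of
  s.\<close>

lemma generic_torus_curve:
  assumes f: "f \<in> rho m F" and Q: "Q \<in> carrier_mat (2 * m) m" and gen: "generic m Q" and F: "F \<in> young m"
  shows "\<exists>p. poly p 0 = f (id_mat (2 * m) m) \<and>
    (\<forall>s. s \<noteq> 0 \<longrightarrow> f (torus m s * Q) = s powi torus_weight m F * lead_monomial m F Q * poly p (1 / s))"
proof -
  let ?a = "2 * m"
  have fU: "f \<in> carrier (U_invariants m)" and wt: "has_weight ?a m F f" using f by (auto simp: rho_iff)
  note fd = U_invariantsD[OF fU]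
  have "m \<le> ?a" by simp
  from generic_decomposition[OF Q gen this] obtain u d n where
    g: "u \<in> unitri m" "\<And>j. d j \<noteq> 0" "n \<in> lower_unitri ?a m" "Q * u = col_scale d n"
      "\<And>i. i \<le> m \<Longrightarrow> minor [0..<i] Q = (\<Prod>j<i. d j)" by blast
  note nc = lower_unitri_carrier[OF g(3)]
  \<comment> \<open>The contracted entries as polynomials in 1/s. Above the diagonal the integer
    exponent is negative and \<open>nat\<close> gives 0, but there n has entry 0.\<close>
  define q where "q i j = monom (n $$ (i, j)) (nat (torus_exp m j - torus_exp m i))" for i j
  obtain p where p: "\<And>s. f (mat ?a m (\<lambda>(i, j). poly (q i j) s)) = poly p s"
    using is_poly_curve[OF fd(1)] by blast
  have lead: "lead_monomial m F Q = mpow m d F"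
    using F by (intro lead_monomial_generic g(5)) (auto simp: young_def antimono_def)
  have "mat ?a m (\<lambda>(i, j). poly (q i j) 0) = id_mat ?a m"
  proof (rule eq_matI)
    fix i j assume "i < dim_row (id_mat ?a m)" "j < dim_col (id_mat ?a m)"
    hence ij: "i < ?a" "j < m" by (auto simp: id_mat_def)
    consider "i = j" | "i < j" | "j < i" by linarith
    thus "mat ?a m (\<lambda>(i, j). poly (q i j) 0) $$ (i, j) = id_mat ?a m $$ (i, j)"
      using ij g(3) lower_unitri_diag[OF g(3), of j] torus_exp_mono[of j i m]
      by cases (auto simp: q_def poly_monom lower_unitri_def)
  qed (auto simp: id_mat_def)
  hence p0: "poly p 0 = f (id_mat ?a m)" using p[of 0] by simp
  have "f (torus m s * Q) = s powi torus_weight m F * lead_monomial m F Q * poly p (1 / s)" if s: "s \<noteq> 0" for s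
  proof -
    let ?N = "mat ?a m (\<lambda>(i, j). poly (q i j) (1 / s))"
    have TQ: "torus m s * Q \<in> carrier_mat ?a m" using Q by (rule mult_carrier_mat[OF diag_of_carrier])
    have Tn: "torus m s * n \<in> carrier_mat ?a m" using nc by (rule mult_carrier_mat[OF diag_of_carrier])
    have Nc: "?N \<in> carrier_mat ?a m" by simp
    have "torus m s * Q * u = torus m s * (Q * u)"
      using diag_of_carrier Q unitri_carrier[OF g(1)] by (rule assoc_mult_mat)
    also have "\<dots> = col_scale d (torus m s * n)"
      unfolding g(4) by (rule left_mult_col_scale[OF diag_of_carrier nc, symmetric])
    finally have "f (torus m s * Q) = mpow m d F * f (torus m s * n)"
      by (rule eval_generic[OF fd(2) wt TQ g(1,2) Tn])
    also have "torus m s * n = col_scale (\<lambda>j. s powi torus_exp m j) ?N"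
    proof (rule eq_matI)
      fix i j assume "i < dim_row (col_scale (\<lambda>j. s powi torus_exp m j) ?N)"
        "j < dim_col (col_scale (\<lambda>j. s powi torus_exp m j) ?N)"
      hence ij: "i < ?a" "j < m" by (auto simp: col_scale_def)
      have "s powi torus_exp m i * n $$ (i, j) = s powi torus_exp m j * poly (q i j) (1 / s)"
      proof (cases "i < j")
        case True thus ?thesis using g(3) ij by (simp add: q_def lower_unitri_def)
      next
        case False
        hence "torus_exp m i \<le> torus_exp m j"
          using torus_exp_mono[of j i m] by (cases "i = j") auto
        hence "(1 / s) ^ nat (torus_exp m j - torus_exp m i) = (1 / s) powi (torus_exp m j - torus_exp m i)"
          by (simp add: power_int_def)
        also have "\<dots> = s powi torus_exp m i / s powi torus_exp m j"
          using s by (simp add: power_int_one_over power_int_diff)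
        finally show ?thesis using s by (simp add: q_def poly_monom)
      qed
      thus "(torus m s * n) $$ (i, j) = col_scale (\<lambda>j. s powi torus_exp m j) ?N $$ (i, j)"
        unfolding diag_of_mult_index[OF nc ij] using ij by (subst col_scale_index[OF Nc]) auto
    qed (use nc in \<open>auto simp: col_scale_def diag_of_def\<close>)
    also have "f (col_scale (\<lambda>j. s powi torus_exp m j) ?N) = s powi torus_weight m F * f ?N"
      using has_weightD[OF wt, of "\<lambda>j. s powi torus_exp m j" ?N] s Nc mpow_torus[OF s] by simp
    finally show ?thesis by (simp add: p lead)
  qed
  thus ?thesis using p0 by blast
qed

definition highest_vec :: "nat \<Rightarrow> (nat \<Rightarrow> nat) \<Rightarrow> complex mat \<Rightarrow> complex" where
  "highest_vec m F = (\<lambda>Q\<in>carrier_mat (2 * m) m. lead_monomial m F Q)"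

text \<open>Along the curve of \<open>generic_torus_curve\<close> the highest possible power of s is
  \<open>torus_weight m F\<close>, with coefficient p(0) = f(\<open>id_mat\<close>) times
  \<open>lead_monomial\<close>. Comparison with the expansion of f by torus weights identifies this
  component, first on generic matrices.\<close>

lemma torus_component:
  assumes f: "f \<in> rho m F" and F: "F \<in> young m"
    and ts: "set ts \<subseteq> terms (2 * m) m" "\<And>Q. Q \<in> carrier_mat (2 * m) m \<Longrightarrow> f Q = term_sum ts Q"
    and Q: "Q \<in> carrier_mat (2 * m) m"
  shows "term_sum (filter (\<lambda>t. row_exp m (snd t) = torus_weight m F) ts) Q =
    f (id_mat (2 * m) m) * lead_monomial m F Q"
proof -
  let ?a = "2 * m"
  let ?\<kappa> = "torus_weight m F"
  let ?w = "\<lambda>\<kappa>. term_sum (filter (\<lambda>t. row_exp m (snd t) = \<kappa>) ts)"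
  have wts: "set (filter (\<lambda>t. row_exp m (snd t) = \<kappa>) ts) \<subseteq> terms ?a m" for \<kappa> using ts(1) by auto
  have "?w ?\<kappa> Q - f (id_mat ?a m) * lead_monomial m F Q = 0"
  proof (rule generic_zero[OF _ _ _ Q])
    show "is_poly ?a m (\<lambda>Q. ?w ?\<kappa> Q - f (id_mat ?a m) * lead_monomial m F Q)"
      by (intro is_poly_diff is_poly_mult is_poly_const is_poly_term_sum wts is_poly_lead_monomial) simp
    fix R assume R: "R \<in> carrier_mat ?a m" and gen: "generic m R"
    obtain p where p: "poly p 0 = f (id_mat ?a m)"
      "\<And>s. s \<noteq> 0 \<Longrightarrow> f (torus m s * R) = s powi ?\<kappa> * lead_monomial m F R * poly p (1 / s)"
      using generic_torus_curve[OF f R gen F] by blast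
    define K where "K = (\<lambda>t. row_exp m (snd t)) ` set ts"
    \<comment> \<open>The difference of the coefficients of s to the power \<open>\<kappa>\<close>
      in the two expansions: one grouped by row exponents, the other read off from p(1/s).\<close>
    define c where "c \<kappa> = (if \<kappa> \<in> K then ?w \<kappa> R else 0) -
      (if \<kappa> \<in> (\<lambda>i. ?\<kappa> - int i) ` {..degree p} then lead_monomial m F R * coeff p (nat (?\<kappa> - \<kappa>)) else 0)" for \<kappa>
    let ?S = "insert ?\<kappa> (K \<union> (\<lambda>i. ?\<kappa> - int i) ` {..degree p})"
    have "(\<Sum>\<kappa>\<in>?S. s powi \<kappa> * c \<kappa>) = 0" if s: "s \<noteq> 0" for s
    proof -
      have hom: "term_sum us (torus m s * R) = s powi \<kappa> * term_sum us R"
        if "set us \<subseteq> terms ?a m" "\<And>t. t \<in> set us \<Longrightarrow> row_exp m (snd t) = \<kappa>" for us \<kappa>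
        using that
      proof (induction us)
        case (Cons t us)
        have "set (snd t) \<subseteq> {..<?a} \<times> {..<m}" using Cons.prems(1) by (auto simp: terms_def)
        from entry_prod_torus[OF this R s] Cons show ?case by (simp add: algebra_simps)
      qed simp
      have TR: "torus m s * R \<in> carrier_mat ?a m" using R by (rule mult_carrier_mat[OF diag_of_carrier])
      have "(\<Sum>\<kappa>\<in>?S. s powi \<kappa> * (if \<kappa> \<in> K then ?w \<kappa> R else 0)) = (\<Sum>\<kappa>\<in>K. ?w \<kappa> (torus m s * R))"
        using hom[OF wts] by (intro sum.mono_neutral_cong_right) (auto simp: K_def)
      also have "\<dots> = f (torus m s * R)"
        unfolding ts(2)[OF TR] by (rule term_sum_group[symmetric]) (auto simp: K_def)
      also have "\<dots> = (\<Sum>i\<le>degree p. s powi (?\<kappa> - int i) * (lead_monomial m F R * coeff p i))"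
        unfolding p(2)[OF s] poly_altdef sum_distrib_left
        using s by (intro sum.cong) (auto simp: power_int_diff power_one_over field_simps)
      also have "\<dots> = (\<Sum>\<kappa>\<in>(\<lambda>i. ?\<kappa> - int i) ` {..degree p}.
          s powi \<kappa> * (lead_monomial m F R * coeff p (nat (?\<kappa> - \<kappa>))))"
        by (subst sum.reindex) (auto simp: inj_on_def)
      also have "\<dots> = (\<Sum>\<kappa>\<in>?S. s powi \<kappa> * (if \<kappa> \<in> (\<lambda>i. ?\<kappa> - int i) ` {..degree p}
          then lead_monomial m F R * coeff p (nat (?\<kappa> - \<kappa>)) else 0))"
        by (intro sum.mono_neutral_cong_left) (auto simp: K_def)
      finally show ?thesis by (simp only: c_def right_diff_distrib sum_subtractf right_minus_eq)
    qed
    hence "c ?\<kappa> = 0" by (intro powi_independent[of ?S c]) (auto simp: K_def)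
    moreover have "?\<kappa> \<in> (\<lambda>i. ?\<kappa> - int i) ` {..degree p}" by (rule image_eqI[of _ _ 0]) auto
    \<comment> \<open>The weight may fail to occur among the terms; its component is then an empty
      sum, in agreement with the convention in c.\<close>
    moreover have "?w ?\<kappa> R = 0" if "?\<kappa> \<notin> K"
    proof -
      have "filter (\<lambda>t. row_exp m (snd t) = ?\<kappa>) ts = []" using that by (auto simp: K_def filter_empty_conv image_iff)
      thus ?thesis by simp
    qed
    ultimately show "?w ?\<kappa> R - f (id_mat ?a m) * lead_monomial m F R = 0"
      using p(1) by (auto simp: c_def poly_0_coeff_0 split: if_splits)
  qed simp
  thus ?thesis by simp
qed

text \<open>Stability under the torus allows the component of w of weight
  \<open>torus_weight m F\<close> to be isolated inside W. By \<open>torus_component\<close> it is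
  the multiple of \<open>highest_vec\<close> by w(\<open>id_mat\<close>), which is nonzero.\<close>

lemma highest_vec_mem:
  assumes W: "fun_space (2 * m) m W" "stable_under (2 * m) m (Sp m) W" "W \<subseteq> rho m F"
    and F: "F \<in> young m" and w: "w \<in> W" "w (id_mat (2 * m) m) \<noteq> 0"
  shows "highest_vec m F \<in> W"
proof -
  let ?a = "2 * m"
  let ?C = "carrier_mat ?a m"
  let ?\<kappa> = "torus_weight m F"
  have wr: "w \<in> rho m F" using w W by blast
  hence "is_poly ?a m w" by (auto simp: rho_iff dest: U_invariantsD)
  from is_poly_terms[OF this] obtain ts where ts: "set ts \<subseteq> terms ?a m" "\<And>Q. Q \<in> ?C \<Longrightarrow> w Q = term_sum ts Q"
    by blast
  let ?w = "\<lambda>\<kappa>. term_sum (filter (\<lambda>t. row_exp m (snd t) = \<kappa>) ts)"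
  define K where "K = (\<lambda>t. row_exp m (snd t)) ` set ts"
  define P where "P a \<longleftrightarrow> (\<lambda>Q\<in>?C. \<Sum>\<kappa>\<in>K. a \<kappa> * ?w \<kappa> Q) \<in> W" for a
  have finK: "finite K" by (simp add: K_def)
  have "\<exists>a' e. P a' \<and> (\<forall>\<gamma>\<in>K. \<gamma> \<noteq> ?\<kappa> \<longrightarrow> a' \<gamma> = 0) \<and> e \<noteq> 0 \<and> a' ?\<kappa> = e * 1"
  \<comment> \<open>The single element \<open>torus m 2\<close> separates all weights, its
    eigenvalues being distinct powers of 2; hence the one-point index set.\<close>
  proof (rule eigen_separation[where \<chi> = "\<lambda>_ \<kappa>. 2 powi \<kappa>" and D = "UNIV :: unit set"])
    have "(\<lambda>Q\<in>?C. \<Sum>\<kappa>\<in>K. 1 * ?w \<kappa> Q) = w"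
    proof -
      have "(\<lambda>Q\<in>?C. \<Sum>\<kappa>\<in>K. 1 * ?w \<kappa> Q) = (\<lambda>Q\<in>?C. w Q)"
      proof (rule restrict_ext)
        fix Q :: "complex mat" assume "Q \<in> ?C"
        thus "(\<Sum>\<kappa>\<in>K. 1 * ?w \<kappa> Q) = w Q"
          using term_sum_group[of K "row_exp m" ts Q] ts(2) by (simp add: K_def)
      qed
      also have "\<dots> = w" using wr by (auto simp: rho_iff dest: U_invariantsD(3))
      finally show ?thesis .
    qed
    thus "P (\<lambda>_. 1)" using w(1) by (simp add: P_def)
  next
    fix a and p :: unit and c :: complex assume a: "P a"
    let ?g = "\<lambda>Q\<in>?C. \<Sum>\<kappa>\<in>K. a \<kappa> * ?w \<kappa> Q"
    have "torus m 2 \<in> Sp m" by (rule torus_Sp) simp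
    hence "(\<lambda>Q\<in>?C. ?g (torus m 2 * Q)) \<in> W"
      using W(2) a diag_of_transpose[of "2 * m"] unfolding stable_under_def P_def by fastforce
    hence "(\<lambda>Q\<in>?C. 1 * (\<lambda>Q\<in>?C. ?g (torus m 2 * Q)) Q + (- c) * ?g Q) \<in> W"
      using W(1) a unfolding fun_space_def P_def by blast
    moreover have "(\<lambda>Q\<in>?C. 1 * (\<lambda>Q\<in>?C. ?g (torus m 2 * Q)) Q + (- c) * ?g Q) =
        (\<lambda>Q\<in>?C. \<Sum>\<kappa>\<in>K. (2 powi \<kappa> - c) * a \<kappa> * ?w \<kappa> Q)"
    proof (rule restrict_ext)
      fix Q :: "complex mat" assume Q: "Q \<in> ?C"
      have TQ: "torus m 2 * Q \<in> ?C" using Q by (rule mult_carrier_mat[OF diag_of_carrier])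
      have hom: "term_sum us (torus m 2 * Q) = 2 powi \<kappa> * term_sum us Q"
        if "set us \<subseteq> terms ?a m" "\<And>t. t \<in> set us \<Longrightarrow> row_exp m (snd t) = \<kappa>" for us \<kappa>
        using that
      proof (induction us)
        case (Cons t us)
        have "set (snd t) \<subseteq> {..<?a} \<times> {..<m}" using Cons.prems(1) by (auto simp: terms_def)
        from entry_prod_torus[OF this Q, of 2] Cons show ?case by (simp add: algebra_simps)
      qed simp
      have h: "?w \<kappa> (torus m 2 * Q) = 2 powi \<kappa> * ?w \<kappa> Q" for \<kappa>
        using ts(1) by (intro hom) auto
      show "1 * (\<lambda>Q\<in>?C. ?g (torus m 2 * Q)) Q + (- c) * ?g Q =
          (\<Sum>\<kappa>\<in>K. (2 powi \<kappa> - c) * a \<kappa> * ?w \<kappa> Q)"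
        using Q TQ by (simp only: restrict_apply' h)
          (simp add: sum_distrib_left sum_subtractf sum_negf algebra_simps)
    qed
    ultimately show "P (\<lambda>\<gamma>. (2 powi \<gamma> - c) * a \<gamma>)" unfolding P_def by simp
  next
    fix \<gamma> assume "\<gamma> \<noteq> ?\<kappa>"
    thus "\<exists>p\<in>(UNIV :: unit set). (2 :: complex) powi \<gamma> \<noteq> 2 powi ?\<kappa>" by (simp add: two_powi_eq_iff)
  qed fact
  then obtain a' e where a': "P a'" "\<forall>\<gamma>\<in>K. \<gamma> \<noteq> ?\<kappa> \<longrightarrow> a' \<gamma> = 0" "e \<noteq> 0" "a' ?\<kappa> = e" by auto
  have sumK: "(\<Sum>\<kappa>\<in>K. a' \<kappa> * ?w \<kappa> Q) = e * (w (id_mat ?a m) * lead_monomial m F Q)" if Q: "Q \<in> ?C" for Q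
  proof -
    have "(\<Sum>\<kappa>\<in>K. a' \<kappa> * ?w \<kappa> Q) = (\<Sum>\<kappa>\<in>K. if \<kappa> = ?\<kappa> then e * ?w ?\<kappa> Q else 0)"
      using a' by (intro sum.cong) auto
    also have "\<dots> = e * ?w ?\<kappa> Q"
    proof (cases "?\<kappa> \<in> K")
      case False
      hence "filter (\<lambda>t. row_exp m (snd t) = ?\<kappa>) ts = []" by (auto simp: K_def filter_empty_conv image_iff)
      thus ?thesis using False finK by simp
    qed (use finK in simp)
    finally show ?thesis using torus_component[OF wr F ts Q] by simp
  qed
  let ?g = "\<lambda>Q\<in>?C. \<Sum>\<kappa>\<in>K. a' \<kappa> * ?w \<kappa> Q"
  have "?g \<in> W" using a'(1) by (simp add: P_def)
  \<comment> \<open>Normalisation: the component found is e times w(\<open>id_mat\<close>) times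
    \<open>highest_vec\<close>.\<close>
  hence "(\<lambda>Q\<in>?C. (1 / (e * w (id_mat ?a m))) * ?g Q + 0 * ?g Q) \<in> W"
    using W(1) unfolding fun_space_def by blast
  moreover have "(\<lambda>Q\<in>?C. (1 / (e * w (id_mat ?a m))) * ?g Q + 0 * ?g Q) = highest_vec m F"
    unfolding highest_vec_def using a'(3) w(2) by (intro restrict_ext) (simp add: sumK)
  ultimately show ?thesis by simp
qed

text \<open>For a weight vector the powers of s cancel on the curve of
  \<open>generic_torus_curve\<close>, so p(1/s) times \<open>lead_monomial\<close> does not depend
  on s and equals its limit at p(0).\<close>

lemma weight_vector_unique:
  assumes f: "f \<in> rho m F" and F: "F \<in> young m"
    and wt: "\<And>s Q. s \<noteq> 0 \<Longrightarrow> Q \<in> carrier_mat (2 * m) m \<Longrightarrow> f (torus m s * Q) = s powi torus_weight m F * f Q"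
    and Q: "Q \<in> carrier_mat (2 * m) m"
  shows "f Q = f (id_mat (2 * m) m) * lead_monomial m F Q"
proof -
  let ?a = "2 * m"
  have "f Q - f (id_mat ?a m) * lead_monomial m F Q = 0"
  proof (rule generic_zero[OF _ _ _ Q])
    show "is_poly ?a m (\<lambda>Q. f Q - f (id_mat ?a m) * lead_monomial m F Q)"
      using f by (intro is_poly_diff is_poly_mult is_poly_const is_poly_lead_monomial)
        (auto simp: rho_iff dest: U_invariantsD)
    fix R assume R: "R \<in> carrier_mat ?a m" and gen: "generic m R"
    obtain p where p: "poly p 0 = f (id_mat ?a m)"
      "\<And>s. s \<noteq> 0 \<Longrightarrow> f (torus m s * R) = s powi torus_weight m F * lead_monomial m F R * poly p (1 / s)"
      using generic_torus_curve[OF f R gen F] by blast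
    have "f R - lead_monomial m F R * poly p s = 0" if "s \<noteq> 0" for s
      using p(2)[of "1 / s"] wt[of "1 / s" R] that R by (simp add: power_int_one_over)
    hence "f R - lead_monomial m F R * poly p 0 = 0"
      by (intro isCont_zero_extend[of "\<lambda>s. f R - lead_monomial m F R * poly p s"]) auto
    thus "f R - f (id_mat ?a m) * lead_monomial m F R = 0" using p(1) by (simp add: mult.commute)
  qed simp
  thus ?thesis by simp
qed

section \<open>The modules \<open>rho\<close> and \<open>vanishing\<close>\<close>

lemma mult_carrier_Sp [simp]:
  "g \<in> Sp m \<Longrightarrow> Q \<in> carrier_mat (2 * m) k \<Longrightarrow> g * Q \<in> carrier_mat (2 * m) k"
  by (rule mult_carrier_mat[OF Sp_carrier])

lemma right_inv_lincomb:
  "right_inv a k f \<Longrightarrow> right_inv a k g \<Longrightarrow> right_inv a k (\<lambda>Q. c * f Q + d * g Q)"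
  by (simp add: right_inv_def)

lemma has_weight_restrict: "has_weight a k \<nu> f \<Longrightarrow> has_weight a k \<nu> (\<lambda>Q\<in>carrier_mat a k. f Q)"
  by (simp add: has_weight_def)

lemma rhoI:
  assumes "is_poly (2 * m) m f" "right_inv (2 * m) m f" "has_weight (2 * m) m F f"
  shows "(\<lambda>Q\<in>carrier_mat (2 * m) m. f Q) \<in> rho m F"
  using assms by (simp add: rho_iff U_invariantsI has_weight_restrict)

lemma rhoD:
  assumes "f \<in> rho m F"
  shows "f \<in> carrier (U_invariants m)" "is_poly (2 * m) m f" "right_inv (2 * m) m f" "has_weight (2 * m) m F f"
    "(\<lambda>Q\<in>carrier_mat (2 * m) m. f Q) = f"
  using assms U_invariantsD[of f m] by (auto simp: rho_iff)

lemma rho_fun_space: "fun_space (2 * m) m (rho m F)"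
  unfolding fun_space_def
proof (intro conjI ballI allI)
  show "rho m F \<subseteq> poly_funs (2 * m) m" by (auto simp: rho_iff U_invariants_carrier)
  show "(\<lambda>Q\<in>carrier_mat (2 * m) m. 0) \<in> rho m F"
    by (intro rhoI is_poly_const) (simp_all add: right_inv_def has_weight_def)
  fix f g c d assume "f \<in> rho m F" "g \<in> rho m F"
  note d = rhoD[OF this(1)] rhoD[OF this(2)]
  show "(\<lambda>Q\<in>carrier_mat (2 * m) m. c * f Q + d * g Q) \<in> rho m F"
    using d by (intro rhoI is_poly_add is_poly_mult is_poly_const right_inv_lincomb
        has_weight_add has_weight_cmult)
qed

lemma is_poly_left_mult:
  assumes "is_poly a k f" "g \<in> carrier_mat a a"
  shows "is_poly a k (\<lambda>Q. f (g * Q))"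
proof (rule is_poly_compose[OF assms(1)])
  show "g * Q \<in> carrier_mat a k" if "Q \<in> carrier_mat a k" for Q
    using assms(2) that by (rule mult_carrier_mat)
  fix i j assume ij: "i < a" "j < k"
  have "is_poly a k (\<lambda>Q. \<Sum>l<a. g $$ (i, l) * Q $$ (l, j))"
    using ij by (intro is_poly_sum is_poly_mult is_poly_const is_poly_entry) auto
  thus "is_poly a k (\<lambda>Q. (g * Q) $$ (i, j))"
    by (rule is_poly_cong) (use assms(2) ij mult_index_sum in blast)
qed

lemma rho_stable: "stable_under (2 * m) m (Sp m) (rho m F)"
  unfolding stable_under_def
proof (intro ballI)
  fix g f assume g: "g \<in> Sp m" and f: "f \<in> rho m F"
  let ?a = "2 * m"
  let ?t = "transpose_mat g"
  note d = rhoD[OF f]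
  have t: "?t \<in> carrier_mat ?a ?a" using Sp_carrier[OF g] by simp
  show "(\<lambda>Q\<in>carrier_mat ?a m. f (?t * Q)) \<in> rho m F"
  proof (rule rhoI)
    show "is_poly ?a m (\<lambda>Q. f (?t * Q))" by (rule is_poly_left_mult[OF d(2) t])
    show "right_inv ?a m (\<lambda>Q. f (?t * Q))"
      unfolding right_inv_def
    proof (intro ballI)
      fix u Q :: "complex mat" assume u: "u \<in> unitri m" and Q: "Q \<in> carrier_mat ?a m"
      have "?t * (Q * u) = ?t * Q * u"
        using assoc_mult_mat[OF t Q unitri_carrier[OF u]] by simp
      thus "f (?t * (Q * u)) = f (?t * Q)"
        using d(3) u mult_carrier_mat[OF t Q] by (simp add: right_inv_def)
    qed
    show "has_weight ?a m F (\<lambda>Q. f (?t * Q))"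
      unfolding has_weight_def
    proof (intro allI impI ballI)
      fix s :: "nat \<Rightarrow> complex" and Q :: "complex mat"
      assume s: "\<forall>j. s j \<noteq> 0" and Q: "Q \<in> carrier_mat ?a m"
      show "f (?t * col_scale s Q) = mpow m s F * f (?t * Q)"
        unfolding left_mult_col_scale[OF t Q, symmetric]
        using has_weightD[OF d(4), of s "?t * Q"] s mult_carrier_mat[OF t Q] by simp
    qed
  qed
qed

text \<open>The products \<open>g * id_mat\<close> are the isotropic m-frames in the orbit of the
  standard one. This space turns out to be the complement of tau.\<close>

definition vanishing :: "nat \<Rightarrow> (nat \<Rightarrow> nat) \<Rightarrow> (complex mat \<Rightarrow> complex) set" where
  "vanishing m F = {f \<in> rho m F. \<forall>g\<in>Sp m. f (g * id_mat (2 * m) m) = 0}"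

lemma vanishing_fun_space: "fun_space (2 * m) m (vanishing m F)"
  using rho_fun_space[of m F] unfolding fun_space_def
  by (auto simp: vanishing_def)

text \<open>The action involves the transpose of g; as the group is closed under transposition,
  translation by g itself is available too.\<close>

lemma stable_underD:
  assumes "stable_under (2 * m) m (Sp m) W" "g \<in> Sp m" "f \<in> W"
  shows "(\<lambda>Q\<in>carrier_mat (2 * m) m. f (g * Q)) \<in> W"
proof -
  have "(\<lambda>Q\<in>carrier_mat (2 * m) m. f (transpose_mat (transpose_mat g) * Q)) \<in> W"
    using assms(1,3) Sp_transpose[OF assms(2)] unfolding stable_under_def by blast
  thus ?thesis by simp
qed

lemma vanishing_stable: "stable_under (2 * m) m (Sp m) (vanishing m F)"
  unfolding stable_under_def
proof (intro ballI)
  fix g f assume g: "g \<in> Sp m" and f: "f \<in> vanishing m F"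
  have fr: "f \<in> rho m F" using f by (simp add: vanishing_def)
  have t: "transpose_mat g \<in> Sp m" by (rule Sp_transpose[OF g])
  have "f (transpose_mat g * (h * id_mat (2 * m) m)) = 0" if h: "h \<in> Sp m" for h
  proof -
    have "transpose_mat g * (h * id_mat (2 * m) m) = (transpose_mat g * h) * id_mat (2 * m) m"
      using assoc_mult_mat[OF Sp_carrier[OF t] Sp_carrier[OF h] id_mat_carrier] by simp
    thus ?thesis using f Sp_mult[OF t h] by (simp add: vanishing_def)
  qed
  thus "(\<lambda>Q\<in>carrier_mat (2 * m) m. f (transpose_mat g * Q)) \<in> vanishing m F"
    using rho_stable[of m F] fr g unfolding stable_under_def vanishing_def by simp
qed

lemma lead_monomial_scale:
  assumes F: "F \<in> young m" and "\<And>i. i \<le> m \<Longrightarrow> minor [0..<i] R = (\<Prod>j<i. t j) * minor [0..<i] Q"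
  shows "lead_monomial m F R = mpow m t F * lead_monomial m F Q"
proof -
  have "lead_monomial m F R = (\<Prod>i<m. ((\<Prod>j<Suc i. t j) * minor [0..<Suc i] Q) ^ (F i - F (Suc i)))"
    unfolding lead_monomial_def
  proof (intro prod.cong refl)
    fix i assume "i \<in> {..<m}"
    hence "minor [0..<Suc i] R = (\<Prod>j<Suc i. t j) * minor [0..<Suc i] Q" by (intro assms(2)) auto
    thus "minor [0..<Suc i] R ^ (F i - F (Suc i)) =
        ((\<Prod>j<Suc i. t j) * minor [0..<Suc i] Q) ^ (F i - F (Suc i))" by (rule arg_cong)
  qed
  also have "\<dots> = (\<Prod>i<m. (\<Prod>j<Suc i. t j) ^ (F i - F (Suc i))) * lead_monomial m F Q"
    unfolding power_mult_distrib prod.distrib lead_monomial_def ..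
  also have "(\<Prod>i<m. (\<Prod>j<Suc i. t j) ^ (F i - F (Suc i))) = mpow m t F"
    using prod_powers_telescope[of m F t] F by (simp add: young_def antimono_def)
  finally show ?thesis .
qed

lemma highest_vec_rho: assumes F: "F \<in> young m" shows "highest_vec m F \<in> rho m F"
  unfolding highest_vec_def
proof (rule rhoI)
  show "is_poly (2 * m) m (lead_monomial m F)" by (rule is_poly_lead_monomial) simp
  show "right_inv (2 * m) m (lead_monomial m F)"
    unfolding right_inv_def
  proof (intro ballI)
    fix u Q :: "complex mat" assume "u \<in> unitri m" "Q \<in> carrier_mat (2 * m) m"
    hence "minor [0..<Suc i] (Q * u) = minor [0..<Suc i] Q" if "i < m" for i
      using minor_right_inv[of "[0..<Suc i]" "2 * m" m] that
      unfolding right_inv_def by (simp add: subset_iff del: upt_Suc)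
    thus "lead_monomial m F (Q * u) = lead_monomial m F Q"
      unfolding lead_monomial_def by (intro prod.cong) auto
  qed
  show "has_weight (2 * m) m F (lead_monomial m F)"
    unfolding has_weight_def
  proof (intro allI impI ballI)
    fix t :: "nat \<Rightarrow> complex" and Q :: "complex mat" assume Q: "Q \<in> carrier_mat (2 * m) m"
    show "lead_monomial m F (col_scale t Q) = mpow m t F * lead_monomial m F Q"
    proof (rule lead_monomial_scale[OF F])
      fix i assume "i \<le> m"
      thus "minor [0..<i] (col_scale t Q) = (\<Prod>j<i. t j) * minor [0..<i] Q"
        using minor_col_scale[OF Q, of "[0..<i]" t] by (simp add: subset_iff)
    qed
  qed
qed

lemma highest_vec_id: "highest_vec m F (id_mat (2 * m) m) = 1"
proof -
  have "minor [0..<Suc i] (id_mat (2 * m) m) = 1" if "i < m" for i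
    using that by (intro minor_lower_unitri[OF id_mat_lower_unitri]) auto
  thus ?thesis by (simp add: highest_vec_def lead_monomial_def del: upt_Suc)
qed

lemma highest_vec_not_vanishing: "highest_vec m F \<notin> vanishing m F"
proof
  assume "highest_vec m F \<in> vanishing m F"
  hence "highest_vec m F (1\<^sub>m (2 * m) * id_mat (2 * m) m) = 0"
    using one_in_Sp unfolding vanishing_def by blast
  thus False using left_mult_one_mat[OF id_mat_carrier] by (simp add: highest_vec_id)
qed

text \<open>A function of W that is nonzero at some g E has a translate in W that is nonzero at E,
  and \<open>highest_vec_mem\<close> applies to the translate.\<close>

lemma highest_vec_mem_submodule:
  assumes W: "fun_space (2 * m) m W" "stable_under (2 * m) m (Sp m) W" "W \<subseteq> rho m F"
    and F: "F \<in> young m" and "\<not> W \<subseteq> vanishing m F"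
  shows "highest_vec m F \<in> W"
proof -
  obtain w g where w: "w \<in> W" "g \<in> Sp m" "w (g * id_mat (2 * m) m) \<noteq> 0"
    using assms(3,5) by (auto simp: vanishing_def)
  show ?thesis
    by (rule highest_vec_mem[OF W F stable_underD[OF W(2) w(2,1)]]) (use w(3) in simp)
qed

lemma zero_in_fun_space: "fun_space a k W \<Longrightarrow> (\<lambda>Q\<in>carrier_mat a k. 0) \<in> W"
  by (simp add: fun_space_def)

lemma Sp_submodule_rho_iff:
  "W \<subseteq> rho m F \<Longrightarrow> Sp_submodule m W \<longleftrightarrow> fun_space (2 * m) m W \<and> stable_under (2 * m) m (Sp m) W"
  unfolding Sp_submodule_iff using rhoD(1) by blast

section \<open>The decomposition of \<open>rho\<close> into tau and its complement\<close>

lemma rho_complement: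
  assumes F: "F \<in> young m" and V: "fun_space (2 * m) m V" "stable_under (2 * m) m (Sp m) V" "V \<subseteq> rho m F"
    and W: "fun_space (2 * m) m W" "stable_under (2 * m) m (Sp m) W" "W \<subseteq> V"
  obtains W' where "fun_space (2 * m) m W'" "stable_under (2 * m) m (Sp m) W'" "W' \<subseteq> V"
    "W \<inter> W' = {\<lambda>Q\<in>carrier_mat (2 * m) m. 0}"
    "\<And>f. f \<in> V \<Longrightarrow> \<exists>w\<in>W. \<exists>w'\<in>W'. f = (\<lambda>Q\<in>carrier_mat (2 * m) m. w Q + w' Q)"
proof -
  have deg: "\<exists>c. \<forall>Q\<in>carrier_mat (2 * m) m. f Q = tensor_fun (2 * m) m (\<Sum>j<m. F j) c Q" if "f \<in> V" for f
  proof -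
    have "f \<in> rho m F" using that V(3) by blast
    from rhoD[OF this] show ?thesis using F by (intro homogeneous_tensor) (auto simp: young_def)
  qed
  have "\<exists>W'. fun_space (2 * m) m W' \<and> stable_under (2 * m) m (Sp m) W' \<and> W' \<subseteq> V \<and>
    W \<inter> W' = {\<lambda>Q\<in>carrier_mat (2 * m) m. 0} \<and>
    (\<forall>f\<in>V. \<exists>w\<in>W. \<exists>w'\<in>W'. f = (\<lambda>Q\<in>carrier_mat (2 * m) m. w Q + w' Q))"
    by (rule invariant_complement[OF _ Sp_conj_transpose V(1,2) W deg]) (use Sp_carrier in blast)+
  then obtain W' where W': "fun_space (2 * m) m W'" "stable_under (2 * m) m (Sp m) W'" "W' \<subseteq> V"
    "W \<inter> W' = {\<lambda>Q\<in>carrier_mat (2 * m) m. 0}"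
    "\<forall>f\<in>V. \<exists>w\<in>W. \<exists>w'\<in>W'. f = (\<lambda>Q\<in>carrier_mat (2 * m) m. w Q + w' Q)" by (elim exE conjE)
  show ?thesis by (rule that[OF W'(1-4)]) (rule bspec[OF W'(5)])
qed

lemma minor_diag_mult:
  assumes Q: "Q \<in> carrier_mat a k" and t: "t \<in> carrier_mat a a" "diagonal_mat t" and i: "i \<le> k" "k \<le> a"
  shows "minor [0..<i] (transpose_mat t * Q) = (\<Prod>j<i. t $$ (j, j)) * minor [0..<i] Q"
proof -
  let ?B = "mat i i (\<lambda>(r, c). Q $$ ([0..<i] ! r, c))"
  let ?D = "diag_of i (\<lambda>j. t $$ (j, j))"
  have tD: "transpose_mat t = diag_of a (\<lambda>j. t $$ (j, j))"
    using t by (intro eq_matI) (auto simp: diag_of_def diagonal_mat_def)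
  have "mat i i (\<lambda>(r, c). (transpose_mat t * Q) $$ ([0..<i] ! r, c)) = ?D * ?B"
  proof (rule eq_matI)
    fix r c assume "r < dim_row (?D * ?B)" "c < dim_col (?D * ?B)"
    hence rc: "r < i" "c < i" by (auto simp: diag_of_def)
    have "(?D * ?B) $$ (r, c) = t $$ (r, r) * ?B $$ (r, c)"
      by (rule diag_of_mult_index[OF mat_carrier rc])
    moreover have "(transpose_mat t * Q) $$ (r, c) = t $$ (r, r) * Q $$ (r, c)"
      unfolding tD using rc i by (intro diag_of_mult_index[OF Q]) auto
    ultimately show "mat i i (\<lambda>(r, c). (transpose_mat t * Q) $$ ([0..<i] ! r, c)) $$ (r, c) = (?D * ?B) $$ (r, c)"
      using rc by simp
  qed (auto simp: diag_of_def)
  hence "minor [0..<i] (transpose_mat t * Q) = det ?D * det ?B"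
    by (simp add: minor_def det_mult[OF diag_of_carrier, of _ i])
  also have "det ?D = prod_list (diag_mat ?D)"
    by (rule det_upper_triangular[of _ i]) (auto simp: diag_of_def)
  also have "\<dots> = (\<Prod>j<i. t $$ (j, j))" by (simp add: diag_mat_def diag_of_def prod_list_upt)
  finally show ?thesis by (simp add: minor_def)
qed

lemma highest_vec_has_highest_weight:
  assumes F: "F \<in> young m" and T: "highest_vec m F \<in> T"
  shows "has_highest_weight m F T"
  unfolding has_highest_weight_def
proof (intro bexI[OF _ T] conjI ballI impI)
  let ?a = "2 * m"
  let ?h = "highest_vec m F"
  show "?h \<noteq> \<zero>\<^bsub>U_invariants m\<^esub>"
  proof
    assume "?h = \<zero>\<^bsub>U_invariants m\<^esub>"
    hence "?h (id_mat ?a m) = 0" by simp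
    thus False by (simp add: highest_vec_id)
  qed
  show "Sp_act m u ?h = ?h" if u: "u \<in> Sp m \<inter> unitri ?a" for u
  proof -
    have uu: "u \<in> unitri ?a" and uS: "u \<in> Sp m" using u by auto
    have emb: "GL_embed ?a ?a u = u"
      by (rule eq_matI) (use unitri_carrier[OF uu] in \<open>auto simp: GL_embed_index\<close>, auto simp: GL_embed_def)
    have "minor [0..<Suc i] (transpose_mat u * Q) = minor [0..<Suc i] Q"
      if "i < m" "Q \<in> carrier_mat ?a m" for i Q
    proof -
      have "left_inv ?a ?a m (minor [0..<Suc i])"
        by (rule minor_left_inv[of _ "Suc i" "[]"]) (use that in auto)
      thus ?thesis using uu that emb unfolding left_inv_def by metis
    qed
    hence "lead_monomial m F (transpose_mat u * Q) = lead_monomial m F Q" if "Q \<in> carrier_mat ?a m" for Q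
      unfolding lead_monomial_def using that by (intro prod.cong) auto
    thus ?thesis
      unfolding Sp_act_eq[OF uS] highest_vec_def using Sp_transpose[OF uS]
      by (intro restrict_ext) simp
  qed
  show "Sp_act m t ?h = torus_char m F t \<odot>\<^bsub>U_invariants m\<^esub> ?h" if t: "t \<in> Sp m" "diagonal_mat t" for t
  proof -
    have "lead_monomial m F (transpose_mat t * Q) = torus_char m F t * lead_monomial m F Q"
      if Q: "Q \<in> carrier_mat ?a m" for Q
    proof -
      have "lead_monomial m F (transpose_mat t * Q) = mpow m (\<lambda>j. t $$ (j, j)) F * lead_monomial m F Q"
        by (rule lead_monomial_scale[OF F], rule minor_diag_mult[OF Q Sp_carrier[OF t(1)] t(2)]) auto
      thus ?thesis by (simp add: torus_char_def mpow_def)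
    qed
    thus ?thesis
      unfolding Sp_act_eq[OF t(1)] highest_vec_def U_invariants_simps using Sp_transpose[OF t(1)]
      by (intro restrict_ext) simp
  qed
qed

text \<open>A highest weight vector h of T has the torus weight for which
  \<open>weight_vector_unique\<close> makes it a multiple of \<open>highest_vec\<close>. The factor
  h(\<open>id_mat\<close>) is nonzero, since otherwise h would be zero.\<close>

lemma highest_vec_mem_tau:
  assumes F: "F \<in> young m" and T: "is_tau m F T"
  shows "highest_vec m F \<in> T"
proof -
  let ?a = "2 * m"
  have Tr: "T \<subseteq> rho m F" and TS: "Sp_submodule m T" using T by (auto simp: is_tau_def Sp_irreducible_def)
  obtain h where h: "h \<in> T" "h \<noteq> \<zero>\<^bsub>U_invariants m\<^esub>"
    "\<And>t. t \<in> Sp m \<Longrightarrow> diagonal_mat t \<Longrightarrow> Sp_act m t h = torus_char m F t \<odot>\<^bsub>U_invariants m\<^esub> h"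
    using T unfolding is_tau_def has_highest_weight_def by blast
  have hr: "h \<in> rho m F" using h Tr by blast
  have "h (torus m s * Q) = s powi torus_weight m F * h Q" if s: "s \<noteq> 0" and Q: "Q \<in> carrier_mat ?a m" for s Q
  proof -
    have "diagonal_mat (torus m s)" by (simp add: diagonal_mat_def diag_of_def)
    from h(3)[OF torus_Sp[OF s] this]
    have "Sp_act m (torus m s) h Q = torus_char m F (torus m s) * h Q" using Q by simp
    moreover have "torus_char m F (torus m s) = mpow m (\<lambda>j. s powi torus_exp m j) F"
      unfolding torus_char_def mpow_def by (intro prod.cong) (auto simp: diag_of_def)
    ultimately show ?thesis
      using Q by (simp add: Sp_act_eq[OF torus_Sp[OF s]] diag_of_transpose mpow_torus[OF s])
  qed
  hence eq: "h Q = h (id_mat ?a m) * lead_monomial m F Q" if "Q \<in> carrier_mat ?a m" for Q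
    using weight_vector_unique[OF hr F _ that] by blast
  have hE: "h (id_mat ?a m) \<noteq> 0"
  proof
    assume 0: "h (id_mat ?a m) = 0"
    have "h Q = 0" if "Q \<in> carrier_mat ?a m" for Q using eq[OF that] unfolding 0 by simp
    hence "(\<lambda>Q\<in>carrier_mat ?a m. h Q) = \<zero>\<^bsub>U_invariants m\<^esub>"
      unfolding U_invariants_simps by (intro restrict_ext)
    thus False using h(2) rhoD(5)[OF hr] by simp
  qed
  have Tf: "fun_space ?a m T" "stable_under ?a m (Sp m) T" using TS by (simp_all add: Sp_submodule_iff)
  show ?thesis by (rule highest_vec_mem[OF Tf Tr F h(1) hE])
qed

lemma set_add_U_invariants:
  "A <+>\<^bsub>U_invariants m\<^esub> B = {\<lambda>Q\<in>carrier_mat (2 * m) m. f Q + g Q | f g. f \<in> A \<and> g \<in> B}"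
  by (auto simp: set_add_def set_mult_def)

text \<open>T is an invariant complement of \<open>vanishing\<close>. Every nonzero submodule of T
  contains \<open>highest_vec\<close>, since it is not inside \<open>vanishing\<close>. A proper
  nonzero submodule would have a nonzero complement in T, and both would contain
  \<open>highest_vec\<close>; so T is irreducible.\<close>

lemma ex_tau_complement:
  assumes F: "F \<in> young m"
  shows "\<exists>T. is_tau m F T \<and> T <+>\<^bsub>U_invariants m\<^esub> vanishing m F = rho m F \<and>
    T \<inter> vanishing m F = {\<zero>\<^bsub>U_invariants m\<^esub>}"
proof -
  let ?V = "vanishing m F"
  let ?C = "carrier_mat (2 * m) m"
  let ?z = "\<lambda>Q\<in>?C. 0"
  have Vr: "?V \<subseteq> rho m F" by (auto simp: vanishing_def)
  obtain T where T: "fun_space (2 * m) m T" "stable_under (2 * m) m (Sp m) T" "T \<subseteq> rho m F"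
    "?V \<inter> T = {?z}" "\<And>f. f \<in> rho m F \<Longrightarrow> \<exists>w\<in>?V. \<exists>w'\<in>T. f = (\<lambda>Q\<in>?C. w Q + w' Q)"
    using rho_complement[OF F rho_fun_space rho_stable order_refl vanishing_fun_space vanishing_stable Vr]
    by blast
  have hv: "highest_vec m F \<in> W"
    if "fun_space (2 * m) m W" "stable_under (2 * m) m (Sp m) W" "W \<subseteq> T" "W \<noteq> {?z}" for W
  proof -
    have "\<not> W \<subseteq> ?V" using that T(4) zero_in_fun_space[OF that(1)] by blast
    thus ?thesis using highest_vec_mem_submodule[OF that(1,2) _ F] that(3) T(3) by blast
  qed
  have hz: "highest_vec m F \<noteq> ?z"
  proof
    assume "highest_vec m F = ?z"
    hence "highest_vec m F (id_mat (2 * m) m) = 0" by simp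
    thus False by (simp add: highest_vec_id)
  qed
  have Tz: "T \<noteq> {?z}"
  proof
    assume Tz: "T = {?z}"
    obtain w where "w \<in> ?V" "highest_vec m F = (\<lambda>Q\<in>?C. w Q + ?z Q)"
      using T(5)[OF highest_vec_rho[OF F]] Tz by blast
    hence "highest_vec m F = (\<lambda>Q\<in>?C. w Q)" by (simp cong: restrict_cong)
    hence "highest_vec m F \<in> ?V" using \<open>w \<in> ?V\<close> Vr rhoD(5)[of w m F] by auto
    thus False using highest_vec_not_vanishing by blast
  qed
  have "is_tau m F T"
    unfolding is_tau_def Sp_irreducible_def
  proof (intro conjI allI impI)
    show "T \<subseteq> rho m F" by fact
    show "Sp_submodule m T" using T by (simp add: Sp_submodule_rho_iff)
    show "T \<noteq> {\<zero>\<^bsub>U_invariants m\<^esub>}" using Tz by simp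
    show "has_highest_weight m F T"
      by (rule highest_vec_has_highest_weight[OF F hv[OF T(1,2) order_refl Tz]])
    fix S assume S: "Sp_submodule m S \<and> S \<subseteq> T"
    hence S': "fun_space (2 * m) m S" "stable_under (2 * m) m (Sp m) S" "S \<subseteq> T"
      using T(3) by (simp_all add: Sp_submodule_iff)
    show "S = {\<zero>\<^bsub>U_invariants m\<^esub>} \<or> S = T"
    proof (rule ccontr)
      assume "\<not> ?thesis"
      hence ne: "S \<noteq> {?z}" "S \<noteq> T" by auto
      obtain S2 where S2: "fun_space (2 * m) m S2" "stable_under (2 * m) m (Sp m) S2" "S2 \<subseteq> T"
        "S \<inter> S2 = {?z}" "\<And>f. f \<in> T \<Longrightarrow> \<exists>w\<in>S. \<exists>w'\<in>S2. f = (\<lambda>Q\<in>?C. w Q + w' Q)"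
        using rho_complement[OF F T(1-3) S'] by blast
      have "S2 \<noteq> {?z}"
      proof
        assume "S2 = {?z}"
        have "f \<in> S" if fT: "f \<in> T" for f
        proof -
          obtain w where w: "w \<in> S" "f = (\<lambda>Q\<in>?C. w Q + ?z Q)"
            using S2(5)[OF fT] \<open>S2 = {?z}\<close> by blast
          have "f = (\<lambda>Q\<in>?C. w Q)" unfolding w(2) by (simp cong: restrict_cong)
          thus ?thesis using w(1) S'(3) T(3) rhoD(5)[of w m F] by auto
        qed
        thus False using ne S'(3) by blast
      qed
      hence "highest_vec m F \<in> S \<inter> S2" using hv[OF S' ne(1)] hv[OF S2(1-3)] by blast
      thus False using S2(4) hz by blast
    qed
  qed
  moreover have "T <+>\<^bsub>U_invariants m\<^esub> ?V = rho m F"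
  proof
    show "T <+>\<^bsub>U_invariants m\<^esub> ?V \<subseteq> rho m F"
    proof
      fix h assume "h \<in> T <+>\<^bsub>U_invariants m\<^esub> ?V"
      then obtain f g where fg: "f \<in> rho m F" "g \<in> rho m F" "h = (\<lambda>Q\<in>?C. f Q + g Q)"
        using T(3) Vr unfolding set_add_U_invariants by blast
      hence "(\<lambda>Q\<in>?C. 1 * f Q + 1 * g Q) \<in> rho m F"
        using rho_fun_space[of m F] unfolding fun_space_def by blast
      thus "h \<in> rho m F" using fg(3) by simp
    qed
    show "rho m F \<subseteq> T <+>\<^bsub>U_invariants m\<^esub> ?V"
    proof
      fix f assume "f \<in> rho m F"
      from T(5)[OF this] obtain w w' where "w \<in> ?V" "w' \<in> T" "f = (\<lambda>Q\<in>?C. w Q + w' Q)" by blast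
      thus "f \<in> T <+>\<^bsub>U_invariants m\<^esub> ?V"
        unfolding set_add_U_invariants by (auto simp: add.commute)
    qed
  qed
  ultimately show ?thesis using T(4) by (intro exI[of _ T]) (auto simp: Int_commute)
qed

text \<open>For uniqueness, let W be a complement of some T with \<open>is_tau\<close>. As T
  contains \<open>highest_vec\<close>, W does not and therefore lies in \<open>vanishing\<close>.
  Irreducibility makes T meet \<open>vanishing\<close> in 0, so the T-component of any element of
  \<open>vanishing\<close> is zero.\<close>

lemma Sp_complement_eq:
  assumes F: "F \<in> young m"
  shows "Sp_complement m F = vanishing m F"
  unfolding Sp_complement_def
proof (rule the_equality)
  let ?V = "vanishing m F"
  let ?C = "carrier_mat (2 * m) m"
  let ?z = "\<lambda>Q\<in>?C. 0"
  have Vr: "?V \<subseteq> rho m F" by (auto simp: vanishing_def)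
  have VS: "Sp_submodule m ?V"
    unfolding Sp_submodule_rho_iff[OF Vr] using vanishing_fun_space vanishing_stable by blast
  show "Sp_submodule m ?V \<and> (\<exists>T. is_tau m F T \<and> T <+>\<^bsub>U_invariants m\<^esub> ?V = rho m F \<and>
      T \<inter> ?V = {\<zero>\<^bsub>U_invariants m\<^esub>})"
    using VS ex_tau_complement[OF F] by blast
  fix W assume "Sp_submodule m W \<and> (\<exists>T. is_tau m F T \<and> T <+>\<^bsub>U_invariants m\<^esub> W = rho m F \<and>
      T \<inter> W = {\<zero>\<^bsub>U_invariants m\<^esub>})"
  then obtain T where WS: "Sp_submodule m W" and T: "is_tau m F T" "T <+>\<^bsub>U_invariants m\<^esub> W = rho m F"
    "T \<inter> W = {?z}" by auto
  have Tr: "T \<subseteq> rho m F" and TS: "Sp_submodule m T" using T(1) by (auto simp: is_tau_def Sp_irreducible_def)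
  have Tf: "fun_space (2 * m) m T" "stable_under (2 * m) m (Sp m) T" using TS by (simp_all add: Sp_submodule_iff)
  have Wf: "fun_space (2 * m) m W" "stable_under (2 * m) m (Sp m) W" "W \<subseteq> carrier (U_invariants m)"
    using WS by (simp_all add: Sp_submodule_iff)
  have hT: "highest_vec m F \<in> T" by (rule highest_vec_mem_tau[OF F T(1)])
  have hz: "highest_vec m F \<noteq> ?z"
  proof
    assume "highest_vec m F = ?z"
    hence "highest_vec m F (id_mat (2 * m) m) = 0" by simp
    thus False by (simp add: highest_vec_id)
  qed
  have Wr: "W \<subseteq> rho m F"
  proof
    fix w assume w: "w \<in> W"
    have "w = (\<lambda>Q\<in>?C. w Q)" using w Wf(3) U_invariantsD(3)[of w m] by auto
    also have "\<dots> = (\<lambda>Q\<in>?C. ?z Q + w Q)" by (simp cong: restrict_cong)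
    finally show "w \<in> rho m F"
      using zero_in_fun_space[OF Tf(1)] w unfolding T(2)[symmetric] set_add_U_invariants by blast
  qed
  have WV: "W \<subseteq> ?V"
  proof (rule ccontr)
    assume "\<not> W \<subseteq> ?V"
    hence "highest_vec m F \<in> W" by (rule highest_vec_mem_submodule[OF Wf(1,2) Wr F])
    thus False using hT T(3) hz by blast
  qed
  have "Sp_submodule m (T \<inter> ?V)"
  proof -
    have "fun_space (2 * m) m (T \<inter> ?V)"
      using Tf(1) vanishing_fun_space[of m F] unfolding fun_space_def by blast
    moreover have "stable_under (2 * m) m (Sp m) (T \<inter> ?V)"
      using Tf(2) vanishing_stable[of m F] unfolding stable_under_def by blast
    ultimately show ?thesis using Sp_submodule_rho_iff[of "T \<inter> ?V" m F] Tr by blast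
  qed
  hence "T \<inter> ?V = {?z} \<or> T \<inter> ?V = T"
    using T(1) unfolding is_tau_def Sp_irreducible_def by (metis Int_lower1 U_invariants_simps(4))
  hence TV: "T \<inter> ?V = {?z}" using hT highest_vec_not_vanishing by blast
  have "?V \<subseteq> W"
  proof
    fix k assume k: "k \<in> ?V"
    hence "k \<in> T <+>\<^bsub>U_invariants m\<^esub> W" using T(2) Vr by blast
    then obtain t w where tw: "t \<in> T" "w \<in> W" "k = (\<lambda>Q\<in>?C. t Q + w Q)"
      unfolding set_add_U_invariants by blast
    have wr: "(\<lambda>Q\<in>?C. w Q) = w" "(\<lambda>Q\<in>?C. t Q) = t" using tw Wr Tr rhoD(5) by blast+
    have "(\<lambda>Q\<in>?C. 1 * k Q + (-1) * w Q) \<in> ?V"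
      using k tw(2) WV vanishing_fun_space[of m F] unfolding fun_space_def by blast
    moreover have "(\<lambda>Q\<in>?C. 1 * k Q + (-1) * w Q) = (\<lambda>Q\<in>?C. t Q)"
      unfolding tw(3) by (intro restrict_ext) simp
    ultimately have "t \<in> T \<inter> ?V" using tw(1) wr by simp
    hence "t = ?z" using TV by blast
    hence "k = (\<lambda>Q\<in>?C. w Q)" unfolding tw(3) by (intro restrict_ext) simp
    thus "k \<in> W" using tw(2) wr by simp
  qed
  thus "W = ?V" using WV by blast
qed

section \<open>The ideal\<close>

lemma finsum_U_invariants:
  assumes "finite S" "w \<in> S \<rightarrow> carrier (U_invariants m)"
  shows "finsum (U_invariants m) w S = (\<lambda>Q\<in>carrier_mat (2 * m) m. \<Sum>F\<in>S. w F Q)"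
proof -
  interpret A: algebra complex_ring "U_invariants m" by (rule U_invariants_algebra)
  show ?thesis using assms
  proof (induction S rule: finite_induct)
    case (insert F S)
    hence "finsum (U_invariants m) w (insert F S) = w F \<oplus>\<^bsub>U_invariants m\<^esub> finsum (U_invariants m) w S"
      by (intro A.M.finsum_insert) auto
    thus ?case using insert by (simp cong: restrict_cong)
  qed simp
qed

text \<open>Scaling the columns of E is the same as multiplying it by a symplectic diagonal matrix,
  whose lower half is forced to be inverse to the upper half. So the set of frames g E is closed
  under column scaling.\<close>

lemma col_scale_isotropic:
  assumes g: "g \<in> Sp m" and t: "\<And>j. t j \<noteq> 0"
  shows "\<exists>h\<in>Sp m. col_scale t (g * id_mat (2 * m) m) = h * id_mat (2 * m) m"
proof -
  let ?a = "2 * m"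
  define x where "x i = (if i < m then t i else 1 / t (?a - 1 - i))" for i
  let ?D = "diag_of ?a x"
  have D: "?D \<in> Sp m"
  proof (rule diag_of_Sp)
    fix i assume i: "i < ?a"
    have "\<not> i < m \<Longrightarrow> ?a - 1 - i < m" "i < m \<Longrightarrow> \<not> ?a - 1 - i < m" "?a - 1 - (?a - 1 - i) = i"
      using i by auto
    thus "x i * x (?a - 1 - i) = 1" using t by (cases "i < m") (simp_all add: x_def)
  qed
  have "col_scale t (id_mat ?a m) = ?D * id_mat ?a m"
  proof (rule eq_matI)
    fix i j assume "i < dim_row (?D * id_mat ?a m)" "j < dim_col (?D * id_mat ?a m)"
    hence ij: "i < ?a" "j < m" by (auto simp: diag_of_def id_mat_def)
    have "col_scale t (id_mat ?a m) $$ (i, j) = t j * id_mat ?a m $$ (i, j)"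
      by (rule col_scale_index[OF id_mat_carrier ij])
    also have "\<dots> = x i * id_mat ?a m $$ (i, j)" using ij by (simp add: x_def)
    also have "\<dots> = (?D * id_mat ?a m) $$ (i, j)"
      by (rule diag_of_mult_index[OF id_mat_carrier ij, symmetric])
    finally show "col_scale t (id_mat ?a m) $$ (i, j) = (?D * id_mat ?a m) $$ (i, j)" .
  qed (auto simp: col_scale_def diag_of_def id_mat_def)
  hence "col_scale t (g * id_mat ?a m) = g * (?D * id_mat ?a m)"
    by (simp add: left_mult_col_scale[OF Sp_carrier[OF g] id_mat_carrier])
  also have "\<dots> = (g * ?D) * id_mat ?a m"
    by (rule assoc_mult_mat[OF Sp_carrier[OF g] diag_of_carrier id_mat_carrier, symmetric])
  finally show ?thesis using Sp_mult[OF g D] by blast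
qed

text \<open>The frames are closed under column scaling, so a function vanishing on all of them has
  weight components that vanish there too. This makes the vanishing ideal a sum of its pieces in the
  \<open>rho m F\<close>.\<close>

lemma I_Sp_eq:
  "I_Sp m = {f \<in> carrier (U_invariants m). \<forall>g\<in>Sp m. f (g * id_mat (2 * m) m) = 0}"
proof
  let ?a = "2 * m"
  let ?C = "carrier_mat ?a m"
  let ?E = "id_mat ?a m"
  interpret A: algebra complex_ring "U_invariants m" by (rule U_invariants_algebra)
  show "I_Sp m \<subseteq> {f \<in> carrier (U_invariants m). \<forall>g\<in>Sp m. f (g * ?E) = 0}"
  proof
    fix f assume "f \<in> I_Sp m"
    then obtain w S where S: "finite S" "S \<subseteq> young m" "w \<in> (\<Pi> F\<in>S. Sp_complement m F)"
      and f: "f = finsum (U_invariants m) w S" by (auto simp: I_Sp_def)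
    have w: "w F \<in> vanishing m F" if "F \<in> S" for F
      using that S(2,3) Sp_complement_eq[of F m] by (auto simp: Pi_iff)
    have "w F \<in> carrier (U_invariants m)" if "F \<in> S" for F
      using w[OF that] rhoD(1)[of "w F" m F] by (simp add: vanishing_def)
    hence wc: "w \<in> S \<rightarrow> carrier (U_invariants m)" by (rule Pi_I)
    have "f (g * ?E) = 0" if g: "g \<in> Sp m" for g
      using w g unfolding f finsum_U_invariants[OF S(1) wc] by (simp add: vanishing_def)
    moreover have "f \<in> carrier (U_invariants m)" unfolding f by (rule A.M.finsum_closed[OF wc])
    ultimately show "f \<in> {f \<in> carrier (U_invariants m). \<forall>g\<in>Sp m. f (g * ?E) = 0}" by blast
  qed
  show "{f \<in> carrier (U_invariants m). \<forall>g\<in>Sp m. f (g * ?E) = 0} \<subseteq> I_Sp m"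
  proof
    fix f assume "f \<in> {f \<in> carrier (U_invariants m). \<forall>g\<in>Sp m. f (g * ?E) = 0}"
    hence f: "f \<in> carrier (U_invariants m)" "\<And>g. g \<in> Sp m \<Longrightarrow> f (g * ?E) = 0" by auto
    note fd = U_invariantsD[OF f(1)]
    obtain S0 F where S0: "finite S0" "\<And>Q. Q \<in> ?C \<Longrightarrow> f Q = (\<Sum>\<kappa>\<in>S0. F \<kappa> Q)"
      "\<And>\<kappa>. is_poly ?a m (F \<kappa>)" "\<And>\<kappa>. has_weight ?a m \<kappa> (F \<kappa>)" "\<And>\<kappa> j. \<kappa> \<in> S0 \<Longrightarrow> m \<le> j \<Longrightarrow> \<kappa> j = 0"
      using weight_decomposition[OF fd(1)] by blast
    \<comment> \<open>Zero components are discarded: only for a nonzero one is the weight known to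
      be decreasing, hence in \<open>young m\<close>.\<close>
    define S where "S = {\<kappa>\<in>S0. \<exists>Q\<in>?C. F \<kappa> Q \<noteq> 0}"
    have finS: "finite S" using S0(1) by (simp add: S_def)
    have inv: "right_inv ?a m (F \<kappa>)" if "\<kappa> \<in> S0" for \<kappa>
      using S0(1,2,4,5) fd(2) that
      by (rule weight_component_right_inv[where S = S0 and F = F and f = f])
    have young: "\<kappa> \<in> young m" if \<kappa>: "\<kappa> \<in> S" for \<kappa>
    proof -
      obtain Q where Q: "\<kappa> \<in> S0" "Q \<in> ?C" "F \<kappa> Q \<noteq> 0" using \<kappa> by (auto simp: S_def)
      have "\<kappa> (Suc j) \<le> \<kappa> j" for j
        using weight_dominant[OF S0(3) inv[OF Q(1)] S0(4) _ Q(2,3), of j] S0(5)[OF Q(1), of "Suc j"]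
        by (cases "Suc j < m") auto
      thus ?thesis using S0(5)[OF Q(1)] by (auto simp: young_def intro: decseq_SucI)
    qed
    define w where "w \<kappa> = (\<lambda>Q\<in>?C. F \<kappa> Q)" for \<kappa>
    have w: "w \<kappa> \<in> vanishing m \<kappa>" if \<kappa>: "\<kappa> \<in> S" for \<kappa>
    proof -
      have \<kappa>0: "\<kappa> \<in> S0" using \<kappa> by (simp add: S_def)
      have "w \<kappa> \<in> rho m \<kappa>" unfolding w_def using S0(3,4) inv[OF \<kappa>0] by (intro rhoI) auto
      moreover have "F \<kappa> (g * ?E) = 0" if g: "g \<in> Sp m" for g
      proof -
        have gE: "g * ?E \<in> ?C" using g by simp
        have "(\<Sum>\<kappa>\<in>S0. mpow m t \<kappa> * F \<kappa> (g * ?E)) = 0" if t: "\<And>j. t j \<noteq> 0" for t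
        proof -
          have "\<exists>h\<in>Sp m. col_scale t (g * ?E) = h * ?E" by (rule col_scale_isotropic[OF g t])
          then obtain h where h: "h \<in> Sp m" "col_scale t (g * ?E) = h * ?E" ..
          have "(\<Sum>\<kappa>\<in>S0. mpow m t \<kappa> * F \<kappa> (g * ?E)) = (\<Sum>\<kappa>\<in>S0. F \<kappa> (col_scale t (g * ?E)))"
            by (intro sum.cong refl has_weightD[OF S0(4) t gE, symmetric])
          also have "\<dots> = f (h * ?E)" using S0(2)[of "h * ?E"] h by simp
          finally show ?thesis using f(2)[OF h(1)] by simp
        qed
        thus ?thesis
          using S0(1,5) \<kappa>0 by (intro mpow_independent[of S0 m "\<lambda>\<kappa>. F \<kappa> (g * ?E)" \<kappa>]) auto
      qed
      ultimately show ?thesis by (simp add: vanishing_def w_def)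
    qed
    have "w \<kappa> \<in> carrier (U_invariants m)" if "\<kappa> \<in> S" for \<kappa>
      using w[OF that] rhoD(1)[of "w \<kappa>" m \<kappa>] by (simp add: vanishing_def)
    hence wc: "w \<in> S \<rightarrow> carrier (U_invariants m)" by (rule Pi_I)
    have "finsum (U_invariants m) w S = (\<lambda>Q\<in>?C. f Q)"
      unfolding finsum_U_invariants[OF finS wc]
    proof (rule restrict_ext)
      fix Q :: "complex mat" assume Q: "Q \<in> ?C"
      have "(\<Sum>\<kappa>\<in>S. w \<kappa> Q) = (\<Sum>\<kappa>\<in>S0. F \<kappa> Q)"
        using Q S0(1) by (intro sum.mono_neutral_cong_left) (auto simp: S_def w_def)
      thus "(\<Sum>\<kappa>\<in>S. w \<kappa> Q) = f Q" using S0(2)[OF Q] by simp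
    qed
    hence "f = finsum (U_invariants m) w S" using fd(3) by simp
    moreover have "w \<in> (\<Pi> \<kappa>\<in>S. Sp_complement m \<kappa>)"
      using w Sp_complement_eq[OF young] by (auto simp: Pi_iff)
    moreover have "S \<subseteq> young m" using young by blast
    ultimately show "f \<in> I_Sp m" unfolding I_Sp_def using finS by blast
  qed
qed

lemma I_Sp_ideal: "ideal (I_Sp m) (U_invariants m)"
proof -
  interpret R: cring "U_invariants m" by (rule algebra.M_cring[OF U_invariants_algebra])
  have "fun_space (2 * m) m (I_Sp m)"
    unfolding fun_space_def
  proof (intro conjI ballI allI)
    show "I_Sp m \<subseteq> poly_funs (2 * m) m" by (auto simp: I_Sp_eq U_invariants_carrier)
    show "(\<lambda>Q\<in>carrier_mat (2 * m) m. 0) \<in> I_Sp m"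
      by (auto simp: I_Sp_eq right_inv_def intro!: U_invariantsI is_poly_const)
    fix f g c d assume "f \<in> I_Sp m" "g \<in> I_Sp m"
    hence fg: "f \<in> carrier (U_invariants m)" "g \<in> carrier (U_invariants m)"
      "\<forall>h\<in>Sp m. f (h * id_mat (2 * m) m) = 0" "\<forall>h\<in>Sp m. g (h * id_mat (2 * m) m) = 0" by (auto simp: I_Sp_eq)
    note d = U_invariantsD[OF fg(1)] U_invariantsD[OF fg(2)]
    have "(\<lambda>Q\<in>carrier_mat (2 * m) m. c * f Q + d * g Q) \<in> carrier (U_invariants m)"
      using d by (intro U_invariantsI is_poly_add is_poly_mult is_poly_const right_inv_lincomb)
    thus "(\<lambda>Q\<in>carrier_mat (2 * m) m. c * f Q + d * g Q) \<in> I_Sp m" using fg by (simp add: I_Sp_eq)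
  qed
  hence "submodule (I_Sp m) complex_ring (U_invariants m)"
    unfolding submodule_iff by (auto simp: I_Sp_eq)
  then interpret submodule "I_Sp m" complex_ring "U_invariants m" .
  have mult: "f \<otimes>\<^bsub>U_invariants m\<^esub> g \<in> I_Sp m"
    if "f \<in> I_Sp m" "g \<in> carrier (U_invariants m)" for f g
  proof -
    have "f \<otimes>\<^bsub>U_invariants m\<^esub> g \<in> carrier (U_invariants m)"
      using that by (intro R.m_closed) (auto simp: I_Sp_eq)
    thus ?thesis using that by (simp add: I_Sp_eq)
  qed
  show ?thesis
  proof (rule idealI)
    show "ring (U_invariants m)" by (rule R.ring_axioms)
    show "subgroup (I_Sp m) (add_monoid (U_invariants m))" by (rule subgroup_axioms)
    fix f g assume fg: "f \<in> I_Sp m" "g \<in> carrier (U_invariants m)"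
    show "f \<otimes>\<^bsub>U_invariants m\<^esub> g \<in> I_Sp m" by (rule mult[OF fg])
    have "g \<otimes>\<^bsub>U_invariants m\<^esub> f = f \<otimes>\<^bsub>U_invariants m\<^esub> g" by (simp add: mult.commute cong: restrict_cong)
    thus "g \<otimes>\<^bsub>U_invariants m\<^esub> f \<in> I_Sp m" using mult[OF fg] by simp
  qed
qed

section \<open>Isotropic frames\<close>

definition anti_diag :: "nat \<Rightarrow> complex mat" where
  "anti_diag m = mat m m (\<lambda>(i, j). if i + j + 1 = m then 1 else 0)"

lemma anti_diag_carrier [simp]: "anti_diag m \<in> carrier_mat m m"
  by (simp add: anti_diag_def)

lemma anti_diag_mult_index:
  assumes "M \<in> carrier_mat m k" "i < m" "j < k"
  shows "(anti_diag m * M) $$ (i, j) = M $$ (m - 1 - i, j)"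
proof -
  have "(anti_diag m * M) $$ (i, j) = (\<Sum>l<m. anti_diag m $$ (i, l) * M $$ (l, j))"
    by (rule mult_index_sum[OF anti_diag_carrier assms])
  also have "\<dots> = (\<Sum>l<m. if l = m - 1 - i then M $$ (m - 1 - i, j) else 0)"
    using assms by (intro sum.cong) (auto simp: anti_diag_def)
  also have "\<dots> = M $$ (m - 1 - i, j)" using assms by simp
  finally show ?thesis .
qed

lemma anti_diag_square: "anti_diag m * anti_diag m = 1\<^sub>m m"
proof (rule eq_matI)
  fix i j assume "i < dim_row (1\<^sub>m m :: complex mat)" "j < dim_col (1\<^sub>m m :: complex mat)"
  hence ij: "i < m" "j < m" by auto
  thus "(anti_diag m * anti_diag m) $$ (i, j) = 1\<^sub>m m $$ (i, j)"
    unfolding anti_diag_mult_index[OF anti_diag_carrier ij] by (auto simp: anti_diag_def)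
qed (auto simp: anti_diag_def)

lemma anti_diag_transpose: "transpose_mat (anti_diag m) = anti_diag m"
  by (intro eq_matI) (auto simp: anti_diag_def)

lemma skew_form_block:
  "skew_form m = four_block_mat (0\<^sub>m m m) (anti_diag m) (- anti_diag m) (0\<^sub>m m m)"
  by (simp add: skew_form_def anti_diag_def Let_def)

text \<open>The columns of \<open>[X; J S X]\<close> with \<open>S\<close> symmetric span a Lagrangian subspace.\<close>

lemma lagrangian_Sp:
  assumes X: "X \<in> carrier_mat m m" "det X \<noteq> 0" and S: "S \<in> carrier_mat m m" "transpose_mat S = S"
  shows "\<exists>D\<in>carrier_mat m m. four_block_mat X (0\<^sub>m m m) (anti_diag m * (S * X)) D \<in> Sp m"
proof -
  from det_non_zero_imp_unit[OF X, of "()"] obtain Y where Y: "Y \<in> carrier_mat m m" "Y * X = 1\<^sub>m m"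
    by (auto simp: Units_def ring_mat_def)
  let ?J = "anti_diag m"
  let ?C = "?J * (S * X)"
  \<comment> \<open>The solution of X^t J D = J, which makes the last m columns pair correctly with
    the first m.\<close>
  let ?D = "?J * (transpose_mat Y * ?J)"
  let ?g = "four_block_mat X (0\<^sub>m m m) ?C ?D"
  note mc = mult_carrier_mat[of _ m m _ m]
  note as = assoc_mult_mat[of _ m m _ m _ m]
  have Xt: "transpose_mat X \<in> carrier_mat m m" "transpose_mat Y \<in> carrier_mat m m" using X Y by auto
  have C: "?C \<in> carrier_mat m m" and D: "?D \<in> carrier_mat m m"
    using X(1) S(1) Xt by (simp_all add: mc)
  have JJ: "?J * (?J * M) = M" if "M \<in> carrier_mat m m" for M
    using that left_mult_one_mat[OF that] by (simp add: as[symmetric] anti_diag_square)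
  have z: "- ?J * X = - (?J * X)" "- ?J * 0\<^sub>m m m = 0\<^sub>m m m" "0\<^sub>m m m * ?C = 0\<^sub>m m m" "0\<^sub>m m m * ?D = 0\<^sub>m m m"
    using X C D by (auto intro!: uminus_mult_left_mat right_mult_zero_mat left_mult_zero_mat)
  have O: "skew_form m * ?g = four_block_mat (S * X) (transpose_mat Y * ?J) (- (?J * X)) (0\<^sub>m m m)"
    unfolding skew_form_block
    by (subst mult_four_block_mat[of _ m m _ m _ m _ _ m _ m])
      (use X(1) S(1) Xt C D in \<open>simp_all add: mc JJ z\<close>)
  have gt: "transpose_mat ?g = four_block_mat (transpose_mat X) (transpose_mat ?C) (0\<^sub>m m m) (transpose_mat ?D)"
    by (subst transpose_four_block_mat[of _ m m _ m _ m]) (use X C D in auto)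
  have Ct: "transpose_mat ?C = transpose_mat X * (S * ?J)"
    using X(1) S by (simp add: transpose_mult[of _ m m _ m] mc as anti_diag_transpose)
  have Dt: "transpose_mat ?D = ?J * (Y * ?J)"
    using Y(1) Xt by (simp add: transpose_mult[of _ m m _ m] mc as anti_diag_transpose)
  have JX: "- (?J * X) \<in> carrier_mat m m" using X by (simp add: mc)
  \<comment> \<open>Isotropy of the first m columns: the two contributions are X^t S X and its
    negative, and here the symmetry of S enters.\<close>
  have e11: "transpose_mat X * (S * X) + transpose_mat ?C * (- (?J * X)) = 0\<^sub>m m m"
  proof -
    have "transpose_mat ?C * (- (?J * X)) = - (transpose_mat ?C * (?J * X))"
      using C X by (intro uminus_mult_right_mat) simp
    also have "transpose_mat ?C * (?J * X) = transpose_mat X * (S * X)"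
      unfolding Ct using X(1) S(1) Xt by (simp add: mc as JJ)
    finally have "transpose_mat ?C * (- (?J * X)) = - (transpose_mat X * (S * X))" .
    moreover have "transpose_mat X * (S * X) \<in> carrier_mat m m" using X(1) S(1) Xt by (simp add: mc)
    ultimately show ?thesis by (simp add: add_uminus_minus_mat[of _ m m])
  qed
  have e12: "transpose_mat X * (transpose_mat Y * ?J) = ?J"
  proof -
    have "transpose_mat X * (transpose_mat Y * ?J) = transpose_mat (Y * X) * ?J"
      using X(1) Y(1) Xt by (simp add: transpose_mult[of _ m m _ m] as)
    thus ?thesis using left_mult_one_mat[OF anti_diag_carrier[of m]] by (simp add: Y(2))
  qed
  have e21: "transpose_mat ?D * (- (?J * X)) = - ?J"
  proof -
    have "transpose_mat ?D * (- (?J * X)) = - (transpose_mat ?D * (?J * X))"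
      using D X by (intro uminus_mult_right_mat) simp
    also have "transpose_mat ?D * (?J * X) = ?J"
      unfolding Dt using X(1) Y right_mult_one_mat[OF anti_diag_carrier[of m]] by (simp add: mc as JJ)
    finally show ?thesis .
  qed
  have c: "S * X \<in> carrier_mat m m" "transpose_mat Y * ?J \<in> carrier_mat m m" using X(1) S(1) Xt by (simp_all add: mc)
  have z': "0\<^sub>m m m * (S * X) = 0\<^sub>m m m" "0\<^sub>m m m * (transpose_mat Y * ?J) = 0\<^sub>m m m"
    "transpose_mat ?C * 0\<^sub>m m m = 0\<^sub>m m m" "transpose_mat ?D * 0\<^sub>m m m = 0\<^sub>m m m"
    using c C D by (auto intro!: right_mult_zero_mat left_mult_zero_mat)
  have "transpose_mat ?g * (skew_form m * ?g) = skew_form m"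
    unfolding O gt unfolding skew_form_block
    by (subst mult_four_block_mat[of _ m m _ m _ m _ _ m _ m])
      (use X(1) S(1) Xt C D JX e11 e12 e21 z' in \<open>simp_all add: mc\<close>)
  moreover have g: "?g \<in> carrier_mat (2 * m) (2 * m)"
    unfolding mult_2 by (rule four_block_carrier_mat[OF X(1) D])
  ultimately have "?g \<in> Sp m"
    unfolding Sp_iff using assoc_mult_mat[OF _ skew_form_carrier g, of "transpose_mat ?g" "2 * m"] by simp
  thus ?thesis using D by blast
qed

section \<open>The comparison map\<close>

text \<open>Row i < n of the result stands for the symbol u_(i+1), and row i with i at least 2n for
  the symbol numbered i + 1, beginning with u_(n+1). The rows in between belong to symbols absent
  from \<open>L_Sp\<close>; the value 0 is the normal form produced by
  \<open>clear_rows\<close>.\<close>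

definition select_rows :: "nat \<Rightarrow> nat \<Rightarrow> complex mat \<Rightarrow> complex mat" where
  "select_rows m n Q = mat (2 * m) n (\<lambda>(i, j).
    if i < n then Q $$ (i, j) else if i < 2 * n then 0 else Q $$ (psi m (i + 1) - 1, j))"

lemma select_rows_carrier [simp]: "select_rows m n Q \<in> carrier_mat (2 * m) n"
  by (simp add: select_rows_def)

lemma psi_less:
  assumes "i < 2 * m" shows "psi m (i + 1) - 1 < 2 * m"
  using assms by (auto simp: psi_def)

lemma is_poly_select_rows:
  assumes "is_poly (2 * m) n f" "n < m"
  shows "is_poly (2 * m) m (\<lambda>Q. f (select_rows m n Q))"
proof (rule is_poly_compose[OF assms(1)])
  fix i j assume ij: "i < 2 * m" "j < n"
  consider "i < n" | "n \<le> i" "i < 2 * n" | "2 * n \<le> i" by linarith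
  thus "is_poly (2 * m) m (\<lambda>Q. select_rows m n Q $$ (i, j))"
  proof cases
    case 1
    have "is_poly (2 * m) m (\<lambda>Q. Q $$ (i, j))" using 1 ij assms(2) by (intro is_poly_entry) auto
    thus ?thesis using 1 ij by (simp add: select_rows_def)
  next
    case 2 thus ?thesis using ij by (simp add: select_rows_def is_poly_const)
  next
    case 3
    have "is_poly (2 * m) m (\<lambda>Q. Q $$ (psi m (i + 1) - 1, j))"
      using psi_less[OF ij(1)] ij assms(2) by (intro is_poly_entry) auto
    thus ?thesis using 3 ij by (simp add: select_rows_def)
  qed
qed simp

text \<open>As u is upper triangular, the first n columns of \<open>Q * u\<close> involve only the
  leading n x n block of u.\<close>

lemma select_rows_mult:
  assumes Q: "Q \<in> carrier_mat (2 * m) m" and u: "u \<in> unitri m" and "n < m"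
  shows "\<exists>v\<in>unitri n. select_rows m n (Q * u) = select_rows m n Q * v"
proof -
  define v where "v = mat n n (\<lambda>ij. u $$ ij)"
  have v: "v \<in> unitri n" using u \<open>n < m\<close> by (intro unitriI) (auto simp: v_def unitri_index)
  have Qu: "(Q * u) $$ (r, j) = (\<Sum>l<n. Q $$ (r, l) * v $$ (l, j))" if "r < 2 * m" "j < n" for r j
  proof -
    have "(Q * u) $$ (r, j) = (\<Sum>l<m. Q $$ (r, l) * u $$ (l, j))"
      using that \<open>n < m\<close> by (intro mult_index_sum[OF Q unitri_carrier[OF u]]) auto
    also have "\<dots> = (\<Sum>l<n. Q $$ (r, l) * v $$ (l, j))"
      using that u \<open>n < m\<close> by (intro sum.mono_neutral_cong_right) (auto simp: v_def unitri_index)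
    finally show ?thesis .
  qed
  have "select_rows m n (Q * u) = select_rows m n Q * v"
  proof (rule eq_matI)
    fix i j assume "i < dim_row (select_rows m n Q * v)" "j < dim_col (select_rows m n Q * v)"
    hence ij: "i < 2 * m" "j < n" by (auto simp: select_rows_def v_def)
    have rhs: "(select_rows m n Q * v) $$ (i, j) = (\<Sum>l<n. select_rows m n Q $$ (i, l) * v $$ (l, j))"
      by (rule mult_index_sum[OF select_rows_carrier unitri_carrier[OF v] ij])
    consider "i < n" | "n \<le> i" "i < 2 * n" | "2 * n \<le> i" by linarith
    thus "select_rows m n (Q * u) $$ (i, j) = (select_rows m n Q * v) $$ (i, j)"
    proof cases
      case 1 thus ?thesis unfolding rhs using ij \<open>n < m\<close> by (simp add: select_rows_def Qu del: index_mult_mat)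
    next
      case 2 thus ?thesis unfolding rhs using ij by (simp add: select_rows_def del: index_mult_mat)
    next
      case 3 thus ?thesis unfolding rhs using ij psi_less[OF ij(1)]
        by (simp add: select_rows_def Qu del: index_mult_mat)
    qed
  qed (auto simp: select_rows_def v_def)
  thus ?thesis using v by blast
qed

lemma select_rows_U_invariants:
  assumes "f \<in> poly_funs (2 * m) n" "right_inv (2 * m) n f" "n < m"
  shows "(\<lambda>Q\<in>carrier_mat (2 * m) m. f (select_rows m n Q)) \<in> carrier (U_invariants m)"
proof (rule U_invariantsI)
  show "is_poly (2 * m) m (\<lambda>Q. f (select_rows m n Q))"
    using assms by (intro is_poly_select_rows poly_funs_is_poly)
  show "right_inv (2 * m) m (\<lambda>Q. f (select_rows m n Q))"
    unfolding right_inv_def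
  proof (intro ballI)
    fix u Q :: "complex mat" assume u: "u \<in> unitri m" and Q: "Q \<in> carrier_mat (2 * m) m"
    obtain v where v: "v \<in> unitri n" "select_rows m n (Q * u) = select_rows m n Q * v"
      using select_rows_mult[OF Q u assms(3)] ..
    show "f (select_rows m n (Q * u)) = f (select_rows m n Q)"
      unfolding v(2) using assms(2) v(1) by (simp add: right_inv_def)
  qed
qed

text \<open>In a frame [X; J S X] the u-rows of Q are put into X directly, completed by an identity
  block to keep X invertible. The v-rows with index above n have to be rows of S X and are obtained
  by solving for S against the invertible leading block of Q.\<close>

lemma select_rows_isotropic:
  assumes Q: "Q \<in> carrier_mat (2 * m) n" and gen: "generic n Q" and "n < m"
    and zero: "\<And>i j. n \<le> i \<Longrightarrow> i < 2 * n \<Longrightarrow> j < n \<Longrightarrow> Q $$ (i, j) = 0"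
  shows "\<exists>g\<in>Sp m. select_rows m n (g * id_mat (2 * m) m) = Q"
proof -
  define A where "A = mat n n (\<lambda>(i, j). Q $$ ([0..<n] ! i, j))"
  have A: "A \<in> carrier_mat n n" "A $$ (i, j) = Q $$ (i, j)" if "i < n" "j < n" for i j
    using that by (simp_all add: A_def)
  have Ac: "A \<in> carrier_mat n n" by (simp add: A_def)
  have detA: "det A \<noteq> 0" using gen by (auto simp: generic_def minor_def A_def)
  \<comment> \<open>Row p of X with p at least n carries the symbol u_(p+1), which is row 2p of
    Q.\<close>
  define B where "B = mat (m - n) n (\<lambda>(i, j). Q $$ (2 * (i + n), j))"
  define X where "X = four_block_mat A (0\<^sub>m n (m - n)) B (1\<^sub>m (m - n))"
  have "X \<in> carrier_mat (n + (m - n)) (n + (m - n))"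
    unfolding X_def by (rule four_block_carrier_mat[OF Ac]) simp
  hence X: "X \<in> carrier_mat m m" using \<open>n < m\<close> by simp
  have "det X = det A * det (1\<^sub>m (m - n))"
    unfolding X_def by (rule det_four_block_mat_upper_right_zero[OF Ac]) (auto simp: B_def)
  hence detX: "det X \<noteq> 0" using detA by simp
  have Xlow: "X $$ (i, j) = Q $$ (i, j)" if "i < n" "j < n" for i j
    using that \<open>n < m\<close> A(2)[OF that] Ac by (simp add: X_def)
  have Xhigh: "X $$ (i, j) = Q $$ (2 * i, j)" if "n \<le> i" "i < m" "j < n" for i j
  proof -
    have "2 * (i - n) + 2 * n = 2 * i" using that by simp
    thus ?thesis using that Ac by (simp add: X_def B_def)
  qed
  \<comment> \<open>The symbol v_(p+1) is row 2p + 1 of Q; it is written as a combination of the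
    first n rows.\<close>
  have "\<exists>r. \<forall>j<n. (\<Sum>c<n. r c * Q $$ (c, j)) = Q $$ (2 * p + 1, j)" for p
  proof -
    have "det (transpose_mat A) \<noteq> 0" using detA det_transpose[OF Ac] by simp
    from det_nonzero_solve[OF transpose_carrier_mat[THEN iffD2, OF Ac] this, of "\<lambda>j. Q $$ (2 * p + 1, j)"]
    obtain r where r: "\<And>j. j < n \<Longrightarrow> (\<Sum>l<n. transpose_mat A $$ (j, l) * r l) = Q $$ (2 * p + 1, j)" by blast
    have "(\<Sum>c<n. r c * Q $$ (c, j)) = Q $$ (2 * p + 1, j)" if "j < n" for j
      unfolding r[OF that, symmetric] using that Ac A(2)
      by (intro sum.cong refl) (auto simp: mult.commute)
    thus ?thesis by blast
  qed
  then obtain R where R: "\<And>p j. j < n \<Longrightarrow> (\<Sum>c<n. R p c * Q $$ (c, j)) = Q $$ (2 * p + 1, j)" by metis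
  \<comment> \<open>Only the blocks coupling the first n coordinates to the others are used, each
    the transpose of the other, so symmetry imposes no condition on R.\<close>
  define S where "S = mat m m (\<lambda>(p, c). if n \<le> p \<and> c < n then R p c else if p < n \<and> n \<le> c then R c p else 0)"
  have S: "S \<in> carrier_mat m m" "transpose_mat S = S" by (auto simp: S_def)
  have SX: "(S * X) $$ (p, j) = Q $$ (2 * p + 1, j)" if "n \<le> p" "p < m" "j < n" for p j
  proof -
    have "(S * X) $$ (p, j) = (\<Sum>l<m. S $$ (p, l) * X $$ (l, j))"
      using that \<open>n < m\<close> by (intro mult_index_sum[OF S(1) X]) auto
    also have "\<dots> = (\<Sum>l<n. R p l * Q $$ (l, j))"
      using that \<open>n < m\<close> Xlow by (intro sum.mono_neutral_cong_right) (auto simp: S_def)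
    finally show ?thesis using R that by simp
  qed
  obtain D where D: "D \<in> carrier_mat m m"
    "four_block_mat X (0\<^sub>m m m) (anti_diag m * (S * X)) D \<in> Sp m" (is "?g \<in> _")
    using lagrangian_Sp[OF X detX S] ..
  have SXc: "S * X \<in> carrier_mat m m" using S(1) X by (rule mult_carrier_mat)
  have gc: "?g \<in> carrier_mat (2 * m) (2 * m)" by (rule Sp_carrier[OF D(2)])
  have gE: "(?g * id_mat (2 * m) m) $$ (i, j) = (if i < m then X $$ (i, j) else (S * X) $$ (2 * m - 1 - i, j))"
    if "i < 2 * m" "j < m" for i j
  proof -
    have "(?g * id_mat (2 * m) m) $$ (i, j) = (\<Sum>l<2 * m. ?g $$ (i, l) * id_mat (2 * m) m $$ (l, j))"
      by (rule mult_index_sum[OF gc id_mat_carrier that])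
    also have "\<dots> = (\<Sum>l<2 * m. if l = j then ?g $$ (i, j) else 0)"
      using that by (intro sum.cong) auto
    also have "\<dots> = ?g $$ (i, j)" using that by simp
    also have "\<dots> = (if i < m then X $$ (i, j) else (anti_diag m * (S * X)) $$ (i - m, j))"
      using that X D(1) SXc by (subst index_mat_four_block) auto
    also have "\<dots> = (if i < m then X $$ (i, j) else (S * X) $$ (2 * m - 1 - i, j))"
      using that anti_diag_mult_index[OF SXc, of "i - m" j] by (auto simp: mult_2 simp del: index_mult_mat)
    finally show ?thesis .
  qed
  have "select_rows m n (?g * id_mat (2 * m) m) = Q"
  proof (rule eq_matI)
    fix i j assume "i < dim_row Q" "j < dim_col Q"
    hence ij: "i < 2 * m" "j < n" using Q by auto
    have jm: "j < m" using ij \<open>n < m\<close> by simp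
    consider "i < n" | "n \<le> i" "i < 2 * n" | "2 * n \<le> i" "even i" | "2 * n \<le> i" "odd i" by linarith
    thus "select_rows m n (?g * id_mat (2 * m) m) $$ (i, j) = Q $$ (i, j)"
    proof cases
      case 1
      thus ?thesis using ij \<open>n < m\<close> gE[of i j] jm Xlow by (simp add: select_rows_def del: index_mult_mat)
    next
      case 2 thus ?thesis using ij zero by (simp add: select_rows_def)
    next
      case 3
      then obtain p where p: "i = 2 * p" by (auto elim: evenE)
      have "psi m (i + 1) - 1 = p" using p by (simp add: psi_def)
      moreover have "n \<le> p" "p < m" using 3 p ij by auto
      ultimately show ?thesis
        using ij 3 p gE[of p j] jm Xhigh by (simp add: select_rows_def del: index_mult_mat)
    next
      case 4
      then obtain p where p: "i = 2 * p + 1" by (auto elim: oddE)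
      have np: "n \<le> p" "p < m" using 4 p ij by auto
      have "psi m (i + 1) - 1 = 2 * m - 1 - p" using p by (simp add: psi_def)
      moreover have "\<not> 2 * m - 1 - p < m" "2 * m - 1 - (2 * m - 1 - p) = p" "2 * m - 1 - p < 2 * m"
        using np by auto
      ultimately show ?thesis
        using ij 4 gE[of "2 * m - 1 - p" j] jm SX[OF np ij(2)] p
        by (simp add: select_rows_def del: index_mult_mat)
    qed
  qed (use Q in \<open>auto simp: select_rows_def\<close>)
  thus ?thesis using D(2) by blast
qed

text \<open>The leading n x n block is invertible, so the rows from n to 2n - 1 are combinations of
  the first n rows. Subtracting these combinations adds earlier rows to later ones, which is what
  left multiplication by the transpose of u does.\<close>

lemma clear_rows:
  assumes Q: "Q \<in> carrier_mat a n" and gen: "generic n Q" and "2 * n \<le> a"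
  obtains u where "u \<in> unitri (2 * n)"
    "\<And>i j. i < a \<Longrightarrow> j < n \<Longrightarrow> (transpose_mat (GL_embed (2 * n) a u) * Q) $$ (i, j) =
      (if n \<le> i \<and> i < 2 * n then 0 else Q $$ (i, j))"
proof -
  let ?A = "mat n n (\<lambda>(i, j). Q $$ ([0..<n] ! i, j))"
  have Ac: "?A \<in> carrier_mat n n" by simp
  have "det ?A \<noteq> 0" using gen by (auto simp: generic_def minor_def)
  hence dt: "det (transpose_mat ?A) \<noteq> 0" using det_transpose[OF Ac] by simp
  have "\<exists>x. \<forall>j<n. (\<Sum>l<n. x l * Q $$ (l, j)) = - Q $$ (i, j)" for i
  proof -
    from det_nonzero_solve[OF transpose_carrier_mat[THEN iffD2, OF Ac] dt, of "\<lambda>j. - Q $$ (i, j)"]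
    obtain r where r: "\<And>j. j < n \<Longrightarrow> (\<Sum>l<n. transpose_mat ?A $$ (j, l) * r l) = - Q $$ (i, j)" by blast
    have "(\<Sum>l<n. r l * Q $$ (l, j)) = - Q $$ (i, j)" if "j < n" for j
      unfolding r[OF that, symmetric] using that by (intro sum.cong refl) (auto simp: mult.commute)
    thus ?thesis by blast
  qed
  then obtain x where x: "\<And>i j. j < n \<Longrightarrow> (\<Sum>l<n. x i l * Q $$ (l, j)) = - Q $$ (i, j)" by metis
  define u where "u = mat (2 * n) (2 * n) (\<lambda>(l, i). if l = i then 1 else if l < n \<and> n \<le> i then x i l else 0)"
  have u: "u \<in> unitri (2 * n)" by (intro unitriI) (auto simp: u_def)
  show ?thesis
  proof (rule that[OF u])
    fix i j assume ij: "i < a" "j < n"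
    show "(transpose_mat (GL_embed (2 * n) a u) * Q) $$ (i, j) =
        (if n \<le> i \<and> i < 2 * n then 0 else Q $$ (i, j))"
    proof (cases "i < 2 * n")
      case True
      have "(\<Sum>l<2 * n. u $$ (l, i) * Q $$ (l, j)) =
          (\<Sum>l<2 * n. (if l = i then Q $$ (i, j) else 0) + (if l < n \<and> n \<le> i then x i l * Q $$ (l, j) else 0))"
        using True by (intro sum.cong) (auto simp: u_def)
      also have "\<dots> = Q $$ (i, j) + (\<Sum>l<2 * n. if l < n \<and> n \<le> i then x i l * Q $$ (l, j) else 0)"
        using True by (simp add: sum.distrib)
      also have "(\<Sum>l<2 * n. if l < n \<and> n \<le> i then x i l * Q $$ (l, j) else 0) =
          (\<Sum>l<n. if n \<le> i then x i l * Q $$ (l, j) else 0)"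
        by (intro sum.mono_neutral_cong_right) auto
      also have "\<dots> = (if n \<le> i then - Q $$ (i, j) else 0)" using x[OF ij(2)] by simp
      finally show ?thesis
        using True by (simp add: GL_embed_mult_index[OF unitri_carrier[OF u] assms(3) Q ij] del: index_mult_mat)
    next
      case False
      thus ?thesis by (simp add: GL_embed_mult_index[OF unitri_carrier[OF u] assms(3) Q ij] del: index_mult_mat)
    qed
  qed
qed

text \<open>A generic matrix with its middle rows cleared is the selection of an isotropic frame,
  and left invariance makes f blind to the clearing. The leading minors do not change in the
  process, so genericity persists.\<close>

lemma eq_0_of_select_rows:
  assumes f: "is_poly (2 * m) n f" "left_inv (2 * n) (2 * m) n f" and "n < m"
    and zero: "\<And>g. g \<in> Sp m \<Longrightarrow> f (select_rows m n (g * id_mat (2 * m) m)) = 0"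
    and Q: "Q \<in> carrier_mat (2 * m) n"
  shows "f Q = 0"
proof (rule generic_zero[OF f(1) _ _ Q])
  fix Q :: "complex mat" assume Q: "Q \<in> carrier_mat (2 * m) n" and gen: "generic n Q"
  have le: "2 * n \<le> 2 * m" using \<open>n < m\<close> by simp
  obtain u where u: "u \<in> unitri (2 * n)"
    "\<And>i j. i < 2 * m \<Longrightarrow> j < n \<Longrightarrow> (transpose_mat (GL_embed (2 * n) (2 * m) u) * Q) $$ (i, j) =
      (if n \<le> i \<and> i < 2 * n then 0 else Q $$ (i, j))"
    using clear_rows[OF Q gen le] by blast
  let ?R = "transpose_mat (GL_embed (2 * n) (2 * m) u) * Q"
  have Rc: "?R \<in> carrier_mat (2 * m) n"
    using Q GL_embed_carrier[OF unitri_carrier[OF u(1)] le] by (intro mult_carrier_mat[of _ _ "2 * m"]) auto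
  have "minor [0..<i] ?R = minor [0..<i] Q" if "i \<le> n" for i
  proof -
    have "left_inv (2 * n) (2 * m) n (minor [0..<i])"
      by (rule minor_left_inv[of _ i "[]"]) (use that \<open>n < m\<close> in auto)
    thus ?thesis using u(1) Q unfolding left_inv_def by blast
  qed
  hence genR: "generic n ?R" using gen by (simp add: generic_def)
  have "\<exists>g\<in>Sp m. select_rows m n (g * id_mat (2 * m) m) = ?R"
    by (rule select_rows_isotropic[OF Rc genR \<open>n < m\<close>]) (use u(2) \<open>n < m\<close> in auto)
  hence "f ?R = 0" using zero by metis
  thus "f Q = 0" using f(2) u(1) Q by (simp add: left_inv_def)
qed (use \<open>n < m\<close> in simp)

text \<open>The rows in \<open>xs\<close> and the corresponding symbols increase together, so both
  determinants have the same rows in the same order and no sign intervenes.\<close>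

lemma delta_eq_minor:
  assumes xs: "xs = [0..<c] @ ys" "sorted_wrt (<) ys" "set ys \<subseteq> {2 * n..<2 * m}" "length xs \<le> n"
    and "n < m" and Q: "Q \<in> carrier_mat (2 * m) m"
  shows "delta m (sym_u ` {1..c} \<union> Suc ` set ys) Q = minor xs (select_rows m n Q)"
proof -
  let ?J = "sym_u ` {1..c} \<union> Suc ` set ys"
  \<comment> \<open>The alphabet numbers of the rows in \<open>xs\<close>: row i of the initial
    segment stands for u_(i+1), numbered 2i + 1, and a row y of \<open>ys\<close> for the symbol
    numbered y + 1.\<close>
  let ?zs = "map (\<lambda>i. 2 * i + 1) [0..<c] @ map Suc ys"
  have cn: "c \<le> n" using xs by simp
  have "set ?zs = ?J"
  proof -
    have "(\<lambda>i. 2 * i + 1) ` {0..<c} = sym_u ` {1..c}"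
    proof (intro equalityI subsetI)
      fix y assume "y \<in> (\<lambda>i. 2 * i + 1) ` {0..<c}"
      then obtain i where "i < c" "y = 2 * i + 1" by auto
      thus "y \<in> sym_u ` {1..c}" by (intro image_eqI[of _ _ "Suc i"]) (auto simp: sym_u_def)
    next
      fix y assume "y \<in> sym_u ` {1..c}"
      then obtain i where "1 \<le> i" "i \<le> c" "y = 2 * i - 1" by (auto simp: sym_u_def)
      thus "y \<in> (\<lambda>i. 2 * i + 1) ` {0..<c}" by (intro image_eqI[of _ _ "i - 1"]) auto
    qed
    thus ?thesis by simp
  qed
  moreover have "sorted_wrt (<) ?zs"
    using xs(2,3) cn by (fastforce simp: sorted_wrt_append sorted_wrt_map)
  hence "sorted ?zs" "distinct ?zs" by (simp_all only: strict_sorted_iff)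
  ultimately have zs: "sorted_list_of_set ?J = ?zs" "card ?J = length xs"
    using sorted_list_of_set.idem_if_sorted_distinct[of ?zs] distinct_card[of ?zs] xs(1) by auto
  have eq: "mat (length xs) (length xs) (\<lambda>(i, j). Q $$ (psi m (?zs ! i) - 1, j)) =
      mat (length xs) (length xs) (\<lambda>(i, j). select_rows m n Q $$ (xs ! i, j))"
  proof (rule cong_mat[OF refl refl], unfold case_prod_conv)
    fix i j assume ij: "i < length xs" "j < length xs"
    hence jn: "j < n" using xs(4) by simp
    show "Q $$ (psi m (?zs ! i) - 1, j) = select_rows m n Q $$ (xs ! i, j)"
    proof (cases "i < c")
      case True
      thus ?thesis using cn jn \<open>n < m\<close> xs(1) by (simp add: nth_append psi_def select_rows_def)
    next
      case False
      hence l: "i - c < length ys" using ij xs(1) by simp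
      hence y: "2 * n \<le> ys ! (i - c)" "ys ! (i - c) < 2 * m" using xs(3) nth_mem by fastforce+
      show ?thesis using False l y jn xs(1) by (simp add: nth_append select_rows_def)
    qed
  qed
  have "delta m ?J Q = det (mat (card ?J) (card ?J)
      (\<lambda>(i, j). Q $$ (psi m (sorted_list_of_set ?J ! i) - 1, j)))"
    using Q by (simp only: delta_def restrict_apply')
  thus ?thesis unfolding zs eq minor_def .
qed

lemma row_list_of_L_Sp:
  assumes J: "J \<in> L_Sp m n" and "n < m"
  obtains c ys where "J = sym_u ` {1..c} \<union> Suc ` set ys" "sorted_wrt (<) ys" "set ys \<subseteq> {2 * n..<2 * m}"
    "c \<le> n" "length ([0..<c] @ ys) \<le> n"
proof -
  obtain c Y where J': "card J \<le> n" "c \<le> n" "Y \<subseteq> {sym_u (n + 1)..sym_v m}" "J = sym_u ` {1..c} \<union> Y"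
    using J by (auto simp: L_Sp_def)
  have Y: "y - 1 \<in> {2 * n..<2 * m}" "Suc (y - 1) = y" if "y \<in> Y" for y
    using subsetD[OF J'(3) that] \<open>n < m\<close> by (auto simp: sym_u_def sym_v_def)
  have finY: "finite Y" using J'(3) finite_subset by blast
  have inj: "inj_on (\<lambda>y. y - 1) Y" by (intro inj_onI) (metis Y(2))
  define ys where "ys = sorted_list_of_set ((\<lambda>y. y - 1) ` Y)"
  have set_ys: "set ys = (\<lambda>y. y - 1) ` Y" using finY by (simp add: ys_def)
  have "Suc ` set ys = Y" unfolding set_ys image_image using Y(2) by simp
  moreover have "sorted_wrt (<) ys" by (simp add: ys_def)
  moreover have "set ys \<subseteq> {2 * n..<2 * m}" unfolding set_ys using Y(1) by blast
  moreover have "length ([0..<c] @ ys) \<le> n"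
  proof -
    have "length ys = card Y" using finY card_image[OF inj] by (simp add: ys_def)
    moreover have "card (sym_u ` {1..c}) = c"
      by (subst card_image) (auto simp: inj_on_def sym_u_def)
    moreover have "sym_u ` {1..c} \<inter> Y = {}"
      using J'(2,3) by (fastforce simp: sym_u_def)
    ultimately have "card J = c + length ys"
      unfolding J'(4) using finY by (subst card_Un_disjoint) auto
    thus ?thesis using J'(1) by simp
  qed
  ultimately show ?thesis using that[of c ys] J'(2,4) by blast
qed

lemma L_Sp_of_row_list:
  assumes "sorted_wrt (<) ys" "set ys \<subseteq> {2 * n..<2 * m}" "length ([0..<c] @ ys) \<le> n" "[0..<c] @ ys \<noteq> []" "n < m"
  shows "sym_u ` {1..c} \<union> Suc ` set ys \<in> L_Sp m n"
proof -
  let ?J = "sym_u ` {1..c} \<union> Suc ` set ys"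
  have "card (sym_u ` {1..c}) = c" by (subst card_image) (auto simp: inj_on_def sym_u_def)
  moreover have "card (Suc ` set ys) = length ys"
    using assms(1) by (simp add: card_image strict_sorted_iff distinct_card)
  moreover have "sym_u ` {1..c} \<inter> Suc ` set ys = {}"
    using assms(2,3) by (fastforce simp: sym_u_def)
  ultimately have "card ?J = c + length ys" by (subst card_Un_disjoint) auto
  moreover have "?J \<subseteq> {1..2 * m}"
    using assms(2,3,5) by (fastforce simp: sym_u_def)
  moreover have "Suc ` set ys \<subseteq> {sym_u (n + 1)..sym_v m}"
    using assms(2) by (fastforce simp: sym_u_def sym_v_def)
  ultimately show ?thesis
    unfolding L_Sp_def using assms(3,4)
    by (intro CollectI conjI exI[of _ c] exI[of _ "Suc ` set ys"]) (auto simp: Suc_le_eq)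
qed

section \<open>The quotient algebra and the isomorphism\<close>

lemma I_Sp_vanishes: "f \<in> I_Sp m \<Longrightarrow> g \<in> Sp m \<Longrightarrow> f (g * id_mat (2 * m) m) = 0"
  by (simp add: I_Sp_eq)

lemma I_Sp_smult:
  assumes "f \<in> I_Sp m" "c \<odot>\<^bsub>U_invariants m\<^esub> f \<in> carrier (U_invariants m)"
  shows "c \<odot>\<^bsub>U_invariants m\<^esub> f \<in> I_Sp m"
  using assms by (simp add: I_Sp_eq)

text \<open>\<open>quot_alg\<close> defines the scalar multiple as a union over all representatives.
  The ideal is closed under scalars, so every member of that union is the same coset.\<close>

lemma quot_alg_smult:
  assumes f: "f \<in> carrier (U_invariants m)"
  shows "c \<odot>\<^bsub>F_Sp m\<^esub> (I_Sp m +>\<^bsub>U_invariants m\<^esub> f) = I_Sp m +>\<^bsub>U_invariants m\<^esub> (c \<odot>\<^bsub>U_invariants m\<^esub> f)"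
proof -
  interpret A: algebra complex_ring "U_invariants m" by (rule U_invariants_algebra)
  interpret I: ideal "I_Sp m" "U_invariants m" by (rule I_Sp_ideal)
  let ?q = "\<lambda>f. I_Sp m +>\<^bsub>U_invariants m\<^esub> f"
  have cf: "c \<odot>\<^bsub>U_invariants m\<^esub> g \<in> carrier (U_invariants m)" if "g \<in> carrier (U_invariants m)" for g
    using that by (intro A.smult_closed) (simp add: complex_ring_def)
  have const: "?q (c \<odot>\<^bsub>U_invariants m\<^esub> g) = ?q (c \<odot>\<^bsub>U_invariants m\<^esub> f)" if g: "g \<in> ?q f" for g
  proof -
    obtain h where h: "h \<in> I_Sp m" "g = h \<oplus>\<^bsub>U_invariants m\<^esub> f"
      using g by (auto simp: a_r_coset_def r_coset_def simp del: U_invariants_simps)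
    have hc: "h \<in> carrier (U_invariants m)" by (rule I.a_Hcarr[OF h(1)])
    have "c \<odot>\<^bsub>U_invariants m\<^esub> h \<in> I_Sp m" by (rule I_Sp_smult[OF h(1) cf[OF hc]])
    moreover have "c \<odot>\<^bsub>U_invariants m\<^esub> g = c \<odot>\<^bsub>U_invariants m\<^esub> h \<oplus>\<^bsub>U_invariants m\<^esub> c \<odot>\<^bsub>U_invariants m\<^esub> f"
      unfolding h(2) using f hc by (intro A.smult_r_distr) (simp_all add: complex_ring_def)
    ultimately have "c \<odot>\<^bsub>U_invariants m\<^esub> g \<in> ?q (c \<odot>\<^bsub>U_invariants m\<^esub> f)"
      by (auto simp: a_r_coset_def r_coset_def simp del: U_invariants_simps)
    thus ?thesis by (rule I.a_repr_independence'[OF _ cf[OF f], symmetric])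
  qed
  have "(\<Union>g\<in>?q f. ?q (c \<odot>\<^bsub>U_invariants m\<^esub> g)) = ?q (c \<odot>\<^bsub>U_invariants m\<^esub> f)"
    by (rule UN_constant_eq[OF I.a_rcos_self[OF f]], intro ballI const)
  thus ?thesis unfolding F_Sp_def quot_alg_def by simp
qed

theorem proposition4p10p2:
  fixes m n :: nat
  assumes "1 \<le> n" and "n < m"
  shows "alg_isomorphic (branching_Sp m n) (branching_GL (2 * m) n (2 * n))"
proof -
  let ?R = "U_invariants m"
  let ?I = "I_Sp m"
  let ?C = "carrier_mat (2 * m) m"
  let ?C' = "carrier_mat (2 * m) n"
  let ?B = "branching_GL (2 * m) n (2 * n)"
  let ?q = "\<lambda>f. ?I +>\<^bsub>?R\<^esub> f"
  let ?S = "{?q (delta m J) | J. J \<in> L_Sp m n}"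
  let ?G = "gen_subalg (F_Sp m) ?S"
  define pull where "pull f = (\<lambda>Q\<in>?C. f (select_rows m n Q))" for f :: "complex mat \<Rightarrow> complex"
  have le: "2 * n \<le> 2 * m" using \<open>n < m\<close> by simp
  interpret I: ideal ?I ?R by (rule I_Sp_ideal)
  have B: "f \<in> carrier ?B \<longleftrightarrow> f \<in> poly_funs (2 * m) n \<and> left_inv (2 * n) (2 * m) n f \<and> right_inv (2 * m) n f" for f
    unfolding branching_GL_carrier[OF le] by simp
  have pullR: "pull f \<in> carrier ?R" if "f \<in> carrier ?B" for f
    unfolding pull_def using that \<open>n < m\<close> by (intro select_rows_U_invariants) (simp_all add: B)
  have q_mult: "?q f \<otimes>\<^bsub>F_Sp m\<^esub> ?q g = ?q (f \<otimes>\<^bsub>?R\<^esub> g)"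
    and q_add: "?q f \<oplus>\<^bsub>F_Sp m\<^esub> ?q g = ?q (f \<oplus>\<^bsub>?R\<^esub> g)"
    if "f \<in> carrier ?R" "g \<in> carrier ?R" for f g
    using ring_hom_mult[OF I.rcos_ring_hom that] ring_hom_add[OF I.rcos_ring_hom that]
    by (simp_all add: F_Sp_def quot_alg_def del: U_invariants_simps)
  have q_one: "\<one>\<^bsub>F_Sp m\<^esub> = ?q \<one>\<^bsub>?R\<^esub>"
    by (simp add: F_Sp_def quot_alg_def FactRing_def del: U_invariants_simps)
  note q_smult = quot_alg_smult[of _ m]
  have one_B: "\<one>\<^bsub>?B\<^esub> = (\<lambda>Q\<in>?C'. 1)" and mult_B: "f \<otimes>\<^bsub>?B\<^esub> g = (\<lambda>Q\<in>?C'. f Q * g Q)"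
    and add_B: "f \<oplus>\<^bsub>?B\<^esub> g = (\<lambda>Q\<in>?C'. f Q + g Q)" and smult_B: "c \<odot>\<^bsub>?B\<^esub> f = (\<lambda>Q\<in>?C'. c * f Q)" for f g c
    by (simp_all add: branching_GL_def)
  have BI: "(\<lambda>Q\<in>?C'. f Q) \<in> carrier ?B"
    if "is_poly (2 * m) n f" "left_inv (2 * n) (2 * m) n f" "right_inv (2 * m) n f" for f
    unfolding B using that le by (auto intro: restrict_poly_funs left_inv_restrict right_inv_restrict)
  have BD: "is_poly (2 * m) n f" "left_inv (2 * n) (2 * m) n f" "right_inv (2 * m) n f"
    "(\<lambda>Q\<in>?C'. f Q) = f" if "f \<in> carrier ?B" for f
    using that by (auto simp: B poly_funs_is_poly poly_funs_restrict)
  have one_closed: "\<one>\<^bsub>?B\<^esub> \<in> carrier ?B"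
    unfolding one_B by (intro BI is_poly_const) (simp_all add: left_inv_def right_inv_def)
  have mult_closed: "f \<otimes>\<^bsub>?B\<^esub> g \<in> carrier ?B" if "f \<in> carrier ?B" "g \<in> carrier ?B" for f g
    unfolding mult_B using BD[OF that(1)] BD[OF that(2)]
    by (intro BI is_poly_mult) (simp_all add: left_inv_def right_inv_def)
  have add_closed: "f \<oplus>\<^bsub>?B\<^esub> g \<in> carrier ?B" if "f \<in> carrier ?B" "g \<in> carrier ?B" for f g
    unfolding add_B using BD[OF that(1)] BD[OF that(2)]
    by (intro BI is_poly_add) (simp_all add: left_inv_def right_inv_def)
  have smult_closed: "c \<odot>\<^bsub>?B\<^esub> f \<in> carrier ?B" if "f \<in> carrier ?B" for c f
    unfolding smult_B using BD[OF that]
    by (intro BI is_poly_mult is_poly_const) (simp_all add: left_inv_def right_inv_def)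
  have pull_one: "pull \<one>\<^bsub>?B\<^esub> = \<one>\<^bsub>?R\<^esub>"
    and pull_mult: "pull (f \<otimes>\<^bsub>?B\<^esub> g) = pull f \<otimes>\<^bsub>?R\<^esub> pull g"
    and pull_add: "pull (f \<oplus>\<^bsub>?B\<^esub> g) = pull f \<oplus>\<^bsub>?R\<^esub> pull g"
    and pull_smult: "pull (c \<odot>\<^bsub>?B\<^esub> f) = c \<odot>\<^bsub>?R\<^esub> pull f" for f g c
    unfolding pull_def one_B mult_B add_B smult_B U_invariants_simps
    by (auto intro!: restrict_ext)
  \<comment> \<open>The comparison map runs from the general linear side to the quotient; the
    isomorphism asked for is its inverse.\<close>
  define \<theta> where "\<theta> f = ?q (pull f)" for f
  have \<theta>_one: "\<theta> \<one>\<^bsub>?B\<^esub> = \<one>\<^bsub>F_Sp m\<^esub>"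
    by (simp only: \<theta>_def pull_one q_one)
  have \<theta>_mult: "\<theta> (f \<otimes>\<^bsub>?B\<^esub> g) = \<theta> f \<otimes>\<^bsub>F_Sp m\<^esub> \<theta> g"
    and \<theta>_add: "\<theta> (f \<oplus>\<^bsub>?B\<^esub> g) = \<theta> f \<oplus>\<^bsub>F_Sp m\<^esub> \<theta> g" if "f \<in> carrier ?B" "g \<in> carrier ?B" for f g
    using pullR[OF that(1)] pullR[OF that(2)]
    by (simp_all only: \<theta>_def pull_mult pull_add q_mult q_add)
  have \<theta>_smult: "\<theta> (c \<odot>\<^bsub>?B\<^esub> f) = c \<odot>\<^bsub>F_Sp m\<^esub> \<theta> f" if "f \<in> carrier ?B" for c f
    using pullR[OF that] by (simp only: \<theta>_def pull_smult q_smult)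
  have minorB: "(\<lambda>Q\<in>?C'. minor xs Q) \<in> carrier ?B" if "xs \<in> row_lists (2 * n) (2 * m) n" for xs
  proof -
    note d = row_listsD[OF that le]
    from that obtain c ys where "xs = [0..<c] @ ys" "c \<le> 2 * n" "set ys \<subseteq> {2 * n..<2 * m}" "length xs \<le> n"
      by (auto simp: row_lists_def)
    thus ?thesis using d le by (intro BI is_poly_minor minor_right_inv minor_left_inv) auto
  qed
  have delta_pull: "delta m (sym_u ` {1..c} \<union> Suc ` set ys) = pull (\<lambda>Q\<in>?C'. minor ([0..<c] @ ys) Q)"
    if "sorted_wrt (<) ys" "set ys \<subseteq> {2 * n..<2 * m}" "length ([0..<c] @ ys) \<le> n" for c ys
  proof -
    have "delta m (sym_u ` {1..c} \<union> Suc ` set ys) = (\<lambda>Q\<in>?C. delta m (sym_u ` {1..c} \<union> Suc ` set ys) Q)"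
      by (simp add: delta_def cong: restrict_cong)
    also have "\<dots> = pull (\<lambda>Q\<in>?C'. minor ([0..<c] @ ys) Q)"
      unfolding pull_def
    proof (rule restrict_ext)
      fix Q :: "complex mat" assume "Q \<in> ?C"
      from delta_eq_minor[OF refl that \<open>n < m\<close> this]
      show "delta m (sym_u ` {1..c} \<union> Suc ` set ys) Q =
          (\<lambda>Q\<in>?C'. minor ([0..<c] @ ys) Q) (select_rows m n Q)" by simp
    qed
    finally show ?thesis .
  qed
  have \<theta>_minor: "\<theta> (\<lambda>Q\<in>?C'. minor xs Q) \<in> ?G" if xs: "xs \<in> row_lists (2 * n) (2 * m) n" for xs
  proof (cases "xs = []")
    case True
    \<comment> \<open>The sets in \<open>L_Sp\<close> are nonempty, so the empty minor has no
      generator; it is the unit, which every generated subalgebra contains.\<close>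
    have "(\<lambda>Q\<in>?C'. minor xs Q) = \<one>\<^bsub>?B\<^esub>" unfolding one_B True by (intro restrict_ext) simp
    thus ?thesis by (simp only: \<theta>_one gen_subalg.one)
  next
    case False
    obtain c ys where x: "xs = [0..<c] @ ys" "sorted_wrt (<) ys" "set ys \<subseteq> {2 * n..<2 * m}" "length xs \<le> n"
      using xs by (auto simp: row_lists_def)
    have "sym_u ` {1..c} \<union> Suc ` set ys \<in> L_Sp m n"
      using x False \<open>n < m\<close> by (intro L_Sp_of_row_list) auto
    moreover have "\<theta> (\<lambda>Q\<in>?C'. minor xs Q) = ?q (delta m (sym_u ` {1..c} \<union> Suc ` set ys))"
      unfolding \<theta>_def x(1) using x by (subst delta_pull) auto
    ultimately show ?thesis by (intro gen_subalg.incl) blast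
  qed
  have prod: "(\<lambda>Q\<in>?C'. minor_prod G Q) \<in> carrier ?B \<and> \<theta> (\<lambda>Q\<in>?C'. minor_prod G Q) \<in> ?G"
    if "set G \<subseteq> row_lists (2 * n) (2 * m) n" for G
    using that
  proof (induction G)
    case Nil
    have "(\<lambda>Q\<in>?C'. minor_prod [] Q) = \<one>\<^bsub>?B\<^esub>" unfolding one_B by (intro restrict_ext) simp
    thus ?case using one_closed by (simp only: \<theta>_one gen_subalg.one)
  next
    case (Cons xs G)
    let ?f = "\<lambda>Q\<in>?C'. minor xs Q" and ?g = "\<lambda>Q\<in>?C'. minor_prod G Q"
    have xs: "xs \<in> row_lists (2 * n) (2 * m) n" and G: "set G \<subseteq> row_lists (2 * n) (2 * m) n"
      using Cons.prems by simp_all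
    have fg: "?f \<in> carrier ?B" "?g \<in> carrier ?B" "\<theta> ?f \<in> ?G" "\<theta> ?g \<in> ?G"
      using minorB[OF xs] Cons.IH[OF G] \<theta>_minor[OF xs] by blast+
    have eq: "(\<lambda>Q\<in>?C'. minor_prod (xs # G) Q) = ?f \<otimes>\<^bsub>?B\<^esub> ?g"
      unfolding mult_B by (intro restrict_ext) simp
    show ?case
      unfolding eq \<theta>_mult[OF fg(1,2)] by (intro conjI mult_closed gen_subalg.mult fg)
  qed
  have comb: "(\<lambda>Q\<in>?C'. minor_comb ts Q) \<in> carrier ?B \<and> \<theta> (\<lambda>Q\<in>?C'. minor_comb ts Q) \<in> ?G"
    if "\<forall>t\<in>set ts. set (snd t) \<subseteq> row_lists (2 * n) (2 * m) n" for ts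
    using that
  proof (induction ts)
    case Nil
    have eq: "(\<lambda>Q\<in>?C'. minor_comb [] Q) = 0 \<odot>\<^bsub>?B\<^esub> \<one>\<^bsub>?B\<^esub>"
      unfolding smult_B by (intro restrict_ext) simp
    show ?case
      unfolding eq \<theta>_smult[OF one_closed] \<theta>_one
      by (intro conjI smult_closed one_closed gen_subalg.smult gen_subalg.one)
  next
    case (Cons t ts)
    let ?f = "\<lambda>Q\<in>?C'. minor_prod (snd t) Q" and ?g = "\<lambda>Q\<in>?C'. minor_comb ts Q"
    have t: "set (snd t) \<subseteq> row_lists (2 * n) (2 * m) n"
      and ts: "\<forall>t\<in>set ts. set (snd t) \<subseteq> row_lists (2 * n) (2 * m) n"
      using Cons.prems by simp_all
    have f: "?f \<in> carrier ?B" "\<theta> ?f \<in> ?G" using prod[OF t] by blast+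
    have g: "?g \<in> carrier ?B" "\<theta> ?g \<in> ?G" using Cons.IH[OF ts] by blast+
    have eq: "(\<lambda>Q\<in>?C'. minor_comb (t # ts) Q) = (fst t \<odot>\<^bsub>?B\<^esub> ?f) \<oplus>\<^bsub>?B\<^esub> ?g"
      unfolding add_B smult_B by (intro restrict_ext) simp
    show ?case
      unfolding eq \<theta>_add[OF smult_closed[OF f(1)] g(1)] \<theta>_smult[OF f(1)]
      by (intro conjI add_closed smult_closed gen_subalg.add gen_subalg.smult f g)
  qed
  \<comment> \<open>The weight components of an invariant are invariants, and each is a combination
    of products of minors, whose images are products of generators.\<close>
  have \<theta>_in: "\<theta> f \<in> ?G" if f: "f \<in> carrier ?B" for f
  proof -
    note d = BD[OF f]
    obtain S F where S: "finite S" "\<And>Q. Q \<in> ?C' \<Longrightarrow> f Q = (\<Sum>\<kappa>\<in>S. F \<kappa> Q)"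
      "\<And>\<kappa>. is_poly (2 * m) n (F \<kappa>)" "\<And>\<kappa>. has_weight (2 * m) n \<kappa> (F \<kappa>)" "\<And>\<kappa> j. \<kappa> \<in> S \<Longrightarrow> n \<le> j \<Longrightarrow> \<kappa> j = 0"
      using weight_decomposition[OF d(1)] by blast
    have comp: "\<exists>ts. (\<forall>t\<in>set ts. set (snd t) \<subseteq> row_lists (2 * n) (2 * m) n) \<and> (\<forall>Q\<in>?C'. F \<kappa> Q = minor_comb ts Q)"
      if \<kappa>: "\<kappa> \<in> S" for \<kappa>
    proof -
      have "right_inv (2 * m) n (F \<kappa>)"
        using S(1,2,4,5) d(3) \<kappa> by (rule weight_component_right_inv[where S = S and F = F and f = f])
      moreover have "left_inv (2 * n) (2 * m) n (F \<kappa>)"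
        using S(1,2,4,5) d(2) le \<kappa> by (rule weight_component_left_inv[where S = S and F = F and f = f])
      ultimately have "minor_span (2 * n) (2 * m) n \<kappa> (F \<kappa>)"
        using S(3,4) S(5)[OF \<kappa>] le by (intro minor_span_of_invariant) auto
      thus ?thesis unfolding minor_span_def by blast
    qed
    have "\<exists>ts. (\<forall>t\<in>set ts. set (snd t) \<subseteq> row_lists (2 * n) (2 * m) n) \<and>
        (\<forall>Q\<in>?C'. (\<Sum>\<kappa>\<in>T. F \<kappa> Q) = minor_comb ts Q)" if "T \<subseteq> S" for T
      using finite_subset[OF that S(1)] that
    proof (induction T rule: finite_induct)
      case empty show ?case by (rule exI[of _ "[]"]) simp
    next
      case (insert \<kappa> T)
      obtain ts where ts: "\<forall>t\<in>set ts. set (snd t) \<subseteq> row_lists (2 * n) (2 * m) n"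
        "\<forall>Q\<in>?C'. F \<kappa> Q = minor_comb ts Q"
        using comp[of \<kappa>] insert.prems by blast
      obtain us where us: "\<forall>t\<in>set us. set (snd t) \<subseteq> row_lists (2 * n) (2 * m) n"
        "\<forall>Q\<in>?C'. (\<Sum>\<kappa>\<in>T. F \<kappa> Q) = minor_comb us Q"
        using insert.IH insert.prems by blast
      show ?case using ts us insert.hyps by (intro exI[of _ "ts @ us"]) auto
    qed
    from this[OF order_refl]
    obtain ts where ts: "\<forall>t\<in>set ts. set (snd t) \<subseteq> row_lists (2 * n) (2 * m) n"
      "\<forall>Q\<in>?C'. (\<Sum>\<kappa>\<in>S. F \<kappa> Q) = minor_comb ts Q" by blast
    have "f = (\<lambda>Q\<in>?C'. f Q)" using d(4) by simp
    also have "\<dots> = (\<lambda>Q\<in>?C'. minor_comb ts Q)" using S(2) ts(2) by (intro restrict_ext) simp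
    finally show ?thesis using comb[OF ts(1)] by simp
  qed
  have "x \<in> \<theta> ` carrier ?B" if "x \<in> ?G" for x
    using that
  proof (induction rule: gen_subalg.induct)
    case one show ?case by (rule image_eqI[where f = \<theta>, OF \<theta>_one[symmetric] one_closed])
  next
    case (incl x)
    then obtain J where J: "J \<in> L_Sp m n" "x = ?q (delta m J)" by blast
    obtain c ys where x: "J = sym_u ` {1..c} \<union> Suc ` set ys" "sorted_wrt (<) ys" "set ys \<subseteq> {2 * n..<2 * m}"
      "c \<le> n" "length ([0..<c] @ ys) \<le> n"
      using row_list_of_L_Sp[OF J(1) \<open>n < m\<close>] by blast
    have "[0..<c] @ ys \<in> row_lists (2 * n) (2 * m) n"
      unfolding row_lists_def using x by (intro CollectI exI[of _ c] exI[of _ ys]) simp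
    from minorB[OF this] show ?case
      unfolding J(2) x(1) delta_pull[OF x(2,3,5)] \<theta>_def by (rule imageI)
  next
    case (add x y)
    then obtain f g where fg: "f \<in> carrier ?B" "x = \<theta> f" "g \<in> carrier ?B" "y = \<theta> g" by blast
    show ?case
      unfolding fg(2,4) by (rule image_eqI[where f = \<theta>, OF \<theta>_add[OF fg(1,3), symmetric] add_closed[OF fg(1,3)]])
  next
    case (mult x y)
    then obtain f g where fg: "f \<in> carrier ?B" "x = \<theta> f" "g \<in> carrier ?B" "y = \<theta> g" by blast
    show ?case
      unfolding fg(2,4) by (rule image_eqI[where f = \<theta>, OF \<theta>_mult[OF fg(1,3), symmetric] mult_closed[OF fg(1,3)]])
  next
    case (smult x c)
    then obtain f where f: "f \<in> carrier ?B" "x = \<theta> f" by blast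
    show ?case
      unfolding f(2) by (rule image_eqI[where f = \<theta>, OF \<theta>_smult[OF f(1), symmetric] smult_closed[OF f(1)]])
  qed
  hence image: "\<theta> ` carrier ?B = ?G" using \<theta>_in by blast
  have inj: "inj_on \<theta> (carrier ?B)"
  proof (rule inj_onI)
    fix f g assume f: "f \<in> carrier ?B" and g: "g \<in> carrier ?B" and eq: "\<theta> f = \<theta> g"
    \<comment> \<open>Equal cosets mean that the two pullbacks differ by an element of the ideal,
      which vanishes on all isotropic frames; \<open>eq_0_of_select_rows\<close> then applies to f -
      g.\<close>
    have "pull f \<in> ?q (pull g)" using I.a_rcos_self[OF pullR[OF f]] eq by (simp only: \<theta>_def)
    then obtain h where h: "h \<in> ?I" "pull f = h \<oplus>\<^bsub>?R\<^esub> pull g" by (auto simp: a_r_coset_def r_coset_def simp del: U_invariants_simps)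
    have zero: "f (select_rows m n (k * id_mat (2 * m) m)) - g (select_rows m n (k * id_mat (2 * m) m)) = 0"
      if k: "k \<in> Sp m" for k
    proof -
      have kE: "k * id_mat (2 * m) m \<in> ?C" using k by simp
      have "h (k * id_mat (2 * m) m) = 0" by (rule I_Sp_vanishes[OF h(1) k])
      thus ?thesis using fun_cong[OF h(2), of "k * id_mat (2 * m) m"] kE by (simp add: pull_def)
    qed
    note df = BD[OF f] and dg = BD[OF g]
    have "f Q - g Q = 0" if Q: "Q \<in> ?C'" for Q
    proof (rule eq_0_of_select_rows[where f = "\<lambda>Q. f Q - g Q", OF _ _ \<open>n < m\<close> zero Q])
      show "is_poly (2 * m) n (\<lambda>Q. f Q - g Q)" by (rule is_poly_diff[OF df(1) dg(1)])
      show "left_inv (2 * n) (2 * m) n (\<lambda>Q. f Q - g Q)" using df(2) dg(2) by (simp add: left_inv_def)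
    qed
    hence "(\<lambda>Q\<in>?C'. f Q) = (\<lambda>Q\<in>?C'. g Q)" by (intro restrict_ext) simp
    thus "f = g" using df(4) dg(4) by simp
  qed
  define \<phi> where "\<phi> = inv_into (carrier ?B) \<theta>"
  have A_simps: "carrier (branching_Sp m n) = ?G"
    "x \<otimes>\<^bsub>branching_Sp m n\<^esub> y = x \<otimes>\<^bsub>F_Sp m\<^esub> y" "x \<oplus>\<^bsub>branching_Sp m n\<^esub> y = x \<oplus>\<^bsub>F_Sp m\<^esub> y"
    "\<one>\<^bsub>branching_Sp m n\<^esub> = \<one>\<^bsub>F_Sp m\<^esub>" "c \<odot>\<^bsub>branching_Sp m n\<^esub> x = c \<odot>\<^bsub>F_Sp m\<^esub> x" for x y c
    by (simp_all add: branching_Sp_def)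
  have \<phi>: "\<phi> x \<in> carrier ?B" "\<theta> (\<phi> x) = x" if "x \<in> ?G" for x
  proof -
    have x: "x \<in> \<theta> ` carrier ?B" using that unfolding image .
    show "\<phi> x \<in> carrier ?B" unfolding \<phi>_def by (rule inv_into_into[OF x])
    show "\<theta> (\<phi> x) = x" unfolding \<phi>_def by (rule f_inv_into_f[OF x])
  qed
  have \<phi>_eq: "\<phi> x = f" if "f \<in> carrier ?B" "x = \<theta> f" for x f
    unfolding \<phi>_def that(2) by (rule inv_into_f_f[OF inj that(1)])
  have "\<phi> \<in> ring_iso (branching_Sp m n) ?B"
    unfolding ring_iso_def
  proof (intro CollectI conjI ring_hom_memI)
    show "bij_betw \<phi> (carrier (branching_Sp m n)) (carrier ?B)"
      unfolding A_simps \<phi>_def image[symmetric] by (rule bij_betw_inv_into[OF inj_on_imp_bij_betw[OF inj]])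
    show "\<phi> \<one>\<^bsub>branching_Sp m n\<^esub> = \<one>\<^bsub>?B\<^esub>"
      unfolding A_simps by (rule \<phi>_eq[OF one_closed \<theta>_one[symmetric]])
    fix x assume "x \<in> carrier (branching_Sp m n)"
    hence x: "x \<in> ?G" by (simp only: A_simps)
    show "\<phi> x \<in> carrier ?B" by (rule \<phi>(1)[OF x])
    fix y assume "y \<in> carrier (branching_Sp m n)"
    hence y: "y \<in> ?G" by (simp only: A_simps)
    show "\<phi> (x \<otimes>\<^bsub>branching_Sp m n\<^esub> y) = \<phi> x \<otimes>\<^bsub>?B\<^esub> \<phi> y"
      unfolding A_simps using \<phi>[OF x] \<phi>[OF y] by (intro \<phi>_eq mult_closed) (simp_all only: \<theta>_mult)
    show "\<phi> (x \<oplus>\<^bsub>branching_Sp m n\<^esub> y) = \<phi> x \<oplus>\<^bsub>?B\<^esub> \<phi> y"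
      unfolding A_simps using \<phi>[OF x] \<phi>[OF y] by (intro \<phi>_eq add_closed) (simp_all only: \<theta>_add)
  qed
  moreover have "\<phi> (c \<odot>\<^bsub>branching_Sp m n\<^esub> x) = c \<odot>\<^bsub>?B\<^esub> \<phi> x" if "x \<in> carrier (branching_Sp m n)" for c x
    using that unfolding A_simps using \<phi>[of x] by (intro \<phi>_eq smult_closed) (simp_all only: \<theta>_smult)
  ultimately show ?thesis unfolding alg_isomorphic_def by blast
qed

end
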